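(* Let $\mathcal{T}_d$ be the triangulated category generated by a $d$-spherical object $E$ ($d\in\mathbb{Z}$ arbitrary), and consider the action of $G=\mathbb{Z}/2\mathbb{Z}$ on it in which the non-trivial element acts by the functor induced by the ring isomorphism $\varphi_{-1}\colon B\to B$, $s\mapsto -s$, where $B=\mathbb{C}[s]/(s^2)$ is the graded endomorphism algebra of $E$. Then $E$ admits two distinct linearisations $\lambda_g^{1}$ and $\lambda_g^{-1}$, and the objects $(E,\lambda_g^{1})$ and $(E,\lambda_g^{-1})$ are exceptional in the linearised category $\mathcal{T}_d^G$. In particular, $\mathcal{T}_d^G$ contains the (bounded) derived category of (finite-dimensional) $\mathbb{C}$-vector spaces as a full admissible triangulated subcategory.
   Context: Everything is over $\mathbb{C}$. An object $E$ of a triangulated category $\mathcal{T}$ is $d$-spherical if the graded algebra $B=\bigoplus_{p\in\mathbb{Z}}\mathrm{Hom}_{\mathcal{T}}(E,E[p])$ is isomorphic to $\mathbb{C}[s]/(s^2)$ with $s$ of degree $d$. An object $E$ is exceptional if $\mathrm{Hom}(E,E)=\mathbb{C}$ and $\mathrm{Hom}(E,E[k])=0$ for $k\ne 0$. A full triangulated subcategory is admissible if its inclusion has a left and a right adjoint. The category $\mathcal{T}_d$ is identified with the perfect derived category $\mathrm{Perf}(B)$ (the smallest thick triangulated subcategory of the derived category of $B$ containing $B$), where $B$ is regarded as a DG-algebra with trivial differential and the DG-module $B$ corresponds to $E$. The enhancement $\mathcal{A}$ used is the DG-category built from finitely generated free $B$-modules, in the DG sense: bounded complexes of finitely generated free $B$-modules,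 i.e. finitely generated semi-free DG-$B$-modules. The non-trivial element $g\in\mathbb{Z}/2\mathbb{Z}$ acts on $\mathcal{A}$ by $M\mapsto(-1)^*M$, i.e. by restricting the module structure along $\varphi_{-1}$: $s$ acts on $(-1)^*M$ as $-s$ acts on $M$. The linearisations $\lambda_g^{\pm1}\colon B\to(-1)^*B$ are the $B$-linear maps determined by $1\mapsto\pm1$ (so $s\mapsto\mp s$); $E$ corresponds to $B$. Linearised category. A linearisation of $A\in\mathcal{A}$ with respect to an action of a finite group $G$ (DG-equivalences $g^*$ with coherent isomorphisms $(gh)^*\simeq h^*g^*$) is a collection of closed degree-$0$ isomorphisms $\lambda_g\colon A\to g^*(A)$ with $\lambda_1=\mathrm{id}$ and $\lambda_{gh}=h^*(\lambda_g)\lambda_h$. $\mathcal{A}^G$ is the DG-category of pairs $(A,\lambda_g)$ with morphisms those $\varphi\in\mathrm{Hom}_{\mathcal{A}}(A,A')$ satisfying $\lambda'_g\varphi=g^*(\varphi)\lambda_g$ for all $g$. One sets $\mathcal{T}_d^G:=H^0((\mathcal{A}^G)^{pretr})$. For a DG-category $\mathcal{C}$, $\mathcal{C}^{pretr}$ has objects $(\oplus_{i=1}^n C_i[r_i],q)$ with $C_i\in\mathcal{C}$, $r_i\in\mathbb{Z}$, $q=(q_{ij})$, $q_{ij}\in\mathrm{Hom}(C_j,C_i)[r_i-r_j]$ homogeneous of degree $1$, $q_{ij}=0$ for $i\ge j$, $dq+q^2=0$; morphisms are matrices $f=(f_{ij})$, $f_{ij}\in\mathrm{Hom}(C_j,C'_i)[r'_i-r_j]$,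 with matrix multiplication and $d(f)=(df_{ij})+q'f-(-1)^l fq$ for $\deg f_{ij}=l$. $H^0$ of a DG-category has the same objects and degree-$0$ cohomology of Hom-complexes as morphisms. *)

theory Defs
  imports
    "HOL-Library.FuncSet"
    "HOL-Library.Function_Algebras"
    "HOL-Computational_Algebra.Polynomial"
    "HOL-Algebra.Elementary_Groups"
    "Jordan_Normal_Form.Matrix_Kernel"
begin

section \<open>Linear categories, functors, adjunctions\<close>

text \<open>
  Categories enriched in complex vector spaces. The Hom-spaces need not be disjoint, so every
  operation that depends on sources and targets takes them as arguments:
  \<open>lc_comp C X Y Z g f\<close> is the composite of \<open>f : X \<rightarrow> Y\<close> and \<open>g : Y \<rightarrow> Z\<close>.
\<close>

record ('o, 'm) lincat =
  lc_ob :: "'o set"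
  lc_hom :: "'o \<Rightarrow> 'o \<Rightarrow> 'm set"
  lc_id :: "'o \<Rightarrow> 'm"
  lc_comp :: "'o \<Rightarrow> 'o \<Rightarrow> 'o \<Rightarrow> 'm \<Rightarrow> 'm \<Rightarrow> 'm"
  lc_zero :: "'o \<Rightarrow> 'o \<Rightarrow> 'm"
  lc_add :: "'o \<Rightarrow> 'o \<Rightarrow> 'm \<Rightarrow> 'm \<Rightarrow> 'm"
  lc_scale :: "'o \<Rightarrow> 'o \<Rightarrow> complex \<Rightarrow> 'm \<Rightarrow> 'm"

definition lc_iso :: "('o, 'm, 'x) lincat_scheme \<Rightarrow> 'o \<Rightarrow> 'o \<Rightarrow> 'm \<Rightarrow> bool" where
  "lc_iso C X Y f \<longleftrightarrow> f \<in> lc_hom C X Y \<and>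
     (\<exists>g \<in> lc_hom C Y X. lc_comp C X Y X g f = lc_id C X \<and> lc_comp C Y X Y f g = lc_id C Y)"

record ('o, 'm, 'p, 'n) funct =
  fo :: "'o \<Rightarrow> 'p"
  fm :: "'o \<Rightarrow> 'o \<Rightarrow> 'm \<Rightarrow> 'n"

definition is_functor ::
  "('o, 'm, 'x) lincat_scheme \<Rightarrow> ('p, 'n, 'y) lincat_scheme \<Rightarrow> ('o, 'm, 'p, 'n) funct \<Rightarrow> bool" where
  "is_functor C D F \<longleftrightarrow>
     (\<forall>X \<in> lc_ob C. fo F X \<in> lc_ob D) \<and>
     (\<forall>X \<in> lc_ob C. \<forall>Y \<in> lc_ob C. \<forall>f \<in> lc_hom C X Y. fm F X Y f \<in> lc_hom D (fo F X) (fo F Y)) \<and>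
     (\<forall>X \<in> lc_ob C. fm F X X (lc_id C X) = lc_id D (fo F X)) \<and>
     (\<forall>X \<in> lc_ob C. \<forall>Y \<in> lc_ob C. \<forall>Z \<in> lc_ob C. \<forall>f \<in> lc_hom C X Y. \<forall>g \<in> lc_hom C Y Z.
        fm F X Z (lc_comp C X Y Z g f) =
        lc_comp D (fo F X) (fo F Y) (fo F Z) (fm F Y Z g) (fm F X Y f))"

definition is_linear_functor ::
  "('o, 'm, 'x) lincat_scheme \<Rightarrow> ('p, 'n, 'y) lincat_scheme \<Rightarrow> ('o, 'm, 'p, 'n) funct \<Rightarrow> bool" where
  "is_linear_functor C D F \<longleftrightarrow> is_functor C D F \<and>
     (\<forall>X \<in> lc_ob C. \<forall>Y \<in> lc_ob C. \<forall>f \<in> lc_hom C X Y. \<forall>g \<in> lc_hom C X Y. \<forall>c.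
        fm F X Y (lc_add C X Y f g) = lc_add D (fo F X) (fo F Y) (fm F X Y f) (fm F X Y g) \<and>
        fm F X Y (lc_scale C X Y c f) = lc_scale D (fo F X) (fo F Y) c (fm F X Y f))"

definition fully_faithful ::
  "('o, 'm, 'x) lincat_scheme \<Rightarrow> ('p, 'n, 'y) lincat_scheme \<Rightarrow> ('o, 'm, 'p, 'n) funct \<Rightarrow> bool" where
  "fully_faithful C D F \<longleftrightarrow> (\<forall>X \<in> lc_ob C. \<forall>Y \<in> lc_ob C.
     bij_betw (fm F X Y) (lc_hom C X Y) (lc_hom D (fo F X) (fo F Y)))"

definition ess_image ::
  "('o, 'm, 'x) lincat_scheme \<Rightarrow> ('p, 'n, 'y) lincat_scheme \<Rightarrow> ('o, 'm, 'p, 'n) funct \<Rightarrow> 'p set" where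
  "ess_image C D F = {Y \<in> lc_ob D. \<exists>X \<in> lc_ob C. \<exists>f. lc_iso D (fo F X) Y f}"

text \<open>\<open>adjoint C D F G\<close>: the functor \<open>F : C \<rightarrow> D\<close> is left adjoint to \<open>G : D \<rightarrow> C\<close>.\<close>

definition adjoint ::
  "('o, 'm, 'x) lincat_scheme \<Rightarrow> ('p, 'n, 'y) lincat_scheme \<Rightarrow>
   ('o, 'm, 'p, 'n) funct \<Rightarrow> ('p, 'n, 'o, 'm) funct \<Rightarrow> bool" where
  "adjoint C D F G \<longleftrightarrow> is_functor C D F \<and> is_functor D C G \<and>
     (\<exists>\<phi>. (\<forall>X \<in> lc_ob C. \<forall>Y \<in> lc_ob D.
             bij_betw (\<phi> X Y) (lc_hom D (fo F X) Y) (lc_hom C X (fo G Y))) \<and>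
          (\<forall>X \<in> lc_ob C. \<forall>X' \<in> lc_ob C. \<forall>Y \<in> lc_ob D. \<forall>Y' \<in> lc_ob D.
             \<forall>a \<in> lc_hom C X' X. \<forall>h \<in> lc_hom D (fo F X) Y. \<forall>b \<in> lc_hom D Y Y'.
             \<phi> X' Y' (lc_comp D (fo F X') Y Y' b (lc_comp D (fo F X') (fo F X) Y h (fm F X' X a))) =
             lc_comp C X' (fo G Y) (fo G Y') (fm G Y Y' b)
               (lc_comp C X' X (fo G Y) (\<phi> X Y h) a)))"

definition incl :: "('o, 'm, 'o, 'm) funct" where
  "incl = \<lparr>fo = (\<lambda>X. X), fm = (\<lambda>X Y f. f)\<rparr>"


section \<open>Linear categories with shift and distinguished triangles\<close>

text \<open>
  \<open>tc_sh k X\<close> and \<open>tc_shm k f\<close> are \<open>X[k]\<close> and \<open>f[k]\<close>; \<open>(X, Y, Z, u, v, w)\<close> stands for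
  \<open>X \<rightarrow> Y \<rightarrow> Z \<rightarrow> X[1]\<close> with arrows \<open>u\<close>, \<open>v\<close>, \<open>w\<close>.
\<close>

type_synonym ('o, 'm) triangle = "'o \<times> 'o \<times> 'o \<times> 'm \<times> 'm \<times> 'm"

record ('o, 'm) tricat = "('o, 'm) lincat" +
  tc_sh :: "int \<Rightarrow> 'o \<Rightarrow> 'o"
  tc_shm :: "int \<Rightarrow> 'm \<Rightarrow> 'm"
  tc_dist :: "('o, 'm) triangle set"

text \<open>
  The third argument is the shift \<open>f \<mapsto> f[1]\<close> on morphisms and the second one \<open>X \<mapsto> X[1]\<close>; they
  are passed separately because this is used to define \<^const>\<open>tc_dist\<close>.
\<close>

definition tri_iso ::
  "('o, 'm, 'x) lincat_scheme \<Rightarrow> ('o \<Rightarrow> 'o) \<Rightarrow> ('m \<Rightarrow> 'm) \<Rightarrow>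
   ('o, 'm) triangle \<Rightarrow> ('o, 'm) triangle \<Rightarrow> bool" where
  "tri_iso C s sm = (\<lambda>(X, Y, Z, u, v, w) (X', Y', Z', u', v', w').
     X \<in> lc_ob C \<and> Y \<in> lc_ob C \<and> Z \<in> lc_ob C \<and> X' \<in> lc_ob C \<and> Y' \<in> lc_ob C \<and> Z' \<in> lc_ob C \<and>
     u \<in> lc_hom C X Y \<and> v \<in> lc_hom C Y Z \<and> w \<in> lc_hom C Z (s X) \<and>
     u' \<in> lc_hom C X' Y' \<and> v' \<in> lc_hom C Y' Z' \<and> w' \<in> lc_hom C Z' (s X') \<and>
     (\<exists>a b c. lc_iso C X X' a \<and> lc_iso C Y Y' b \<and> lc_iso C Z Z' c \<and>
        lc_comp C X Y Y' b u = lc_comp C X X' Y' u' a \<and>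
        lc_comp C Y Z Z' c v = lc_comp C Y Y' Z' v' b \<and>
        lc_comp C Z (s X) (s X') (sm a) w = lc_comp C Z Z' (s X') w' c))"

definition full_sub :: "('o, 'm) tricat \<Rightarrow> 'o set \<Rightarrow> ('o, 'm) tricat" where
  "full_sub T S = T\<lparr>lc_ob := S,
     tc_dist := {(X, Y, Z, u, v, w) \<in> tc_dist T. X \<in> S \<and> Y \<in> S \<and> Z \<in> S}\<rparr>"

definition triangulated_subcategory :: "('o, 'm) tricat \<Rightarrow> 'o set \<Rightarrow> bool" where
  "triangulated_subcategory T S \<longleftrightarrow> S \<subseteq> lc_ob T \<and> S \<noteq> {} \<and>
     (\<forall>X \<in> S. \<forall>Y \<in> lc_ob T. \<forall>f. lc_iso T X Y f \<longrightarrow> Y \<in> S) \<and>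
     (\<forall>X \<in> S. \<forall>k. tc_sh T k X \<in> S) \<and>
     (\<forall>X Y Z u v w. (X, Y, Z, u, v, w) \<in> tc_dist T \<longrightarrow> X \<in> S \<longrightarrow> Y \<in> S \<longrightarrow> Z \<in> S)"

definition admissible :: "('o, 'm) tricat \<Rightarrow> 'o set \<Rightarrow> bool" where
  "admissible T S \<longleftrightarrow> triangulated_subcategory T S \<and>
     (\<exists>L. adjoint T (full_sub T S) L incl) \<and> (\<exists>R. adjoint (full_sub T S) T incl R)"

definition exact_functor ::
  "('o, 'm) tricat \<Rightarrow> ('p, 'n) tricat \<Rightarrow> ('o, 'm, 'p, 'n) funct \<Rightarrow> bool" where
  "exact_functor C D F \<longleftrightarrow> is_linear_functor C D F \<and>
     (\<exists>\<theta>. (\<forall>X \<in> lc_ob C. lc_iso D (fo F (tc_sh C 1 X)) (tc_sh D 1 (fo F X)) (\<theta> X)) \<and>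
          (\<forall>X \<in> lc_ob C. \<forall>Y \<in> lc_ob C. \<forall>f \<in> lc_hom C X Y.
             lc_comp D (fo F (tc_sh C 1 X)) (tc_sh D 1 (fo F X)) (tc_sh D 1 (fo F Y))
               (tc_shm D 1 (fm F X Y f)) (\<theta> X) =
             lc_comp D (fo F (tc_sh C 1 X)) (fo F (tc_sh C 1 Y)) (tc_sh D 1 (fo F Y))
               (\<theta> Y) (fm F (tc_sh C 1 X) (tc_sh C 1 Y) (tc_shm C 1 f))) \<and>
          (\<forall>X Y Z u v w. (X, Y, Z, u, v, w) \<in> tc_dist C \<longrightarrow>
             (fo F X, fo F Y, fo F Z, fm F X Y u, fm F Y Z v,
              lc_comp D (fo F Z) (fo F (tc_sh C 1 X)) (tc_sh D 1 (fo F X))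
                (\<theta> X) (fm F Z (tc_sh C 1 X) w)) \<in> tc_dist D))"

text \<open>\<open>Hom(E, E) = \<complex>\<close> means that \<open>c \<mapsto> c \<cdot> id\<close> identifies the two.\<close>

definition exceptional :: "('o, 'm) tricat \<Rightarrow> 'o \<Rightarrow> bool" where
  "exceptional T E \<longleftrightarrow> E \<in> lc_ob T \<and>
     bij_betw (\<lambda>c. lc_scale T E E c (lc_id T E)) UNIV (lc_hom T E E) \<and>
     (\<forall>k. k \<noteq> 0 \<longrightarrow> lc_hom T E (tc_sh T k E) = {lc_zero T E (tc_sh T k E)})"


section \<open>DG-categories\<close>

text \<open>
  \<open>dg_hom A X Y k\<close> is the degree \<open>k\<close> part of the Hom-complex; \<open>dg_diff A X Y k\<close> is its differential
  from degree \<open>k\<close> to degree \<open>k + 1\<close>. Addition and zero are those of the type of morphisms.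
\<close>

record ('o, 'm) dgcat =
  dg_ob :: "'o set"
  dg_hom :: "'o \<Rightarrow> 'o \<Rightarrow> int \<Rightarrow> 'm set"
  dg_id :: "'o \<Rightarrow> 'm"
  dg_comp :: "'o \<Rightarrow> 'o \<Rightarrow> 'o \<Rightarrow> 'm \<Rightarrow> 'm \<Rightarrow> 'm"
  dg_scale :: "complex \<Rightarrow> 'm \<Rightarrow> 'm"
  dg_diff :: "'o \<Rightarrow> 'o \<Rightarrow> int \<Rightarrow> 'm \<Rightarrow> 'm"

abbreviation sg :: "int \<Rightarrow> complex" where
  "sg k \<equiv> (- 1) powi k"

definition dg_cocycles :: "('o, 'm::ab_group_add, 'x) dgcat_scheme \<Rightarrow> 'o \<Rightarrow> 'o \<Rightarrow> 'm set" where
  "dg_cocycles A X Y = {f \<in> dg_hom A X Y 0. dg_diff A X Y 0 f = 0}"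

text \<open>The class of a closed degree \<open>0\<close> morphism in \<open>H\<^sup>0\<close>, as a coset of the boundaries.\<close>

definition dg_class :: "('o, 'm::ab_group_add, 'x) dgcat_scheme \<Rightarrow> 'o \<Rightarrow> 'o \<Rightarrow> 'm \<Rightarrow> 'm set" where
  "dg_class A X Y f = {f + dg_diff A X Y (-1) h | h. h \<in> dg_hom A X Y (-1)}"

definition H0 :: "('o, 'm::ab_group_add, 'x) dgcat_scheme \<Rightarrow> ('o, 'm set) lincat" where
  "H0 A = \<lparr>
     lc_ob = dg_ob A,
     lc_hom = (\<lambda>X Y. dg_class A X Y ` dg_cocycles A X Y),
     lc_id = (\<lambda>X. dg_class A X X (dg_id A X)),
     lc_comp = (\<lambda>X Y Z G F. \<Union>g \<in> G. \<Union>f \<in> F. dg_class A X Z (dg_comp A X Y Z g f)),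
     lc_zero = (\<lambda>X Y. dg_class A X Y 0),
     lc_add = (\<lambda>X Y F G. \<Union>f \<in> F. \<Union>g \<in> G. dg_class A X Y (f + g)),
     lc_scale = (\<lambda>X Y c F. \<Union>f \<in> F. dg_class A X Y (dg_scale A c f))\<rparr>"

subsection \<open>The pretriangulated hull\<close>

text \<open>
  An object \<open>(\<Oplus>i. C\<^sub>i[r\<^sub>i], q)\<close> is the list of the pairs \<open>(C\<^sub>i, r\<^sub>i)\<close> together with the matrix \<open>q\<close>.
  Matrices vanish outside of their index range. An entry of degree \<open>l\<close> in
  \<open>Hom(C\<^sub>j, C'\<^sub>i)[r'\<^sub>i - r\<^sub>j]\<close> is an element of \<open>Hom(C\<^sub>j, C'\<^sub>i)\<close> of degree \<open>l + r'\<^sub>i - r\<^sub>j\<close>.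
  The differential of \<open>C[r]\<close> is \<open>(-1)\<^sup>r\<close> times that of \<open>C\<close>, so that the differential of
  \<open>f\<^sub>i\<^sub>j\<close> in \<open>Hom(C\<^sub>j[r\<^sub>j], C'\<^sub>i[r'\<^sub>i])\<close> is \<open>(-1)\<close> to the power \<open>r'\<^sub>i\<close> times its differential in
  \<open>Hom(C\<^sub>j, C'\<^sub>i)\<close>; with matrix multiplication free of signs, this is the sign required by the
  Leibniz rule.
\<close>

type_synonym ('o, 'm) twisted = "('o \<times> int) list \<times> (nat \<Rightarrow> nat \<Rightarrow> 'm)"

definition sz :: "('o, 'm) twisted \<Rightarrow> nat" where
  "sz X = length (fst X)"

definition tob :: "('o, 'm) twisted \<Rightarrow> nat \<Rightarrow> 'o" where
  "tob X i = fst (fst X ! i)"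

definition tsh :: "('o, 'm) twisted \<Rightarrow> nat \<Rightarrow> int" where
  "tsh X i = snd (fst X ! i)"

definition tq :: "('o, 'm) twisted \<Rightarrow> nat \<Rightarrow> nat \<Rightarrow> 'm" where
  "tq X = snd X"

definition pt_hom :: "('o, 'm::ab_group_add, 'x) dgcat_scheme \<Rightarrow>
    ('o, 'm) twisted \<Rightarrow> ('o, 'm) twisted \<Rightarrow> int \<Rightarrow> (nat \<Rightarrow> nat \<Rightarrow> 'm) set" where
  "pt_hom A X Y l = {f. \<forall>i j. if i < sz Y \<and> j < sz X
     then f i j \<in> dg_hom A (tob X j) (tob Y i) (l + tsh Y i - tsh X j) else f i j = 0}"

definition pt_comp :: "('o, 'm::ab_group_add, 'x) dgcat_scheme \<Rightarrow>
    ('o, 'm) twisted \<Rightarrow> ('o, 'm) twisted \<Rightarrow> ('o, 'm) twisted \<Rightarrow>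
    (nat \<Rightarrow> nat \<Rightarrow> 'm) \<Rightarrow> (nat \<Rightarrow> nat \<Rightarrow> 'm) \<Rightarrow> (nat \<Rightarrow> nat \<Rightarrow> 'm)" where
  "pt_comp A X Y Z g f = (\<lambda>i j. if i < sz Z \<and> j < sz X
     then (\<Sum>k<sz Y. dg_comp A (tob X j) (tob Y k) (tob Z i) (g i k) (f k j)) else 0)"

text \<open>The matrix \<open>(df\<^sub>i\<^sub>j)\<close> for \<open>f\<close> of degree \<open>l\<close>.\<close>

definition pt_naive_diff :: "('o, 'm::ab_group_add, 'x) dgcat_scheme \<Rightarrow>
    ('o, 'm) twisted \<Rightarrow> ('o, 'm) twisted \<Rightarrow> int \<Rightarrow> (nat \<Rightarrow> nat \<Rightarrow> 'm) \<Rightarrow> (nat \<Rightarrow> nat \<Rightarrow> 'm)" where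
  "pt_naive_diff A X Y l f = (\<lambda>i j. if i < sz Y \<and> j < sz X
     then dg_scale A (sg (tsh Y i))
            (dg_diff A (tob X j) (tob Y i) (l + tsh Y i - tsh X j) (f i j))
     else 0)"

definition pt_scale :: "('o, 'm, 'x) dgcat_scheme \<Rightarrow> complex \<Rightarrow>
    (nat \<Rightarrow> nat \<Rightarrow> 'm) \<Rightarrow> (nat \<Rightarrow> nat \<Rightarrow> 'm)" where
  "pt_scale A c f = (\<lambda>i j. dg_scale A c (f i j))"

definition pt_ob :: "('o, 'm::ab_group_add, 'x) dgcat_scheme \<Rightarrow> ('o, 'm) twisted set" where
  "pt_ob A = {X. (\<forall>i<sz X. tob X i \<in> dg_ob A) \<and>
     tq X \<in> pt_hom A X X 1 \<and> (\<forall>i j. i \<ge> j \<longrightarrow> tq X i j = 0) \<and>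
     pt_naive_diff A X X 1 (tq X) + pt_comp A X X X (tq X) (tq X) = 0}"

definition pretr :: "('o, 'm::ab_group_add, 'x) dgcat_scheme \<Rightarrow>
    (('o, 'm) twisted, nat \<Rightarrow> nat \<Rightarrow> 'm) dgcat" where
  "pretr A = \<lparr>
     dg_ob = pt_ob A,
     dg_hom = pt_hom A,
     dg_id = (\<lambda>X i j. if i = j \<and> i < sz X then dg_id A (tob X i) else 0),
     dg_comp = pt_comp A,
     dg_scale = pt_scale A,
     dg_diff = (\<lambda>X Y l f. pt_naive_diff A X Y l f + pt_comp A X Y Y (tq Y) f
                  - pt_scale A (sg l) (pt_comp A X X Y f (tq X)))\<rparr>"

definition pt_shift :: "('o, 'm, 'x) dgcat_scheme \<Rightarrow> int \<Rightarrow> ('o, 'm) twisted \<Rightarrow> ('o, 'm) twisted" where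
  "pt_shift A k X = (map (\<lambda>(c, r). (c, r + k)) (fst X), pt_scale A (sg k) (tq X))"

text \<open>The cone of \<open>f : X \<rightarrow> Y\<close> is \<open>Y \<oplus> X[1]\<close>, with \<open>q\<close> the block matrix with rows
  \<open>(q\<^sub>Y, f)\<close> and \<open>(0, -q\<^sub>X)\<close>.\<close>

definition pt_cone :: "('o, 'm::ab_group_add, 'x) dgcat_scheme \<Rightarrow>
    ('o, 'm) twisted \<Rightarrow> ('o, 'm) twisted \<Rightarrow> (nat \<Rightarrow> nat \<Rightarrow> 'm) \<Rightarrow> ('o, 'm) twisted" where
  "pt_cone A X Y f = (fst Y @ fst (pt_shift A 1 X), (\<lambda>i j.
     if j < sz Y then (if i < sz Y then tq Y i j else 0)
     else if i < sz Y then f i (j - sz Y)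
     else tq (pt_shift A 1 X) (i - sz Y) (j - sz Y)))"

definition pt_cone_in :: "('o, 'm::ab_group_add, 'x) dgcat_scheme \<Rightarrow>
    ('o, 'm) twisted \<Rightarrow> (nat \<Rightarrow> nat \<Rightarrow> 'm)" where
  "pt_cone_in A Y = (\<lambda>i j. if i = j \<and> j < sz Y then dg_id A (tob Y j) else 0)"

definition pt_cone_out :: "('o, 'm::ab_group_add, 'x) dgcat_scheme \<Rightarrow>
    ('o, 'm) twisted \<Rightarrow> ('o, 'm) twisted \<Rightarrow> (nat \<Rightarrow> nat \<Rightarrow> 'm)" where
  "pt_cone_out A X Y = (\<lambda>i j. if j = sz Y + i \<and> i < sz X then dg_id A (tob X i) else 0)"

text \<open>
  The shift by \<open>k\<close> does not change the matrix of a degree \<open>0\<close> morphism, and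
  multiplies the differential on the Hom-complexes by a sign; hence it is the identity on the cosets
  which are the morphisms of \<open>H\<^sup>0\<close>. A triangle is distinguished if it is isomorphic to
  \<open>X \<rightarrow> Y \<rightarrow> cone f \<rightarrow> X[1]\<close> for some closed \<open>f\<close>.
\<close>

definition H0_pretr :: "('o, 'm::ab_group_add, 'x) dgcat_scheme \<Rightarrow>
    (('o, 'm) twisted, (nat \<Rightarrow> nat \<Rightarrow> 'm) set) tricat" where
  "H0_pretr A = lincat.extend (H0 (pretr A)) \<lparr>
     tc_sh = pt_shift A,
     tc_shm = (\<lambda>k F. F),
     tc_dist = {t. \<exists>X \<in> pt_ob A. \<exists>Y \<in> pt_ob A. \<exists>f \<in> dg_cocycles (pretr A) X Y.
       tri_iso (H0 (pretr A)) (pt_shift A 1) (\<lambda>F. F)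
         (X, Y, pt_cone A X Y f,
          dg_class (pretr A) X Y f,
          dg_class (pretr A) Y (pt_cone A X Y f) (pt_cone_in A Y),
          dg_class (pretr A) (pt_cone A X Y f) (pt_shift A 1 X) (pt_cone_out A X Y)) t}\<rparr>"

subsection \<open>Linearisations\<close>

text \<open>
  An action of \<open>G\<close> on \<open>A\<close> is given by \<open>g\<^sup>*\<close> on objects (\<open>ao g\<close>) and on morphisms
  (\<open>am g\<close>). Only strict actions, \<open>(gh)\<^sup>* = h\<^sup>* g\<^sup>*\<close>, are needed below, so there are no coherence
  isomorphisms. Families \<open>\<lambda>\<^sub>g\<close> are extensional in \<open>g\<close>, so that they are equal iff all members are.
\<close>

definition linearisation :: "'g monoid \<Rightarrow> ('o, 'm::ab_group_add) dgcat \<Rightarrow>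
    ('g \<Rightarrow> 'o \<Rightarrow> 'o) \<Rightarrow> ('g \<Rightarrow> 'm \<Rightarrow> 'm) \<Rightarrow> 'o \<Rightarrow> ('g \<Rightarrow> 'm) \<Rightarrow> bool" where
  "linearisation G A ao am X l \<longleftrightarrow>
     l \<in> extensional (carrier G) \<and>
     (\<forall>g \<in> carrier G. l g \<in> dg_cocycles A X (ao g X) \<and>
        (\<exists>m \<in> dg_cocycles A (ao g X) X.
           dg_comp A X (ao g X) X m (l g) = dg_id A X \<and>
           dg_comp A (ao g X) X (ao g X) (l g) m = dg_id A (ao g X))) \<and>
     l \<one>\<^bsub>G\<^esub> = dg_id A X \<and>
     (\<forall>g \<in> carrier G. \<forall>h \<in> carrier G.
        l (g \<otimes>\<^bsub>G\<^esub> h) = dg_comp A X (ao h X) (ao h (ao g X)) (am h (l g)) (l h))"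

definition linearised :: "'g monoid \<Rightarrow> ('o, 'm::ab_group_add) dgcat \<Rightarrow>
    ('g \<Rightarrow> 'o \<Rightarrow> 'o) \<Rightarrow> ('g \<Rightarrow> 'm \<Rightarrow> 'm) \<Rightarrow> ('o \<times> ('g \<Rightarrow> 'm), 'm) dgcat" where
  "linearised G A ao am = \<lparr>
     dg_ob = {(X, l). X \<in> dg_ob A \<and> linearisation G A ao am X l},
     dg_hom = (\<lambda>(X, l) (X', l') k. {f \<in> dg_hom A X X' k. \<forall>g \<in> carrier G.
        dg_comp A X X' (ao g X') (l' g) f = dg_comp A X (ao g X) (ao g X') (am g f) (l g)}),
     dg_id = (\<lambda>(X, l). dg_id A X),
     dg_comp = (\<lambda>(X, l) (X', l') (X'', l''). dg_comp A X X' X''),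
     dg_scale = dg_scale A,
     dg_diff = (\<lambda>(X, l) (X', l'). dg_diff A X X')\<rparr>"


section \<open>The algebra \<open>B = \<complex>[s]/(s\<^sup>2)\<close> and its DG-modules\<close>

text \<open>Elements \<open>a + bs\<close> of \<open>B\<close> are represented by polynomials \<open>[:a, b:]\<close>; \<open>s\<close> has degree \<open>d\<close>.\<close>

definition Balg :: "complex poly set" where
  "Balg = {b. degree b \<le> 1}"

definition Bgr :: "int \<Rightarrow> int \<Rightarrow> complex poly set" where
  "Bgr d k = {b \<in> Balg. (coeff b 0 \<noteq> 0 \<longrightarrow> k = 0) \<and> (coeff b 1 \<noteq> 0 \<longrightarrow> k = d)}"

definition Bmult :: "complex poly \<Rightarrow> complex poly \<Rightarrow> complex poly" where
  "Bmult x b = (x * b) mod [:0, 0, 1:]"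

definition phi_neg :: "complex poly \<Rightarrow> complex poly" where
  "phi_neg b = b \<circ>\<^sub>p [:0, -1:]"

text \<open>
  The total spaces of DG-modules are subspaces of a fixed complex vector space of countably infinite
  dimension, for which we take \<^typ>\<open>complex poly\<close> (forgetting its multiplication). Every DG-module
  of finite dimension is isomorphic to one of this kind. The grading is an internal direct sum.
  Modules are right modules (\<open>dm_act M x b\<close> is \<open>x \<cdot> b\<close>), so that neither \<open>B\<close>-linearity of
  homogeneous maps nor the Leibniz rule (for the zero differential of \<open>B\<close>) involves a sign.
\<close>

record dgmod =
  dm_gr :: "int \<Rightarrow> complex poly set"
  dm_act :: "complex poly \<Rightarrow> complex poly \<Rightarrow> complex poly"
  dm_diff :: "complex poly \<Rightarrow> complex poly"

definition tot :: "dgmod \<Rightarrow> complex poly set" where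
  "tot M = module.span Polynomial.smult (\<Union>p. dm_gr M p)"

definition linear_on :: "complex poly set \<Rightarrow> (complex poly \<Rightarrow> complex poly) \<Rightarrow> bool" where
  "linear_on V f \<longleftrightarrow> (\<forall>x \<in> V. \<forall>y \<in> V. f (x + y) = f x + f y) \<and>
     (\<forall>c. \<forall>x \<in> V. f (Polynomial.smult c x) = Polynomial.smult c (f x))"

definition dg_module :: "int \<Rightarrow> dgmod \<Rightarrow> bool" where
  "dg_module d M \<longleftrightarrow>
     (\<forall>p. module.subspace Polynomial.smult (dm_gr M p)) \<and>
     (\<forall>x. (\<forall>p. x p \<in> dm_gr M p) \<and> finite {p. x p \<noteq> 0} \<and> (\<Sum>p | x p \<noteq> 0. x p) = 0
        \<longrightarrow> (\<forall>p. x p = 0)) \<and>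
     (\<forall>p k. \<forall>x \<in> dm_gr M p. \<forall>b \<in> Bgr d k. dm_act M x b \<in> dm_gr M (p + k)) \<and>
     (\<forall>b \<in> Balg. linear_on (tot M) (\<lambda>x. dm_act M x b)) \<and>
     (\<forall>x \<in> tot M. linear_on Balg (dm_act M x)) \<and>
     (\<forall>x \<in> tot M. dm_act M x 1 = x) \<and>
     (\<forall>x \<in> tot M. \<forall>b \<in> Balg. \<forall>c \<in> Balg. dm_act M (dm_act M x b) c = dm_act M x (Bmult b c)) \<and>
     linear_on (tot M) (dm_diff M) \<and>
     (\<forall>p. \<forall>x \<in> dm_gr M p. dm_diff M x \<in> dm_gr M (p + 1)) \<and>
     (\<forall>x \<in> tot M. dm_diff M (dm_diff M x) = 0) \<and>
     (\<forall>x \<in> tot M. \<forall>b \<in> Balg. dm_diff M (dm_act M x b) = dm_act M (dm_diff M x) b)"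

text \<open>
  Finitely generated and semi-free: there is a finite homogeneous \<open>B\<close>-basis
  \<open>e\<^sub>0, e\<^sub>1, \<dots>\<close> such that the differential of \<open>e\<^sub>j\<close> lies in the submodule generated by the \<open>e\<^sub>i\<close>
  with \<open>i < j\<close>.
\<close>

definition semifree :: "int \<Rightarrow> dgmod \<Rightarrow> bool" where
  "semifree d M \<longleftrightarrow> dg_module d M \<and>
     (\<exists>n e r. (\<forall>i<n::nat. e i \<in> dm_gr M (r i)) \<and>
        (\<forall>x \<in> tot M. \<exists>!b. b \<in> {..<n} \<rightarrow>\<^sub>E Balg \<and> x = (\<Sum>i<n. dm_act M (e i) (b i))) \<and>
        (\<forall>j<n. \<exists>b \<in> {..<j} \<rightarrow> Balg. dm_diff M (e j) = (\<Sum>i<j. dm_act M (e i) (b i))))"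

text \<open>Maps vanish outside of the total space of their source; this makes equality and addition of
  maps those of functions.\<close>

definition dm_hom :: "dgmod \<Rightarrow> dgmod \<Rightarrow> int \<Rightarrow> (complex poly \<Rightarrow> complex poly) set" where
  "dm_hom M N k = {f. linear_on (tot M) f \<and>
     (\<forall>p. \<forall>x \<in> dm_gr M p. f x \<in> dm_gr N (p + k)) \<and>
     (\<forall>x \<in> tot M. \<forall>b \<in> Balg. f (dm_act M x b) = dm_act N (f x) b) \<and>
     (\<forall>x. x \<notin> tot M \<longrightarrow> f x = 0)}"

definition semifree_cat :: "int \<Rightarrow> (dgmod, complex poly \<Rightarrow> complex poly) dgcat" where
  "semifree_cat d = \<lparr>
     dg_ob = {M. semifree d M},
     dg_hom = dm_hom,
     dg_id = (\<lambda>M x. if x \<in> tot M then x else 0),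
     dg_comp = (\<lambda>M N P g f x. if x \<in> tot M then g (f x) else 0),
     dg_scale = (\<lambda>c f x. Polynomial.smult c (f x)),
     dg_diff = (\<lambda>M N k f x.
        if x \<in> tot M then dm_diff N (f x) - Polynomial.smult (sg k) (f (dm_diff M x)) else 0)\<rparr>"

text \<open>The free module \<open>B\<close>, which corresponds to the spherical object \<open>E\<close>.\<close>

definition Bmod :: "int \<Rightarrow> dgmod" where
  "Bmod d = \<lparr>dm_gr = Bgr d, dm_act = Bmult, dm_diff = (\<lambda>x. 0)\<rparr>"

text \<open>The group \<open>\<int>/2\<int>\<close> and its action: the non-trivial element restricts the module structure along
  \<^const>\<open>phi_neg\<close> and leaves the maps unchanged.\<close>

abbreviation Z2 :: "int monoid" where
  "Z2 \<equiv> integer_mod_group 2"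

definition twist_ob :: "int \<Rightarrow> dgmod \<Rightarrow> dgmod" where
  "twist_ob g M = (if g = 0 then M else M\<lparr>dm_act := (\<lambda>x b. dm_act M x (phi_neg b))\<rparr>)"

definition twist_mor :: "int \<Rightarrow> (complex poly \<Rightarrow> complex poly) \<Rightarrow> (complex poly \<Rightarrow> complex poly)" where
  "twist_mor g f = f"

text \<open>The family \<open>\<lambda>\<^sup>\<epsilon>\<close>: for the non-trivial \<open>g\<close>, the \<open>B\<close>-linear map \<open>B \<rightarrow> (-1)\<^sup>*B\<close> with
  \<open>1 \<mapsto> \<epsilon>\<close>, that is \<open>b \<mapsto> \<epsilon> \<cdot> b\<close> with the action of \<open>b\<close> taken in \<open>(-1)\<^sup>*B\<close>.\<close>

definition lam :: "int \<Rightarrow> complex \<Rightarrow> int \<Rightarrow> (complex poly \<Rightarrow> complex poly)" where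
  "lam d \<epsilon> = (\<lambda>g \<in> carrier Z2. \<lambda>b. if b \<in> tot (Bmod d)
     then (if g = 0 then b else dm_act (twist_ob g (Bmod d)) [:\<epsilon>:] b) else 0)"

definition Tdlin :: "int \<Rightarrow>
    ((dgmod \<times> (int \<Rightarrow> complex poly \<Rightarrow> complex poly), complex poly \<Rightarrow> complex poly) twisted,
     (nat \<Rightarrow> nat \<Rightarrow> complex poly \<Rightarrow> complex poly) set) tricat" where
  "Tdlin d = H0_pretr (linearised Z2 (semifree_cat d) twist_ob twist_mor)"

text \<open>An object of a DG-category as an object of its pretriangulated hull.\<close>

definition pt_single :: "'o \<Rightarrow> ('o, 'm::zero) twisted" where
  "pt_single X = ([(X, 0)], (\<lambda>i j. 0))"


section \<open>The bounded derived category of finite-dimensional vector spaces\<close>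

text \<open>
  Finite-dimensional vector spaces are taken to be the spaces \<open>\<complex>\<^sup>n\<close>, and linear maps to be matrices.
  A complex consists of the dimensions of its terms and of its differentials.
\<close>

type_synonym cplx = "(int \<Rightarrow> nat) \<times> (int \<Rightarrow> complex mat)"

type_synonym cmap = "int \<Rightarrow> complex mat"

definition vc_complexes :: "cplx set" where
  "vc_complexes = {(n, d). finite {i. n i \<noteq> 0} \<and> (\<forall>i. d i \<in> carrier_mat (n (i + 1)) (n i)) \<and>
     (\<forall>i. d (i + 1) * d i = 0\<^sub>m (n (i + 2)) (n i))}"

definition vc_maps :: "cplx \<Rightarrow> cplx \<Rightarrow> cmap set" where
  "vc_maps X Y = {f. (\<forall>i. f i \<in> carrier_mat (fst Y i) (fst X i)) \<and>
     (\<forall>i. snd Y i * f i = f (i + 1) * snd X i)}"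

definition vc_homotopic :: "cplx \<Rightarrow> cplx \<Rightarrow> cmap \<Rightarrow> cmap \<Rightarrow> bool" where
  "vc_homotopic X Y f g \<longleftrightarrow> (\<exists>h. (\<forall>i. h i \<in> carrier_mat (fst Y (i - 1)) (fst X i)) \<and>
     (\<forall>i. f i - g i = snd Y (i - 1) * h i + h (i + 1) * snd X i))"

definition vc_class :: "cplx \<Rightarrow> cplx \<Rightarrow> cmap \<Rightarrow> cmap set" where
  "vc_class X Y f = {g \<in> vc_maps X Y. vc_homotopic X Y f g}"

definition vc_lin :: "(cplx, cmap set) lincat" where
  "vc_lin = \<lparr>
     lc_ob = vc_complexes,
     lc_hom = (\<lambda>X Y. vc_class X Y ` vc_maps X Y),
     lc_id = (\<lambda>X. vc_class X X (\<lambda>i. 1\<^sub>m (fst X i))),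
     lc_comp = (\<lambda>X Y Z G F. \<Union>g \<in> G. \<Union>f \<in> F. vc_class X Z (\<lambda>i. g i * f i)),
     lc_zero = (\<lambda>X Y. vc_class X Y (\<lambda>i. 0\<^sub>m (fst Y i) (fst X i))),
     lc_add = (\<lambda>X Y F G. \<Union>f \<in> F. \<Union>g \<in> G. vc_class X Y (\<lambda>i. f i + g i)),
     lc_scale = (\<lambda>X Y c F. \<Union>f \<in> F. vc_class X Y (\<lambda>i. c \<cdot>\<^sub>m f i))\<rparr>"

definition vc_shift :: "int \<Rightarrow> cplx \<Rightarrow> cplx" where
  "vc_shift k X = ((\<lambda>i. fst X (i + k)), (\<lambda>i. sg k \<cdot>\<^sub>m snd X (i + k)))"

definition vc_shm :: "int \<Rightarrow> cmap set \<Rightarrow> cmap set" where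
  "vc_shm k F = (\<lambda>f i. f (i + k)) ` F"

definition vc_cone :: "cplx \<Rightarrow> cplx \<Rightarrow> cmap \<Rightarrow> cplx" where
  "vc_cone X Y f = ((\<lambda>i. fst Y i + fst X (i + 1)),
     (\<lambda>i. four_block_mat (snd Y i) (f (i + 1))
            (0\<^sub>m (fst X (i + 2)) (fst Y i)) (- snd X (i + 1))))"

definition vc_cone_in :: "cplx \<Rightarrow> cplx \<Rightarrow> cmap" where
  "vc_cone_in X Y = (\<lambda>i. mat (fst Y i + fst X (i + 1)) (fst Y i)
     (\<lambda>(r, c). if r = c then 1 else 0))"

definition vc_cone_out :: "cplx \<Rightarrow> cplx \<Rightarrow> cmap" where
  "vc_cone_out X Y = (\<lambda>i. mat (fst X (i + 1)) (fst Y i + fst X (i + 1))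
     (\<lambda>(r, c). if c = fst Y i + r then 1 else 0))"

text \<open>The bounded homotopy category \<open>K\<^sup>b\<close>.\<close>

definition Kb_vect :: "(cplx, cmap set) tricat" where
  "Kb_vect = lincat.extend vc_lin \<lparr>
     tc_sh = vc_shift,
     tc_shm = vc_shm,
     tc_dist = {t. \<exists>X \<in> vc_complexes. \<exists>Y \<in> vc_complexes. \<exists>f \<in> vc_maps X Y.
       tri_iso vc_lin (vc_shift 1) (vc_shm 1)
         (X, Y, vc_cone X Y f,
          vc_class X Y f,
          vc_class Y (vc_cone X Y f) (vc_cone_in X Y),
          vc_class (vc_cone X Y f) (vc_shift 1 X) (vc_cone_out X Y)) t}\<rparr>"

text \<open>Cohomology, as the set of cosets of the coboundaries in the cocycles, and quasi-isomorphisms.\<close>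

definition vc_cls :: "cplx \<Rightarrow> int \<Rightarrow> complex vec \<Rightarrow> complex vec set" where
  "vc_cls X i v = {v + snd X (i - 1) *\<^sub>v u | u. u \<in> carrier_vec (fst X (i - 1))}"

definition vc_coh :: "cplx \<Rightarrow> int \<Rightarrow> complex vec set set" where
  "vc_coh X i = vc_cls X i ` mat_kernel (snd X i)"

definition vc_qis :: "cplx \<Rightarrow> cplx \<Rightarrow> cmap \<Rightarrow> bool" where
  "vc_qis X Y f \<longleftrightarrow>
     (\<forall>i. bij_betw (\<lambda>c. \<Union>v \<in> c. vc_cls Y i (f i *\<^sub>v v)) (vc_coh X i) (vc_coh Y i))"

subsection \<open>Localisation by a calculus of right fractions\<close>

text \<open>
  For a class \<open>S\<close> of morphisms of \<open>C\<close> satisfying the Ore conditions, the morphisms \<open>X \<rightarrow> Y\<close> of the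
  localisation are the equivalence classes of roofs \<open>X \<leftarrow> W \<rightarrow> Y\<close> (written \<open>(W, s, f)\<close>) with \<open>s\<close>
  in \<open>S\<close>. The shift of \<open>C\<close> is supposed to be an automorphism that preserves \<open>S\<close>, so that it maps
  equivalence classes onto equivalence classes.
\<close>

type_synonym ('o, 'm) roof = "'o \<times> 'm \<times> 'm"

definition roofs :: "('o, 'm) tricat \<Rightarrow> ('o \<Rightarrow> 'o \<Rightarrow> 'm set) \<Rightarrow> 'o \<Rightarrow> 'o \<Rightarrow> ('o, 'm) roof set" where
  "roofs C S X Y = {(W, s, f). W \<in> lc_ob C \<and> s \<in> S W X \<and> s \<in> lc_hom C W X \<and> f \<in> lc_hom C W Y}"

definition roof_class :: "('o, 'm) tricat \<Rightarrow> ('o \<Rightarrow> 'o \<Rightarrow> 'm set) \<Rightarrow> 'o \<Rightarrow> 'o \<Rightarrow>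
    ('o, 'm) roof \<Rightarrow> ('o, 'm) roof set" where
  "roof_class C S X Y = (\<lambda>(W, s, f). {(W', s', f') \<in> roofs C S X Y.
     \<exists>V \<in> lc_ob C. \<exists>u \<in> lc_hom C V W. \<exists>u' \<in> lc_hom C V W'.
       lc_comp C V W X s u \<in> S V X \<and>
       lc_comp C V W X s u = lc_comp C V W' X s' u' \<and>
       lc_comp C V W Y f u = lc_comp C V W' Y f' u'})"

definition loc_lin :: "('o, 'm) tricat \<Rightarrow> ('o \<Rightarrow> 'o \<Rightarrow> 'm set) \<Rightarrow> ('o, ('o, 'm) roof set) lincat" where
  "loc_lin C S = \<lparr>
     lc_ob = lc_ob C,
     lc_hom = (\<lambda>X Y. roof_class C S X Y ` roofs C S X Y),
     lc_id = (\<lambda>X. roof_class C S X X (X, lc_id C X, lc_id C X)),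
     lc_comp = (\<lambda>X Y Z \<beta> \<alpha>. \<Union>{roof_class C S X Z
          (V, lc_comp C V W X s u, lc_comp C V W' Z g v) | V W W' s f t g u v.
          (W, s, f) \<in> \<alpha> \<and> (W', t, g) \<in> \<beta> \<and> V \<in> lc_ob C \<and>
          u \<in> lc_hom C V W \<and> u \<in> S V W \<and> v \<in> lc_hom C V W' \<and>
          lc_comp C V W Y f u = lc_comp C V W' Y t v}),
     lc_zero = (\<lambda>X Y. roof_class C S X Y (X, lc_id C X, lc_zero C X Y)),
     lc_add = (\<lambda>X Y \<alpha> \<beta>. \<Union>{roof_class C S X Y (W, s, lc_add C W Y f g) | W s f g.
          (W, s, f) \<in> \<alpha> \<and> (W, s, g) \<in> \<beta>}),
     lc_scale = (\<lambda>X Y c \<alpha>. \<Union>{roof_class C S X Y (W, s, lc_scale C W Y c f) | W s f.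
          (W, s, f) \<in> \<alpha>})\<rparr>"

definition loc_shm :: "('o, 'm) tricat \<Rightarrow> int \<Rightarrow> ('o, 'm) roof set \<Rightarrow> ('o, 'm) roof set" where
  "loc_shm C k \<alpha> = {(tc_sh C k W, tc_shm C k s, tc_shm C k f) | W s f. (W, s, f) \<in> \<alpha>}"

definition loc_mor :: "('o, 'm) tricat \<Rightarrow> ('o \<Rightarrow> 'o \<Rightarrow> 'm set) \<Rightarrow> 'o \<Rightarrow> 'o \<Rightarrow> 'm \<Rightarrow>
    ('o, 'm) roof set" where
  "loc_mor C S X Y f = roof_class C S X Y (X, lc_id C X, f)"

definition localisation ::
  "('o, 'm) tricat \<Rightarrow> ('o \<Rightarrow> 'o \<Rightarrow> 'm set) \<Rightarrow> ('o, ('o, 'm) roof set) tricat" where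
  "localisation C S = lincat.extend (loc_lin C S) \<lparr>
     tc_sh = tc_sh C,
     tc_shm = loc_shm C,
     tc_dist = {t. \<exists>X Y Z u v w. (X, Y, Z, u, v, w) \<in> tc_dist C \<and>
       tri_iso (loc_lin C S) (tc_sh C 1) (loc_shm C 1)
         (X, Y, Z, loc_mor C S X Y u, loc_mor C S Y Z v, loc_mor C S Z (tc_sh C 1 X) w) t}\<rparr>"

definition Db_vect :: "(cplx, (cplx, cmap set) roof set) tricat" where
  "Db_vect = localisation Kb_vect (\<lambda>X Y. {F. \<exists>f \<in> F. vc_qis X Y f})"

end

theory Submission
  imports Defs
begin

text \<open>
  A \<open>B\<close>-linear endomorphism of \<open>B\<close> is the multiplication by some \<open>a + bs\<close>; since \<open>\<lambda>\<^sub>g\<close> changes the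
  sign of \<open>s\<close> relative to \<open>1\<close>, compatibility with the linearisation forces \<open>b = 0\<close>. So
  \<open>(E, \<lambda>)\<close> is exceptional, already on the level of Hom-complexes. As these are finite-dimensional,
  every object \<open>Y\<close> receives a morphism from a sum of shifts of \<open>E\<close> that induces bijections on
  cohomology classes of morphisms from \<open>E\<close>, and dually maps universally to such a sum; hence the
  sums of shifts of \<open>E\<close>, which make up the left orthogonal of the objects \<open>Z\<close> with
  \<open>Hom(E, Z[k]) = 0\<close> for all \<open>k\<close>, form an admissible subcategory. A bounded complex of vector
  spaces gives a twisted complex of shifts of \<open>E\<close>, fully faithfully up to homotopy. Quasi-isomorphisms
  of such complexes are homotopy equivalences, so \<open>D\<^sup>b\<close> differs from \<open>K\<^sup>b\<close> only by localising at
  isomorphisms.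
\<close>

section \<open>Linear and triangulated categories\<close>

text \<open>Computing directly with matrices of twisted complexes would burden every diagram chase
  with index ranges, shifts and signs. The chases are therefore done in one ring that contains all
  morphisms: an object is an idempotent \<open>one X\<close> with an element \<open>D X\<close> of
  square zero, the differential of a Hom-complex is a graded commutator, and a cone is four maps
  with a few relations. The concrete category only has to supply these data. The subcategory is
  defined by orthogonality because a left orthogonal is closed under cones, shifts and homotopy
  equivalence by short arguments; that its objects are sums of shifts is a consequence. Complexes of
  vector spaces enter through coordinates (inclusions, projections, a scalar twisting matrix).
  Coordinates are chosen for each complex, so the embedding respects shifts and cones only up to
  isomorphism, and the isomorphisms are identity matrices between two choices. The homotopy category
  inherits its composition laws from the category into which it embeds.\<close>

locale lin_category =
  fixes C :: "('o, 'm, 'x) lincat_scheme"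
  assumes id_in: "X \<in> lc_ob C \<Longrightarrow> lc_id C X \<in> lc_hom C X X"
    and comp_in: "\<lbrakk>X \<in> lc_ob C; Y \<in> lc_ob C; Z \<in> lc_ob C; f \<in> lc_hom C X Y; g \<in> lc_hom C Y Z\<rbrakk>
      \<Longrightarrow> lc_comp C X Y Z g f \<in> lc_hom C X Z"
    and id_left: "\<lbrakk>X \<in> lc_ob C; Y \<in> lc_ob C; f \<in> lc_hom C X Y\<rbrakk>
      \<Longrightarrow> lc_comp C X Y Y (lc_id C Y) f = f"
    and id_right: "\<lbrakk>X \<in> lc_ob C; Y \<in> lc_ob C; f \<in> lc_hom C X Y\<rbrakk>
      \<Longrightarrow> lc_comp C X X Y f (lc_id C X) = f"
    and assoc: "\<lbrakk>X \<in> lc_ob C; Y \<in> lc_ob C; Z \<in> lc_ob C; W \<in> lc_ob C;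
        f \<in> lc_hom C X Y; g \<in> lc_hom C Y Z; h \<in> lc_hom C Z W\<rbrakk>
      \<Longrightarrow> lc_comp C X Y W (lc_comp C Y Z W h g) f = lc_comp C X Z W h (lc_comp C X Y Z g f)"
    and add_in: "\<lbrakk>X \<in> lc_ob C; Y \<in> lc_ob C; f \<in> lc_hom C X Y; g \<in> lc_hom C X Y\<rbrakk>
      \<Longrightarrow> lc_add C X Y f g \<in> lc_hom C X Y"
    and scale_in: "\<lbrakk>X \<in> lc_ob C; Y \<in> lc_ob C; f \<in> lc_hom C X Y\<rbrakk>
      \<Longrightarrow> lc_scale C X Y c f \<in> lc_hom C X Y"
    and add_comp: "\<lbrakk>X \<in> lc_ob C; Y \<in> lc_ob C; Z \<in> lc_ob C; u \<in> lc_hom C X Y;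
        f \<in> lc_hom C Y Z; g \<in> lc_hom C Y Z\<rbrakk>
      \<Longrightarrow> lc_comp C X Y Z (lc_add C Y Z f g) u
        = lc_add C X Z (lc_comp C X Y Z f u) (lc_comp C X Y Z g u)"
    and scale_comp: "\<lbrakk>X \<in> lc_ob C; Y \<in> lc_ob C; Z \<in> lc_ob C; u \<in> lc_hom C X Y; f \<in> lc_hom C Y Z\<rbrakk>
      \<Longrightarrow> lc_comp C X Y Z (lc_scale C Y Z c f) u = lc_scale C X Z c (lc_comp C X Y Z f u)"
begin

lemma iso_id: "X \<in> lc_ob C \<Longrightarrow> lc_iso C X X (lc_id C X)"
  unfolding lc_iso_def using id_in id_left by blast

lemma iso_in: "lc_iso C X Y f \<Longrightarrow> f \<in> lc_hom C X Y"
  by (simp add: lc_iso_def)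

lemma iso_inv:
  assumes "lc_iso C X Y f"
  obtains g where "lc_iso C Y X g" "g \<in> lc_hom C Y X" "lc_comp C X Y X g f = lc_id C X"
    "lc_comp C Y X Y f g = lc_id C Y"
  using assms unfolding lc_iso_def by blast

lemma iso_comp:
  assumes ob: "X \<in> lc_ob C" "Y \<in> lc_ob C" "Z \<in> lc_ob C"
    and f: "lc_iso C X Y f" and g: "lc_iso C Y Z g"
  shows "lc_iso C X Z (lc_comp C X Y Z g f)"
proof -
  obtain f' where f': "f' \<in> lc_hom C Y X" "lc_comp C X Y X f' f = lc_id C X"
    "lc_comp C Y X Y f f' = lc_id C Y" using iso_inv[OF f] by metis
  obtain g' where g': "g' \<in> lc_hom C Z Y" "lc_comp C Y Z Y g' g = lc_id C Y"
    "lc_comp C Z Y Z g g' = lc_id C Z" using iso_inv[OF g] by metis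
  note fh = iso_in[OF f] and gh = iso_in[OF g]
  have "lc_comp C X Z X (lc_comp C Z Y X f' g') (lc_comp C X Y Z g f)
      = lc_comp C X Y X f' (lc_comp C X Z Y g' (lc_comp C X Y Z g f))"
    using ob fh gh f' g' comp_in assoc by metis
  also have "lc_comp C X Z Y g' (lc_comp C X Y Z g f) = f"
    using ob fh gh g' assoc[of X Y Z Y f g g'] id_left by simp
  finally have 1: "lc_comp C X Z X (lc_comp C Z Y X f' g') (lc_comp C X Y Z g f) = lc_id C X"
    using f' by simp
  have "lc_comp C Z X Z (lc_comp C X Y Z g f) (lc_comp C Z Y X f' g')
      = lc_comp C Z Y Z g (lc_comp C Z X Y f (lc_comp C Z Y X f' g'))"
    using ob fh gh f' g' comp_in assoc by metis
  also have "lc_comp C Z X Y f (lc_comp C Z Y X f' g') = g'"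
    using ob fh gh f' g' assoc[of Z Y X Y g' f' f] id_left by simp
  finally have 2: "lc_comp C Z X Z (lc_comp C X Y Z g f) (lc_comp C Z Y X f' g') = lc_id C Z"
    using g' by simp
  show ?thesis unfolding lc_iso_def
    using 1 2 comp_in ob fh gh f' g' by blast
qed

text \<open>Isomorphisms are epimorphisms; this makes the morphism represented by a roof
  unique.\<close>

lemma iso_cancel_right:
  assumes ob: "X \<in> lc_ob C" "Y \<in> lc_ob C" "Z \<in> lc_ob C"
    and s: "lc_iso C X Y s" and f: "f \<in> lc_hom C Y Z" "g \<in> lc_hom C Y Z"
    and eq: "lc_comp C X Y Z f s = lc_comp C X Y Z g s"
  shows "f = g"
proof -
  obtain s' where s': "s' \<in> lc_hom C Y X" "lc_comp C Y X Y s s' = lc_id C Y"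
    using iso_inv[OF s] by metis
  note sh = iso_in[OF s]
  have "lc_comp C Y X Z (lc_comp C X Y Z h s) s' = h" if "h \<in> lc_hom C Y Z" for h
    using that ob s' sh assoc[of Y X Y Z s' s h] id_right by simp
  then show ?thesis using f eq by metis
qed

text \<open>\<open>f\<close> is the composite of \<open>g f\<close> with the inverse of
  \<open>g\<close>. This identifies the legs of a common refinement of two roofs as
  isomorphisms.\<close>

lemma iso_two_of_three:
  assumes ob: "X \<in> lc_ob C" "Y \<in> lc_ob C" "Z \<in> lc_ob C"
    and g: "lc_iso C Y Z g" and f: "f \<in> lc_hom C X Y" and gf: "lc_iso C X Z (lc_comp C X Y Z g f)"
  shows "lc_iso C X Y f"
proof -
  obtain g' where g': "lc_iso C Z Y g'" "g' \<in> lc_hom C Z Y" "lc_comp C Y Z Y g' g = lc_id C Y"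
    using iso_inv[OF g] by metis
  have "lc_comp C X Z Y g' (lc_comp C X Y Z g f) = f"
    using ob f g' iso_in[OF g] assoc[of X Y Z Y f g g'] id_left by simp
  then show ?thesis using iso_comp[OF ob(1,3,2) gf g'(1)] by simp
qed

end

text \<open>What is recorded is what moves distinguished triangles along isomorphisms: the shift by
  1 is a functor, and the distinguished triangles are the triangles isomorphic to a member of a set
  of standard ones.\<close>

locale tri_category = lin_category C for C :: "('o, 'm) tricat" +
  fixes standard :: "('o, 'm) triangle set"
  assumes sh_ob: "X \<in> lc_ob C \<Longrightarrow> tc_sh C k X \<in> lc_ob C"
    and shm_in: "\<lbrakk>X \<in> lc_ob C; Y \<in> lc_ob C; f \<in> lc_hom C X Y\<rbrakk>
      \<Longrightarrow> tc_shm C 1 f \<in> lc_hom C (tc_sh C 1 X) (tc_sh C 1 Y)"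
    and shm_id: "X \<in> lc_ob C \<Longrightarrow> tc_shm C 1 (lc_id C X) = lc_id C (tc_sh C 1 X)"
    and shm_comp: "\<lbrakk>X \<in> lc_ob C; Y \<in> lc_ob C; Z \<in> lc_ob C; f \<in> lc_hom C X Y; g \<in> lc_hom C Y Z\<rbrakk>
      \<Longrightarrow> tc_shm C 1 (lc_comp C X Y Z g f)
        = lc_comp C (tc_sh C 1 X) (tc_sh C 1 Y) (tc_sh C 1 Z) (tc_shm C 1 g) (tc_shm C 1 f)"
    and dist_eq: "tc_dist C = {t. \<exists>t0 \<in> standard. tri_iso C (tc_sh C 1) (tc_shm C 1) t0 t}"
begin

lemma shm_iso:
  assumes "X \<in> lc_ob C" "Y \<in> lc_ob C" "lc_iso C X Y f"
  shows "lc_iso C (tc_sh C 1 X) (tc_sh C 1 Y) (tc_shm C 1 f)"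
proof -
  obtain g where g: "g \<in> lc_hom C Y X" "lc_comp C X Y X g f = lc_id C X"
    "lc_comp C Y X Y f g = lc_id C Y" using iso_inv[OF assms(3)] by metis
  note fh = iso_in[OF assms(3)]
  show ?thesis unfolding lc_iso_def
    using g fh shm_in shm_comp[of X Y X f g] shm_comp[of Y X Y g f] shm_id assms(1,2) by metis
qed

text \<open>The component isomorphisms are composed. In the last square the composite appears
  shifted, so functoriality of the shift enters.\<close>

lemma tri_iso_trans:
  assumes 1: "tri_iso C (tc_sh C 1) (tc_shm C 1) t t'"
    and 2: "tri_iso C (tc_sh C 1) (tc_shm C 1) t' t''"
  shows "tri_iso C (tc_sh C 1) (tc_shm C 1) t t''"
proof -
  obtain X Y Z u v w X' Y' Z' u' v' w' X'' Y'' Z'' u'' v'' w'' where t: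
    "t = (X, Y, Z, u, v, w)" "t' = (X', Y', Z', u', v', w')" "t'' = (X'', Y'', Z'', u'', v'', w'')"
    using prod_cases6 by metis
  obtain a b c where abc: "lc_iso C X X' a" "lc_iso C Y Y' b" "lc_iso C Z Z' c"
      "lc_comp C X Y Y' b u = lc_comp C X X' Y' u' a"
      "lc_comp C Y Z Z' c v = lc_comp C Y Y' Z' v' b"
      "lc_comp C Z (tc_sh C 1 X) (tc_sh C 1 X') (tc_shm C 1 a) w = lc_comp C Z Z' (tc_sh C 1 X') w' c"
    using 1 unfolding tri_iso_def t by auto
  obtain a' b' c' where abc': "lc_iso C X' X'' a'" "lc_iso C Y' Y'' b'" "lc_iso C Z' Z'' c'"
      "lc_comp C X' Y' Y'' b' u' = lc_comp C X' X'' Y'' u'' a'"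
      "lc_comp C Y' Z' Z'' c' v' = lc_comp C Y' Y'' Z'' v'' b'"
      "lc_comp C Z' (tc_sh C 1 X') (tc_sh C 1 X'') (tc_shm C 1 a') w'
        = lc_comp C Z' Z'' (tc_sh C 1 X'') w'' c'"
    using 2 unfolding tri_iso_def t by auto
  have ob: "X \<in> lc_ob C" "Y \<in> lc_ob C" "Z \<in> lc_ob C" "X' \<in> lc_ob C" "Y' \<in> lc_ob C" "Z' \<in> lc_ob C"
      "X'' \<in> lc_ob C" "Y'' \<in> lc_ob C" "Z'' \<in> lc_ob C"
    and hm: "u \<in> lc_hom C X Y" "v \<in> lc_hom C Y Z" "w \<in> lc_hom C Z (tc_sh C 1 X)"
      "u' \<in> lc_hom C X' Y'" "v' \<in> lc_hom C Y' Z'" "w' \<in> lc_hom C Z' (tc_sh C 1 X')"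
      "u'' \<in> lc_hom C X'' Y''" "v'' \<in> lc_hom C Y'' Z''" "w'' \<in> lc_hom C Z'' (tc_sh C 1 X'')"
    using 1 2 unfolding tri_iso_def t by auto
  note h = abc(1-3)[THEN iso_in] abc'(1-3)[THEN iso_in]
  \<comment> \<open>Pasting of two commutative squares, stated once for all three squares of a
    triangle.\<close>
  have sq: "lc_comp C A B B'' (lc_comp C B B' B'' y' y) x = lc_comp C A A'' B'' x'' (lc_comp C A A' A'' z' z)"
    if "A \<in> lc_ob C" "B \<in> lc_ob C" "A' \<in> lc_ob C" "B' \<in> lc_ob C" "A'' \<in> lc_ob C" "B'' \<in> lc_ob C"
      "x \<in> lc_hom C A B" "x' \<in> lc_hom C A' B'" "x'' \<in> lc_hom C A'' B''"
      "y \<in> lc_hom C B B'" "y' \<in> lc_hom C B' B''" "z \<in> lc_hom C A A'" "z' \<in> lc_hom C A' A''"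
      "lc_comp C A B B' y x = lc_comp C A A' B' x' z"
      "lc_comp C A' B' B'' y' x' = lc_comp C A' A'' B'' x'' z'"
    for A B A' B' A'' B'' x x' x'' y y' z z'
  proof -
    have "lc_comp C A B B'' (lc_comp C B B' B'' y' y) x = lc_comp C A B' B'' y' (lc_comp C A B B' y x)"
      by (rule assoc[OF that(1,2,4,6,7,10,11)])
    also have "\<dots> = lc_comp C A A' B'' (lc_comp C A' B' B'' y' x') z"
      using assoc[OF that(1,3,4,6,12,8,11)] that(14) by simp
    also have "\<dots> = lc_comp C A A'' B'' x'' (lc_comp C A A' A'' z' z)"
      using assoc[OF that(1,3,5,6,12,13,9)] that(15) by simp
    finally show ?thesis .
  qed
  have 3: "lc_comp C Z (tc_sh C 1 X) (tc_sh C 1 X'') (tc_shm C 1 (lc_comp C X X' X'' a' a)) w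
      = lc_comp C Z Z'' (tc_sh C 1 X'') w'' (lc_comp C Z Z' Z'' c' c)"
    using sq[of Z "tc_sh C 1 X" Z' "tc_sh C 1 X'" Z'' "tc_sh C 1 X''" w w' w'' "tc_shm C 1 a"
        "tc_shm C 1 a'" c c'] ob hm h abc abc' sh_ob shm_in shm_comp by simp
  show ?thesis unfolding tri_iso_def t split_def fst_conv snd_conv
    using ob hm iso_comp[OF _ _ _ abc(1) abc'(1)] iso_comp[OF _ _ _ abc(2) abc'(2)]
      iso_comp[OF _ _ _ abc(3) abc'(3)] 3
      sq[of X Y X' Y' X'' Y'' u u' u'' b b' a a'] sq[of Y Z Y' Z' Y'' Z'' v v' v'' c c' b b'] abc abc' h
    by blast
qed

lemma dist_iso:
  "t \<in> tc_dist C \<Longrightarrow> tri_iso C (tc_sh C 1) (tc_shm C 1) t t' \<Longrightarrow> t' \<in> tc_dist C"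
  unfolding dist_eq using tri_iso_trans by blast

lemma dist_typed:
  assumes "(X, Y, Z, u, v, w) \<in> tc_dist C"
  shows "X \<in> lc_ob C" "Y \<in> lc_ob C" "Z \<in> lc_ob C" "u \<in> lc_hom C X Y" "v \<in> lc_hom C Y Z"
    "w \<in> lc_hom C Z (tc_sh C 1 X)"
  using assms unfolding dist_eq tri_iso_def by auto

end

lemma functorD:
  assumes "is_functor C D F"
  shows "X \<in> lc_ob C \<Longrightarrow> fo F X \<in> lc_ob D"
    and "\<lbrakk>X \<in> lc_ob C; Y \<in> lc_ob C; f \<in> lc_hom C X Y\<rbrakk> \<Longrightarrow> fm F X Y f \<in> lc_hom D (fo F X) (fo F Y)"
    and "X \<in> lc_ob C \<Longrightarrow> fm F X X (lc_id C X) = lc_id D (fo F X)"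
    and "\<lbrakk>X \<in> lc_ob C; Y \<in> lc_ob C; Z \<in> lc_ob C; f \<in> lc_hom C X Y; g \<in> lc_hom C Y Z\<rbrakk>
      \<Longrightarrow> fm F X Z (lc_comp C X Y Z g f)
        = lc_comp D (fo F X) (fo F Y) (fo F Z) (fm F Y Z g) (fm F X Y f)"
  using assms unfolding is_functor_def by blast+

lemma functor_iso:
  assumes F: "is_functor C D F" and "X \<in> lc_ob C" "Y \<in> lc_ob C" "lc_iso C X Y f"
  shows "lc_iso D (fo F X) (fo F Y) (fm F X Y f)"
  using assms(2-) functorD[OF F] unfolding lc_iso_def by metis

text \<open>By naturality of \<open>\<theta>\<close> the third square survives although its last
  vertex is moved from \<open>F (X[1])\<close> to \<open>(F X)[1]\<close>. Hence exactness of a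
  functor can be checked on standard triangles.\<close>

lemma exact_functor_tri_iso:
  assumes C: "tri_category C sC" and D: "tri_category D sD" and F: "is_functor C D F"
    and th: "\<And>X. X \<in> lc_ob C \<Longrightarrow> lc_iso D (fo F (tc_sh C 1 X)) (tc_sh D 1 (fo F X)) (\<theta> X)"
    and nat: "\<And>X Y f. \<lbrakk>X \<in> lc_ob C; Y \<in> lc_ob C; f \<in> lc_hom C X Y\<rbrakk> \<Longrightarrow>
             lc_comp D (fo F (tc_sh C 1 X)) (tc_sh D 1 (fo F X)) (tc_sh D 1 (fo F Y))
               (tc_shm D 1 (fm F X Y f)) (\<theta> X) =
             lc_comp D (fo F (tc_sh C 1 X)) (fo F (tc_sh C 1 Y)) (tc_sh D 1 (fo F Y))
               (\<theta> Y) (fm F (tc_sh C 1 X) (tc_sh C 1 Y) (tc_shm C 1 f))"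
    and t: "tri_iso C (tc_sh C 1) (tc_shm C 1) (X, Y, Z, u, v, w) (X', Y', Z', u', v', w')"
  shows "tri_iso D (tc_sh D 1) (tc_shm D 1)
    (fo F X, fo F Y, fo F Z, fm F X Y u, fm F Y Z v,
      lc_comp D (fo F Z) (fo F (tc_sh C 1 X)) (tc_sh D 1 (fo F X)) (\<theta> X) (fm F Z (tc_sh C 1 X) w))
    (fo F X', fo F Y', fo F Z', fm F X' Y' u', fm F Y' Z' v',
      lc_comp D (fo F Z') (fo F (tc_sh C 1 X')) (tc_sh D 1 (fo F X')) (\<theta> X')
        (fm F Z' (tc_sh C 1 X') w'))"
proof -
  interpret C: tri_category C sC by (rule C)
  interpret D: tri_category D sD by (rule D)
  note Fo = functorD(1)[OF F] and Fm = functorD(2)[OF F] and Fc = functorD(4)[OF F]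
  obtain a b c where abc: "lc_iso C X X' a" "lc_iso C Y Y' b" "lc_iso C Z Z' c"
      "lc_comp C X Y Y' b u = lc_comp C X X' Y' u' a"
      "lc_comp C Y Z Z' c v = lc_comp C Y Y' Z' v' b"
      "lc_comp C Z (tc_sh C 1 X) (tc_sh C 1 X') (tc_shm C 1 a) w = lc_comp C Z Z' (tc_sh C 1 X') w' c"
    using t unfolding tri_iso_def by auto
  have ob: "X \<in> lc_ob C" "Y \<in> lc_ob C" "Z \<in> lc_ob C" "X' \<in> lc_ob C" "Y' \<in> lc_ob C" "Z' \<in> lc_ob C"
    and hm: "u \<in> lc_hom C X Y" "v \<in> lc_hom C Y Z" "w \<in> lc_hom C Z (tc_sh C 1 X)"
      "u' \<in> lc_hom C X' Y'" "v' \<in> lc_hom C Y' Z'" "w' \<in> lc_hom C Z' (tc_sh C 1 X')"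
    using t unfolding tri_iso_def by auto
  note h = abc(1-3)[THEN C.iso_in]
  note sob = ob ob[THEN C.sh_ob, of 1]
  note thin = th[THEN D.iso_in]
  let ?s = "tc_sh C 1" and ?S = "tc_sh D 1"
  have sa: "tc_shm C 1 a \<in> lc_hom C (?s X) (?s X')" using C.shm_in ob h by blast
  \<comment> \<open>The third square: naturality of \<open>\<theta>\<close> exchanges the shift in
    \<open>D\<close> for the shift in \<open>C\<close>, after which the square in \<open>C\<close>
    is transported by \<open>F\<close>.\<close>
  have "lc_comp D (fo F Z) (?S (fo F X)) (?S (fo F X')) (tc_shm D 1 (fm F X X' a))
          (lc_comp D (fo F Z) (fo F (?s X)) (?S (fo F X)) (\<theta> X) (fm F Z (?s X) w))
      = lc_comp D (fo F Z) (fo F (?s X)) (?S (fo F X'))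
          (lc_comp D (fo F (?s X)) (?S (fo F X)) (?S (fo F X')) (tc_shm D 1 (fm F X X' a)) (\<theta> X))
          (fm F Z (?s X) w)"
    using D.assoc[of "fo F Z" "fo F (?s X)" "?S (fo F X)" "?S (fo F X')" "fm F Z (?s X) w" "\<theta> X"
        "tc_shm D 1 (fm F X X' a)"] sob hm h thin Fo Fm D.sh_ob D.shm_in by simp
  also have "\<dots> = lc_comp D (fo F Z) (fo F (?s X)) (?S (fo F X'))
      (lc_comp D (fo F (?s X)) (fo F (?s X')) (?S (fo F X')) (\<theta> X')
         (fm F (?s X) (?s X') (tc_shm C 1 a))) (fm F Z (?s X) w)"
    using nat ob h by simp
  also have "\<dots> = lc_comp D (fo F Z) (fo F (?s X')) (?S (fo F X')) (\<theta> X')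
      (lc_comp D (fo F Z) (fo F (?s X)) (fo F (?s X')) (fm F (?s X) (?s X') (tc_shm C 1 a)) (fm F Z (?s X) w))"
    using D.assoc[of "fo F Z" "fo F (?s X)" "fo F (?s X')" "?S (fo F X')" "fm F Z (?s X) w"
        "fm F (?s X) (?s X') (tc_shm C 1 a)" "\<theta> X'"] sob hm h sa thin Fo Fm D.sh_ob by simp
  also have "\<dots> = lc_comp D (fo F Z) (fo F (?s X')) (?S (fo F X')) (\<theta> X')
      (lc_comp D (fo F Z) (fo F Z') (fo F (?s X')) (fm F Z' (?s X') w') (fm F Z Z' c))"
    using Fc[of Z "?s X" "?s X'" w "tc_shm C 1 a"] Fc[of Z Z' "?s X'" c w'] abc(6) sob hm h sa by simp
  also have "\<dots> = lc_comp D (fo F Z) (fo F Z') (?S (fo F X'))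
      (lc_comp D (fo F Z') (fo F (?s X')) (?S (fo F X')) (\<theta> X') (fm F Z' (?s X') w')) (fm F Z Z' c)"
    using D.assoc[of "fo F Z" "fo F Z'" "fo F (?s X')" "?S (fo F X')" "fm F Z Z' c"
        "fm F Z' (?s X') w'" "\<theta> X'"] sob hm h thin Fo Fm D.sh_ob by simp
  finally have 3: "lc_comp D (fo F Z) (?S (fo F X)) (?S (fo F X')) (tc_shm D 1 (fm F X X' a))
          (lc_comp D (fo F Z) (fo F (?s X)) (?S (fo F X)) (\<theta> X) (fm F Z (?s X) w)) = \<dots>" .
  have 1: "lc_comp D (fo F X) (fo F Y) (fo F Y') (fm F Y Y' b) (fm F X Y u)
      = lc_comp D (fo F X) (fo F X') (fo F Y') (fm F X' Y' u') (fm F X X' a)"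
    using abc(4) Fc[of X Y Y' u b] Fc[of X X' Y' a u'] ob hm h by simp
  have 2: "lc_comp D (fo F Y) (fo F Z) (fo F Z') (fm F Z Z' c) (fm F Y Z v)
      = lc_comp D (fo F Y) (fo F Y') (fo F Z') (fm F Y' Z' v') (fm F Y Y' b)"
    using abc(5) Fc[of Y Z Z' v c] Fc[of Y Y' Z' b v'] ob hm h by simp
  have w: "lc_comp D (fo F Z) (fo F (?s X)) (?S (fo F X)) (\<theta> X) (fm F Z (?s X) w)
      \<in> lc_hom D (fo F Z) (?S (fo F X))"
    "lc_comp D (fo F Z') (fo F (?s X')) (?S (fo F X')) (\<theta> X') (fm F Z' (?s X') w')
      \<in> lc_hom D (fo F Z') (?S (fo F X'))"
    using sob hm thin Fo Fm D.sh_ob by (auto intro!: D.comp_in)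
  have ob': "fo F X \<in> lc_ob D" "fo F Y \<in> lc_ob D" "fo F Z \<in> lc_ob D" "fo F X' \<in> lc_ob D"
    "fo F Y' \<in> lc_ob D" "fo F Z' \<in> lc_ob D" using ob Fo by auto
  have hm': "fm F X Y u \<in> lc_hom D (fo F X) (fo F Y)" "fm F Y Z v \<in> lc_hom D (fo F Y) (fo F Z)"
    "fm F X' Y' u' \<in> lc_hom D (fo F X') (fo F Y')" "fm F Y' Z' v' \<in> lc_hom D (fo F Y') (fo F Z')"
    using ob hm Fm by auto
  show ?thesis unfolding tri_iso_def split_def fst_conv snd_conv
    using ob' hm' w 1 2 3 functor_iso[OF F _ _ abc(1)] functor_iso[OF F _ _ abc(2)]
      functor_iso[OF F _ _ abc(3)] ob by blast
qed

section \<open>Adjoints of inclusions and localisation at isomorphisms\<close>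

text \<open>Universal arrows \<open>\<epsilon> Y\<close> from the subcategory, one for each object,
  determine the adjoint: it sends \<open>b\<close> to the unique lift of \<open>b\<close> after
  \<open>\<epsilon> Y\<close>, and uniqueness of lifts gives functoriality and naturality.\<close>

lemma right_adjoint_of_incl:
  assumes cat: "lin_category (T :: ('o, 'm) tricat)" and S: "S \<subseteq> lc_ob T"
    and univ: "\<And>Y. Y \<in> lc_ob T \<Longrightarrow> \<exists>V \<in> S. \<exists>\<epsilon> \<in> lc_hom T V Y.
      \<forall>X \<in> S. bij_betw (lc_comp T X V Y \<epsilon>) (lc_hom T X V) (lc_hom T X Y)"
  shows "\<exists>R. adjoint (full_sub T S) T incl R"
proof -
  interpret lin_category T by (rule cat)
  obtain V \<epsilon> where V: "\<And>Y. Y \<in> lc_ob T \<Longrightarrow> V Y \<in> S"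
    and eps: "\<And>Y. Y \<in> lc_ob T \<Longrightarrow> \<epsilon> Y \<in> lc_hom T (V Y) Y"
    and bij: "\<And>Y X. Y \<in> lc_ob T \<Longrightarrow> X \<in> S \<Longrightarrow>
      bij_betw (lc_comp T X (V Y) Y (\<epsilon> Y)) (lc_hom T X (V Y)) (lc_hom T X Y)"
    using univ by metis
  \<comment> \<open>The inverse of composition with \<open>\<epsilon> Y\<close>; it also serves as
    the bijection of the adjunction.\<close>
  define lift where "lift X Y = inv_into (lc_hom T X (V Y)) (lc_comp T X (V Y) Y (\<epsilon> Y))" for X Y
  have lift_in: "lift X Y h \<in> lc_hom T X (V Y)" and lift: "lc_comp T X (V Y) Y (\<epsilon> Y) (lift X Y h) = h"
    if "Y \<in> lc_ob T" "X \<in> S" "h \<in> lc_hom T X Y" for X Y h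
    using bij[OF that(1,2)] that(3) unfolding lift_def bij_betw_def
    by (metis inv_into_into, metis f_inv_into_f)
  have uniq: "g = lift X Y h" if "Y \<in> lc_ob T" "X \<in> S" "g \<in> lc_hom T X (V Y)"
    "lc_comp T X (V Y) Y (\<epsilon> Y) g = h" for X Y g h
    using bij[OF that(1,2)] that(3,4) unfolding lift_def bij_betw_def by (metis inv_into_f_f)
  have VT: "V Y \<in> lc_ob T" if "Y \<in> lc_ob T" for Y using V that S by blast
  define R where "R = \<lparr>fo = V, fm = (\<lambda>Y Y' b. lift (V Y) Y' (lc_comp T (V Y) Y Y' b (\<epsilon> Y)))\<rparr>"
  have Rm: "fm R Y Y' b \<in> lc_hom T (V Y) (V Y')"
    "lc_comp T (V Y) (V Y') Y' (\<epsilon> Y') (fm R Y Y' b) = lc_comp T (V Y) Y Y' b (\<epsilon> Y)"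
    if "Y \<in> lc_ob T" "Y' \<in> lc_ob T" "b \<in> lc_hom T Y Y'" for Y Y' b
    using lift_in lift that V VT eps comp_in unfolding R_def by auto
  have Rf: "is_functor T (full_sub T S) R"
    unfolding is_functor_def
  proof (intro conjI ballI)
    fix X assume X: "X \<in> lc_ob T"
    show "fo R X \<in> lc_ob (full_sub T S)" using X V by (simp add: R_def full_sub_def)
    have "lc_id T (V X) = lift (V X) X (lc_comp T (V X) X X (lc_id T X) (\<epsilon> X))"
      using uniq[OF X V[OF X] id_in[OF VT[OF X]]] X VT eps id_left id_right by simp
    then show "fm R X X (lc_id T X) = lc_id (full_sub T S) (fo R X)"
      by (simp add: R_def full_sub_def)
  next
    fix X Y f assume "X \<in> lc_ob T" "Y \<in> lc_ob T" "f \<in> lc_hom T X Y"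
    then show "fm R X Y f \<in> lc_hom (full_sub T S) (fo R X) (fo R Y)"
      using Rm(1) by (simp add: R_def full_sub_def)
  next
    fix X Y Z f g assume ob: "X \<in> lc_ob T" "Y \<in> lc_ob T" "Z \<in> lc_ob T"
      and f: "f \<in> lc_hom T X Y" and g: "g \<in> lc_hom T Y Z"
    have "lc_comp T (V X) (V Z) Z (\<epsilon> Z) (lc_comp T (V X) (V Y) (V Z) (fm R Y Z g) (fm R X Y f))
        = lc_comp T (V X) (V Y) Z (lc_comp T (V Y) (V Z) Z (\<epsilon> Z) (fm R Y Z g)) (fm R X Y f)"
      using assoc[of "V X" "V Y" "V Z" Z "fm R X Y f" "fm R Y Z g" "\<epsilon> Z"] ob VT Rm f g eps by simp
    also have "\<dots> = lc_comp T (V X) (V Y) Z (lc_comp T (V Y) Y Z g (\<epsilon> Y)) (fm R X Y f)"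
      using Rm ob g by simp
    also have "\<dots> = lc_comp T (V X) Y Z g (lc_comp T (V X) X Y f (\<epsilon> X))"
      using assoc[of "V X" "V Y" Y Z "fm R X Y f" "\<epsilon> Y" g] Rm ob f g eps VT by simp
    also have "\<dots> = lc_comp T (V X) X Z (lc_comp T X Y Z g f) (\<epsilon> X)"
      using assoc[of "V X" X Y Z "\<epsilon> X" f g] ob f g eps VT by simp
    finally have "lc_comp T (V X) (V Y) (V Z) (fm R Y Z g) (fm R X Y f)
        = lift (V X) Z (lc_comp T (V X) X Z (lc_comp T X Y Z g f) (\<epsilon> X))"
      using uniq[OF ob(3) V[OF ob(1)]] comp_in VT ob Rm f g by simp
    then show "fm R X Z (lc_comp T X Y Z g f) = lc_comp (full_sub T S) (fo R X) (fo R Y) (fo R Z)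
        (fm R Y Z g) (fm R X Y f)" by (simp add: R_def full_sub_def)
  qed
  have "adjoint (full_sub T S) T incl R"
    unfolding adjoint_def
  proof (intro conjI exI[of _ lift] ballI)
    show "is_functor (full_sub T S) T incl" using S by (auto simp: is_functor_def full_sub_def incl_def)
    show "is_functor T (full_sub T S) R" by (rule Rf)
  next
    fix X Y assume "X \<in> lc_ob (full_sub T S)" and Y: "Y \<in> lc_ob T"
    then have X: "X \<in> S" by (simp add: full_sub_def)
    show "bij_betw (lift X Y) (lc_hom T (fo incl X) Y) (lc_hom (full_sub T S) X (fo R Y))"
      using bij_betw_inv_into[OF bij[OF Y X]] by (simp add: incl_def full_sub_def R_def lift_def)
  next
    fix X X' Y Y' a h b
    assume "X \<in> lc_ob (full_sub T S)" "X' \<in> lc_ob (full_sub T S)" and Y: "Y \<in> lc_ob T" "Y' \<in> lc_ob T"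
      and "a \<in> lc_hom (full_sub T S) X' X" "h \<in> lc_hom T (fo incl X) Y" and b: "b \<in> lc_hom T Y Y'"
    then have X: "X \<in> S" "X' \<in> S" and a: "a \<in> lc_hom T X' X" and h: "h \<in> lc_hom T X Y"
      by (auto simp: full_sub_def incl_def)
    have XT: "X \<in> lc_ob T" "X' \<in> lc_ob T" using X S by auto
    let ?l = "lift X Y h" and ?r = "fm R Y Y' b"
    note l = lift_in[OF Y(1) X(1) h] lift[OF Y(1) X(1) h] and r = Rm[OF Y b]
    have la: "lc_comp T X' X (V Y) ?l a \<in> lc_hom T X' (V Y)" using comp_in XT VT Y l a by blast
    have "lc_comp T X' (V Y') Y' (\<epsilon> Y') (lc_comp T X' (V Y) (V Y') ?r (lc_comp T X' X (V Y) ?l a))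
       = lc_comp T X' (V Y) Y' (lc_comp T (V Y) (V Y') Y' (\<epsilon> Y') ?r) (lc_comp T X' X (V Y) ?l a)"
      using assoc[of X' "V Y" "V Y'" Y' "lc_comp T X' X (V Y) ?l a" ?r "\<epsilon> Y'"] XT VT Y la r eps by simp
    also have "\<dots> = lc_comp T X' Y Y' b (lc_comp T X' (V Y) Y (\<epsilon> Y) (lc_comp T X' X (V Y) ?l a))"
      using assoc[of X' "V Y" Y Y' "lc_comp T X' X (V Y) ?l a" "\<epsilon> Y" b] XT VT Y la r b eps by simp
    also have "\<dots> = lc_comp T X' Y Y' b (lc_comp T X' X Y h a)"
      using assoc[of X' X "V Y" Y a ?l "\<epsilon> Y"] XT VT Y l a eps by simp
    finally show "lift X' Y' (lc_comp T (fo incl X') Y Y' b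
          (lc_comp T (fo incl X') (fo incl X) Y h (fm incl X' X a))) =
        lc_comp (full_sub T S) X' (fo R Y) (fo R Y') (fm R Y Y' b)
          (lc_comp (full_sub T S) X' X (fo R Y) (lift X Y h) a)"
      using uniq[OF Y(2) X(2), of "lc_comp T X' (V Y) (V Y') ?r (lc_comp T X' X (V Y) ?l a)"]
        comp_in XT VT Y r la by (simp add: incl_def full_sub_def R_def)
  qed
  then show ?thesis by blast
qed

text \<open>Dual of the previous construction. Here the bijection of the adjunction is
  precomposition with \<open>\<eta> Y\<close> itself, and its inverse \<open>ext\<close> defines the
  functor on morphisms.\<close>

lemma left_adjoint_of_incl:
  assumes cat: "lin_category (T :: ('o, 'm) tricat)" and S: "S \<subseteq> lc_ob T"
    and univ: "\<And>Y. Y \<in> lc_ob T \<Longrightarrow> \<exists>V \<in> S. \<exists>\<eta> \<in> lc_hom T Y V.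
      \<forall>X \<in> S. bij_betw (\<lambda>f. lc_comp T Y V X f \<eta>) (lc_hom T V X) (lc_hom T Y X)"
  shows "\<exists>L. adjoint T (full_sub T S) L incl"
proof -
  interpret lin_category T by (rule cat)
  obtain V \<eta> where V: "\<And>Y. Y \<in> lc_ob T \<Longrightarrow> V Y \<in> S"
    and eta: "\<And>Y. Y \<in> lc_ob T \<Longrightarrow> \<eta> Y \<in> lc_hom T Y (V Y)"
    and bij: "\<And>Y X. Y \<in> lc_ob T \<Longrightarrow> X \<in> S \<Longrightarrow>
      bij_betw (\<lambda>f. lc_comp T Y (V Y) X f (\<eta> Y)) (lc_hom T (V Y) X) (lc_hom T Y X)"
    using univ by metis
  define ext where "ext Y X = inv_into (lc_hom T (V Y) X) (\<lambda>f. lc_comp T Y (V Y) X f (\<eta> Y))" for Y X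
  have ext_in: "ext Y X h \<in> lc_hom T (V Y) X" and ext: "lc_comp T Y (V Y) X (ext Y X h) (\<eta> Y) = h"
    if "Y \<in> lc_ob T" "X \<in> S" "h \<in> lc_hom T Y X" for X Y h
    using bij[OF that(1,2)] that(3) unfolding ext_def bij_betw_def
    by (metis inv_into_into, metis (mono_tags, lifting) f_inv_into_f)
  have uniq: "g = ext Y X h" if "Y \<in> lc_ob T" "X \<in> S" "g \<in> lc_hom T (V Y) X"
    "lc_comp T Y (V Y) X g (\<eta> Y) = h" for X Y g h
    using bij[OF that(1,2)] that(3,4) unfolding ext_def bij_betw_def
    by (metis (mono_tags, lifting) inv_into_f_f)
  have VT: "V Y \<in> lc_ob T" if "Y \<in> lc_ob T" for Y using V that S by blast
  define L where "L = \<lparr>fo = V, fm = (\<lambda>Y Y' b. ext Y (V Y') (lc_comp T Y Y' (V Y') (\<eta> Y') b))\<rparr>"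
  have Lm: "fm L Y Y' b \<in> lc_hom T (V Y) (V Y')"
    "lc_comp T Y (V Y) (V Y') (fm L Y Y' b) (\<eta> Y) = lc_comp T Y Y' (V Y') (\<eta> Y') b"
    if "Y \<in> lc_ob T" "Y' \<in> lc_ob T" "b \<in> lc_hom T Y Y'" for Y Y' b
    using ext_in ext that V VT eta comp_in unfolding L_def by auto
  have Lf: "is_functor T (full_sub T S) L"
    unfolding is_functor_def
  proof (intro conjI ballI)
    fix X assume X: "X \<in> lc_ob T"
    show "fo L X \<in> lc_ob (full_sub T S)" using X V by (simp add: L_def full_sub_def)
    have "lc_id T (V X) = ext X (V X) (lc_comp T X X (V X) (\<eta> X) (lc_id T X))"
      using uniq[OF X V[OF X] id_in[OF VT[OF X]]] X VT eta id_left id_right by simp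
    then show "fm L X X (lc_id T X) = lc_id (full_sub T S) (fo L X)"
      by (simp add: L_def full_sub_def)
  next
    fix X Y f assume "X \<in> lc_ob T" "Y \<in> lc_ob T" "f \<in> lc_hom T X Y"
    then show "fm L X Y f \<in> lc_hom (full_sub T S) (fo L X) (fo L Y)"
      using Lm(1) by (simp add: L_def full_sub_def)
  next
    fix X Y Z f g assume ob: "X \<in> lc_ob T" "Y \<in> lc_ob T" "Z \<in> lc_ob T"
      and f: "f \<in> lc_hom T X Y" and g: "g \<in> lc_hom T Y Z"
    have "lc_comp T X (V X) (V Z) (lc_comp T (V X) (V Y) (V Z) (fm L Y Z g) (fm L X Y f)) (\<eta> X)
        = lc_comp T X (V Y) (V Z) (fm L Y Z g) (lc_comp T X (V X) (V Y) (fm L X Y f) (\<eta> X))"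
      using assoc[of X "V X" "V Y" "V Z" "\<eta> X" "fm L X Y f" "fm L Y Z g"] ob VT Lm f g eta by simp
    also have "\<dots> = lc_comp T X Y (V Z) (lc_comp T Y (V Y) (V Z) (fm L Y Z g) (\<eta> Y)) f"
      using assoc[of X Y "V Y" "V Z" f "\<eta> Y" "fm L Y Z g"] Lm ob f g eta VT by simp
    also have "\<dots> = lc_comp T X Z (V Z) (\<eta> Z) (lc_comp T X Y Z g f)"
      using assoc[of X Y Z "V Z" f g "\<eta> Z"] Lm ob f g eta VT by simp
    finally have "lc_comp T (V X) (V Y) (V Z) (fm L Y Z g) (fm L X Y f)
        = ext X (V Z) (lc_comp T X Z (V Z) (\<eta> Z) (lc_comp T X Y Z g f))"
      using uniq[OF ob(1) V[OF ob(3)]] comp_in VT ob Lm f g by simp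
    then show "fm L X Z (lc_comp T X Y Z g f) = lc_comp (full_sub T S) (fo L X) (fo L Y) (fo L Z)
        (fm L Y Z g) (fm L X Y f)" by (simp add: L_def full_sub_def)
  qed
  have "adjoint T (full_sub T S) L incl"
    unfolding adjoint_def
  proof (intro conjI exI[of _ "\<lambda>Y X f. lc_comp T Y (V Y) X f (\<eta> Y)"] ballI)
    show "is_functor (full_sub T S) T incl" using S by (auto simp: is_functor_def full_sub_def incl_def)
    show "is_functor T (full_sub T S) L" by (rule Lf)
  next
    fix X Y assume Y: "Y \<in> lc_ob T" and "X \<in> lc_ob (full_sub T S)"
    then have X: "X \<in> S" by (simp add: full_sub_def)
    show "bij_betw (\<lambda>f. lc_comp T Y (V Y) X f (\<eta> Y)) (lc_hom (full_sub T S) (fo L Y) X)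
        (lc_hom T Y (fo incl X))"
      using bij[OF Y X] by (simp add: incl_def full_sub_def L_def)
  next
    fix Y Y' X X' a h b
    assume Y: "Y \<in> lc_ob T" "Y' \<in> lc_ob T" and "X \<in> lc_ob (full_sub T S)" "X' \<in> lc_ob (full_sub T S)"
      and a: "a \<in> lc_hom T Y' Y" and "h \<in> lc_hom (full_sub T S) (fo L Y) X"
      and "b \<in> lc_hom (full_sub T S) X X'"
    then have X: "X \<in> S" "X' \<in> S" and b: "b \<in> lc_hom T X X'" and h: "h \<in> lc_hom T (V Y) X"
      by (auto simp: full_sub_def L_def)
    have XT: "X \<in> lc_ob T" "X' \<in> lc_ob T" using X S by auto
    let ?l = "fm L Y' Y a"
    note l = Lm[OF Y(2,1) a]
    have hl: "lc_comp T (V Y') (V Y) X h ?l \<in> lc_hom T (V Y') X" using comp_in XT VT Y l h by blast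
    have "lc_comp T Y' (V Y') X' (lc_comp T (V Y') X X' b (lc_comp T (V Y') (V Y) X h ?l)) (\<eta> Y')
       = lc_comp T Y' X X' b (lc_comp T Y' (V Y') X (lc_comp T (V Y') (V Y) X h ?l) (\<eta> Y'))"
      using assoc[of Y' "V Y'" X X' "\<eta> Y'" "lc_comp T (V Y') (V Y) X h ?l" b] XT VT Y hl b eta by simp
    also have "\<dots> = lc_comp T Y' X X' b (lc_comp T Y' (V Y) X h (lc_comp T Y' (V Y') (V Y) ?l (\<eta> Y')))"
      using assoc[of Y' "V Y'" "V Y" X "\<eta> Y'" ?l h] XT VT Y l h eta by simp
    also have "\<dots> = lc_comp T Y' X X' b (lc_comp T Y' Y X (lc_comp T Y (V Y) X h (\<eta> Y)) a)"
      using assoc[of Y' Y "V Y" X a "\<eta> Y" h] XT VT Y l h a eta by simp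
    finally show "lc_comp T Y' (V Y') X'
          (lc_comp (full_sub T S) (fo L Y') X X' b
            (lc_comp (full_sub T S) (fo L Y') (fo L Y) X h (fm L Y' Y a))) (\<eta> Y') =
        lc_comp T Y' (fo incl X) (fo incl X') (fm incl X X' b)
          (lc_comp T Y' Y (fo incl X) (lc_comp T Y (V Y) X h (\<eta> Y)) a)"
      by (simp add: incl_def full_sub_def L_def)
  qed
  then show ?thesis by blast
qed

section \<open>Localisation at a class of isomorphisms\<close>

locale loc_at_isos = tri_category C standard for C :: "('o, 'm) tricat" and standard +
  fixes S :: "'o \<Rightarrow> 'o \<Rightarrow> 'm set"
  assumes S_iso: "\<lbrakk>W \<in> lc_ob C; X \<in> lc_ob C; s \<in> S W X; s \<in> lc_hom C W X\<rbrakk> \<Longrightarrow> lc_iso C W X s"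
    and id_S: "X \<in> lc_ob C \<Longrightarrow> lc_id C X \<in> S X X"
begin

abbreviation "Loc \<equiv> localisation C S"

lemma Loc_simps [simp]:
  "lc_ob Loc = lc_ob C" "lc_hom Loc = lc_hom (loc_lin C S)" "lc_id Loc = lc_id (loc_lin C S)"
  "lc_comp Loc = lc_comp (loc_lin C S)" "lc_add Loc = lc_add (loc_lin C S)"
  "lc_scale Loc = lc_scale (loc_lin C S)" "tc_sh Loc = tc_sh C" "tc_shm Loc = loc_shm C"
  by (simp_all add: localisation_def lincat.defs loc_lin_def)

text \<open>A roof \<open>(W, s, f)\<close> represents \<open>f \<circ> s\<^sup>-\<^sup>1\<close>. The set of all roofs representing \<open>\<phi>\<close> is a morphism
  of the localisation; the weaker predicate \<open>represents\<close> is what the shift of roofs visibly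
  preserves.\<close>

definition RC :: "'o \<Rightarrow> 'o \<Rightarrow> 'm \<Rightarrow> ('o, 'm) roof set" where
  "RC X Y \<phi> = {(W, s, f). (W, s, f) \<in> roofs C S X Y \<and> f = lc_comp C W X Y \<phi> s}"

definition represents :: "'o \<Rightarrow> 'o \<Rightarrow> ('o, 'm) roof set \<Rightarrow> 'm \<Rightarrow> bool" where
  "represents X Y \<alpha> \<phi> \<longleftrightarrow> \<phi> \<in> lc_hom C X Y \<and> \<alpha> \<noteq> {} \<and>
     (\<forall>(W, s, f) \<in> \<alpha>. W \<in> lc_ob C \<and> lc_iso C W X s \<and> f = lc_comp C W X Y \<phi> s)"

text \<open>A common refinement of two roofs has isomorphisms as legs, so it can be cancelled;
  conversely \<open>X\<close> itself refines any two roofs that represent the same morphism. The leg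
  \<open>s\<close> is taken to be any isomorphism because the legs obtained by composing roofs need
  not lie in \<open>S\<close>.\<close>

lemma roof_class_eq:
  assumes ob: "X \<in> lc_ob C" "Y \<in> lc_ob C" "W \<in> lc_ob C" and s: "lc_iso C W X s"
    and \<phi>: "\<phi> \<in> lc_hom C X Y" and f: "f = lc_comp C W X Y \<phi> s"
  shows "roof_class C S X Y (W, s, f) = RC X Y \<phi>"
proof (intro equalityI subsetI)
  fix r assume r: "r \<in> roof_class C S X Y (W, s, f)"
  obtain W' s' f' where r': "r = (W', s', f')" using prod_cases3 by blast
  obtain V u u' where roof: "(W', s', f') \<in> roofs C S X Y" and V: "V \<in> lc_ob C"
    and u: "u \<in> lc_hom C V W" and u': "u' \<in> lc_hom C V W'"
    and su: "lc_comp C V W X s u \<in> S V X" "lc_comp C V W X s u = lc_comp C V W' X s' u'"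
    and fu: "lc_comp C V W Y f u = lc_comp C V W' Y f' u'"
    using r unfolding roof_class_def r' by blast
  have W': "W' \<in> lc_ob C" "s' \<in> S W' X" "s' \<in> lc_hom C W' X" "f' \<in> lc_hom C W' Y"
    using roof by (auto simp: roofs_def)
  have s': "lc_iso C W' X s'" using S_iso W' ob by blast
  have "lc_iso C V X (lc_comp C V W' X s' u')"
    using S_iso[OF V ob(1) su(1)] su(2) comp_in[OF V W'(1) ob(1) u' W'(3)] by simp
  \<comment> \<open>The composite with \<open>s'\<close> is in \<open>S\<close>, so two out of three
    applies and \<open>u'\<close> may be cancelled.\<close>
  then have "lc_iso C V W' u'" using iso_two_of_three[OF V W'(1) ob(1) s' u'] by blast
  moreover have "lc_comp C V W' Y f' u' = lc_comp C V W' Y (lc_comp C W' X Y \<phi> s') u'"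
  proof -
    have "lc_comp C V W' Y f' u' = lc_comp C V X Y \<phi> (lc_comp C V W X s u)"
      using fu f assoc[OF V ob(3,1,2) u iso_in[OF s] \<phi>] by simp
    then show ?thesis using su(2) assoc[OF V W'(1) ob(1,2) u' W'(3) \<phi>] by simp
  qed
  ultimately have "f' = lc_comp C W' X Y \<phi> s'"
    using iso_cancel_right[OF V W'(1) ob(2)] W'(4) comp_in[OF W'(1) ob(1,2) W'(3) \<phi>] by blast
  then show "r \<in> RC X Y \<phi>" using roof by (simp add: RC_def r')
next
  fix r assume r: "r \<in> RC X Y \<phi>"
  obtain W' s' f' where r': "r = (W', s', f')" using prod_cases3 by blast
  have roof: "(W', s', f') \<in> roofs C S X Y" and f': "f' = lc_comp C W' X Y \<phi> s'"
    using r unfolding r' RC_def by auto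
  have W': "W' \<in> lc_ob C" "s' \<in> S W' X" "s' \<in> lc_hom C W' X" "f' \<in> lc_hom C W' Y"
    using roof by (auto simp: roofs_def)
  have s': "lc_iso C W' X s'" using S_iso W' ob by blast
  \<comment> \<open>The inverses of the two legs make \<open>X\<close> a common refinement: the
    composites with the legs are the identity, which is in \<open>S\<close>, and the other two
    composites are both \<open>\<phi>\<close>.\<close>
  obtain u where u: "u \<in> lc_hom C X W" "lc_comp C X W X s u = lc_id C X" using iso_inv[OF s] by metis
  obtain u' where u': "u' \<in> lc_hom C X W'" "lc_comp C X W' X s' u' = lc_id C X"
    using iso_inv[OF s'] by metis
  have "lc_comp C X W Y f u = \<phi>" "lc_comp C X W' Y f' u' = \<phi>"
    using assoc[OF ob(1,3,1,2) u(1) iso_in[OF s] \<phi>] assoc[OF ob(1) W'(1) ob(1,2) u'(1) W'(3) \<phi>]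
      u u' f f' id_right \<phi> ob by auto
  then show "r \<in> roof_class C S X Y (W, s, f)"
    unfolding r' roof_class_def using roof ob(1) u u' id_S
    unfolding prod.case by (intro CollectI case_prodI2 case_prodI conjI bexI[of _ X] bexI[of _ u] bexI[of _ u']) auto
qed

lemma base_roof: "\<lbrakk>X \<in> lc_ob C; Y \<in> lc_ob C; \<phi> \<in> lc_hom C X Y\<rbrakk> \<Longrightarrow> (X, lc_id C X, \<phi>) \<in> RC X Y \<phi>"
  using id_in id_S id_right by (auto simp: RC_def roofs_def)

lemma represents_RC: "\<lbrakk>X \<in> lc_ob C; Y \<in> lc_ob C; \<phi> \<in> lc_hom C X Y\<rbrakk> \<Longrightarrow> represents X Y (RC X Y \<phi>) \<phi>"
proof -
  assume ob: "X \<in> lc_ob C" "Y \<in> lc_ob C" "\<phi> \<in> lc_hom C X Y"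
  have "RC X Y \<phi> \<noteq> {}" using base_roof[OF ob] by blast
  then show ?thesis using ob S_iso unfolding represents_def by (auto simp: RC_def roofs_def)
qed

lemma represents_unique:
  assumes "X \<in> lc_ob C" "Y \<in> lc_ob C" "represents X Y \<alpha> \<phi>" "represents X Y \<alpha> \<psi>"
  shows "\<phi> = \<psi>"
proof -
  obtain W s f where "(W, s, f) \<in> \<alpha>" using assms(3) unfolding represents_def by auto
  then show ?thesis
    using iso_cancel_right[of W X Y s \<phi> \<psi>] assms unfolding represents_def by fastforce
qed

lemma roof_exists:
  assumes ob: "X \<in> lc_ob C" "Y \<in> lc_ob C" and r: "(W, s, f) \<in> roofs C S X Y"
  shows "\<exists>\<phi> \<in> lc_hom C X Y. f = lc_comp C W X Y \<phi> s"
proof -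
  have W: "W \<in> lc_ob C" "s \<in> S W X" "s \<in> lc_hom C W X" "f \<in> lc_hom C W Y"
    using r by (auto simp: roofs_def)
  obtain t where t: "t \<in> lc_hom C X W" "lc_comp C W X W t s = lc_id C W"
    using iso_inv[OF S_iso[OF W(1) ob(1) W(2,3)]] by metis
  have "lc_comp C W X Y (lc_comp C X W Y f t) s = f"
    using assoc[OF W(1) ob(1) W(1) ob(2) W(3) t(1) W(4)] t W ob id_right by simp
  then show ?thesis using comp_in[OF ob(1) W(1) ob(2) t(1) W(4)] by metis
qed

lemma Loc_hom:
  assumes ob: "X \<in> lc_ob C" "Y \<in> lc_ob C"
  shows "lc_hom (loc_lin C S) X Y = RC X Y ` lc_hom C X Y"
proof (intro equalityI subsetI)
  fix \<alpha> assume "\<alpha> \<in> lc_hom (loc_lin C S) X Y"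
  then obtain W s f where r: "(W, s, f) \<in> roofs C S X Y" "\<alpha> = roof_class C S X Y (W, s, f)"
    by (auto simp: loc_lin_def)
  obtain \<phi> where "\<phi> \<in> lc_hom C X Y" "f = lc_comp C W X Y \<phi> s" using roof_exists[OF ob r(1)] by blast
  then show "\<alpha> \<in> RC X Y ` lc_hom C X Y"
    using roof_class_eq[OF ob, of W s \<phi> f] r S_iso ob by (auto simp: roofs_def)
next
  fix \<alpha> assume "\<alpha> \<in> RC X Y ` lc_hom C X Y"
  then obtain \<phi> where \<phi>: "\<phi> \<in> lc_hom C X Y" "\<alpha> = RC X Y \<phi>" by blast
  have "roof_class C S X Y (X, lc_id C X, \<phi>) = \<alpha>"
    using roof_class_eq[OF ob ob(1) iso_id[OF ob(1)] \<phi>(1)] \<phi> id_right ob by simp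
  then show "\<alpha> \<in> lc_hom (loc_lin C S) X Y"
    using base_roof[OF ob \<phi>(1)] by (force simp: loc_lin_def RC_def)
qed

lemma Loc_mor:
  assumes "X \<in> lc_ob C" "Y \<in> lc_ob C" "\<phi> \<in> lc_hom C X Y"
  shows "loc_mor C S X Y \<phi> = RC X Y \<phi>"
  unfolding loc_mor_def
  using roof_class_eq[OF assms(1,2,1) iso_id[OF assms(1)] assms(3)] id_right assms by simp

lemma Loc_id: "X \<in> lc_ob C \<Longrightarrow> lc_id (loc_lin C S) X = RC X X (lc_id C X)"
  using Loc_mor[of X X "lc_id C X"] id_in by (simp add: loc_mor_def loc_lin_def)

text \<open>The composite is a union over all ways of completing two roofs to a diagram. Each way
  yields the class of the composite of \<open>\<psi>\<close> and \<open>\<phi>\<close>, so the union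
  is that class as soon as one completion exists. The hypotheses use \<open>represents\<close>, so
  that shifted classes of roofs are covered too.\<close>

lemma Loc_comp:
  assumes ob: "X \<in> lc_ob C" "Y \<in> lc_ob C" "Z \<in> lc_ob C"
    and \<alpha>: "represents X Y \<alpha> \<phi>" and \<beta>: "represents Y Z \<beta> \<psi>"
  shows "lc_comp (loc_lin C S) X Y Z \<beta> \<alpha> = RC X Z (lc_comp C X Y Z \<psi> \<phi>)"
proof -
  define A where "A = {roof_class C S X Z (V, lc_comp C V W X s u, lc_comp C V W' Z g v) | V W W' s f t g u v.
      (W, s, f) \<in> \<alpha> \<and> (W', t, g) \<in> \<beta> \<and> V \<in> lc_ob C \<and> u \<in> lc_hom C V W \<and> u \<in> S V W \<and>
      v \<in> lc_hom C V W' \<and> lc_comp C V W Y f u = lc_comp C V W' Y t v}"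
  have \<phi>: "\<phi> \<in> lc_hom C X Y" and \<psi>: "\<psi> \<in> lc_hom C Y Z" using \<alpha> \<beta> by (auto simp: represents_def)
  have 1: "roof_class C S X Z (V, lc_comp C V W X s u, lc_comp C V W' Z g v) = RC X Z (lc_comp C X Y Z \<psi> \<phi>)"
    if a: "(W, s, f) \<in> \<alpha>" "(W', t, g) \<in> \<beta>" and V: "V \<in> lc_ob C" and u: "u \<in> lc_hom C V W" "u \<in> S V W"
      and v: "v \<in> lc_hom C V W'" and fu: "lc_comp C V W Y f u = lc_comp C V W' Y t v"
    for V W W' s f t g u v
  proof -
    have W: "W \<in> lc_ob C" "lc_iso C W X s" "f = lc_comp C W X Y \<phi> s"
      and W': "W' \<in> lc_ob C" "lc_iso C W' Y t" "g = lc_comp C W' Y Z \<psi> t"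
      using \<alpha> \<beta> a unfolding represents_def by auto
    note st = iso_in[OF W(2)] iso_in[OF W'(2)]
    have "lc_comp C V W' Z g v = lc_comp C V Y Z \<psi> (lc_comp C V W Y f u)"
      using assoc[OF V W'(1) ob(2,3) v st(2) \<psi>] W' fu by simp
    also have "\<dots> = lc_comp C V Y Z \<psi> (lc_comp C V X Y \<phi> (lc_comp C V W X s u))"
      using assoc[OF V W(1) ob(1,2) u(1) st(1) \<phi>] W by simp
    also have "\<dots> = lc_comp C V X Z (lc_comp C X Y Z \<psi> \<phi>) (lc_comp C V W X s u)"
      using assoc[OF V ob comp_in[OF V W(1) ob(1) u(1) st(1)] \<phi> \<psi>] by simp
    finally show ?thesis
      using roof_class_eq[OF ob(1,3) V iso_comp[OF V W(1) ob(1) S_iso[OF V W(1) u(2,1)] W(2)]]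
        comp_in[OF ob \<phi> \<psi>] by blast
  qed
  obtain W s f where a: "(W, s, f) \<in> \<alpha>" using \<alpha> unfolding represents_def by auto
  obtain W' t g where b: "(W', t, g) \<in> \<beta>" using \<beta> unfolding represents_def by auto
  have W: "W \<in> lc_ob C" "lc_iso C W X s" "f = lc_comp C W X Y \<phi> s"
    and W': "W' \<in> lc_ob C" "lc_iso C W' Y t"
    using \<alpha> \<beta> a b unfolding represents_def by auto
  have fh: "f \<in> lc_hom C W Y" using comp_in[OF W(1) ob(1,2) iso_in[OF W(2)] \<phi>] W by simp
  \<comment> \<open>One completion has \<open>V = W\<close>: its left arrow is the identity, which
    is in \<open>S\<close>, and its right arrow is \<open>f\<close> followed by the inverse of
    \<open>t\<close>.\<close>
  obtain t' where t': "t' \<in> lc_hom C Y W'" "lc_comp C Y W' Y t t' = lc_id C Y"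
    using iso_inv[OF W'(2)] by metis
  have "lc_comp C W W Y f (lc_id C W) = lc_comp C W W' Y t (lc_comp C W Y W' t' f)"
    using assoc[OF W(1) ob(2) W'(1) ob(2) fh t'(1) iso_in[OF W'(2)]] t' id_left id_right fh W ob by simp
  then have "roof_class C S X Z (W, lc_comp C W W X s (lc_id C W),
      lc_comp C W W' Z g (lc_comp C W Y W' t' f)) \<in> A"
    unfolding A_def using a b W(1) id_in[OF W(1)] id_S[OF W(1)] comp_in[OF W(1) ob(2) W'(1) fh t'(1)]
    by (intro CollectI exI conjI) (rule refl, assumption+)
  moreover have "x = RC X Z (lc_comp C X Y Z \<psi> \<phi>)" if "x \<in> A" for x
    using that 1 unfolding A_def by blast
  ultimately have "\<Union>A = RC X Z (lc_comp C X Y Z \<psi> \<phi>)" by blast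
  then show ?thesis by (simp add: loc_lin_def A_def)
qed

lemma Loc_add:
  assumes ob: "X \<in> lc_ob C" "Y \<in> lc_ob C" and \<phi>: "\<phi> \<in> lc_hom C X Y" and \<psi>: "\<psi> \<in> lc_hom C X Y"
  shows "lc_add (loc_lin C S) X Y (RC X Y \<phi>) (RC X Y \<psi>) = RC X Y (lc_add C X Y \<phi> \<psi>)"
proof -
  let ?A = "{roof_class C S X Y (W, s, lc_add C W Y f g) | W s f g.
      (W, s, f) \<in> RC X Y \<phi> \<and> (W, s, g) \<in> RC X Y \<psi>}"
  have "roof_class C S X Y (W, s, lc_add C W Y f g) = RC X Y (lc_add C X Y \<phi> \<psi>)"
    if "(W, s, f) \<in> RC X Y \<phi>" "(W, s, g) \<in> RC X Y \<psi>" for W s f g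
    using that roof_class_eq[OF ob, of W s "lc_add C X Y \<phi> \<psi>"] add_in[OF ob \<phi> \<psi>] S_iso[of W X s]
      add_comp[of W X Y s \<phi> \<psi>] ob \<phi> \<psi> by (auto simp: RC_def roofs_def)
  then have "\<forall>x \<in> ?A. x = RC X Y (lc_add C X Y \<phi> \<psi>)" by blast
  moreover have "?A \<noteq> {}" using base_roof ob \<phi> \<psi> by blast
  ultimately have "\<Union>?A = RC X Y (lc_add C X Y \<phi> \<psi>)" by blast
  then show ?thesis by (simp add: loc_lin_def)
qed

lemma Loc_scale:
  assumes ob: "X \<in> lc_ob C" "Y \<in> lc_ob C" and \<phi>: "\<phi> \<in> lc_hom C X Y"
  shows "lc_scale (loc_lin C S) X Y c (RC X Y \<phi>) = RC X Y (lc_scale C X Y c \<phi>)"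
proof -
  let ?A = "{roof_class C S X Y (W, s, lc_scale C W Y c f) | W s f. (W, s, f) \<in> RC X Y \<phi>}"
  have "roof_class C S X Y (W, s, lc_scale C W Y c f) = RC X Y (lc_scale C X Y c \<phi>)"
    if "(W, s, f) \<in> RC X Y \<phi>" for W s f
    using that roof_class_eq[OF ob, of W s "lc_scale C X Y c \<phi>"] scale_in[OF ob \<phi>] S_iso[of W X s]
      scale_comp[of W X Y s \<phi>] ob \<phi> by (auto simp: RC_def roofs_def)
  then have "\<forall>x \<in> ?A. x = RC X Y (lc_scale C X Y c \<phi>)" by blast
  moreover have "?A \<noteq> {}" using base_roof ob \<phi> by blast
  ultimately have "\<Union>?A = RC X Y (lc_scale C X Y c \<phi>)" by blast
  then show ?thesis by (simp add: loc_lin_def)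
qed

lemma represents_shm:
  assumes ob: "X \<in> lc_ob C" "Y \<in> lc_ob C" and \<alpha>: "represents X Y \<alpha> \<phi>"
  shows "represents (tc_sh C 1 X) (tc_sh C 1 Y) (loc_shm C 1 \<alpha>) (tc_shm C 1 \<phi>)"
proof -
  have \<phi>: "\<phi> \<in> lc_hom C X Y" using \<alpha> by (simp add: represents_def)
  have "tc_sh C 1 W \<in> lc_ob C \<and> lc_iso C (tc_sh C 1 W) (tc_sh C 1 X) (tc_shm C 1 s) \<and>
      tc_shm C 1 f = lc_comp C (tc_sh C 1 W) (tc_sh C 1 X) (tc_sh C 1 Y) (tc_shm C 1 \<phi>) (tc_shm C 1 s)"
    if "(W, s, f) \<in> \<alpha>" for W s f
  proof -
    have W: "W \<in> lc_ob C" "lc_iso C W X s" "f = lc_comp C W X Y \<phi> s"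
      using \<alpha> that unfolding represents_def by auto
    show ?thesis using sh_ob shm_iso[OF W(1) ob(1) W(2)] shm_comp[OF W(1) ob iso_in[OF W(2)] \<phi>] W by simp
  qed
  moreover have "loc_shm C 1 \<alpha> \<noteq> {}" using \<alpha> unfolding represents_def loc_shm_def by auto
  ultimately show ?thesis
    using shm_in[OF ob \<phi>] unfolding represents_def by (auto simp: loc_shm_def)
qed

text \<open>Defined through \<open>represents\<close> and not as the inverse of \<open>RC\<close>,
  so that it can be evaluated on the image of a class under \<open>loc_shm\<close>, which need not
  contain all roofs.\<close>

definition val :: "'o \<Rightarrow> 'o \<Rightarrow> ('o, 'm) roof set \<Rightarrow> 'm" where
  "val X Y \<alpha> = (THE \<phi>. represents X Y \<alpha> \<phi>)"

lemma val: "\<lbrakk>X \<in> lc_ob C; Y \<in> lc_ob C; represents X Y \<alpha> \<phi>\<rbrakk> \<Longrightarrow> val X Y \<alpha> = \<phi>"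
  unfolding val_def using represents_unique by blast

lemma val_RC: "\<lbrakk>X \<in> lc_ob C; Y \<in> lc_ob C; \<phi> \<in> lc_hom C X Y\<rbrakk> \<Longrightarrow> val X Y (RC X Y \<phi>) = \<phi>"
  using val represents_RC by blast

lemma RC_val:
  assumes "X \<in> lc_ob C" "Y \<in> lc_ob C" "\<alpha> \<in> lc_hom (loc_lin C S) X Y"
  shows "val X Y \<alpha> \<in> lc_hom C X Y" "RC X Y (val X Y \<alpha>) = \<alpha>"
  using assms val_RC Loc_hom by auto

lemma val_comp:
  assumes "X \<in> lc_ob C" "Y \<in> lc_ob C" "Z \<in> lc_ob C" "represents X Y \<alpha> \<phi>" "represents Y Z \<beta> \<psi>"
  shows "val X Z (lc_comp (loc_lin C S) X Y Z \<beta> \<alpha>) = lc_comp C X Y Z \<psi> \<phi>"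
  using Loc_comp[OF assms] val_RC comp_in assms by (simp add: represents_def)

lemma represents_val:
  assumes "X \<in> lc_ob C" "Y \<in> lc_ob C" "\<alpha> \<in> lc_hom (loc_lin C S) X Y"
  shows "represents X Y \<alpha> (val X Y \<alpha>)"
  using RC_val[OF assms] represents_RC[OF assms(1,2)] by metis

lemma val_iso:
  assumes ob: "X \<in> lc_ob C" "Y \<in> lc_ob C" and a: "lc_iso (loc_lin C S) X Y a"
  shows "lc_iso C X Y (val X Y a)"
proof -
  obtain b where b: "a \<in> lc_hom (loc_lin C S) X Y" "b \<in> lc_hom (loc_lin C S) Y X"
    "lc_comp (loc_lin C S) X Y X b a = lc_id (loc_lin C S) X"
    "lc_comp (loc_lin C S) Y X Y a b = lc_id (loc_lin C S) Y"
    using a unfolding lc_iso_def by blast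
  note ra = represents_val[OF ob b(1)] and rb = represents_val[OF ob(2,1) b(2)]
  have "lc_comp C X Y X (val Y X b) (val X Y a) = lc_id C X"
    "lc_comp C Y X Y (val X Y a) (val Y X b) = lc_id C Y"
    using val_comp[OF ob(1,2,1) ra rb] val_comp[OF ob(2,1,2) rb ra] b Loc_id val_RC id_in ob by simp_all
  then show ?thesis unfolding lc_iso_def using RC_val ob b by blast
qed

text \<open>Composites of classes of roofs become composites in \<open>C\<close>; for the third
  square, which contains a shifted class, this rests on \<open>represents_shm\<close>.\<close>

lemma val_tri_iso:
  assumes "tri_iso (loc_lin C S) (tc_sh C 1) (loc_shm C 1) (X, Y, Z, u, v, w) (X', Y', Z', u', v', w')"
  shows "tri_iso C (tc_sh C 1) (tc_shm C 1)
    (X, Y, Z, val X Y u, val Y Z v, val Z (tc_sh C 1 X) w)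
    (X', Y', Z', val X' Y' u', val Y' Z' v', val Z' (tc_sh C 1 X') w')"
proof -
  let ?L = "loc_lin C S"
  have Lob: "lc_ob ?L = lc_ob C" by (simp add: loc_lin_def)
  obtain a b c where abc: "lc_iso ?L X X' a" "lc_iso ?L Y Y' b" "lc_iso ?L Z Z' c"
      "lc_comp ?L X Y Y' b u = lc_comp ?L X X' Y' u' a"
      "lc_comp ?L Y Z Z' c v = lc_comp ?L Y Y' Z' v' b"
      "lc_comp ?L Z (tc_sh C 1 X) (tc_sh C 1 X') (loc_shm C 1 a) w = lc_comp ?L Z Z' (tc_sh C 1 X') w' c"
    using assms unfolding tri_iso_def by auto
  have ob: "X \<in> lc_ob C" "Y \<in> lc_ob C" "Z \<in> lc_ob C" "X' \<in> lc_ob C" "Y' \<in> lc_ob C" "Z' \<in> lc_ob C"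
    and hm: "u \<in> lc_hom ?L X Y" "v \<in> lc_hom ?L Y Z" "w \<in> lc_hom ?L Z (tc_sh C 1 X)"
      "u' \<in> lc_hom ?L X' Y'" "v' \<in> lc_hom ?L Y' Z'" "w' \<in> lc_hom ?L Z' (tc_sh C 1 X')"
    using assms unfolding tri_iso_def Lob by auto
  have h: "a \<in> lc_hom ?L X X'" "b \<in> lc_hom ?L Y Y'" "c \<in> lc_hom ?L Z Z'"
    using abc(1-3) by (auto simp: lc_iso_def)
  note sob = ob[THEN sh_ob, of 1]
  have 1: "lc_comp C X Y Y' (val Y Y' b) (val X Y u) = lc_comp C X X' Y' (val X' Y' u') (val X X' a)"
    using val_comp[OF ob(1,2,5) represents_val[OF ob(1,2) hm(1)] represents_val[OF ob(2,5) h(2)]]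
      val_comp[OF ob(1,4,5) represents_val[OF ob(1,4) h(1)] represents_val[OF ob(4,5) hm(4)]] abc(4)
    by simp
  have 2: "lc_comp C Y Z Z' (val Z Z' c) (val Y Z v) = lc_comp C Y Y' Z' (val Y' Z' v') (val Y Y' b)"
    using val_comp[OF ob(2,3,6) represents_val[OF ob(2,3) hm(2)] represents_val[OF ob(3,6) h(3)]]
      val_comp[OF ob(2,5,6) represents_val[OF ob(2,5) h(2)] represents_val[OF ob(5,6) hm(5)]] abc(5)
    by simp
  have 3: "lc_comp C Z (tc_sh C 1 X) (tc_sh C 1 X') (tc_shm C 1 (val X X' a)) (val Z (tc_sh C 1 X) w)
      = lc_comp C Z Z' (tc_sh C 1 X') (val Z' (tc_sh C 1 X') w') (val Z Z' c)"
    using val_comp[OF ob(3) sob(1,4) represents_val[OF ob(3) sob(1) hm(3)]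
        represents_shm[OF ob(1,4) represents_val[OF ob(1,4) h(1)]]]
      val_comp[OF ob(3,6) sob(4) represents_val[OF ob(3,6) h(3)] represents_val[OF ob(6) sob(4) hm(6)]]
      abc(6)
    by simp
  show ?thesis unfolding tri_iso_def split_def fst_conv snd_conv
    using ob hm h sob RC_val(1) 1 2 3 val_iso abc(1-3) by blast
qed

text \<open>\<open>val\<close> identifies the localisation with \<open>C\<close>, so
  \<open>\<Phi>\<close> is \<open>F\<close> after \<open>val\<close>, with the same
  \<open>\<theta>\<close>. A distinguished triangle of the localisation is isomorphic there to one
  from \<open>C\<close>; \<open>val\<close> turns this into an isomorphism in \<open>C\<close>, and
  exactness of \<open>F\<close> takes over.\<close>

theorem exact_functor_on_localisation:
  assumes D: "tri_category D sD" and F: "exact_functor C D F" and ff: "fully_faithful C D F"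
  shows "\<exists>\<Phi>. exact_functor Loc D \<Phi> \<and> fully_faithful Loc D \<Phi> \<and> fo \<Phi> = fo F"
proof -
  interpret D: tri_category D sD by (rule D)
  define \<Phi> where "\<Phi> = \<lparr>fo = fo F, fm = (\<lambda>X Y \<alpha>. fm F X Y (val X Y \<alpha>))\<rparr>"
  have \<Phi>o: "fo \<Phi> = fo F" and \<Phi>m: "\<And>X Y \<alpha>. fm \<Phi> X Y \<alpha> = fm F X Y (val X Y \<alpha>)"
    by (simp_all add: \<Phi>_def)
  have Flin: "is_linear_functor C D F" using F by (simp add: exact_functor_def)
  then have Ff: "is_functor C D F" by (simp add: is_linear_functor_def)
  note Fn = functorD[OF Ff]
  have add: "fm F X Y (lc_add C X Y f g) = lc_add D (fo F X) (fo F Y) (fm F X Y f) (fm F X Y g)"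
    and scale: "fm F X Y (lc_scale C X Y c f) = lc_scale D (fo F X) (fo F Y) c (fm F X Y f)"
    if "X \<in> lc_ob C" "Y \<in> lc_ob C" "f \<in> lc_hom C X Y" "g \<in> lc_hom C X Y" for X Y f g c
    using Flin that unfolding is_linear_functor_def by blast+
  obtain \<theta> where
    th': "\<forall>X \<in> lc_ob C. lc_iso D (fo F (tc_sh C 1 X)) (tc_sh D 1 (fo F X)) (\<theta> X)"
    and nat': "\<forall>X \<in> lc_ob C. \<forall>Y \<in> lc_ob C. \<forall>f \<in> lc_hom C X Y.
             lc_comp D (fo F (tc_sh C 1 X)) (tc_sh D 1 (fo F X)) (tc_sh D 1 (fo F Y))
               (tc_shm D 1 (fm F X Y f)) (\<theta> X) =
             lc_comp D (fo F (tc_sh C 1 X)) (fo F (tc_sh C 1 Y)) (tc_sh D 1 (fo F Y))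
               (\<theta> Y) (fm F (tc_sh C 1 X) (tc_sh C 1 Y) (tc_shm C 1 f))"
    and dist: "\<forall>X Y Z u v w. (X, Y, Z, u, v, w) \<in> tc_dist C \<longrightarrow>
             (fo F X, fo F Y, fo F Z, fm F X Y u, fm F Y Z v,
              lc_comp D (fo F Z) (fo F (tc_sh C 1 X)) (tc_sh D 1 (fo F X))
                (\<theta> X) (fm F Z (tc_sh C 1 X) w)) \<in> tc_dist D"
    using F unfolding exact_functor_def by (elim conjE exE) (rule that)
  note th = th'[rule_format] and nat = nat'[rule_format]
  have "is_functor Loc D \<Phi>"
    unfolding is_functor_def Loc_simps \<Phi>o \<Phi>m
  proof (intro conjI ballI)
    fix X assume X: "X \<in> lc_ob C"
    then show "fo F X \<in> lc_ob D" by (rule Fn)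
    show "fm F X X (val X X (lc_id (loc_lin C S) X)) = lc_id D (fo F X)"
      using X Loc_id val_RC id_in Fn(3) by simp
  next
    fix X Y f assume "X \<in> lc_ob C" "Y \<in> lc_ob C" "f \<in> lc_hom (loc_lin C S) X Y"
    then show "fm F X Y (val X Y f) \<in> lc_hom D (fo F X) (fo F Y)" using Fn(2) RC_val(1) by blast
  next
    fix X Y Z f g
    assume ob: "X \<in> lc_ob C" "Y \<in> lc_ob C" "Z \<in> lc_ob C"
      and f: "f \<in> lc_hom (loc_lin C S) X Y" and g: "g \<in> lc_hom (loc_lin C S) Y Z"
    show "fm F X Z (val X Z (lc_comp (loc_lin C S) X Y Z g f))
        = lc_comp D (fo F X) (fo F Y) (fo F Z) (fm F Y Z (val Y Z g)) (fm F X Y (val X Y f))"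
      unfolding val_comp[OF ob represents_val[OF ob(1,2) f] represents_val[OF ob(2,3) g]]
      by (rule Fn(4)[OF ob RC_val(1)[OF ob(1,2) f] RC_val(1)[OF ob(2,3) g]])
  qed
  moreover have "\<forall>X \<in> lc_ob C. \<forall>Y \<in> lc_ob C. \<forall>f \<in> lc_hom (loc_lin C S) X Y. \<forall>g \<in> lc_hom (loc_lin C S) X Y. \<forall>c.
        fm F X Y (val X Y (lc_add (loc_lin C S) X Y f g))
          = lc_add D (fo F X) (fo F Y) (fm F X Y (val X Y f)) (fm F X Y (val X Y g)) \<and>
        fm F X Y (val X Y (lc_scale (loc_lin C S) X Y c f))
          = lc_scale D (fo F X) (fo F Y) c (fm F X Y (val X Y f))"
  proof (intro ballI allI)
    fix X Y f g c
    assume ob: "X \<in> lc_ob C" "Y \<in> lc_ob C" and f: "f \<in> lc_hom (loc_lin C S) X Y"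
      and g: "g \<in> lc_hom (loc_lin C S) X Y"
    have "val X Y (lc_add (loc_lin C S) X Y f g) = lc_add C X Y (val X Y f) (val X Y g)"
      using Loc_add[OF ob RC_val(1)[OF ob f] RC_val(1)[OF ob g]] RC_val[OF ob f] RC_val[OF ob g]
        val_RC ob add_in by simp
    moreover have "val X Y (lc_scale (loc_lin C S) X Y c f) = lc_scale C X Y c (val X Y f)"
      using Loc_scale[OF ob RC_val(1)[OF ob f]] RC_val[OF ob f] val_RC ob scale_in by simp
    ultimately show "fm F X Y (val X Y (lc_add (loc_lin C S) X Y f g))
          = lc_add D (fo F X) (fo F Y) (fm F X Y (val X Y f)) (fm F X Y (val X Y g)) \<and>
        fm F X Y (val X Y (lc_scale (loc_lin C S) X Y c f))
          = lc_scale D (fo F X) (fo F Y) c (fm F X Y (val X Y f))"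
      using add scale ob RC_val(1)[OF ob f] RC_val(1)[OF ob g] by simp
  qed
  ultimately have lin: "is_linear_functor Loc D \<Phi>"
    unfolding is_linear_functor_def Loc_simps \<Phi>o \<Phi>m by (rule conjI)
  have "exact_functor Loc D \<Phi>"
    unfolding exact_functor_def
  proof (intro conjI exI[of _ \<theta>] lin; unfold Loc_simps \<Phi>o \<Phi>m)
    show "\<forall>X\<in>lc_ob C. lc_iso D (fo F (tc_sh C 1 X)) (tc_sh D 1 (fo F X)) (\<theta> X)" using th by blast
    show "\<forall>X\<in>lc_ob C. \<forall>Y\<in>lc_ob C. \<forall>f\<in>lc_hom (loc_lin C S) X Y.
        lc_comp D (fo F (tc_sh C 1 X)) (tc_sh D 1 (fo F X)) (tc_sh D 1 (fo F Y))
          (tc_shm D 1 (fm F X Y (val X Y f))) (\<theta> X) =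
        lc_comp D (fo F (tc_sh C 1 X)) (fo F (tc_sh C 1 Y)) (tc_sh D 1 (fo F Y)) (\<theta> Y)
          (fm F (tc_sh C 1 X) (tc_sh C 1 Y) (val (tc_sh C 1 X) (tc_sh C 1 Y) (loc_shm C 1 f)))"
    proof (intro ballI)
      fix X Y f assume ob: "X \<in> lc_ob C" "Y \<in> lc_ob C" and f: "f \<in> lc_hom (loc_lin C S) X Y"
      have "val (tc_sh C 1 X) (tc_sh C 1 Y) (loc_shm C 1 f) = tc_shm C 1 (val X Y f)"
        by (rule val[OF sh_ob[OF ob(1)] sh_ob[OF ob(2)] represents_shm[OF ob represents_val[OF ob f]]])
      then show "lc_comp D (fo F (tc_sh C 1 X)) (tc_sh D 1 (fo F X)) (tc_sh D 1 (fo F Y))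
          (tc_shm D 1 (fm F X Y (val X Y f))) (\<theta> X) =
        lc_comp D (fo F (tc_sh C 1 X)) (fo F (tc_sh C 1 Y)) (tc_sh D 1 (fo F Y)) (\<theta> Y)
          (fm F (tc_sh C 1 X) (tc_sh C 1 Y) (val (tc_sh C 1 X) (tc_sh C 1 Y) (loc_shm C 1 f)))"
        using nat[OF ob RC_val(1)[OF ob f]] by simp
    qed
    show "\<forall>X Y Z u v w. (X, Y, Z, u, v, w) \<in> tc_dist Loc \<longrightarrow>
        (fo F X, fo F Y, fo F Z, fm F X Y (val X Y u), fm F Y Z (val Y Z v),
         lc_comp D (fo F Z) (fo F (tc_sh C 1 X)) (tc_sh D 1 (fo F X)) (\<theta> X)
          (fm F Z (tc_sh C 1 X) (val Z (tc_sh C 1 X) w))) \<in> tc_dist D"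
    proof (intro allI impI)
      fix X Y Z u v w assume "(X, Y, Z, u, v, w) \<in> tc_dist Loc"
      then obtain X0 Y0 Z0 u0 v0 w0 where d: "(X0, Y0, Z0, u0, v0, w0) \<in> tc_dist C"
        and i: "tri_iso (loc_lin C S) (tc_sh C 1) (loc_shm C 1)
         (X0, Y0, Z0, loc_mor C S X0 Y0 u0, loc_mor C S Y0 Z0 v0, loc_mor C S Z0 (tc_sh C 1 X0) w0)
         (X, Y, Z, u, v, w)"
        by (auto simp: localisation_def lincat.defs)
      note ty = dist_typed[OF d]
      have i': "tri_iso C (tc_sh C 1) (tc_shm C 1) (X0, Y0, Z0, u0, v0, w0)
         (X, Y, Z, val X Y u, val Y Z v, val Z (tc_sh C 1 X) w)"
        using val_tri_iso[OF i] ty Loc_mor val_RC sh_ob by simp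
      have "tri_iso D (tc_sh D 1) (tc_shm D 1)
         (fo F X0, fo F Y0, fo F Z0, fm F X0 Y0 u0, fm F Y0 Z0 v0,
          lc_comp D (fo F Z0) (fo F (tc_sh C 1 X0)) (tc_sh D 1 (fo F X0)) (\<theta> X0)
            (fm F Z0 (tc_sh C 1 X0) w0))
         (fo F X, fo F Y, fo F Z, fm F X Y (val X Y u), fm F Y Z (val Y Z v),
          lc_comp D (fo F Z) (fo F (tc_sh C 1 X)) (tc_sh D 1 (fo F X)) (\<theta> X)
            (fm F Z (tc_sh C 1 X) (val Z (tc_sh C 1 X) w)))"
        by (rule exact_functor_tri_iso[where \<theta> = \<theta>, OF tri_category_axioms D Ff _ _ i'])
          (rule th, assumption, rule nat, assumption+)
      then show "(fo F X, fo F Y, fo F Z, fm F X Y (val X Y u), fm F Y Z (val Y Z v),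
         lc_comp D (fo F Z) (fo F (tc_sh C 1 X)) (tc_sh D 1 (fo F X)) (\<theta> X)
          (fm F Z (tc_sh C 1 X) (val Z (tc_sh C 1 X) w))) \<in> tc_dist D"
        by (rule D.dist_iso[OF dist[rule_format, OF d]])
    qed
  qed
  moreover have "fully_faithful Loc D \<Phi>"
    unfolding fully_faithful_def Loc_simps \<Phi>o
  proof (intro ballI)
    fix X Y assume ob: "X \<in> lc_ob C" "Y \<in> lc_ob C"
    have "bij_betw (val X Y) (lc_hom (loc_lin C S) X Y) (lc_hom C X Y)"
      by (rule bij_betw_byWitness[of _ "RC X Y"]) (use RC_val val_RC Loc_hom ob in auto)
    moreover have "bij_betw (fm F X Y) (lc_hom C X Y) (lc_hom D (fo F X) (fo F Y))"
      using ff ob by (simp add: fully_faithful_def)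
    moreover have "fm \<Phi> X Y = fm F X Y \<circ> val X Y" by (rule ext) (simp add: \<Phi>m)
    ultimately show "bij_betw (fm \<Phi> X Y) (lc_hom (loc_lin C S) X Y) (lc_hom D (fo F X) (fo F Y))"
      by (simp add: bij_betw_trans)
  qed
  ultimately show ?thesis using \<Phi>o by (intro exI[of _ \<Phi>] conjI)
qed

end

section \<open>Linear algebra\<close>

context vector_space
begin

text \<open>A basis \<open>S0\<close> of \<open>B\<close> is extended to a basis \<open>S1\<close>
  of \<open>Z\<close>; the added vectors represent a basis of the quotient. For cocycles and
  boundaries this gives explicit representatives of a basis of cohomology.\<close>

lemma quotient_basis:
  assumes Z: "subspace Z" and B: "subspace B" "B \<subseteq> Z" and F: "finite F" "Z \<subseteq> span F"
  shows "\<exists>n (\<phi> :: nat \<Rightarrow> 'b). (\<forall>a<n. \<phi> a \<in> Z) \<and> (\<forall>u \<in> Z. \<exists>c. u - (\<Sum>a<n. c a *s \<phi> a) \<in> B) \<and>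
    (\<forall>c. (\<Sum>a<n. c a *s \<phi> a) \<in> B \<longrightarrow> (\<forall>a<n. c a = 0))"
proof -
  obtain S0 where S0: "S0 \<subseteq> B" "independent S0" "B \<subseteq> span S0"
    using maximal_independent_subset[of B] by blast
  obtain S1 where S1: "S0 \<subseteq> S1" "S1 \<subseteq> Z" "independent S1" "Z \<subseteq> span S1"
    using maximal_independent_subset_extend[of S0 Z] S0 B by blast
  have fin: "finite S1" using independent_span_bound[OF F(1) S1(3)] S1(2) F(2) by blast
  have fin0: "finite S0" using S1(1) fin finite_subset by blast
  define Q where "Q = S1 - S0"
  obtain \<phi> where bij: "bij_betw \<phi> {0..<card Q} Q"
    using ex_bij_betw_nat_finite[of Q] fin by (auto simp: Q_def)
  have inj: "inj_on \<phi> {..<card Q}" and im: "\<phi> ` {..<card Q} = Q"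
    using bij by (auto simp: bij_betw_def lessThan_atLeast0)
  have split: "(\<Sum>v\<in>S1. r v *s v) = (\<Sum>v\<in>Q. r v *s v) + (\<Sum>v\<in>S0. r v *s v)" for r
    unfolding Q_def using sum.subset_diff[OF S1(1) fin] by auto
  show ?thesis
  proof (intro exI[of _ "card Q"] exI[of _ \<phi>] conjI allI ballI impI)
    fix a assume "a < card Q"
    then show "\<phi> a \<in> Z" using im S1(2) by (auto simp: Q_def)
  next
    fix u assume "u \<in> Z"
    then obtain r where r: "u = (\<Sum>v\<in>S1. r v *s v)" using S1(4) span_finite[OF fin] by auto
    have "u - (\<Sum>a<card Q. r (\<phi> a) *s \<phi> a) = (\<Sum>v\<in>S0. r v *s v)"
      using split[of r] r sum.reindex[OF inj, of "\<lambda>v. r v *s v"] im by simp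
    moreover have "(\<Sum>v\<in>S0. r v *s v) \<in> B"
      using B(1) S0(1) by (intro subspace_sum subspace_scale) auto
    ultimately show "\<exists>c. u - (\<Sum>a<card Q. c a *s \<phi> a) \<in> B" by metis
  next
    fix c a assume c: "(\<Sum>a<card Q. c a *s \<phi> a) \<in> B" and a: "a < card Q"
    define r where "r v = c (inv_into {..<card Q} \<phi> v)" for v
    have r: "r (\<phi> a) = c a" if "a < card Q" for a using inj that by (simp add: r_def)
    have "(\<Sum>a<card Q. c a *s \<phi> a) = (\<Sum>v\<in>Q. r v *s v)"
      using sum.reindex[OF inj, of "\<lambda>v. r v *s v"] im r by simp
    moreover obtain r0 where "(\<Sum>a<card Q. c a *s \<phi> a) = (\<Sum>v\<in>S0. r0 v *s v)"
      using c S0(3) span_finite[OF fin0] by auto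
    ultimately have eq: "(\<Sum>v\<in>Q. r v *s v) = (\<Sum>v\<in>S0. r0 v *s v)" by simp
    \<comment> \<open>Both sides of \<open>eq\<close> are collected into one vanishing combination
      of the basis \<open>S1\<close>.\<close>
    define w where "w v = (if v \<in> S0 then - r0 v else r v)" for v
    have "(\<Sum>v\<in>S1. w v *s v) = 0"
      unfolding split using eq
      by (simp add: w_def Q_def sum_negf sum.cong[of Q Q "\<lambda>v. w v *s v" "\<lambda>v. r v *s v"])
    then have "w (\<phi> a) = 0"
      using independentD[OF S1(3) fin order_refl, of w "\<phi> a"] im a by (auto simp: Q_def)
    then show "c a = 0" using im a r by (auto simp: w_def Q_def split: if_splits)
  qed
qed

text \<open>Non-zero vectors taken from different summands are linearly independent, so there are at
  most \<open>card F\<close> of them.\<close>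

lemma finite_support_of_direct_sum:
  assumes F: "finite F" "\<And>k. U k \<subseteq> span F" and sub: "\<And>k. subspace (U k)"
    and direct: "\<And>K f. finite K \<Longrightarrow> (\<forall>k \<in> K. f k \<in> U k) \<Longrightarrow> (\<Sum>k\<in>K. f k) = 0 \<Longrightarrow> \<forall>k \<in> K. f k = 0"
  shows "finite {k. U k \<noteq> {0}}"
proof (rule ccontr)
  assume "infinite {k. U k \<noteq> {0}}"
  then obtain K where K: "finite K" "card K = Suc (card F)" "K \<subseteq> {k. U k \<noteq> {0}}"
    using infinite_arbitrarily_large by metis
  have "\<forall>k \<in> K. \<exists>x. x \<in> U k \<and> x \<noteq> 0" using K(3) subspace_0[OF sub] by fastforce
  then obtain x where x: "\<And>k. k \<in> K \<Longrightarrow> x k \<in> U k" "\<And>k. k \<in> K \<Longrightarrow> x k \<noteq> 0" by metis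
  have zero: "\<forall>k \<in> K. c k = 0" if "(\<Sum>k\<in>K. c k *s x k) = 0" for c
    using direct[OF K(1) _ that] x subspace_scale[OF sub] by simp
  have inj: "inj_on x K"
  proof (rule inj_onI, rule ccontr)
    fix k l assume kl: "k \<in> K" "l \<in> K" "x k = x l" "k \<noteq> l"
    \<comment> \<open>Equal vectors from two different summands would satisfy the relation with
      coefficients 1 and -1, which directness excludes.\<close>
    define c where "c i = (if i = k then 1 else if i = l then - 1 else 0 :: 'a)" for i
    have "(\<Sum>i\<in>K. c i *s x i) = (\<Sum>i\<in>{k, l}. c i *s x i)"
      using K(1) kl by (intro sum.mono_neutral_right) (auto simp: c_def)
    also have "\<dots> = 0" using kl by (simp add: c_def)
    finally have "c k = 0" using zero kl by blast
    then show False by (simp add: c_def)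
  qed
  have "independent (x ` K)"
  proof (subst dependent_finite)
    show "finite (x ` K)" using K by simp
    show "\<not> (\<exists>u. (\<exists>v\<in>x ` K. u v \<noteq> 0) \<and> (\<Sum>v\<in>x ` K. u v *s v) = 0)"
    proof
      assume "\<exists>u. (\<exists>v\<in>x ` K. u v \<noteq> 0) \<and> (\<Sum>v\<in>x ` K. u v *s v) = 0"
      then obtain u k where u: "k \<in> K" "u (x k) \<noteq> 0" "(\<Sum>v\<in>x ` K. u v *s v) = 0" by auto
      have "(\<Sum>k\<in>K. u (x k) *s x k) = 0" using u(3) sum.reindex[OF inj, of "\<lambda>v. u v *s v"] by simp
      then show False using zero[of "\<lambda>k. u (x k)"] u by blast
    qed
  qed
  moreover have "x ` K \<subseteq> span F" using x F(2) by blast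
  ultimately have "card (x ` K) \<le> card F" using independent_span_bound[OF F(1)] by blast
  then show False using card_image[OF inj] K by simp
qed

end

section \<open>DG-categories of operators\<close>

text \<open>The sign is taken in the ring of operators, where the differentials live;
  \<open>sg\<close> is the scalar version used for the concrete modules.\<close>

definition sn :: "int \<Rightarrow> 'r::ring_1" where
  "sn k = (if even k then 1 else - 1)"

lemma sn_simps: "sn 0 = 1" "sn 1 = - 1" "sn (- 1) = - 1"
  by (simp_all add: sn_def)

lemma sn_add: "sn (k + l) = sn k * sn l"
  and sn_comm: "x * sn k = sn k * x" and sn_square: "sn k * sn k = 1" "sn k * (sn k * x) = x"
  by (simp_all add: sn_def)

text \<open>Turns a relation between two factors into a rewrite rule for right-nested products;
  computations with cones are normalised in this way.\<close>

lemma mult_eq_assoc: "a * b = c \<Longrightarrow> a * (b * x) = c * x" for a :: "'a::semigroup_mult"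
  by (simp flip: mult.assoc)

text \<open>
  The morphisms are elements of one ring, so that composition needs no reference to objects, and
  the differential of \<open>f : X \<rightarrow> Y\<close> of degree \<open>k\<close> is \<open>D\<^sub>Y f - (-1)\<^sup>k f D\<^sub>X\<close>.
\<close>

locale op_cat =
  fixes sc :: "complex \<Rightarrow> 'r::ring_1" and ob :: "'o set" and one :: "'o \<Rightarrow> 'r" and D :: "'o \<Rightarrow> 'r"
    and hom :: "'o \<Rightarrow> 'o \<Rightarrow> int \<Rightarrow> 'r set"
  assumes sc_add: "sc (a + b) = sc a + sc b" and sc_mult: "sc (a * b) = sc a * sc b" and sc_1: "sc 1 = 1"
    and sc_comm: "x * sc a = sc a * x"
    and hom_0: "\<lbrakk>X \<in> ob; Y \<in> ob\<rbrakk> \<Longrightarrow> 0 \<in> hom X Y k"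
    and hom_add: "\<lbrakk>X \<in> ob; Y \<in> ob; f \<in> hom X Y k; g \<in> hom X Y k\<rbrakk> \<Longrightarrow> f + g \<in> hom X Y k"
    and hom_sc: "\<lbrakk>X \<in> ob; Y \<in> ob; f \<in> hom X Y k\<rbrakk> \<Longrightarrow> sc c * f \<in> hom X Y k"
    and hom_mult: "\<lbrakk>X \<in> ob; Y \<in> ob; Z \<in> ob; f \<in> hom X Y k; g \<in> hom Y Z l\<rbrakk> \<Longrightarrow> g * f \<in> hom X Z (k + l)"
    and hom_one: "X \<in> ob \<Longrightarrow> one X \<in> hom X X 0"
    and one_left: "\<lbrakk>X \<in> ob; Y \<in> ob; f \<in> hom X Y k\<rbrakk> \<Longrightarrow> one Y * f = f"
    and one_right: "\<lbrakk>X \<in> ob; Y \<in> ob; f \<in> hom X Y k\<rbrakk> \<Longrightarrow> f * one X = f"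
    and hom_D: "X \<in> ob \<Longrightarrow> D X \<in> hom X X 1"
    and D_square: "X \<in> ob \<Longrightarrow> D X * D X = 0"
begin

lemma sc_0: "sc 0 = 0" using sc_add[of 0 0] by simp

lemma sc_minus: "sc (- c) = - sc c"
  using sc_add[of c "- c"] sc_0 by (simp add: minus_unique)

lemma sc_diff: "sc (a - b) = sc a - sc b"
  using sc_add[of a "- b"] sc_minus by simp

lemma sn_sc: "sn k = sc (if even k then 1 else - 1)"
  by (simp add: sn_def sc_1 sc_minus)

lemma sc_left_comm: "x * (sc a * y) = sc a * (x * y)"
  by (metis mult.assoc sc_comm)

lemma vec: "vector_space (\<lambda>c f. sc c * f)"
  by unfold_locales (simp_all add: distrib_left distrib_right sc_add sc_mult sc_1 mult.assoc)

definition cyc :: "'o \<Rightarrow> 'o \<Rightarrow> int \<Rightarrow> 'r set" where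
  "cyc X Y k = {f \<in> hom X Y k. D Y * f = sn k * f * D X}"

text \<open>A primitive \<open>h\<close> has degree \<open>k - 1\<close>, which turns the sign
  \<open>- sn (k - 1)\<close> of the graded commutator into \<open>sn k\<close>.\<close>

definition bnd :: "'o \<Rightarrow> 'o \<Rightarrow> int \<Rightarrow> 'r set" where
  "bnd X Y k = {D Y * h + sn k * h * D X | h. h \<in> hom X Y (k - 1)}"

lemma hom_minus: "\<lbrakk>X \<in> ob; Y \<in> ob; f \<in> hom X Y k\<rbrakk> \<Longrightarrow> - f \<in> hom X Y k"
  using hom_sc[of X Y f k "- 1"] by (simp add: sc_minus sc_1)

lemma hom_diff: "\<lbrakk>X \<in> ob; Y \<in> ob; f \<in> hom X Y k; g \<in> hom X Y k\<rbrakk> \<Longrightarrow> f - g \<in> hom X Y k"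
  using hom_add[of X Y f k "- g"] hom_minus by simp

lemma hom_sn: "\<lbrakk>X \<in> ob; Y \<in> ob; f \<in> hom X Y k\<rbrakk> \<Longrightarrow> sn l * f \<in> hom X Y k"
  by (simp add: sn_sc hom_sc)

lemma hom_sum:
  "\<lbrakk>X \<in> ob; Y \<in> ob; \<And>a. a \<in> A \<Longrightarrow> f a \<in> hom X Y k\<rbrakk> \<Longrightarrow> (\<Sum>a\<in>A. f a) \<in> hom X Y k"
  by (induction A rule: infinite_finite_induct) (auto simp: hom_0 hom_add)

lemma hom_comp:
  "\<lbrakk>X \<in> ob; Y \<in> ob; Z \<in> ob; f \<in> hom X Y k; g \<in> hom Y Z l; m = k + l\<rbrakk> \<Longrightarrow> g * f \<in> hom X Z m"
  using hom_mult by blast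

lemma cyc_hom: "f \<in> cyc X Y k \<Longrightarrow> f \<in> hom X Y k" by (simp add: cyc_def)

lemma cyc_0: "\<lbrakk>X \<in> ob; Y \<in> ob\<rbrakk> \<Longrightarrow> 0 \<in> cyc X Y k" by (simp add: cyc_def hom_0)

lemma cyc_add: "\<lbrakk>X \<in> ob; Y \<in> ob; f \<in> cyc X Y k; g \<in> cyc X Y k\<rbrakk> \<Longrightarrow> f + g \<in> cyc X Y k"
  by (simp add: cyc_def hom_add algebra_simps)

lemma cyc_sc: "\<lbrakk>X \<in> ob; Y \<in> ob; f \<in> cyc X Y k\<rbrakk> \<Longrightarrow> sc c * f \<in> cyc X Y k"
  by (auto simp: cyc_def hom_sc sc_left_comm mult.assoc)

lemma cyc_minus: "\<lbrakk>X \<in> ob; Y \<in> ob; f \<in> cyc X Y k\<rbrakk> \<Longrightarrow> - f \<in> cyc X Y k"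
  using cyc_sc[of X Y f k "- 1"] by (simp add: sc_minus sc_1)

lemma cyc_diff: "\<lbrakk>X \<in> ob; Y \<in> ob; f \<in> cyc X Y k; g \<in> cyc X Y k\<rbrakk> \<Longrightarrow> f - g \<in> cyc X Y k"
  using cyc_add[of X Y f k "- g"] cyc_minus by simp

lemma cyc_one: "X \<in> ob \<Longrightarrow> one X \<in> cyc X X 0"
  using hom_D[of X] one_left[of X X "D X" 1] one_right[of X X "D X" 1]
  by (simp add: cyc_def hom_one sn_simps)

lemma cyc_comp:
  assumes "X \<in> ob" "Y \<in> ob" "Z \<in> ob" and f: "f \<in> cyc X Y k" and g: "g \<in> cyc Y Z l" and m: "m = k + l"
  shows "g * f \<in> cyc X Z m"
proof -
  have "D Z * (g * f) = sn l * (g * (D Y * f))"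
    using g by (simp add: cyc_def mult.assoc mult_eq_assoc[of "D Z"])
  also have "\<dots> = sn m * (g * f) * D X"
    using f m by (simp add: cyc_def mult.assoc sn_add) (metis mult.assoc sn_comm)
  finally show ?thesis
    using hom_comp[OF assms(1-3) cyc_hom[OF f] cyc_hom[OF g] m] by (simp add: cyc_def)
qed

lemma bnd_0: "\<lbrakk>X \<in> ob; Y \<in> ob\<rbrakk> \<Longrightarrow> 0 \<in> bnd X Y k"
  unfolding bnd_def by (rule CollectI, rule exI[of _ 0]) (simp add: hom_0)

lemma bnd_add:
  assumes "X \<in> ob" "Y \<in> ob" "f \<in> bnd X Y k" "g \<in> bnd X Y k" shows "f + g \<in> bnd X Y k"
proof -
  obtain h h' where "h \<in> hom X Y (k - 1)" "f = D Y * h + sn k * h * D X"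
    "h' \<in> hom X Y (k - 1)" "g = D Y * h' + sn k * h' * D X" using assms(3,4) unfolding bnd_def by blast
  then show ?thesis unfolding bnd_def
    using assms(1,2) by (intro CollectI exI[of _ "h + h'"]) (simp add: hom_add algebra_simps)
qed

lemma bnd_sc:
  assumes "X \<in> ob" "Y \<in> ob" "f \<in> bnd X Y k" shows "sc c * f \<in> bnd X Y k"
proof -
  obtain h where "h \<in> hom X Y (k - 1)" "f = D Y * h + sn k * h * D X"
    using assms(3) unfolding bnd_def by blast
  then show ?thesis unfolding bnd_def
    using assms(1,2)
    by (intro CollectI exI[of _ "sc c * h"]) (simp add: hom_sc sc_left_comm mult.assoc distrib_left)
qed

lemma bnd_minus: "\<lbrakk>X \<in> ob; Y \<in> ob; f \<in> bnd X Y k\<rbrakk> \<Longrightarrow> - f \<in> bnd X Y k"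
  using bnd_sc[of X Y f k "- 1"] by (simp add: sc_minus sc_1)

lemma bnd_diff: "\<lbrakk>X \<in> ob; Y \<in> ob; f \<in> bnd X Y k; g \<in> bnd X Y k\<rbrakk> \<Longrightarrow> f - g \<in> bnd X Y k"
  using bnd_add[of X Y f k "- g"] bnd_minus by simp

lemma bnd_sum:
  "\<lbrakk>X \<in> ob; Y \<in> ob; \<And>a. a \<in> A \<Longrightarrow> f a \<in> bnd X Y k\<rbrakk> \<Longrightarrow> (\<Sum>a\<in>A. f a) \<in> bnd X Y k"
  by (induction A rule: infinite_finite_induct) (auto simp: bnd_0 bnd_add)

lemma bnd_cyc:
  assumes ob: "X \<in> ob" "Y \<in> ob" and f: "f \<in> bnd X Y k" shows "f \<in> cyc X Y k"
proof -
  obtain h where h: "h \<in> hom X Y (k - 1)" "f = D Y * h + sn k * (h * D X)"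
    using f unfolding bnd_def by (auto simp: mult.assoc)
  have "D Y * h \<in> hom X Y k" "h * D X \<in> hom X Y k"
    using hom_comp[OF ob(1,2,2) h(1) hom_D[OF ob(2)]] hom_comp[OF ob(1,1,2) hom_D[OF ob(1)] h(1)] by auto
  then have "f \<in> hom X Y k" unfolding h(2) by (intro hom_add hom_sn ob)
  moreover have "D Y * f = sn k * f * D X"
    using D_square[OF ob(1)] mult_eq_assoc[OF D_square[OF ob(2)]] unfolding h(2)
    by (simp add: sn_def distrib_left distrib_right mult.assoc)
  ultimately show ?thesis by (simp add: cyc_def)
qed

text \<open>Moving the cocycle \<open>g\<close> of degree \<open>l\<close> past the differential
  costs the sign \<open>sn l\<close>, so the primitive of \<open>g * b\<close> is
  \<open>sn l * (g * h)\<close>.\<close>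

lemma bnd_comp_left:
  assumes ob: "X \<in> ob" "Y \<in> ob" "Z \<in> ob" and b: "b \<in> bnd X Y k" and g: "g \<in> cyc Y Z l" and m: "m = k + l"
  shows "g * b \<in> bnd X Z m"
proof -
  obtain h where h: "h \<in> hom X Y (k - 1)" "b = D Y * h + sn k * (h * D X)"
    using b unfolding bnd_def by (auto simp: mult.assoc)
  have gD: "g * D Y = sn l * (D Z * g)" using g by (simp add: cyc_def mult.assoc sn_square)
  have "sn l * (g * h) \<in> hom X Z (m - 1)"
    by (intro hom_sn ob hom_comp[OF ob h(1) cyc_hom[OF g]]) (simp add: m)
  moreover have "g * b = D Z * (sn l * (g * h)) + sn m * (sn l * (g * h)) * D X"
    unfolding h(2) m using mult_eq_assoc[OF gD]
    by (simp add: sn_def distrib_left distrib_right mult.assoc)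
  ultimately show ?thesis unfolding bnd_def by blast
qed

text \<open>With the cocycle on the right, \<open>h * f\<close> is a primitive without any
  sign.\<close>

lemma bnd_comp_right:
  assumes ob: "X \<in> ob" "Y \<in> ob" "Z \<in> ob" and f: "f \<in> cyc X Y k" and b: "b \<in> bnd Y Z l" and m: "m = k + l"
  shows "b * f \<in> bnd X Z m"
proof -
  obtain h where h: "h \<in> hom Y Z (l - 1)" "b = D Z * h + sn l * (h * D Y)"
    using b unfolding bnd_def by (auto simp: mult.assoc)
  have Df: "D Y * f = sn k * (f * D X)" using f by (simp add: cyc_def mult.assoc)
  have "h * f \<in> hom X Z (m - 1)" by (rule hom_comp[OF ob cyc_hom[OF f] h(1)]) (simp add: m)
  moreover have "b * f = D Z * (h * f) + sn m * (h * f) * D X"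
    unfolding h(2) m using Df by (simp add: sn_def distrib_left distrib_right mult.assoc)
  ultimately show ?thesis unfolding bnd_def by blast
qed

definition heq :: "'o \<Rightarrow> 'o \<Rightarrow> bool" where
  "heq X Y \<longleftrightarrow> X \<in> ob \<and> Y \<in> ob \<and>
     (\<exists>f \<in> cyc X Y 0. \<exists>g \<in> cyc Y X 0. one X - g * f \<in> bnd X X 0 \<and> one Y - f * g \<in> bnd Y Y 0)"

lemma heq_sym: "heq X Y \<Longrightarrow> heq Y X" unfolding heq_def by blast

lemma strict_iso_heq:
  assumes "X \<in> ob" "Y \<in> ob" "f \<in> cyc X Y 0" "g \<in> cyc Y X 0" "g * f = one X" "f * g = one Y"
  shows "heq X Y"
  unfolding heq_def using assms bnd_0 by (intro conjI bexI[of _ f] bexI[of _ g]) auto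

end

text \<open>Shifts and cones in the form in which the diagram chases use them. A shift changes the
  degrees of maps and the sign of the differential, but not the maps. The cone of
  \<open>f : X \<rightarrow> Y\<close> is split by the inclusions \<open>cj\<close> of
  \<open>Y\<close> and \<open>ct\<close> of \<open>X[1]\<close> with projections \<open>cs\<close>
  and \<open>cp\<close>; these depend only on \<open>X\<close> and \<open>Y\<close>, while
  \<open>f\<close> enters the differential, a block matrix with entries \<open>D Y\<close>,
  \<open>f\<close> and \<open>- D X\<close>. That \<open>E\<close> is exceptional is assumed on the
  level of Hom-complexes.\<close>

locale dg_ops = op_cat sc ob one D hom
  for sc :: "complex \<Rightarrow> 'r::ring_1" and ob :: "'o set" and one D :: "'o \<Rightarrow> 'r"
    and hom :: "'o \<Rightarrow> 'o \<Rightarrow> int \<Rightarrow> 'r set" +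
  fixes E :: 'o and sh :: "int \<Rightarrow> 'o \<Rightarrow> 'o" and cn :: "'o \<Rightarrow> 'o \<Rightarrow> 'r \<Rightarrow> 'o"
    and cj cs ct cp :: "'o \<Rightarrow> 'o \<Rightarrow> 'r"
  assumes E_ob: "E \<in> ob" and hom_EE0: "hom E E 0 = range (\<lambda>c. sc c * one E)"
    and hom_EE: "k \<noteq> 0 \<Longrightarrow> hom E E k = {0}" and sc_one_E: "sc c * one E = 0 \<Longrightarrow> c = 0"
    and sh_ob: "X \<in> ob \<Longrightarrow> sh k X \<in> ob" and D_sh: "X \<in> ob \<Longrightarrow> D (sh k X) = sn k * D X"
    and one_sh: "X \<in> ob \<Longrightarrow> one (sh k X) = one X"
    and hom_sh_left: "\<lbrakk>X \<in> ob; Y \<in> ob\<rbrakk> \<Longrightarrow> hom (sh m X) Y k = hom X Y (k - m)"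
    and hom_sh_right: "\<lbrakk>X \<in> ob; Y \<in> ob\<rbrakk> \<Longrightarrow> hom X (sh m Y) k = hom X Y (k + m)"
    and cn_ob: "\<lbrakk>X \<in> ob; Y \<in> ob; f \<in> cyc X Y 0\<rbrakk> \<Longrightarrow> cn X Y f \<in> ob"
    and cone_hom: "\<lbrakk>X \<in> ob; Y \<in> ob; f \<in> cyc X Y 0\<rbrakk> \<Longrightarrow> cj X Y \<in> hom Y (cn X Y f) 0 \<and>
      cs X Y \<in> hom (cn X Y f) Y 0 \<and> ct X Y \<in> hom X (cn X Y f) (- 1) \<and> cp X Y \<in> hom (cn X Y f) X 1"
    and cone_eqs: "\<lbrakk>X \<in> ob; Y \<in> ob; f \<in> cyc X Y 0\<rbrakk> \<Longrightarrow> cp X Y * ct X Y = one X \<and>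
      cs X Y * cj X Y = one Y \<and> cs X Y * ct X Y = 0 \<and> cp X Y * cj X Y = 0 \<and>
      cj X Y * cs X Y + ct X Y * cp X Y = one (cn X Y f) \<and>
      D (cn X Y f) = cj X Y * D Y * cs X Y + cj X Y * f * cp X Y - ct X Y * D X * cp X Y"
    and zero_ob: "\<exists>Z \<in> ob. one Z = 0"
    and fin_dim: "\<lbrakk>X \<in> ob; Y \<in> ob\<rbrakk> \<Longrightarrow>
      \<exists>F. finite F \<and> (\<forall>k. hom X Y k \<subseteq> range (\<lambda>c. \<Sum>f\<in>F. sc (c f) * f))"
    and direct: "\<lbrakk>X \<in> ob; Y \<in> ob; finite K; \<forall>k \<in> K. u k \<in> hom X Y k; (\<Sum>k\<in>K. u k) = 0\<rbrakk>
      \<Longrightarrow> \<forall>k \<in> K. u k = 0"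
begin

lemma D_E: "D E = 0" using hom_D[OF E_ob] hom_EE[of 1] by simp

lemma cyc_E: "cyc E X k = {u \<in> hom E X k. D X * u = 0}"
  by (simp add: cyc_def D_E)

lemma bnd_E: "bnd E X k = {D X * h | h. h \<in> hom E X (k - 1)}"
  by (simp add: bnd_def D_E)

text \<open>The inclusion of \<open>Y\<close> and the projection to \<open>X[1]\<close> are closed;
  the other two maps fail to be closed exactly by a term with \<open>f\<close>.\<close>

lemma cone_D:
  assumes "X \<in> ob" "Y \<in> ob" "f \<in> cyc X Y 0"
  shows "D (cn X Y f) * cj X Y = cj X Y * D Y"
    and "D (cn X Y f) * ct X Y = cj X Y * f - ct X Y * D X"
    and "cs X Y * D (cn X Y f) = D Y * cs X Y + f * cp X Y"
    and "cp X Y * D (cn X Y f) = - (D X * cp X Y)"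
proof -
  have e: "cp X Y * ct X Y = one X" "cs X Y * cj X Y = one Y" "cs X Y * ct X Y = 0" "cp X Y * cj X Y = 0"
    and D: "D (cn X Y f) = cj X Y * D Y * cs X Y + cj X Y * f * cp X Y - ct X Y * D X * cp X Y"
    using cone_eqs[OF assms] by auto
  note e' = e e[THEN mult_eq_assoc]
  have o: "D Y * one Y = D Y" "one Y * (D Y * x) = D Y * x" "f * one X = f" "one Y * (f * x) = f * x"
    "D X * one X = D X" "one X * (D X * x) = D X * x" for x
    using assms one_left[OF _ _ hom_D] one_right[OF _ _ hom_D] one_left[OF _ _ cyc_hom] one_right[OF _ _ cyc_hom]
    by (simp_all flip: mult.assoc)
  show "D (cn X Y f) * cj X Y = cj X Y * D Y" "D (cn X Y f) * ct X Y = cj X Y * f - ct X Y * D X"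
    "cs X Y * D (cn X Y f) = D Y * cs X Y + f * cp X Y" "cp X Y * D (cn X Y f) = - (D X * cp X Y)"
    unfolding D by (simp_all add: distrib_left distrib_right left_diff_distrib right_diff_distrib mult.assoc e' o)
qed

section \<open>Acyclic objects and their left orthogonal\<close>

definition acyclic :: "'o \<Rightarrow> bool" where
  "acyclic Z \<longleftrightarrow> Z \<in> ob \<and> (\<forall>k. cyc E Z k \<subseteq> bnd E Z k)"

definition lorth :: "'o \<Rightarrow> bool" where
  "lorth Y \<longleftrightarrow> Y \<in> ob \<and> (\<forall>Z. acyclic Z \<longrightarrow> (\<forall>k. cyc Y Z k \<subseteq> bnd Y Z k))"

text \<open>Bijectivity on the cohomology of the Hom-complexes from \<open>E\<close>: the first
  condition on cocycles is injectivity, the second surjectivity.\<close>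

definition qi :: "'o \<Rightarrow> 'o \<Rightarrow> 'r \<Rightarrow> bool" where
  "qi X Y f \<longleftrightarrow> X \<in> ob \<and> Y \<in> ob \<and> f \<in> cyc X Y 0 \<and>
     (\<forall>k. \<forall>u \<in> cyc E X k. f * u \<in> bnd E Y k \<longrightarrow> u \<in> bnd E X k) \<and>
     (\<forall>k. \<forall>u \<in> cyc E Y k. \<exists>v \<in> cyc E X k. u - f * v \<in> bnd E Y k)"

text \<open>The long exact sequence of the cone, made explicit. The component \<open>cp * u\<close>
  of a cocycle is a cocycle of \<open>X\<close> that becomes a boundary in \<open>Y\<close>, hence
  is some \<open>D X * x'\<close>. Correcting the other component by \<open>f * x'\<close> gives a
  cocycle of \<open>Y\<close>, which comes from \<open>X\<close> up to a boundary.\<close>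

lemma cone_acyclic:
  assumes qi: "qi X Y f" shows "acyclic (cn X Y f)"
proof -
  have ob: "X \<in> ob" "Y \<in> ob" and f: "f \<in> cyc X Y 0" using qi by (auto simp: qi_def)
  let ?C = "cn X Y f" and ?j = "cj X Y" and ?s = "cs X Y" and ?t = "ct X Y" and ?p = "cp X Y"
  have C: "?C \<in> ob" using cn_ob[OF ob f] .
  have j: "?j \<in> hom Y ?C 0" and s: "?s \<in> hom ?C Y 0" and t: "?t \<in> hom X ?C (- 1)" and p: "?p \<in> hom ?C X 1"
    using cone_hom[OF ob f] by auto
  have id: "?j * ?s + ?t * ?p = one ?C" using cone_eqs[OF ob f] by auto
  note cD = cone_D[OF ob f]
  have Df: "D Y * f = f * D X" using f by (simp add: cyc_def sn_simps)
  have "u \<in> bnd E ?C k" if u: "u \<in> cyc E ?C k" for u k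
  proof -
    have uh: "u \<in> hom E ?C k" and Du: "D ?C * u = 0" using u by (auto simp: cyc_E)
    have x: "?p * u \<in> hom E X (k + 1)" and y: "?s * u \<in> hom E Y k"
      using hom_mult[OF E_ob C ob(1) uh p] hom_mult[OF E_ob C ob(2) uh s] by auto
    have Dx: "D X * (?p * u) = 0"
      using mult_eq_assoc[OF cD(4), of u] Du by (simp add: mult.assoc)
    have Dy: "D Y * (?s * u) + f * (?p * u) = 0"
      using mult_eq_assoc[OF cD(3), of u] Du by (simp add: distrib_right mult.assoc)
    then have "f * (?p * u) = D Y * (- (?s * u))" by (simp add: add_eq_0_iff)
    then have "f * (?p * u) \<in> bnd E Y (k + 1)"
      unfolding bnd_E using hom_minus[OF E_ob ob(2) y] by (intro CollectI exI[of _ "- (?s * u)"]) simp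
    then obtain x' where x': "x' \<in> hom E X k" "?p * u = D X * x'"
      using qi x Dx unfolding qi_def cyc_E bnd_E by force
    have "D Y * (?s * u + f * x') = 0"
      using Dy x'(2) mult_eq_assoc[OF Df, of x'] by (simp add: distrib_left mult.assoc)
    moreover have "?s * u + f * x' \<in> hom E Y k"
      using hom_add[OF E_ob ob(2) y] hom_mult[OF E_ob ob x'(1) cyc_hom[OF f]] by simp
    ultimately obtain v y' where v: "v \<in> hom E X k" "D X * v = 0"
      and y': "y' \<in> hom E Y (k - 1)" "?s * u + f * x' - f * v = D Y * y'"
      using qi unfolding qi_def cyc_E bnd_E by blast
    \<comment> \<open>The primitive of \<open>u\<close>: its \<open>Y\<close>-component is
      \<open>y'\<close>, and its \<open>X\<close>-component \<open>v - x'\<close> combines the two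
      corrections.\<close>
    have "?j * y' + ?t * (v - x') \<in> hom E ?C (k - 1)"
      by (rule hom_add[OF E_ob C hom_comp[OF E_ob ob(2) C y'(1) j]
            hom_comp[OF E_ob ob(1) C hom_diff[OF E_ob ob(1) v(1) x'(1)] t]]) auto
    moreover have "D ?C * (?j * y' + ?t * (v - x')) = u"
    proof -
      have "D ?C * (?j * y' + ?t * (v - x'))
          = ?j * (D Y * y' + f * (v - x')) - ?t * (D X * (v - x'))"
        using mult_eq_assoc[OF cD(1), of y'] mult_eq_assoc[OF cD(2), of "v - x'"]
        by (simp add: algebra_simps)
      also have "D Y * y' + f * (v - x') = ?s * u" using y'(2) by (simp add: algebra_simps)
      also have "D X * (v - x') = - (?p * u)" using v(2) x'(2) by (simp add: algebra_simps)
      finally have "D ?C * (?j * y' + ?t * (v - x')) = (?j * ?s + ?t * ?p) * u" by (simp add: algebra_simps)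
      then show ?thesis using id one_left[OF E_ob C uh] by simp
    qed
    ultimately show ?thesis unfolding bnd_E by force
  qed
  then show ?thesis using C by (auto simp: acyclic_def)
qed

lemma lorth_ob: "lorth Y \<Longrightarrow> Y \<in> ob" by (simp add: lorth_def)

lemma lorth_E: "lorth E" by (simp add: lorth_def acyclic_def E_ob)

lemma cyc_sh: "\<lbrakk>X \<in> ob; Y \<in> ob\<rbrakk> \<Longrightarrow> cyc (sh m X) Y k = cyc X Y (k - m)"
  by (auto simp: cyc_def hom_sh_left D_sh sn_def)

lemma cyc_sh_right: "\<lbrakk>X \<in> ob; Y \<in> ob\<rbrakk> \<Longrightarrow> cyc X (sh m Y) k = cyc X Y (k + m)"
  by (auto simp: cyc_def hom_sh_right D_sh sn_def) (metis minus_minus)+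

lemma bnd_sh:
  assumes ob: "X \<in> ob" "Y \<in> ob" shows "bnd (sh m X) Y k = bnd X Y (k - m)"
proof -
  have "hom (sh m X) Y (k - 1) = hom X Y (k - m - 1)"
    using hom_sh_left[OF ob, of m "k - 1"] by (simp add: algebra_simps)
  moreover have "D Y * g + sn k * g * D (sh m X) = D Y * g + sn (k - m) * g * D X" for g
    by (simp add: D_sh[OF ob(1)] sn_def)
  ultimately show ?thesis by (simp add: bnd_def)
qed

text \<open>Shifting the target multiplies its differential by \<open>sn m\<close>, which is
  absorbed by multiplying the primitive by the same sign.\<close>

lemma bnd_sh_right:
  assumes ob: "X \<in> ob" "Y \<in> ob" shows "bnd X (sh m Y) k = bnd X Y (k + m)"
proof -
  have h: "hom X (sh m Y) (k - 1) = hom X Y (k + m - 1)"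
    using hom_sh_right[OF ob, of m "k - 1"] by (simp add: algebra_simps)
  have "D (sh m Y) * g + sn k * g * D X = D Y * (sn m * g) + sn (k + m) * (sn m * g) * D X" for g
    by (simp add: D_sh[OF ob(2)] sn_def)
  moreover have "\<exists>g'. g = sn m * g' \<and> g' \<in> hom X Y l" if "g \<in> hom X Y l" for g l
    using hom_sn[OF ob that, of m] sn_square(2) by metis
  ultimately show ?thesis unfolding bnd_def h using hom_sn[OF ob]
    by (intro equalityI subsetI; clarsimp) (blast, metis)
qed

lemma lorth_sh: "lorth X \<Longrightarrow> lorth (sh m X)"
  by (auto simp: lorth_def acyclic_def sh_ob cyc_sh bnd_sh)

text \<open>\<open>u = u * (one Y - f * g) + (u * f) * g\<close>: the first summand is a boundary
  because \<open>f * g\<close> is homotopic to the identity, the second because \<open>u * f\<close>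
  starts at \<open>X\<close>.\<close>

lemma lorth_heq:
  assumes eq: "heq X Y" and X: "lorth X" shows "lorth Y"
proof -
  obtain f g where ob: "X \<in> ob" "Y \<in> ob" and f: "f \<in> cyc X Y 0" and g: "g \<in> cyc Y X 0"
    and fg: "one Y - f * g \<in> bnd Y Y 0" using eq unfolding heq_def by blast
  have "u \<in> bnd Y Z k" if Z: "acyclic Z" and u: "u \<in> cyc Y Z k" for u Z k
  proof -
    have Zo: "Z \<in> ob" using Z by (simp add: acyclic_def)
    have "u * f \<in> cyc X Z k" using cyc_comp[OF ob Zo f u] by simp
    then have "u * f \<in> bnd X Z k" using X Z by (auto simp: lorth_def)
    then have "u * f * g \<in> bnd Y Z k" using bnd_comp_right[OF ob(2,1) Zo g] by simp
    moreover have "u * (one Y - f * g) \<in> bnd Y Z k" using bnd_comp_left[OF ob(2,2) Zo fg u] by simp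
    ultimately have "u * (one Y - f * g) + u * f * g \<in> bnd Y Z k" by (intro bnd_add ob Zo)
    then show ?thesis using one_right[OF ob(2) Zo cyc_hom[OF u]] by (simp add: algebra_simps)
  qed
  then show ?thesis using ob by (auto simp: lorth_def)
qed

text \<open>The restriction of a cocycle \<open>u\<close> to \<open>Y\<close> is a boundary.
  Extending its primitive by zero to the cone and subtracting the resulting boundary
  \<open>w\<close> leaves a cocycle that vanishes on \<open>Y\<close>; it factors through the
  projection to \<open>X[1]\<close>, where the hypothesis on \<open>X\<close> applies.\<close>

lemma lorth_cone:
  assumes X: "lorth X" and Y: "lorth Y" and f: "f \<in> cyc X Y 0" shows "lorth (cn X Y f)"
proof -
  note ob = lorth_ob[OF X] lorth_ob[OF Y]
  let ?C = "cn X Y f" and ?j = "cj X Y" and ?s = "cs X Y" and ?t = "ct X Y" and ?p = "cp X Y"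
  have C: "?C \<in> ob" using cn_ob[OF ob f] .
  have j: "?j \<in> hom Y ?C 0" and s: "?s \<in> hom ?C Y 0" and t: "?t \<in> hom X ?C (- 1)" and p: "?p \<in> hom ?C X 1"
    using cone_hom[OF ob f] by auto
  have e: "?p * ?t = one X" "?s * ?j = one Y" "?s * ?t = 0" "?p * ?j = 0"
    and id: "?j * ?s + ?t * ?p = one ?C" using cone_eqs[OF ob f] by auto
  note cD = cone_D[OF ob f]
  have jc: "?j \<in> cyc Y ?C 0" using j cD(1) by (simp add: cyc_def sn_simps)
  have pc: "?p \<in> cyc ?C X 1" using p cD(4) by (simp add: cyc_def sn_simps)
  have "u \<in> bnd ?C Z k" if Z: "acyclic Z" and u: "u \<in> cyc ?C Z k" for u Z k
  proof -
    have Zo: "Z \<in> ob" using Z by (simp add: acyclic_def)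
    have "u * ?j \<in> cyc Y Z k" using cyc_comp[OF ob(2) C Zo jc u] by simp
    then have "u * ?j \<in> bnd Y Z k" using Y Z by (auto simp: lorth_def)
    then obtain a where a: "a \<in> hom Y Z (k - 1)" "u * ?j = D Z * a + sn k * a * D Y"
      unfolding bnd_def by blast
    define w where "w = D Z * (a * ?s) + sn k * (a * ?s) * D ?C"
    have w: "w \<in> bnd ?C Z k"
      unfolding w_def bnd_def using hom_comp[OF C ob(2) Zo s a(1)] by auto
    have wj: "w * ?j = u * ?j"
    proof -
      have "a * (?s * (?j * x)) = a * x" for x
        using one_right[OF ob(2) Zo a(1)] e(2) by (metis mult.assoc)
      moreover have "a * (?s * ?j) = a" using one_right[OF ob(2) Zo a(1)] e(2) by simp
      ultimately show ?thesis unfolding w_def a(2) using cD(1) by (simp add: distrib_right mult.assoc)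
    qed
    have u': "u - w \<in> cyc ?C Z k" using cyc_diff[OF C Zo u bnd_cyc[OF C Zo w]] .
    have u't: "u - w = (u - w) * ?t * ?p"
    proof -
      have "u - w = (u - w) * (?j * ?s + ?t * ?p)" using one_right[OF C Zo cyc_hom[OF u']] id by simp
      also have "\<dots> = (u - w) * ?j * ?s + (u - w) * ?t * ?p" by (simp add: distrib_left mult.assoc)
      finally show ?thesis using wj by (simp add: algebra_simps)
    qed
    \<comment> \<open>The differential of \<open>?t\<close> has a term with \<open>?j * f\<close>,
      which disappears because \<open>u - w\<close> vanishes on \<open>?j\<close>.\<close>
    have "(u - w) * ?t \<in> cyc X Z (k - 1)"
    proof -
      have "D Z * ((u - w) * ?t) = sn k * ((u - w) * (D ?C * ?t))"
        using u' by (simp add: cyc_def mult.assoc mult_eq_assoc[of "D Z"])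
      also have "(u - w) * (D ?C * ?t) = (u - w) * ?j * f - (u - w) * ?t * D X"
        unfolding cD(2) by (simp add: right_diff_distrib mult.assoc)
      also have "(u - w) * ?j = 0" using wj by (simp add: left_diff_distrib)
      finally have "D Z * ((u - w) * ?t) = sn (k - 1) * ((u - w) * ?t) * D X"
        by (simp add: sn_def mult.assoc)
      then show ?thesis using hom_comp[OF ob(1) C Zo t cyc_hom[OF u']] by (simp add: cyc_def)
    qed
    then have "(u - w) * ?t \<in> bnd X Z (k - 1)" using X Z by (auto simp: lorth_def)
    then have "(u - w) * ?t * ?p \<in> bnd ?C Z k" 
      by (intro bnd_comp_right[OF C ob(1) Zo pc]) auto
    then have "u - w \<in> bnd ?C Z k" using u't by simp
    then show ?thesis using bnd_add[OF C Zo _ w, of "u - w"] by simp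
  qed
  then show ?thesis using C by (auto simp: lorth_def)
qed

lemma lorth_zero:
  assumes "Z \<in> ob" "one Z = 0" shows "lorth Z"
proof -
  have "u \<in> bnd Z W k" if "acyclic W" "u \<in> cyc Z W k" for u W k
    using one_right[of Z W u k] that assms cyc_hom bnd_0 by (simp add: acyclic_def)
  then show ?thesis using assms by (auto simp: lorth_def)
qed

text \<open>A quasi-isomorphism has an acyclic cone, hence induces bijections on the morphisms from an
  object in the left orthogonal.\<close>

lemma qi_surj:
  assumes qi: "qi X Y f" and W: "lorth W" and u: "u \<in> cyc W Y 0"
  shows "\<exists>v \<in> cyc W X 0. u - f * v \<in> bnd W Y 0"
proof -
  have ob: "X \<in> ob" "Y \<in> ob" and f: "f \<in> cyc X Y 0" using qi by (auto simp: qi_def)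
  note Wo = lorth_ob[OF W]
  let ?C = "cn X Y f" and ?j = "cj X Y" and ?s = "cs X Y" and ?p = "cp X Y"
  have C: "?C \<in> ob" using cn_ob[OF ob f] .
  have j: "?j \<in> hom Y ?C 0" and s: "?s \<in> hom ?C Y 0" and p: "?p \<in> hom ?C X 1"
    using cone_hom[OF ob f] by auto
  have e: "?s * ?j = one Y" "?p * ?j = 0" using cone_eqs[OF ob f] by auto
  note cD = cone_D[OF ob f]
  have jc: "?j \<in> cyc Y ?C 0" using j cD(1) by (simp add: cyc_def sn_simps)
  have "?j * u \<in> cyc W ?C 0" using cyc_comp[OF Wo ob(2) C u jc] by simp
  then have "?j * u \<in> bnd W ?C 0" using W cone_acyclic[OF qi] by (auto simp: lorth_def)
  then obtain h where h: "h \<in> hom W ?C (- 1)" "?j * u = D ?C * h + h * D W"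
    unfolding bnd_def by (auto simp: sn_simps)
  \<comment> \<open>The null-homotopy \<open>h\<close> of \<open>?j * u\<close> carries both
    answers: its \<open>X\<close>-component is the lift of \<open>u\<close>, its
    \<open>Y\<close>-component the homotopy between \<open>u\<close> and the image of the
    lift.\<close>
  have v: "?p * h \<in> hom W X 0" using hom_comp[OF Wo C ob(1) h(1) p] by simp
  have sh: "?s * h \<in> hom W Y (- 1)" using hom_comp[OF Wo C ob(2) h(1) s] by simp
  have "?p * (?j * u) = - (D X * (?p * h)) + ?p * h * D W"
    unfolding h(2) using mult_eq_assoc[OF cD(4), of h] by (simp add: distrib_left mult.assoc)
  then have "D X * (?p * h) = ?p * h * D W" using mult_eq_assoc[OF e(2), of u] by (simp add: add_eq_0_iff)
  then have "?p * h \<in> cyc W X 0" using v by (simp add: cyc_def sn_simps)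
  moreover have "?s * (?j * u) = D Y * (?s * h) + f * (?p * h) + ?s * h * D W"
    unfolding h(2) using mult_eq_assoc[OF cD(3), of h] by (simp add: distrib_left distrib_right mult.assoc)
  then have "u - f * (?p * h) = D Y * (?s * h) + sn 0 * (?s * h) * D W"
    using mult_eq_assoc[OF e(1), of u] one_left[OF Wo ob(2) cyc_hom[OF u]] by (simp add: sn_simps)
  then have "u - f * (?p * h) \<in> bnd W Y 0" unfolding bnd_def using sh by auto
  ultimately show ?thesis by blast
qed

text \<open>A primitive \<open>h\<close> of \<open>f * v\<close> makes
  \<open>ct * v - cj * h\<close> a cocycle of degree -1 with values in the acyclic cone; the
  \<open>X\<close>-component of a primitive of this cocycle bounds \<open>v\<close> up to
  sign.\<close>

lemma qi_inj:
  assumes qi: "qi X Y f" and W: "lorth W" and v: "v \<in> cyc W X 0" and fv: "f * v \<in> bnd W Y 0"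
  shows "v \<in> bnd W X 0"
proof -
  have ob: "X \<in> ob" "Y \<in> ob" and f: "f \<in> cyc X Y 0" using qi by (auto simp: qi_def)
  note Wo = lorth_ob[OF W]
  let ?C = "cn X Y f" and ?j = "cj X Y" and ?t = "ct X Y" and ?p = "cp X Y"
  have C: "?C \<in> ob" using cn_ob[OF ob f] .
  have j: "?j \<in> hom Y ?C 0" and t: "?t \<in> hom X ?C (- 1)" and p: "?p \<in> hom ?C X 1"
    using cone_hom[OF ob f] by auto
  have e: "?p * ?t = one X" "?p * ?j = 0" using cone_eqs[OF ob f] by auto
  note cD = cone_D[OF ob f]
  obtain h where h: "h \<in> hom W Y (- 1)" "f * v = D Y * h + h * D W"
    using fv unfolding bnd_def by (auto simp: sn_simps)
  define w where "w = ?t * v - ?j * h"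
  have wh: "w \<in> hom W ?C (- 1)" unfolding w_def
    using hom_comp[OF Wo ob(1) C cyc_hom[OF v] t] hom_comp[OF Wo ob(2) C h(1) j] by (intro hom_diff Wo C) auto
  have Dv: "D X * v = v * D W" using v by (simp add: cyc_def sn_simps)
  have "D ?C * w = ?j * (f * v) - ?t * (D X * v) - ?j * (D Y * h)"
    unfolding w_def using mult_eq_assoc[OF cD(1), of h] mult_eq_assoc[OF cD(2), of v]
    by (simp add: algebra_simps)
  also have "\<dots> = - (w * D W)" unfolding h(2) Dv w_def by (simp add: algebra_simps)
  finally have "w \<in> cyc W ?C (- 1)" using wh by (simp add: cyc_def sn_simps)
  then have "w \<in> bnd W ?C (- 1)" using W cone_acyclic[OF qi] by (auto simp: lorth_def)
  then obtain k where k: "k \<in> hom W ?C (- 2)" "w = D ?C * k - k * D W"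
    unfolding bnd_def by (auto simp: sn_simps)
  have "?p * w = v" unfolding w_def using mult_eq_assoc[OF e(1), of v] mult_eq_assoc[OF e(2), of h]
      one_left[OF Wo ob(1) cyc_hom[OF v]] by (simp add: right_diff_distrib)
  moreover have "?p * w = D X * (- (?p * k)) + sn 0 * (- (?p * k)) * D W"
    unfolding k(2) using mult_eq_assoc[OF cD(4), of k] by (simp add: right_diff_distrib mult.assoc sn_simps)
  moreover have "- (?p * k) \<in> hom W X (0 - 1)" using hom_comp[OF Wo C ob(1) k(1) p] by (intro hom_minus Wo ob) simp
  ultimately have "v = D X * (- (?p * k)) + sn 0 * (- (?p * k)) * D W" "- (?p * k) \<in> hom W X (0 - 1)"
    by simp_all
  then show ?thesis unfolding bnd_def by blast
qed

text \<open>Surjectivity applied to the identity of \<open>Y\<close> gives \<open>g\<close> with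
  \<open>f * g\<close> homotopic to the identity. Then
  \<open>f * (one X - g * f) = (one Y - f * g) * f\<close> is a boundary, and injectivity yields the
  other homotopy.\<close>

lemma qi_heq:
  assumes qi: "qi X Y f" and X: "lorth X" and Y: "lorth Y"
  shows "\<exists>g \<in> cyc Y X 0. one X - g * f \<in> bnd X X 0 \<and> one Y - f * g \<in> bnd Y Y 0"
proof -
  note ob = lorth_ob[OF X] lorth_ob[OF Y]
  have f: "f \<in> cyc X Y 0" using qi by (simp add: qi_def)
  obtain g where g: "g \<in> cyc Y X 0" "one Y - f * g \<in> bnd Y Y 0"
    using qi_surj[OF qi Y cyc_one[OF ob(2)]] by blast
  have "one X - g * f \<in> cyc X X 0"
    using cyc_diff[OF ob(1,1) cyc_one[OF ob(1)]] cyc_comp[OF ob ob(1) f g(1)] by simp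
  moreover have "f * (one X - g * f) = (one Y - f * g) * f"
    using one_left[OF ob cyc_hom[OF f]] one_right[OF ob cyc_hom[OF f]] by (simp add: algebra_simps)
  then have "f * (one X - g * f) \<in> bnd X Y 0" using bnd_comp_right[OF ob ob(2) f g(2)] by simp
  ultimately show ?thesis using qi_inj[OF qi X] g by blast
qed

end

context dg_ops
begin

section \<open>Objects with coordinates\<close>

text \<open>
  \<open>rz Z \<iota> \<pi> A q\<close>: the object \<open>Z\<close> is the sum of shifts of \<open>E\<close> indexed by \<open>A\<close>, the first component of
  an index being the degree, with inclusions \<open>\<iota>\<close>, projections \<open>\<pi>\<close> and scalar twisting matrix \<open>q\<close>.
\<close>

definition rz :: "'o \<Rightarrow> (int \<times> nat \<Rightarrow> 'r) \<Rightarrow> (int \<times> nat \<Rightarrow> 'r) \<Rightarrow> (int \<times> nat) set \<Rightarrow>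
    (int \<times> nat \<Rightarrow> int \<times> nat \<Rightarrow> complex) \<Rightarrow> bool" where
  "rz Z \<iota> \<pi> A q \<longleftrightarrow> Z \<in> ob \<and> finite A \<and>
     (\<forall>a \<in> A. \<iota> a \<in> hom E Z (fst a) \<and> \<pi> a \<in> hom Z E (- fst a)) \<and>
     (\<forall>a \<in> A. \<forall>b \<in> A. \<pi> a * \<iota> b = (if a = b then one E else 0)) \<and>
     (\<Sum>a\<in>A. \<iota> a * \<pi> a) = one Z \<and>
     (\<forall>b \<in> A. D Z * \<iota> b = (\<Sum>a\<in>A. sc (q a b) * \<iota> a))"

definition graded :: "int \<Rightarrow> (int \<times> nat) set \<Rightarrow> (int \<times> nat) set \<Rightarrow>
    (int \<times> nat \<Rightarrow> int \<times> nat \<Rightarrow> complex) \<Rightarrow> bool" where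
  "graded k A B m \<longleftrightarrow> (\<forall>a \<in> A. \<forall>b \<in> B. m a b \<noteq> 0 \<longrightarrow> fst a = fst b + k)"

lemma sc_hom: "\<lbrakk>X \<in> ob; Y \<in> ob; c \<noteq> 0 \<Longrightarrow> f \<in> hom X Y k\<rbrakk> \<Longrightarrow> sc c * f \<in> hom X Y k"
  by (cases "c = 0") (simp_all add: sc_0 hom_0 hom_sc)

text \<open>The summands are attached in order of decreasing degree. A summand of lowest degree
  receives nothing from the others, so attaching it means forming the cone of a map from a shift of
  \<open>E\<close>, given by its column of \<open>q\<close>. As only cones of shifts of
  \<open>E\<close> occur, membership in the left orthogonal comes along.\<close>

lemma rz_exists:
  assumes "finite A" "graded 1 A A q" "\<forall>a \<in> A. \<forall>c \<in> A. (\<Sum>b\<in>A. q a b * q b c) = 0"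
  shows "\<exists>Z \<iota> \<pi>. rz Z \<iota> \<pi> A q \<and> lorth Z"
  using assms
proof (induction A rule: finite_ranking_induct[where f = "\<lambda>a. - fst a"])
  case empty
  obtain Z where "Z \<in> ob" "one Z = 0" using zero_ob by blast
  then show ?case using lorth_zero by (auto simp: rz_def)
next
  case (insert b S)
  show ?case
  proof (cases "b \<in> S")
    case True
    then show ?thesis using insert by (simp add: insert_absorb)
  next
    case False
    have gr: "graded 1 S S q" using insert.prems(1) by (auto simp: graded_def)
    have qb: "q b c = 0" if "c \<in> insert b S" for c
      using insert.prems(1) insert.hyps(2)[of c] that by (force simp: graded_def)
    have sum: "(\<Sum>x\<in>S. q a x * q x c) = 0" if "a \<in> S" "c \<in> insert b S" for a c
      using insert.prems(2)[rule_format, of a c] that qb[of c] insert.hyps(1) False by simp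
    obtain Z \<iota> \<pi> where rz: "rz Z \<iota> \<pi> S q" and Zl: "lorth Z" using insert.IH[OF gr] sum by auto
    have Z: "Z \<in> ob" and \<iota>: "\<And>a. a \<in> S \<Longrightarrow> \<iota> a \<in> hom E Z (fst a)"
      and \<pi>: "\<And>a. a \<in> S \<Longrightarrow> \<pi> a \<in> hom Z E (- fst a)"
      and \<pi>\<iota>: "\<And>a b. a \<in> S \<Longrightarrow> b \<in> S \<Longrightarrow> \<pi> a * \<iota> b = (if a = b then one E else 0)"
      and id: "(\<Sum>a\<in>S. \<iota> a * \<pi> a) = one Z"
      and DZ: "\<And>b. b \<in> S \<Longrightarrow> D Z * \<iota> b = (\<Sum>a\<in>S. sc (q a b) * \<iota> a)"
      using rz unfolding rz_def by auto
    \<comment> \<open>The shift for which the column \<open>f\<close>, of degree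
      \<open>fst b + 1\<close> on \<open>E\<close>, has degree 0 on \<open>X\<close>, and for which
      \<open>ct\<close>, of degree -1 on \<open>X\<close>, has degree \<open>fst b\<close> on
      \<open>E\<close>.\<close>
    define X where "X = sh (- fst b - 1) E"
    define f where "f = (\<Sum>a\<in>S. sc (q a b) * \<iota> a)"
    have X: "X \<in> ob" and Xl: "lorth X" and oneX: "one X = one E" and DX: "D X = 0"
      unfolding X_def using sh_ob E_ob lorth_sh lorth_E one_sh D_sh D_E by auto
    have fh: "f \<in> hom E Z (fst b + 1)"
      unfolding f_def
    proof (intro hom_sum sc_hom E_ob Z)
      fix a assume "a \<in> S" "q a b \<noteq> 0"
      then show "\<iota> a \<in> hom E Z (fst b + 1)"
        using \<iota>[of a] insert.prems(1) unfolding graded_def by (metis insertCI)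
    qed
    have sc_sc: "sc u * (sc v * w) = sc (v * u) * w" for u v w
      by (simp add: mult.commute[of v u] sc_mult mult.assoc)
    \<comment> \<open>\<open>f\<close> is closed because column \<open>b\<close> of the square of
      \<open>q\<close> vanishes.\<close>
    have "D Z * f = (\<Sum>a\<in>S. sc (q a b) * (\<Sum>c\<in>S. sc (q c a) * \<iota> c))"
      unfolding f_def sum_distrib_left
      by (intro sum.cong refl) (simp only: sc_left_comm[of "D Z"] DZ sum_distrib_left)
    also have "\<dots> = (\<Sum>a\<in>S. \<Sum>c\<in>S. sc (q c a * q a b) * \<iota> c)"
      by (simp add: sum_distrib_left sc_sc)
    also have "\<dots> = (\<Sum>c\<in>S. \<Sum>a\<in>S. sc (q c a * q a b) * \<iota> c)"
      by (rule sum.swap)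
    also have "\<dots> = (\<Sum>c\<in>S. sc (\<Sum>a\<in>S. q c a * q a b) * \<iota> c)"
    proof -
      have "sc (\<Sum>a\<in>T. g a) = (\<Sum>a\<in>T. sc (g a))" for g :: "int \<times> nat \<Rightarrow> complex" and T
        by (induction T rule: infinite_finite_induct) (auto simp: sc_0 sc_add)
      then show ?thesis by (simp add: sum_distrib_right)
    qed
    also have "\<dots> = 0" using sum by (simp add: sc_0)
    finally have f: "f \<in> cyc X Z 0"
      using fh hom_sh_left[OF E_ob Z] DX by (simp add: cyc_def X_def add.commute)
    let ?C = "cn X Z f" and ?j = "cj X Z" and ?s = "cs X Z" and ?t = "ct X Z" and ?p = "cp X Z"
    have C: "?C \<in> ob" using cn_ob[OF X Z f] .
    have j: "?j \<in> hom Z ?C 0" and s: "?s \<in> hom ?C Z 0" and t: "?t \<in> hom X ?C (- 1)" and p: "?p \<in> hom ?C X 1"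
      using cone_hom[OF X Z f] by auto
    have e: "?p * ?t = one E" "?s * ?j = one Z" "?s * ?t = 0" "?p * ?j = 0"
      and idC: "?j * ?s + ?t * ?p = one ?C" using cone_eqs[OF X Z f] oneX by auto
    have t': "?t \<in> hom E ?C (fst b)" using t hom_sh_left[OF E_ob C] by (simp add: X_def)
    have p': "?p \<in> hom ?C E (- fst b)" using p hom_sh_right[OF C E_ob] by (simp add: X_def)
    note cD = cone_D[OF X Z f]
    define \<iota>' where "\<iota>' a = (if a = b then ?t else ?j * \<iota> a)" for a
    define \<pi>' where "\<pi>' a = (if a = b then ?p else \<pi> a * ?s)" for a
    have S: "\<iota>' a = ?j * \<iota> a" "\<pi>' a = \<pi> a * ?s" if "a \<in> S" for a
      using that False by (auto simp: \<iota>'_def \<pi>'_def)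
    have B: "\<iota>' b = ?t" "\<pi>' b = ?p" by (auto simp: \<iota>'_def \<pi>'_def)
    have sj: "?s * (?j * \<iota> a) = \<iota> a" if "a \<in> S" for a
      using mult_eq_assoc[OF e(2)] one_left[OF E_ob Z \<iota>[OF that]] by simp
    have "rz ?C \<iota>' \<pi>' (insert b S) q"
      unfolding rz_def
    proof (intro conjI ballI)
      fix a assume a: "a \<in> insert b S"
      show "\<iota>' a \<in> hom E ?C (fst a)"
        using a t' S(1)[of a] B hom_comp[OF E_ob Z C \<iota>[of a] j, of "fst a"] by (cases "a = b") simp_all
      show "\<pi>' a \<in> hom ?C E (- fst a)"
        using a p' S(2)[of a] B hom_comp[OF C Z E_ob s \<pi>[of a], of "- fst a"] by (cases "a = b") simp_all
      fix c assume c: "c \<in> insert b S"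
      show "\<pi>' a * \<iota>' c = (if a = c then one E else 0)"
        using a c False S(2)[of a] S(1)[of c] B e \<pi>\<iota>[of a c] sj[of c] mult_eq_assoc[OF e(4), of "\<iota> c"]
        by (cases "a = b"; cases "c = b") (simp_all add: mult.assoc)
    next
      have "(\<Sum>a\<in>S. \<iota>' a * \<pi>' a) = ?j * (\<Sum>a\<in>S. \<iota> a * \<pi> a) * ?s"
        using S by (simp add: sum_distrib_left sum_distrib_right mult.assoc)
      then show "(\<Sum>a\<in>insert b S. \<iota>' a * \<pi>' a) = one ?C"
        using id idC insert.hyps(1) False B one_right[OF Z C j] by (simp add: add.commute)
    next
      fix c assume c: "c \<in> insert b S"
      have "D ?C * \<iota>' c = (\<Sum>a\<in>S. sc (q a c) * (?j * \<iota> a))"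
      proof (cases "c = b")
        case True
        then show ?thesis using cD(2) DX by (simp add: B f_def sum_distrib_left sc_left_comm)
      next
        case False
        then have "D ?C * \<iota>' c = ?j * (D Z * \<iota> c)" using c S mult_eq_assoc[OF cD(1)] by (simp add: mult.assoc)
        then show ?thesis using DZ c False by (simp add: sum_distrib_left sc_left_comm)
      qed
      then show "D ?C * \<iota>' c = (\<Sum>a\<in>insert b S. sc (q a c) * \<iota>' a)"
        using S insert.hyps(1) False qb[OF c] by (simp add: sc_0)
    qed (use C insert.hyps(1) in auto)
    then show ?thesis using lorth_cone[OF Xl Zl f] by blast
  qed
qed

subsection \<open>Morphisms as matrices\<close>

definition mo :: "(int \<times> nat \<Rightarrow> 'r) \<Rightarrow> (int \<times> nat) set \<Rightarrow> (int \<times> nat \<Rightarrow> 'r) \<Rightarrow> (int \<times> nat) set \<Rightarrow>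
    (int \<times> nat \<Rightarrow> int \<times> nat \<Rightarrow> complex) \<Rightarrow> 'r" where
  "mo \<iota> A \<pi> B m = (\<Sum>a\<in>A. \<Sum>b\<in>B. sc (m a b) * (\<iota> a * \<pi> b))"

lemma rzD:
  assumes "rz Z \<iota> \<pi> A q"
  shows "Z \<in> ob" "finite A" "\<And>a. a \<in> A \<Longrightarrow> \<iota> a \<in> hom E Z (fst a)"
    "\<And>a. a \<in> A \<Longrightarrow> \<pi> a \<in> hom Z E (- fst a)"
    "\<And>a b. a \<in> A \<Longrightarrow> b \<in> A \<Longrightarrow> \<pi> a * \<iota> b = (if a = b then one E else 0)"
    "(\<Sum>a\<in>A. \<iota> a * \<pi> a) = one Z" "\<And>b. b \<in> A \<Longrightarrow> D Z * \<iota> b = (\<Sum>a\<in>A. sc (q a b) * \<iota> a)"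
  using assms unfolding rz_def by auto

lemma sc_sum: "sc (\<Sum>a\<in>T. g a) = (\<Sum>a\<in>T. sc (g a))"
  by (induction T rule: infinite_finite_induct) (auto simp: sc_0 sc_add)

lemma mo_cong: "(\<And>a b. a \<in> A \<Longrightarrow> b \<in> B \<Longrightarrow> m a b = m' a b) \<Longrightarrow> mo \<iota> A \<pi> B m = mo \<iota> A \<pi> B m'"
  by (auto simp: mo_def intro!: sum.cong)

lemma mo_add: "mo \<iota> A \<pi> B (\<lambda>a b. m a b + m' a b) = mo \<iota> A \<pi> B m + mo \<iota> A \<pi> B m'"
  by (simp add: mo_def sc_add distrib_right sum.distrib)

lemma mo_diff: "mo \<iota> A \<pi> B (\<lambda>a b. m a b - m' a b) = mo \<iota> A \<pi> B m - mo \<iota> A \<pi> B m'"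
  by (simp add: mo_def sc_diff left_diff_distrib sum_subtractf)

lemma mo_sc: "mo \<iota> A \<pi> B (\<lambda>a b. c * m a b) = sc c * mo \<iota> A \<pi> B m"
  by (simp add: mo_def sc_mult sum_distrib_left mult.assoc)

lemma mo_hom:
  assumes Z: "rz Z \<iota> \<pi> A q" and Z': "rz Z' \<iota>' \<pi>' A' q'" and m: "graded k A' A m"
  shows "mo \<iota>' A' \<pi> A m \<in> hom Z Z' k"
  unfolding mo_def
proof (intro hom_sum sc_hom rzD(1)[OF Z] rzD(1)[OF Z'])
  fix a b assume a: "a \<in> A'" "b \<in> A" and "m a b \<noteq> 0"
  then have "fst a = fst b + k" using m by (auto simp: graded_def)
  then show "\<iota>' a * \<pi> b \<in> hom Z Z' k"
    by (intro hom_comp[OF rzD(1)[OF Z] E_ob rzD(1)[OF Z'] rzD(4)[OF Z a(2)] rzD(3)[OF Z' a(1)]]) simp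
qed

text \<open>Only terms with equal inner indices survive, since \<open>\<pi> b * \<iota> b'\<close>
  is the identity of \<open>E\<close> or zero.\<close>

lemma mo_comp:
  assumes Z: "rz Z \<iota> \<pi> A q" and Z': "rz Z' \<iota>' \<pi>' A' q'"
  shows "mo \<iota>' A' \<pi> A m' * mo \<iota> A \<pi>'' B m = mo \<iota>' A' \<pi>'' B (\<lambda>a c. \<Sum>b\<in>A. m' a b * m b c)"
proof -
  have key: "sc x * (\<iota>' a * \<pi> b) * (sc y * (\<iota> b' * \<pi>'' c)) = (if b' = b then sc (x * y) * (\<iota>' a * \<pi>'' c) else 0)"
    if "a \<in> A'" "b \<in> A" "b' \<in> A" for a b b' c x y
  proof -
    have "sc x * (\<iota>' a * \<pi> b) * (sc y * (\<iota> b' * \<pi>'' c)) = sc (x * y) * (\<iota>' a * (\<pi> b * \<iota> b') * \<pi>'' c)"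
      using sc_left_comm[of "\<iota>' a * \<pi> b" y "\<iota> b' * \<pi>'' c"] by (simp add: mult.assoc sc_mult)
    then show ?thesis
      using rzD(5)[OF Z that(2,3)] one_right[OF E_ob rzD(1)[OF Z'] rzD(3)[OF Z' that(1)]] by simp
  qed
  have "mo \<iota>' A' \<pi> A m' * mo \<iota> A \<pi>'' B m
      = (\<Sum>a\<in>A'. \<Sum>b\<in>A. \<Sum>b'\<in>A. \<Sum>c\<in>B. sc (m' a b) * (\<iota>' a * \<pi> b) * (sc (m b' c) * (\<iota> b' * \<pi>'' c)))"
    by (simp only: mo_def sum_distrib_right, simp only: sum_distrib_left)
  also have "\<dots> = (\<Sum>a\<in>A'. \<Sum>b\<in>A. \<Sum>b'\<in>A. if b' = b then \<Sum>c\<in>B. sc (m' a b * m b c) * (\<iota>' a * \<pi>'' c) else 0)"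
  proof (intro sum.cong refl)
    fix a b b' assume "a \<in> A'" "b \<in> A" "b' \<in> A"
    then show "(\<Sum>c\<in>B. sc (m' a b) * (\<iota>' a * \<pi> b) * (sc (m b' c) * (\<iota> b' * \<pi>'' c)))
        = (if b' = b then \<Sum>c\<in>B. sc (m' a b * m b c) * (\<iota>' a * \<pi>'' c) else 0)"
      using key by simp
  qed
  also have "\<dots> = (\<Sum>a\<in>A'. \<Sum>c\<in>B. \<Sum>b\<in>A. sc (m' a b * m b c) * (\<iota>' a * \<pi>'' c))"
    using rzD(2)[OF Z] by (simp add: sum.swap[of _ A B])
  finally show ?thesis by (simp add: mo_def sc_sum sum_distrib_right)
qed

lemma mo_entry:
  assumes Z: "rz Z \<iota> \<pi> A q" and Z': "rz Z' \<iota>' \<pi>' A' q'" and a: "a \<in> A'" and b: "b \<in> A"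
  shows "\<pi>' a * mo \<iota>' A' \<pi> A m * \<iota> b = sc (m a b) * one E"
proof -
  have key: "\<pi>' a * (sc x * (\<iota>' a' * \<pi> b')) * \<iota> b = (if a' = a \<and> b' = b then sc x * one E else 0)"
    if "a' \<in> A'" "b' \<in> A" for a' b' x
  proof -
    have "\<pi>' a * (sc x * (\<iota>' a' * \<pi> b')) * \<iota> b = sc x * ((\<pi>' a * \<iota>' a') * (\<pi> b' * \<iota> b))"
      by (simp add: mult.assoc sc_left_comm)
    then show ?thesis using rzD(5)[OF Z that(2) b] rzD(5)[OF Z' a that(1)]
        one_left[OF E_ob E_ob hom_one[OF E_ob]] by auto
  qed
  have "\<pi>' a * mo \<iota>' A' \<pi> A m * \<iota> b = (\<Sum>a'\<in>A'. \<Sum>b'\<in>A. if a' = a \<and> b' = b then sc (m a' b') * one E else 0)"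
    using key by (auto simp: mo_def sum_distrib_left sum_distrib_right intro!: sum.cong)
  also have "\<dots> = (\<Sum>a'\<in>A'. if a' = a then sc (m a' b) * one E else 0)"
    using rzD(2)[OF Z] b by (intro sum.cong refl) auto
  also have "\<dots> = sc (m a b) * one E" using rzD(2)[OF Z'] a by simp
  finally show ?thesis .
qed

lemma mo_inj:
  assumes "rz Z \<iota> \<pi> A q" "rz Z' \<iota>' \<pi>' A' q'" and eq: "mo \<iota>' A' \<pi> A m = mo \<iota>' A' \<pi> A m'" and a: "a \<in> A'" "b \<in> A"
  shows "m a b = m' a b"
proof -
  have "sc (m a b - m' a b) * one E = 0"
    using mo_entry[OF assms(1,2) a, of m] mo_entry[OF assms(1,2) a, of m'] eq
    by (simp add: sc_diff left_diff_distrib)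
  then show ?thesis using sc_one_E by fastforce
qed

text \<open>Inserting the two decompositions of the identity reduces \<open>F\<close> to its
  entries. These are endomorphisms of \<open>E\<close> of some degree, hence scalars in degree 0 and
  zero otherwise.\<close>

lemma mo_surj:
  assumes Z: "rz Z \<iota> \<pi> A q" and Z': "rz Z' \<iota>' \<pi>' A' q'" and F: "F \<in> hom Z Z' k"
  shows "\<exists>m. graded k A' A m \<and> F = mo \<iota>' A' \<pi> A m"
proof -
  note ob = rzD(1)[OF Z] rzD(1)[OF Z']
  have h: "\<pi>' a * F * \<iota> b \<in> hom E E (fst b + k - fst a)" if "a \<in> A'" "b \<in> A" for a b
    by (rule hom_comp[OF E_ob ob(1) E_ob rzD(3)[OF Z that(2)] hom_comp[OF ob E_ob F rzD(4)[OF Z' that(1)] refl]])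
      simp
  have "\<exists>c. \<pi>' a * F * \<iota> b = sc c * one E \<and> (c \<noteq> 0 \<longrightarrow> fst a = fst b + k)" if "a \<in> A'" "b \<in> A" for a b
  proof (cases "fst b + k - fst a = 0")
    case True
    then show ?thesis using h[OF that] hom_EE0 by auto
  next
    case False
    then have "\<pi>' a * F * \<iota> b = 0" using h[OF that] hom_EE by auto
    then show ?thesis by (intro exI[of _ 0]) (simp add: sc_0)
  qed
  then obtain m where m: "\<And>a b. a \<in> A' \<Longrightarrow> b \<in> A \<Longrightarrow> \<pi>' a * F * \<iota> b = sc (m a b) * one E"
    "\<And>a b. a \<in> A' \<Longrightarrow> b \<in> A \<Longrightarrow> m a b \<noteq> 0 \<longrightarrow> fst a = fst b + k" by metis
  have "F = one Z' * F * one Z" using one_left[OF ob F] one_right[OF ob F] by simp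
  also have "\<dots> = (\<Sum>a\<in>A'. \<Sum>b\<in>A. \<iota>' a * (\<pi>' a * F * \<iota> b) * \<pi> b)"
    unfolding rzD(6)[OF Z, symmetric] rzD(6)[OF Z', symmetric] sum_distrib_left sum_distrib_right
    by (subst sum.swap) (simp add: mult.assoc)
  also have "\<dots> = mo \<iota>' A' \<pi> A m"
    unfolding mo_def using m(1) one_right[OF E_ob ob(2) rzD(3)[OF Z']]
    by (intro sum.cong refl) (simp add: sc_left_comm mult.assoc flip: mult.assoc[of _ "one E"])
  finally show ?thesis using m(2) unfolding graded_def by blast
qed

lemma mo_one:
  assumes Z: "rz Z \<iota> \<pi> A q" shows "mo \<iota> A \<pi> A (\<lambda>a b. if a = b then 1 else 0) = one Z"
proof -
  have "mo \<iota> A \<pi> A (\<lambda>a b. if a = b then 1 else 0) = (\<Sum>a\<in>A. \<Sum>b\<in>A. if a = b then \<iota> a * \<pi> b else 0)"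
    unfolding mo_def by (intro sum.cong refl) (auto simp: sc_0 sc_1)
  then show ?thesis using rzD(2,6)[OF Z] by simp
qed

lemma mo_D:
  assumes Z: "rz Z \<iota> \<pi> A q" shows "mo \<iota> A \<pi> A q = D Z"
proof -
  have "D Z = D Z * one Z" using one_right[OF rzD(1)[OF Z] rzD(1)[OF Z] hom_D[OF rzD(1)[OF Z]]] by simp
  also have "\<dots> = (\<Sum>b\<in>A. D Z * \<iota> b * \<pi> b)"
    unfolding rzD(6)[OF Z, symmetric] by (simp add: sum_distrib_left mult.assoc)
  also have "\<dots> = (\<Sum>b\<in>A. \<Sum>a\<in>A. sc (q a b) * (\<iota> a * \<pi> b))"
    using rzD(7)[OF Z] by (simp add: sum_distrib_right mult.assoc)
  also have "\<dots> = mo \<iota> A \<pi> A q" unfolding mo_def by (rule sum.swap)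
  finally show ?thesis by simp
qed

text \<open>The identity matrix, read in the two coordinate systems, is a strict
  isomorphism.\<close>

lemma rz_heq:
  assumes Z: "rz Z \<iota> \<pi> A q" and Z': "rz Z' \<iota>' \<pi>' A q"
  shows "heq Z Z'"
proof -
  let ?d = "\<lambda>a b. if a = b then 1 else 0 :: complex"
  have g: "graded 0 A A ?d" by (auto simp: graded_def)
  have fin: "finite A" using rzD(2)[OF Z] .
  have l: "(\<Sum>b\<in>A. ?d a b * m b c) = m a c" if "a \<in> A" for a c and m :: "int \<times> nat \<Rightarrow> int \<times> nat \<Rightarrow> complex"
    using fin that sum.delta'[OF fin, of a "\<lambda>b. m b c"] by (simp add: if_distrib[of "\<lambda>x. x * _"] cong: if_cong)
  have r: "(\<Sum>b\<in>A. m a b * ?d b c) = m a c" if "c \<in> A" for a c and m :: "int \<times> nat \<Rightarrow> int \<times> nat \<Rightarrow> complex"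
    using fin that by (simp add: if_distrib[of "\<lambda>x. _ * x"] cong: if_cong)
  have cyc: "mo \<iota>2 A \<pi>1 A ?d \<in> cyc Z1 Z2 0" if 1: "rz Z1 \<iota>1 \<pi>1 A q" and 2: "rz Z2 \<iota>2 \<pi>2 A q"
    for Z1 Z2 \<iota>1 \<iota>2 \<pi>1 \<pi>2
  proof -
    have "D Z2 * mo \<iota>2 A \<pi>1 A ?d = mo \<iota>2 A \<pi>1 A ?d * D Z1"
      unfolding mo_D[OF 1, symmetric] mo_D[OF 2, symmetric] mo_comp[OF 1 2] mo_comp[OF 2 2]
      using l r by (intro mo_cong) auto
    then show ?thesis using mo_hom[OF 1 2 g] by (simp add: cyc_def sn_simps)
  qed
  have "mo \<iota>1 A \<pi>2 A ?d * mo \<iota>2 A \<pi>1 A ?d = one Z1" if 1: "rz Z1 \<iota>1 \<pi>1 A q" and 2: "rz Z2 \<iota>2 \<pi>2 A q"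
    for Z1 Z2 \<iota>1 \<iota>2 \<pi>1 \<pi>2
    unfolding mo_comp[OF 2 1] mo_one[OF 1, symmetric] by (intro mo_cong) (rule l)
  then show ?thesis using strict_iso_heq[OF rzD(1)[OF Z] rzD(1)[OF Z'] cyc[OF Z Z'] cyc[OF Z' Z]] Z Z' by blast
qed

text \<open>An object with coordinates need not have been built by iterated cones. But the square of
  \<open>q\<close> vanishes by \<open>D_square\<close>, and the object that \<open>rz_exists\<close>
  builds from \<open>q\<close> is isomorphic to the given one.\<close>

lemma rz_lorth:
  assumes Z: "rz Z \<iota> \<pi> A q" and q: "graded 1 A A q" shows "lorth Z"
proof -
  have "mo \<iota> A \<pi> A (\<lambda>a c. \<Sum>b\<in>A. q a b * q b c) = mo \<iota> A \<pi> A (\<lambda>a b. 0)"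
    unfolding mo_comp[OF Z Z, symmetric] mo_D[OF Z] D_square[OF rzD(1)[OF Z]] by (simp add: mo_def sc_0)
  then have "\<forall>a\<in>A. \<forall>c\<in>A. (\<Sum>b\<in>A. q a b * q b c) = 0" using mo_inj[OF Z Z] by blast
  then obtain Z' \<iota>' \<pi>' where Z': "rz Z' \<iota>' \<pi>' A q" "lorth Z'" using rz_exists[OF rzD(2)[OF Z] q] by blast
  show ?thesis using lorth_heq[OF rz_heq[OF Z'(1) Z] Z'(2)] .
qed

end

section \<open>Graded index sets\<close>

definition Ix :: "(int \<Rightarrow> nat) \<Rightarrow> (int \<times> nat) set" where
  "Ix n = {(i, a). a < n i}"

lemma Ix_iff [simp]: "(i, a) \<in> Ix n \<longleftrightarrow> a < n i"
  by (simp add: Ix_def)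

lemma finite_Ix: "finite {i. n i \<noteq> 0} \<Longrightarrow> finite (Ix n)"
proof -
  assume fin: "finite {i. n i \<noteq> 0}"
  have "Ix n = Sigma {i. n i \<noteq> 0} (\<lambda>i. {..<n i})" by (auto simp: Ix_def)
  then show ?thesis using fin by simp
qed

lemma sum_Ix:
  assumes "finite (Ix n)" "\<And>x. x \<in> Ix n \<Longrightarrow> fst x \<noteq> k \<Longrightarrow> g x = 0"
  shows "(\<Sum>x\<in>Ix n. g x) = (\<Sum>a<n k. g (k, a))"
proof -
  have "fst x \<noteq> k" if "x \<in> Ix n - Pair k ` {..<n k}" for x using that by (cases x) auto
  then have "(\<Sum>x\<in>Ix n. g x) = (\<Sum>x\<in>Pair k ` {..<n k}. g x)"
    using assms by (intro sum.mono_neutral_right) auto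
  then show ?thesis by (simp add: sum.reindex inj_on_def)
qed

section \<open>Cohomology of Hom-complexes and universal morphisms\<close>

context dg_ops
begin

text \<open>Representatives of bases of all cohomology groups at once. Only finitely many groups are
  non-zero, since the graded pieces are independent subspaces of a finite-dimensional space.\<close>

lemma hom_basis:
  assumes ob: "X \<in> ob" "Y \<in> ob"
  obtains n and \<phi> :: "int \<Rightarrow> nat \<Rightarrow> 'r" where "finite {k. n k \<noteq> 0}"
    and "\<And>k a. a < n k \<Longrightarrow> \<phi> k a \<in> cyc X Y k"
    and "\<And>k u. u \<in> cyc X Y k \<Longrightarrow> \<exists>c. u - (\<Sum>a<n k. sc (c a) * \<phi> k a) \<in> bnd X Y k"
    and "\<And>k c a. (\<Sum>a<n k. sc (c a) * \<phi> k a) \<in> bnd X Y k \<Longrightarrow> a < n k \<Longrightarrow> c a = 0"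
proof -
  interpret V: vector_space "\<lambda>c f. sc c * f" by (rule vec)
  obtain F where F: "finite F" "\<And>k. hom X Y k \<subseteq> V.span F"
  proof -
    obtain F where F: "finite F" "\<And>k. hom X Y k \<subseteq> range (\<lambda>c. \<Sum>f\<in>F. sc (c f) * f)"
      using fin_dim[OF ob] by blast
    then show thesis using that[of F] V.span_finite[of F] by simp
  qed
  have sub: "V.subspace (hom X Y k)" "V.subspace (cyc X Y k)" "V.subspace (bnd X Y k)" for k
    unfolding V.subspace_def using hom_0 hom_add hom_sc cyc_0 cyc_add cyc_sc bnd_0 bnd_add bnd_sc ob by auto
  define P where "P k n \<phi> \<longleftrightarrow> (\<forall>a<n. \<phi> a \<in> cyc X Y k) \<and>
    (\<forall>u \<in> cyc X Y k. \<exists>c. u - (\<Sum>a<n. sc (c a) * \<phi> a) \<in> bnd X Y k) \<and>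
    (\<forall>c. (\<Sum>a<n. sc (c a) * \<phi> a) \<in> bnd X Y k \<longrightarrow> (\<forall>a<n. c a = 0))"
    for k n and \<phi> :: "nat \<Rightarrow> 'r"
  have "\<exists>n \<phi>. P k n \<phi>" for k
    unfolding P_def
  proof (rule V.quotient_basis[OF sub(2,3) _ F(1)])
    show "cyc X Y k \<subseteq> V.span F" using F(2)[of k] cyc_hom by blast
  qed (use bnd_cyc[OF ob] in blast)
  then obtain n \<phi> where "\<And>k. P k (n k) (\<phi> k)" by metis
  note n = this[unfolded P_def]
  have "finite {k. hom X Y k \<noteq> {0}}"
    by (rule V.finite_support_of_direct_sum[OF F sub(1) direct[OF ob]])
  moreover have "n k = 0" if "hom X Y k = {0}" for k
  proof (rule ccontr)
    assume "n k \<noteq> 0"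
    moreover have "\<phi> k a = 0" if "a < n k" for a
      using n[of k, THEN conjunct1] that \<open>hom X Y k = {0}\<close> cyc_hom by blast
    \<comment> \<open>If all representatives are zero, their sum is a boundary with coefficients 1,
      against independence.\<close>
    then have "(\<Sum>a<n k. sc 1 * \<phi> k a) \<in> bnd X Y k" using bnd_0[OF ob] by simp
    ultimately show False using n[of k, THEN conjunct2, THEN conjunct2, rule_format, of "\<lambda>_. 1" 0] by simp
  qed
  then have "{k. n k \<noteq> 0} \<subseteq> {k. hom X Y k \<noteq> {0}}" by auto
  ultimately have fin: "finite {k. n k \<noteq> 0}" using finite_subset by blast
  show ?thesis
  proof (rule that[of n \<phi>, OF fin])
    fix k c a assume "(\<Sum>a<n k. sc (c a) * \<phi> k a) \<in> bnd X Y k" "a < n k"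
    then show "c a = 0" using n[of k, THEN conjunct2, THEN conjunct2, rule_format, of c a] by simp
  qed (fact n[THEN conjunct1, rule_format], fact n[THEN conjunct2, THEN conjunct1, rule_format])
qed

text \<open>With \<open>E\<close> as an object with a single coordinate, morphisms from and to
  \<open>E\<close> become matrices with one column or one row.\<close>

lemma rz_E: "rz E (\<lambda>_. one E) (\<lambda>_. one E) {(0, 0)} (\<lambda>_ _. 0)"
  using E_ob hom_one[OF E_ob] one_left[OF E_ob E_ob hom_one[OF E_ob]] D_E by (simp add: rz_def sc_0)

lemma hom_E_rz:
  assumes Z: "rz Z \<iota> \<pi> (Ix n) q" and v: "v \<in> hom E Z k"
  shows "\<exists>c. v = (\<Sum>a<n k. sc (c a) * \<iota> (k, a))"
proof -
  obtain m where m: "graded k (Ix n) {(0, 0)} m" "v = mo \<iota> (Ix n) (\<lambda>_. one E) {(0, 0)} m"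
    using mo_surj[OF rz_E Z v] by blast
  have "v = (\<Sum>x\<in>Ix n. sc (m x (0, 0)) * \<iota> x)"
    unfolding m(2) mo_def using one_right[OF E_ob rzD(1)[OF Z] rzD(3)[OF Z]] by (intro sum.cong refl) simp
  also have "\<dots> = (\<Sum>a<n k. sc (m (k, a) (0, 0)) * \<iota> (k, a))"
    using m(1) rzD(2)[OF Z] by (intro sum_Ix) (auto simp: graded_def sc_0)
  finally show ?thesis by (intro exI[of _ "\<lambda>a. m (k, a) (0, 0)"])
qed

lemma hom_rz_E:
  assumes Z: "rz Z \<iota> \<pi> (Ix n) q" and w: "w \<in> hom Z E (- k)"
  shows "\<exists>c. w = (\<Sum>a<n k. sc (c a) * \<pi> (k, a))"
proof -
  obtain m where m: "graded (- k) {(0, 0)} (Ix n) m" "w = mo (\<lambda>_. one E) {(0, 0)} \<pi> (Ix n) m"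
    using mo_surj[OF Z rz_E w] by blast
  have "w = (\<Sum>x\<in>Ix n. sc (m (0, 0) x) * \<pi> x)"
    unfolding m(2) mo_def using one_left[OF rzD(1)[OF Z] E_ob rzD(4)[OF Z]] by simp
  also have "\<dots> = (\<Sum>a<n k. sc (m (0, 0) (k, a)) * \<pi> (k, a))"
    using m(1) rzD(2)[OF Z] by (intro sum_Ix) (auto simp: graded_def sc_0)
  finally show ?thesis by (intro exI[of _ "\<lambda>a. m (0, 0) (k, a)"])
qed

text \<open>The twisted complex without twist: \<open>E\<close> tensored with a graded vector space
  of dimensions \<open>n\<close>.\<close>

definition formal :: "'o \<Rightarrow> (int \<times> nat \<Rightarrow> 'r) \<Rightarrow> (int \<times> nat \<Rightarrow> 'r) \<Rightarrow> (int \<Rightarrow> nat) \<Rightarrow> bool" where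
  "formal V \<iota> \<pi> n \<longleftrightarrow> finite {k. n k \<noteq> 0} \<and> rz V \<iota> \<pi> (Ix n) (\<lambda>_ _. 0)"

lemma formal_exists: "finite {k. n k \<noteq> 0} \<Longrightarrow> \<exists>V \<iota> \<pi>. formal V \<iota> \<pi> n"
  using rz_exists[OF finite_Ix, of n "\<lambda>_ _. 0"] by (auto simp: formal_def graded_def)

lemma formal_D: "formal V \<iota> \<pi> n \<Longrightarrow> D V = 0"
  using mo_D[of V \<iota> \<pi> "Ix n" "\<lambda>_ _. 0"] by (simp add: formal_def mo_def sc_0)

lemma formal_lorth: "formal V \<iota> \<pi> n \<Longrightarrow> lorth V"
  unfolding formal_def by (erule conjE, erule rz_lorth) (simp add: graded_def)

text \<open>\<open>V\<close> is the cohomology of \<open>Hom(E, Y)\<close> tensored with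
  \<open>E\<close>, and \<open>\<epsilon>\<close> is evaluation. As \<open>V\<close> and
  \<open>E\<close> have zero differential, \<open>Hom(E, V)\<close> is its own cohomology, and
  \<open>\<epsilon>\<close> takes its basis \<open>\<iota>\<close> to the chosen representatives
  \<open>\<phi>\<close>.\<close>

lemma cover:
  assumes Y: "Y \<in> ob"
  shows "\<exists>V \<iota> \<pi> n \<epsilon>. formal V \<iota> \<pi> n \<and> qi V Y \<epsilon>"
proof -
  obtain n and \<phi> :: "int \<Rightarrow> nat \<Rightarrow> 'r" where fin: "finite {k. n k \<noteq> 0}"
    and \<phi>: "\<And>k a. a < n k \<Longrightarrow> \<phi> k a \<in> cyc E Y k"
    and span: "\<And>k u. u \<in> cyc E Y k \<Longrightarrow> \<exists>c. u - (\<Sum>a<n k. sc (c a) * \<phi> k a) \<in> bnd E Y k"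
    and indep: "\<And>k c a. (\<Sum>a<n k. sc (c a) * \<phi> k a) \<in> bnd E Y k \<Longrightarrow> a < n k \<Longrightarrow> c a = 0"
    by (rule hom_basis[OF E_ob Y]) (rule that)
  obtain V \<iota> \<pi> where sp: "formal V \<iota> \<pi> n" using formal_exists[OF fin] by blast
  then have V: "rz V \<iota> \<pi> (Ix n) (\<lambda>_ _. 0)" by (simp add: formal_def)
  note Vo = rzD(1)[OF V] and DV = formal_D[OF sp]
  define \<epsilon> where "\<epsilon> = (\<Sum>x\<in>Ix n. \<phi> (fst x) (snd x) * \<pi> x)"
  have \<phi>': "\<phi> (fst x) (snd x) \<in> cyc E Y (fst x)" if "x \<in> Ix n" for x using \<phi> that by (auto simp: Ix_def)
  have "\<epsilon> \<in> hom V Y 0" unfolding \<epsilon>_def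
    by (intro hom_sum Vo Y hom_comp[OF Vo E_ob Y rzD(4)[OF V] cyc_hom[OF \<phi>']]) auto
  moreover have "D Y * \<epsilon> = 0"
    unfolding \<epsilon>_def sum_distrib_left
  proof (intro sum.neutral ballI)
    fix x assume "x \<in> Ix n"
    then have "D Y * \<phi> (fst x) (snd x) = 0" using \<phi>' by (simp add: cyc_E)
    then show "D Y * (\<phi> (fst x) (snd x) * \<pi> x) = 0" by (simp flip: mult.assoc)
  qed
  ultimately have \<epsilon>: "\<epsilon> \<in> cyc V Y 0" by (simp add: cyc_def DV)
  have \<epsilon>\<iota>: "\<epsilon> * \<iota> (k, a) = \<phi> k a" if a: "a < n k" for k a
  proof -
    have "\<epsilon> * \<iota> (k, a) = (\<Sum>x\<in>Ix n. if x = (k, a) then \<phi> k a else 0)"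
      unfolding \<epsilon>_def sum_distrib_right
      using rzD(5)[OF V, of _ "(k, a)"] a one_right[OF E_ob Y cyc_hom[OF \<phi>[OF a]]]
      by (intro sum.cong refl) (auto simp: mult.assoc)
    then show ?thesis using a rzD(2)[OF V] by simp
  qed
  have \<epsilon>sum: "\<epsilon> * (\<Sum>a<n k. sc (c a) * \<iota> (k, a)) = (\<Sum>a<n k. sc (c a) * \<phi> k a)" for k c
    unfolding sum_distrib_left using \<epsilon>\<iota> by (intro sum.cong refl) (simp add: sc_left_comm[of \<epsilon>])
  have "qi V Y \<epsilon>"
    unfolding qi_def
  proof (intro conjI allI ballI impI)
    fix k u assume u: "u \<in> cyc E V k" "\<epsilon> * u \<in> bnd E Y k"
    obtain c where c: "u = (\<Sum>a<n k. sc (c a) * \<iota> (k, a))" using hom_E_rz[OF V cyc_hom[OF u(1)]] by blast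
    have "c a = 0" if "a < n k" for a using indep u(2) that unfolding c \<epsilon>sum by blast
    then have "u = 0" unfolding c by (simp add: sc_0)
    then show "u \<in> bnd E V k" using bnd_0 E_ob Vo by simp
  next
    fix k u assume "u \<in> cyc E Y k"
    then obtain c where c: "u - (\<Sum>a<n k. sc (c a) * \<phi> k a) \<in> bnd E Y k" using span by blast
    have "(\<Sum>a<n k. sc (c a) * \<iota> (k, a)) \<in> hom E V k"
      using rzD(3)[OF V, of "(k, _)"] by (intro hom_sum hom_sc E_ob Vo) auto
    then show "\<exists>v\<in>cyc E V k. u - \<epsilon> * v \<in> bnd E Y k"
      using c \<epsilon>sum by (intro bexI[of _ "\<Sum>a<n k. sc (c a) * \<iota> (k, a)"]) (simp_all add: cyc_E DV)
  qed (use Vo Y \<epsilon> in auto)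
  then show ?thesis using sp by blast
qed

lemma right_universal:
  assumes "Y \<in> ob"
  shows "\<exists>V \<epsilon>. lorth V \<and> \<epsilon> \<in> cyc V Y 0 \<and> (\<forall>X. lorth X \<longrightarrow>
    (\<forall>u \<in> cyc X Y 0. \<exists>v \<in> cyc X V 0. u - \<epsilon> * v \<in> bnd X Y 0) \<and>
    (\<forall>v \<in> cyc X V 0. \<epsilon> * v \<in> bnd X Y 0 \<longrightarrow> v \<in> bnd X V 0))"
proof -
  obtain V \<iota> \<pi> n \<epsilon> where "formal V \<iota> \<pi> n" and qi: "qi V Y \<epsilon>" using cover[OF assms] by blast
  then have "lorth V" using formal_lorth by blast
  then show ?thesis using qi qi_surj[OF qi] qi_inj[OF qi] unfolding qi_def by blast
qed

text \<open>The evaluation map is a quasi-isomorphism between two objects of the left orthogonal,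
  hence a homotopy equivalence.\<close>

lemma lorth_heq_formal:
  assumes "lorth Y" shows "\<exists>V \<iota> \<pi> n. formal V \<iota> \<pi> n \<and> heq V Y"
proof -
  obtain V \<iota> \<pi> n \<epsilon> where V: "formal V \<iota> \<pi> n" and qi: "qi V Y \<epsilon>" using cover[OF lorth_ob[OF assms]] by blast
  then have "heq V Y" using qi_heq[OF qi formal_lorth[OF V] assms] unfolding heq_def qi_def by blast
  then show ?thesis using V by blast
qed

text \<open>\<open>\<eta>\<close> is coevaluation into \<open>E\<close> tensored with the dual of
  the cohomology of \<open>Hom(Y, E)\<close>. For the target \<open>E\<close>, in all degrees,
  composition with \<open>\<eta>\<close> is bijective on cohomology by construction. Any other
  target is homotopy equivalent to a finite sum of shifts of \<open>E\<close> and is treated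
  component by component.\<close>

lemma left_universal:
  assumes Y: "Y \<in> ob"
  shows "\<exists>V \<eta>. lorth V \<and> \<eta> \<in> cyc Y V 0 \<and> (\<forall>X. lorth X \<longrightarrow>
    (\<forall>u \<in> cyc Y X 0. \<exists>w \<in> cyc V X 0. u - w * \<eta> \<in> bnd Y X 0) \<and>
    (\<forall>w \<in> cyc V X 0. w * \<eta> \<in> bnd Y X 0 \<longrightarrow> w \<in> bnd V X 0))"
proof -
  obtain n0 and \<phi> :: "int \<Rightarrow> nat \<Rightarrow> 'r" where fin0: "finite {k. n0 k \<noteq> 0}"
    and \<phi>: "\<And>k a. a < n0 k \<Longrightarrow> \<phi> k a \<in> cyc Y E k"
    and span0: "\<And>k u. u \<in> cyc Y E k \<Longrightarrow> \<exists>c. u - (\<Sum>a<n0 k. sc (c a) * \<phi> k a) \<in> bnd Y E k"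
    and indep0: "\<And>k c a. (\<Sum>a<n0 k. sc (c a) * \<phi> k a) \<in> bnd Y E k \<Longrightarrow> a < n0 k \<Longrightarrow> c a = 0"
    by (rule hom_basis[OF Y E_ob]) (rule that)
  \<comment> \<open>A class of degree \<open>k\<close> is a morphism to \<open>E[k]\<close>, and
    that summand has index degree \<open>- k\<close>.\<close>
  define n where "n k = n0 (- k)" for k
  define \<psi> where "\<psi> x = \<phi> (- fst x) (snd x)" for x
  have "{k. n k \<noteq> 0} \<subseteq> uminus ` {k. n0 k \<noteq> 0}"
  proof
    fix k assume "k \<in> {k. n k \<noteq> 0}"
    then show "k \<in> uminus ` {k. n0 k \<noteq> 0}" by (intro image_eqI[of _ _ "- k"]) (auto simp: n_def)
  qed
  then have fin: "finite {k. n k \<noteq> 0}" using fin0 finite_surj by blast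
  obtain V \<iota> \<pi> where sp: "formal V \<iota> \<pi> n" using formal_exists[OF fin] by blast
  then have V: "rz V \<iota> \<pi> (Ix n) (\<lambda>_ _. 0)" by (simp add: formal_def)
  note Vo = rzD(1)[OF V] and DV = formal_D[OF sp]
  have \<psi>: "\<psi> x \<in> cyc Y E (- fst x)" if "x \<in> Ix n" for x
    using \<phi> that by (cases x) (simp add: \<psi>_def n_def)
  have \<psi>D: "\<psi> x * D Y = 0" if "x \<in> Ix n" for x
    using \<psi>[OF that] by (simp add: cyc_def D_E) (metis mult.assoc mult_zero_right sn_square(2))
  define \<eta> where "\<eta> = (\<Sum>x\<in>Ix n. \<iota> x * \<psi> x)"
  have "\<eta> \<in> hom Y V 0" unfolding \<eta>_def
    by (intro hom_sum Vo Y hom_comp[OF Y E_ob Vo cyc_hom[OF \<psi>] rzD(3)[OF V]]) auto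
  moreover have "\<eta> * D Y = 0" unfolding \<eta>_def sum_distrib_right using \<psi>D by (simp add: mult.assoc)
  ultimately have \<eta>: "\<eta> \<in> cyc Y V 0" by (simp add: cyc_def DV mult.assoc)
  have \<pi>\<eta>: "\<pi> y * \<eta> = \<psi> y" if y: "y \<in> Ix n" for y
  proof -
    have "\<pi> y * \<eta> = (\<Sum>x\<in>Ix n. if y = x then \<psi> y else 0)"
      unfolding \<eta>_def sum_distrib_left
      using rzD(5)[OF V y] one_left[OF Y E_ob cyc_hom[OF \<psi>[OF y]]]
      by (intro sum.cong refl) (auto simp flip: mult.assoc)
    then show ?thesis using y rzD(2)[OF V] by simp
  qed
  have sum\<eta>: "(\<Sum>a<n k. sc (c a) * \<pi> (k, a)) * \<eta> = (\<Sum>a<n0 (- k). sc (c a) * \<phi> (- k) a)" for k c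
    unfolding sum_distrib_right using \<pi>\<eta>[of "(k, _)"] by (simp add: mult.assoc \<psi>_def n_def)
  have surj: "\<exists>w \<in> hom V E k. u - w * \<eta> \<in> bnd Y E k" if u: "u \<in> cyc Y E k" for u k
  proof -
    obtain c where c: "u - (\<Sum>a<n0 k. sc (c a) * \<phi> k a) \<in> bnd Y E k" using span0[OF u] by blast
    have "(\<Sum>a<n (- k). sc (c a) * \<pi> (- k, a)) \<in> hom V E k"
      using rzD(4)[OF V, of "(- k, _)"] by (intro hom_sum hom_sc E_ob Vo) auto
    then show ?thesis using c sum\<eta>[of c "- k"]
      by (intro bexI[of _ "\<Sum>a<n (- k). sc (c a) * \<pi> (- k, a)"]) simp_all
  qed
  have inj: "w = 0" if w: "w \<in> hom V E k" "w * \<eta> \<in> bnd Y E k" for w k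
  proof -
    obtain c where c: "w = (\<Sum>a<n (- k). sc (c a) * \<pi> (- k, a))" using hom_rz_E[OF V, of w "- k"] w(1) by auto
    have "c a = 0" if "a < n (- k)" for a
      using indep0[of c k a] w(2) that sum\<eta>[of c "- k"] unfolding c by (simp add: n_def)
    then show ?thesis unfolding c by (simp add: sc_0)
  qed
  have univ: "(\<forall>u \<in> cyc Y X 0. \<exists>w \<in> cyc V X 0. u - w * \<eta> \<in> bnd Y X 0) \<and>
    (\<forall>w \<in> cyc V X 0. w * \<eta> \<in> bnd Y X 0 \<longrightarrow> w \<in> bnd V X 0)" if X: "lorth X" for X
  proof -
    obtain V' \<iota>' \<pi>' n' where sp': "formal V' \<iota>' \<pi>' n'" and eq: "heq V' X" using lorth_heq_formal[OF X] by blast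
    have V': "rz V' \<iota>' \<pi>' (Ix n') (\<lambda>_ _. 0)" using sp' by (simp add: formal_def)
    note V'o = rzD(1)[OF V'] and DV' = formal_D[OF sp'] and Xo = lorth_ob[OF X]
    obtain b a where b: "b \<in> cyc V' X 0" and a: "a \<in> cyc X V' 0" and ba: "one X - b * a \<in> bnd X X 0"
      using eq unfolding heq_def by blast
    have \<pi>'c: "\<pi>' x \<in> cyc V' E (- fst x)" "\<iota>' x \<in> cyc E V' (fst x)" if "x \<in> Ix n'" for x
      using rzD(3,4)[OF V' that] by (simp_all add: cyc_def DV' D_E)
    have idV': "(\<Sum>x\<in>Ix n'. \<iota>' x * \<pi>' x) = one V'" using rzD(6)[OF V'] .
    show ?thesis
    proof (intro conjI ballI impI)
      fix u assume u: "u \<in> cyc Y X 0"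
      have au: "a * u \<in> cyc Y V' 0" using cyc_comp[OF Y Xo V'o u a] by simp
      have "\<exists>w \<in> hom V E (- fst x). \<pi>' x * (a * u) - w * \<eta> \<in> bnd Y E (- fst x)" if "x \<in> Ix n'" for x
        using surj cyc_comp[OF Y V'o E_ob au \<pi>'c(1)[OF that]] by simp
      then obtain w where w: "\<And>x. x \<in> Ix n' \<Longrightarrow> w x \<in> hom V E (- fst x)"
        "\<And>x. x \<in> Ix n' \<Longrightarrow> \<pi>' x * (a * u) - w x * \<eta> \<in> bnd Y E (- fst x)" by metis
      \<comment> \<open>The extension of \<open>a * u\<close> is assembled from extensions of its
        components in the shifts of \<open>E\<close>.\<close>
      define W where "W = (\<Sum>x\<in>Ix n'. \<iota>' x * w x)"
      have "W \<in> hom V V' 0" unfolding W_def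
        by (intro hom_sum Vo V'o hom_comp[OF Vo E_ob V'o w(1) rzD(3)[OF V']]) auto
      then have W: "W \<in> cyc V V' 0" by (simp add: cyc_def DV DV')
      have "a * u - W * \<eta> = one V' * (a * u) - W * \<eta>" using one_left[OF Y V'o cyc_hom[OF au]] by simp
      also have "\<dots> = (\<Sum>x\<in>Ix n'. \<iota>' x * (\<pi>' x * (a * u) - w x * \<eta>))"
        unfolding idV'[symmetric] W_def
        by (simp add: sum_distrib_right sum_subtractf right_diff_distrib mult.assoc)
      also have "\<dots> \<in> bnd Y V' 0"
        by (intro bnd_sum Y V'o bnd_comp_left[OF Y E_ob V'o w(2) \<pi>'c(2)]) auto
      finally have "b * (a * u - W * \<eta>) \<in> bnd Y X 0" using bnd_comp_left[OF Y V'o Xo _ b] by simp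
      moreover have "(one X - b * a) * u \<in> bnd Y X 0" using bnd_comp_right[OF Y Xo Xo u ba] by simp
      ultimately have "(one X - b * a) * u + b * (a * u - W * \<eta>) \<in> bnd Y X 0" by (intro bnd_add Y Xo)
      moreover have "(one X - b * a) * u + b * (a * u - W * \<eta>) = u - b * W * \<eta>"
        using one_left[OF Y Xo cyc_hom[OF u]] by (simp add: algebra_simps)
      moreover have "b * W \<in> cyc V X 0" using cyc_comp[OF Vo V'o Xo W b] by simp
      ultimately show "\<exists>w \<in> cyc V X 0. u - w * \<eta> \<in> bnd Y X 0" by metis
    next
      fix w assume w: "w \<in> cyc V X 0" and w\<eta>: "w * \<eta> \<in> bnd Y X 0"
      have aw: "a * w \<in> cyc V V' 0" using cyc_comp[OF Vo Xo V'o w a] by simp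
      have "\<pi>' x * (a * w) = 0" if x: "x \<in> Ix n'" for x
      proof (rule inj)
        show "\<pi>' x * (a * w) \<in> hom V E (- fst x)"
          using hom_comp[OF Vo V'o E_ob cyc_hom[OF aw] rzD(4)[OF V' x]] by simp
        have "a * (w * \<eta>) \<in> bnd Y V' 0" using bnd_comp_left[OF Y Xo V'o w\<eta> a] by simp
        then have "\<pi>' x * (a * (w * \<eta>)) \<in> bnd Y E (- fst x)"
          by (rule bnd_comp_left[OF Y V'o E_ob _ \<pi>'c(1)[OF x]]) simp
        then show "\<pi>' x * (a * w) * \<eta> \<in> bnd Y E (- fst x)" by (simp add: mult.assoc)
      qed
      then have "one V' * (a * w) = 0" unfolding idV'[symmetric] by (simp add: sum_distrib_right mult.assoc)
      then have "a * w = 0" using one_left[OF Vo V'o cyc_hom[OF aw]] by simp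
      \<comment> \<open>As \<open>a * w\<close> is zero on the nose, \<open>w\<close> is a multiple
        of the null-homotopic \<open>one X - b * a\<close>.\<close>
      then have "(one X - b * a) * w = w"
        using one_left[OF Vo Xo cyc_hom[OF w]] by (simp add: left_diff_distrib mult.assoc)
      then show "w \<in> bnd V X 0" using bnd_comp_right[OF Vo Xo Xo w ba] by simp
    qed
  qed
  show ?thesis using formal_lorth[OF sp] \<eta> univ by blast
qed

end

section \<open>Complexes of vector spaces as objects with coordinates\<close>

definition FM :: "int \<Rightarrow> cplx \<Rightarrow> cplx \<Rightarrow> cmap set" where
  "FM k X Y = {f. \<forall>j. f j \<in> carrier_mat (fst Y (j + k)) (fst X j)}"

text \<open>One matrix over all graded indices in place of a family of matrices; composition of
  families, with its shift of the index, becomes matrix multiplication.\<close>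

definition fam :: "int \<Rightarrow> cmap \<Rightarrow> int \<times> nat \<Rightarrow> int \<times> nat \<Rightarrow> complex" where
  "fam k f = (\<lambda>(i, a) (j, b). if i = j + k then f j $$ (a, b) else 0)"

lemma fam_comp:
  assumes fin: "finite (Ix (fst Y))" and f: "f \<in> FM k X Y" and g: "g \<in> FM l Y Z"
    and c: "c \<in> Ix (fst Z)" and b: "b \<in> Ix (fst X)"
  shows "(\<Sum>a\<in>Ix (fst Y). fam l g c a * fam k f a b) = fam (k + l) (\<lambda>j. g (j + k) * f j) c b"
proof -
  obtain i r j s where cb: "c = (i, r)" "b = (j, s)" by (cases c, cases b)
  have f': "f j \<in> carrier_mat (fst Y (j + k)) (fst X j)"
    and g': "g (j + k) \<in> carrier_mat (fst Z (j + k + l)) (fst Y (j + k))"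
    using f g by (auto simp: FM_def)
  have "(\<Sum>a\<in>Ix (fst Y). fam l g c a * fam k f a b)
      = (\<Sum>a<fst Y (j + k). fam l g c (j + k, a) * fam k f (j + k, a) b)"
    by (rule sum_Ix[OF fin]) (auto simp: fam_def cb)
  also have "\<dots> = fam (k + l) (\<lambda>j. g (j + k) * f j) c b"
  proof (cases "i = j + k + l")
    case True
    then have r: "r < fst Z (j + k + l)" and s: "s < fst X j" using c b cb by auto
    have "(g (j + k) * f j) $$ (r, s) = (\<Sum>a<fst Y (j + k). g (j + k) $$ (r, a) * f j $$ (a, s))"
      using f' g' r s by (auto simp: scalar_prod_def lessThan_atLeast0 intro!: sum.cong)
    then show ?thesis using True by (simp add: fam_def cb add.assoc)
  qed (simp add: fam_def cb add.assoc)
  finally show ?thesis .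
qed

lemma fam_surj:
  assumes m: "\<forall>a \<in> Ix (fst Y). \<forall>b \<in> Ix (fst X). m a b \<noteq> 0 \<longrightarrow> fst a = fst b + k"
  shows "\<exists>f \<in> FM k X Y. \<forall>a \<in> Ix (fst Y). \<forall>b \<in> Ix (fst X). m a b = fam k f a b"
proof (intro bexI ballI)
  let ?f = "\<lambda>j. mat (fst Y (j + k)) (fst X j) (\<lambda>(a, b). m (j + k, a) (j, b))"
  show "?f \<in> FM k X Y" by (simp add: FM_def)
  fix a b assume a: "a \<in> Ix (fst Y)" and b: "b \<in> Ix (fst X)"
  show "m a b = fam k ?f a b"
    using a b m[rule_format, OF a b] by (cases a; cases b) (auto simp: fam_def)
qed

lemma fam_inj:
  assumes f: "f \<in> FM k X Y" and g: "g \<in> FM k X Y"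
    and eq: "\<And>a b. a \<in> Ix (fst Y) \<Longrightarrow> b \<in> Ix (fst X) \<Longrightarrow> fam k f a b = fam k g a b"
  shows "f = g"
proof
  fix j
  have c: "f j \<in> carrier_mat (fst Y (j + k)) (fst X j)" "g j \<in> carrier_mat (fst Y (j + k)) (fst X j)"
    using f g by (auto simp: FM_def)
  show "f j = g j"
  proof (rule eq_matI)
    fix a b assume "a < dim_row (g j)" "b < dim_col (g j)"
    then show "f j $$ (a, b) = g j $$ (a, b)"
      using eq[of "(j + k, a)" "(j, b)"] c by (simp add: fam_def)
  qed (use c in auto)
qed

lemma fam_add:
  assumes "f \<in> FM k X Y" "g \<in> FM k X Y" "a \<in> Ix (fst Y)" "b \<in> Ix (fst X)"
  shows "fam k (\<lambda>j. f j + g j) a b = fam k f a b + fam k g a b"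
proof -
  obtain i r j s where ab: "a = (i, r)" "b = (j, s)" by (cases a, cases b)
  have "g j \<in> carrier_mat (fst Y (j + k)) (fst X j)" using assms by (simp add: FM_def)
  then show ?thesis using assms(3,4) by (auto simp: fam_def ab)
qed

lemma fam_diff:
  assumes "f \<in> FM k X Y" "g \<in> FM k X Y" "a \<in> Ix (fst Y)" "b \<in> Ix (fst X)"
  shows "fam k (\<lambda>j. f j - g j) a b = fam k f a b - fam k g a b"
proof -
  obtain i r j s where ab: "a = (i, r)" "b = (j, s)" by (cases a, cases b)
  have "g j \<in> carrier_mat (fst Y (j + k)) (fst X j)" using assms by (simp add: FM_def)
  then show ?thesis using assms(3,4) by (auto simp: fam_def ab)
qed

lemma fam_scale:
  assumes "f \<in> FM k X Y" "a \<in> Ix (fst Y)" "b \<in> Ix (fst X)"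
  shows "fam k (\<lambda>j. c \<cdot>\<^sub>m f j) a b = c * fam k f a b"
proof -
  obtain i r j s where ab: "a = (i, r)" "b = (j, s)" by (cases a, cases b)
  have "f j \<in> carrier_mat (fst Y (j + k)) (fst X j)" using assms by (simp add: FM_def)
  then show ?thesis using assms(2,3) by (auto simp: fam_def ab)
qed

lemma fam_one: "a \<in> Ix n \<Longrightarrow> b \<in> Ix n \<Longrightarrow> fam 0 (\<lambda>j. 1\<^sub>m (n j)) a b = (if a = b then 1 else 0)"
  by (cases a; cases b) (auto simp: fam_def)

lemma vc_complexesD:
  assumes "X \<in> vc_complexes"
  shows "finite (Ix (fst X))" "snd X \<in> FM 1 X X" "\<And>i. snd X i \<in> carrier_mat (fst X (i + 1)) (fst X i)"
    "\<And>i. snd X (i + 1) * snd X i = 0\<^sub>m (fst X (i + 2)) (fst X i)"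
  using assms finite_Ix by (auto simp: vc_complexes_def FM_def)

lemma vc_maps_FM: "f \<in> vc_maps X Y \<Longrightarrow> f \<in> FM 0 X Y"
  by (simp add: vc_maps_def FM_def)

section \<open>Realising complexes of vector spaces by sums of shifts of \<open>E\<close>\<close>

context dg_ops
begin

text \<open>\<open>Z\<close> is the complex \<open>X\<close> tensored with \<open>E\<close>: one
  copy of \<open>E\<close> for each basis vector of each term, twisted by the differential of
  \<open>X\<close>.\<close>

definition R :: "'o \<Rightarrow> (int \<times> nat \<Rightarrow> 'r) \<Rightarrow> (int \<times> nat \<Rightarrow> 'r) \<Rightarrow> cplx \<Rightarrow> bool" where
  "R Z \<iota> \<pi> X \<longleftrightarrow> X \<in> vc_complexes \<and> rz Z \<iota> \<pi> (Ix (fst X)) (fam 1 (snd X))"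

definition mf :: "int \<Rightarrow> (int \<times> nat \<Rightarrow> 'r) \<Rightarrow> cplx \<Rightarrow> (int \<times> nat \<Rightarrow> 'r) \<Rightarrow> cplx \<Rightarrow> cmap \<Rightarrow> 'r" where
  "mf k \<iota> Y \<pi> X f = mo \<iota> (Ix (fst Y)) \<pi> (Ix (fst X)) (fam k f)"

lemma graded_fam: "graded k A B (fam k f)"
  by (auto simp: graded_def fam_def split: if_splits)

lemma RD:
  assumes "R Z \<iota> \<pi> X"
  shows "X \<in> vc_complexes" "rz Z \<iota> \<pi> (Ix (fst X)) (fam 1 (snd X))" "Z \<in> ob"
  using assms rzD(1) by (auto simp: R_def)

lemma R_lorth: "R Z \<iota> \<pi> X \<Longrightarrow> lorth Z"
  using rz_lorth[OF RD(2) graded_fam] .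

lemma R_exists:
  assumes X: "X \<in> vc_complexes" shows "\<exists>Z \<iota> \<pi>. R Z \<iota> \<pi> X"
proof -
  note d = vc_complexesD[OF X]
  have "\<forall>a\<in>Ix (fst X). \<forall>c\<in>Ix (fst X). (\<Sum>b\<in>Ix (fst X). fam 1 (snd X) a b * fam 1 (snd X) b c) = 0"
  proof (intro ballI)
    fix a c assume a: "a \<in> Ix (fst X)" and c: "c \<in> Ix (fst X)"
    obtain i r j s where ac: "a = (i, r)" "c = (j, s)" by (cases a, cases c)
    show "(\<Sum>b\<in>Ix (fst X). fam 1 (snd X) a b * fam 1 (snd X) b c) = 0"
      unfolding fam_comp[OF d(1,2,2) a c] using a c by (auto simp: fam_def d(4) ac)
  qed
  then obtain Z \<iota> \<pi> where "rz Z \<iota> \<pi> (Ix (fst X)) (fam 1 (snd X))"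
    using rz_exists[OF d(1) graded_fam] by blast
  then show ?thesis using X unfolding R_def by blast
qed

lemma mf_hom: "R Z \<iota> \<pi> X \<Longrightarrow> R Z' \<iota>' \<pi>' Y \<Longrightarrow> mf k \<iota>' Y \<pi> X f \<in> hom Z Z' k"
  unfolding mf_def by (intro mo_hom[OF RD(2) RD(2)] graded_fam)

lemma mf_surj:
  assumes X: "R Z \<iota> \<pi> X" and Y: "R Z' \<iota>' \<pi>' Y" and F: "F \<in> hom Z Z' k"
  shows "\<exists>f \<in> FM k X Y. F = mf k \<iota>' Y \<pi> X f"
proof -
  obtain m where m: "graded k (Ix (fst Y)) (Ix (fst X)) m" "F = mo \<iota>' (Ix (fst Y)) \<pi> (Ix (fst X)) m"
    using mo_surj[OF RD(2)[OF X] RD(2)[OF Y] F] by blast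
  obtain f where f: "f \<in> FM k X Y" "\<And>a b. a \<in> Ix (fst Y) \<Longrightarrow> b \<in> Ix (fst X) \<Longrightarrow> m a b = fam k f a b"
    using fam_surj[of Y X m k] m(1) unfolding graded_def by blast
  have "F = mf k \<iota>' Y \<pi> X f" unfolding m(2) mf_def using f(2) by (rule mo_cong)
  then show ?thesis using f(1) by blast
qed

lemma mf_inj:
  assumes "R Z \<iota> \<pi> X" "R Z' \<iota>' \<pi>' Y" "f \<in> FM k X Y" "g \<in> FM k X Y" "mf k \<iota>' Y \<pi> X f = mf k \<iota>' Y \<pi> X g"
  shows "f = g"
  using assms(5) mo_inj[OF RD(2)[OF assms(1)] RD(2)[OF assms(2)]] unfolding mf_def
  by (intro fam_inj[OF assms(3,4)]) blast

lemma mf_comp: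
  assumes X: "R Z \<iota> \<pi> X" and Y: "R Z' \<iota>' \<pi>' Y" and f: "f \<in> FM k X Y" and g: "g \<in> FM l Y W"
    and W: "R Z'' \<iota>'' \<pi>'' W"
  shows "mf l \<iota>'' W \<pi>' Y g * mf k \<iota>' Y \<pi> X f = mf (k + l) \<iota>'' W \<pi> X (\<lambda>j. g (j + k) * f j)"
  unfolding mf_def mo_comp[OF RD(2)[OF Y] RD(2)[OF W]]
  using fam_comp[OF vc_complexesD(1)[OF RD(1)[OF Y]] f g] by (rule mo_cong)

lemma mf_D: "R Z \<iota> \<pi> X \<Longrightarrow> mf 1 \<iota> X \<pi> X (snd X) = D Z"
  unfolding mf_def using mo_D[OF RD(2)] .

lemma mf_one: "R Z \<iota> \<pi> X \<Longrightarrow> mf 0 \<iota> X \<pi> X (\<lambda>j. 1\<^sub>m (fst X j)) = one Z"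
  unfolding mf_def mo_one[OF RD(2), symmetric] by (rule mo_cong[OF fam_one])

lemma mf_add: "f \<in> FM k X Y \<Longrightarrow> g \<in> FM k X Y \<Longrightarrow>
    mf k \<iota>' Y \<pi> X (\<lambda>j. f j + g j) = mf k \<iota>' Y \<pi> X f + mf k \<iota>' Y \<pi> X g"
  unfolding mf_def mo_add[symmetric] by (rule mo_cong) (rule fam_add)

lemma mf_diff: "f \<in> FM k X Y \<Longrightarrow> g \<in> FM k X Y \<Longrightarrow>
    mf k \<iota>' Y \<pi> X (\<lambda>j. f j - g j) = mf k \<iota>' Y \<pi> X f - mf k \<iota>' Y \<pi> X g"
  unfolding mf_def mo_diff[symmetric] by (rule mo_cong) (rule fam_diff)

lemma mf_scale: "f \<in> FM k X Y \<Longrightarrow> mf k \<iota>' Y \<pi> X (\<lambda>j. c \<cdot>\<^sub>m f j) = sc c * mf k \<iota>' Y \<pi> X f"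
  unfolding mf_def mo_sc[symmetric] by (rule mo_cong) (rule fam_scale)

lemma mf_D_left:
  assumes X: "R Z \<iota> \<pi> X" and Y: "R Z' \<iota>' \<pi>' Y" and f: "f \<in> FM k X Y"
  shows "D Z' * mf k \<iota>' Y \<pi> X f = mf (k + 1) \<iota>' Y \<pi> X (\<lambda>j. snd Y (j + k) * f j)"
  unfolding mf_D[OF Y, symmetric] by (rule mf_comp[OF X Y f vc_complexesD(2)[OF RD(1)[OF Y]] Y])

lemma mf_D_right:
  assumes X: "R Z \<iota> \<pi> X" and Y: "R Z' \<iota>' \<pi>' Y" and f: "f \<in> FM k X Y"
  shows "mf k \<iota>' Y \<pi> X f * D Z = mf (1 + k) \<iota>' Y \<pi> X (\<lambda>j. f (j + 1) * snd X j)"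
  unfolding mf_D[OF X, symmetric] by (rule mf_comp[OF X X vc_complexesD(2)[OF RD(1)[OF X]] f Y])

lemma mult_FM:
  assumes "f \<in> FM k X Y" "g \<in> FM l Y W" "m = k + l" shows "(\<lambda>j. g (j + k) * f j) \<in> FM m X W"
  unfolding FM_def
proof (intro CollectI allI)
  fix j
  have "g (j + k) \<in> carrier_mat (fst W (j + m)) (fst Y (j + k))" "f j \<in> carrier_mat (fst Y (j + k)) (fst X j)"
    using assms by (simp_all add: FM_def) (metis add.assoc)
  then show "g (j + k) * f j \<in> carrier_mat (fst W (j + m)) (fst X j)" by simp
qed

text \<open>Both composites with the differentials are given by families of degree 1, and a family
  is determined by the morphism it defines.\<close>

lemma mf_cyc_iff:
  assumes X: "R Z \<iota> \<pi> X" and Y: "R Z' \<iota>' \<pi>' Y" and f: "f \<in> FM 0 X Y"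
  shows "mf 0 \<iota>' Y \<pi> X f \<in> cyc Z Z' 0 \<longleftrightarrow> f \<in> vc_maps X Y"
proof -
  note dX = vc_complexesD(2)[OF RD(1)[OF X]] and dY = vc_complexesD(2)[OF RD(1)[OF Y]]
  have 1: "(\<lambda>j. snd Y (j + 0) * f j) \<in> FM 1 X Y" by (rule mult_FM[OF f dY]) simp
  have 2: "(\<lambda>j. f (j + 1) * snd X j) \<in> FM 1 X Y" by (rule mult_FM[OF dX f]) simp
  have "mf 0 \<iota>' Y \<pi> X f \<in> cyc Z Z' 0 \<longleftrightarrow> D Z' * mf 0 \<iota>' Y \<pi> X f = mf 0 \<iota>' Y \<pi> X f * D Z"
    using mf_hom[OF X Y] by (simp add: cyc_def sn_simps)
  also have "\<dots> \<longleftrightarrow> (\<lambda>j. snd Y (j + 0) * f j) = (\<lambda>j. f (j + 1) * snd X j)"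
    using mf_inj[OF X Y 1 2] unfolding mf_D_left[OF X Y f] mf_D_right[OF X Y f] by auto
  also have "\<dots> \<longleftrightarrow> f \<in> vc_maps X Y" using f by (auto simp: vc_maps_def FM_def fun_eq_iff)
  finally show ?thesis .
qed

lemma mf_cyc_surj:
  assumes X: "R Z \<iota> \<pi> X" and Y: "R Z' \<iota>' \<pi>' Y" and F: "F \<in> cyc Z Z' 0"
  shows "\<exists>f \<in> vc_maps X Y. F = mf 0 \<iota>' Y \<pi> X f"
  using mf_surj[OF X Y cyc_hom[OF F]] mf_cyc_iff[OF X Y] F by blast

text \<open>Every morphism of degree -1 comes from a family of matrices, and in degree 0 the
  boundary has a plus sign, as in \<open>vc_homotopic\<close>. Together with
  \<open>mf_cyc_surj\<close> this makes the passage from complexes to twisted complexes fully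
  faithful up to homotopy.\<close>

lemma mf_bnd_iff:
  assumes X: "R Z \<iota> \<pi> X" and Y: "R Z' \<iota>' \<pi>' Y" and f: "f \<in> FM 0 X Y" and g: "g \<in> FM 0 X Y"
  shows "mf 0 \<iota>' Y \<pi> X f - mf 0 \<iota>' Y \<pi> X g \<in> bnd Z Z' 0 \<longleftrightarrow> vc_homotopic X Y f g"
proof -
  note dX = vc_complexesD(2)[OF RD(1)[OF X]] and dY = vc_complexesD(2)[OF RD(1)[OF Y]]
  let ?H = "\<lambda>h j. snd Y (j - 1) * h j + h (j + 1) * snd X j"
  have fg: "(\<lambda>j. f j - g j) \<in> FM 0 X Y" using f g unfolding FM_def by (auto intro!: minus_carrier_mat)
  have H: "D Z' * mf (-1) \<iota>' Y \<pi> X h + mf (-1) \<iota>' Y \<pi> X h * D Z = mf 0 \<iota>' Y \<pi> X (?H h)"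
    and HFM: "?H h \<in> FM 0 X Y" if h: "h \<in> FM (-1) X Y" for h
  proof -
    have 1: "(\<lambda>j. snd Y (j + -1) * h j) \<in> FM 0 X Y" by (rule mult_FM[OF h dY]) simp
    have 2: "(\<lambda>j. h (j + 1) * snd X j) \<in> FM 0 X Y" by (rule mult_FM[OF dX h]) simp
    show "D Z' * mf (-1) \<iota>' Y \<pi> X h + mf (-1) \<iota>' Y \<pi> X h * D Z = mf 0 \<iota>' Y \<pi> X (?H h)"
      unfolding mf_D_left[OF X Y h] mf_D_right[OF X Y h] using mf_add[OF 1 2] by simp
    show "?H h \<in> FM 0 X Y" using 1 2 by (auto simp: FM_def)
  qed
  have "mf 0 \<iota>' Y \<pi> X f - mf 0 \<iota>' Y \<pi> X g \<in> bnd Z Z' 0 \<longleftrightarrow>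
      (\<exists>h \<in> FM (-1) X Y. mf 0 \<iota>' Y \<pi> X (\<lambda>j. f j - g j) = mf 0 \<iota>' Y \<pi> X (?H h))" (is "?L \<longleftrightarrow> ?R")
  proof
    assume ?L
    then obtain F where F: "F \<in> hom Z Z' (-1)"
      "mf 0 \<iota>' Y \<pi> X f - mf 0 \<iota>' Y \<pi> X g = D Z' * F + F * D Z"
      unfolding bnd_def by (auto simp: sn_simps)
    obtain h where "h \<in> FM (-1) X Y" "F = mf (-1) \<iota>' Y \<pi> X h" using mf_surj[OF X Y F(1)] by blast
    then show ?R using F(2) H mf_diff[OF f g] by auto
  next
    assume ?R
    then obtain h where h: "h \<in> FM (-1) X Y" "mf 0 \<iota>' Y \<pi> X (\<lambda>j. f j - g j) = mf 0 \<iota>' Y \<pi> X (?H h)"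
      by blast
    have "mf 0 \<iota>' Y \<pi> X f - mf 0 \<iota>' Y \<pi> X g
        = D Z' * mf (-1) \<iota>' Y \<pi> X h + sn 0 * mf (-1) \<iota>' Y \<pi> X h * D Z"
      using h(2) H[OF h(1)] mf_diff[OF f g] by (simp add: sn_simps)
    then show ?L unfolding bnd_def using mf_hom[OF X Y, of "-1" h] by auto
  qed
  also have "\<dots> \<longleftrightarrow> (\<exists>h \<in> FM (-1) X Y. (\<lambda>j. f j - g j) = ?H h)"
  proof (rule bex_cong[OF refl], rule iffI)
    fix h assume h: "h \<in> FM (-1) X Y" "mf 0 \<iota>' Y \<pi> X (\<lambda>j. f j - g j) = mf 0 \<iota>' Y \<pi> X (?H h)"
    show "(\<lambda>j. f j - g j) = ?H h" by (rule mf_inj[OF X Y fg HFM[OF h(1)] h(2)])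
  qed (rule arg_cong[where f = "mf 0 \<iota>' Y \<pi> X"])
  also have "\<dots> \<longleftrightarrow> vc_homotopic X Y f g"
    by (auto simp: vc_homotopic_def FM_def fun_eq_iff)
  finally show ?thesis .
qed

lemma mf_eqI:
  assumes X: "R Z \<iota> \<pi> X" and Y: "R Z' \<iota>' \<pi>' Y" and F: "F \<in> hom Z Z' k"
    and eq: "\<And>a b. a \<in> Ix (fst Y) \<Longrightarrow> b \<in> Ix (fst X) \<Longrightarrow> \<pi>' a * F * \<iota> b = sc (fam k f a b) * one E"
  shows "F = mf k \<iota>' Y \<pi> X f"
proof -
  obtain m where m: "F = mo \<iota>' (Ix (fst Y)) \<pi> (Ix (fst X)) m"
    using mo_surj[OF RD(2)[OF X] RD(2)[OF Y] F] by blast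
  have "m a b = fam k f a b" if "a \<in> Ix (fst Y)" "b \<in> Ix (fst X)" for a b
  proof -
    have "sc (m a b - fam k f a b) * one E = 0"
      using eq[OF that] mo_entry[OF RD(2)[OF X] RD(2)[OF Y] that, of m] m
      by (simp add: sc_diff left_diff_distrib)
    then show ?thesis using sc_one_E by fastforce
  qed
  then show ?thesis unfolding m mf_def by (rule mo_cong)
qed

end

subsection \<open>Shifts and cones\<close>

text \<open>An index of \<open>X[1]\<close> as an index of \<open>X\<close>: the term of
  \<open>X[1]\<close> in degree \<open>i\<close> is the term of \<open>X\<close> in degree
  \<open>i + 1\<close>.\<close>

definition up :: "int \<times> nat \<Rightarrow> int \<times> nat" where
  "up x = (fst x + 1, snd x)"

lemma sum_up: "(\<Sum>x\<in>Ix (\<lambda>i. n (i + 1)). g (up x)) = (\<Sum>x\<in>Ix n. g x)"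
proof -
  have "Ix n = up ` Ix (\<lambda>i. n (i + 1))"
  proof (intro equalityI subsetI)
    fix x assume "x \<in> Ix n"
    then show "x \<in> up ` Ix (\<lambda>i. n (i + 1))"
      by (intro image_eqI[of _ _ "(fst x - 1, snd x)"]) (auto simp: up_def Ix_def)
  qed (auto simp: up_def Ix_def)
  moreover have "inj_on up (Ix (\<lambda>i. n (i + 1)))" by (auto simp: up_def inj_on_def)
  ultimately show ?thesis by (simp add: sum.reindex)
qed

lemma up_Ix: "up x \<in> Ix n \<longleftrightarrow> x \<in> Ix (\<lambda>i. n (i + 1))"
  by (auto simp: up_def Ix_def)

lemma vc_shift_complexes:
  assumes X: "X \<in> vc_complexes" shows "vc_shift k X \<in> vc_complexes"
proof -
  have fin: "finite {i. fst X i \<noteq> 0}" using X by (auto simp: vc_complexes_def)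
  have "{i. fst X (i + k) \<noteq> 0} \<subseteq> (\<lambda>i. i - k) ` {i. fst X i \<noteq> 0}"
  proof
    fix i assume "i \<in> {i. fst X (i + k) \<noteq> 0}"
    then show "i \<in> (\<lambda>i. i - k) ` {i. fst X i \<noteq> 0}" by (intro image_eqI[of _ _ "i + k"]) auto
  qed
  then have "finite {i. fst X (i + k) \<noteq> 0}" using fin finite_surj by blast
  moreover have c: "snd X (i + k) \<in> carrier_mat (fst X (i + 1 + k)) (fst X (i + k))" for i
    using vc_complexesD(3)[OF X, of "i + k"] by (simp add: algebra_simps)
  moreover have "(sg k \<cdot>\<^sub>m snd X (i + 1 + k)) * (sg k \<cdot>\<^sub>m snd X (i + k)) = 0\<^sub>m (fst X (i + 2 + k)) (fst X (i + k))" for i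
  proof -
    have c': "snd X (i + 1 + k) \<in> carrier_mat (fst X (i + 2 + k)) (fst X (i + 1 + k))"
      using c[of "i + 1"] by (simp add: algebra_simps)
    have "snd X (i + 1 + k) * snd X (i + k) = 0\<^sub>m (fst X (i + 2 + k)) (fst X (i + k))"
      using vc_complexesD(4)[OF X, of "i + k"] by (simp add: algebra_simps)
    then show ?thesis
      unfolding mult_smult_assoc_mat[OF c' smult_carrier_mat[OF c]] mult_smult_distrib[OF c' c]
      by (simp add: eq_matI)
  qed
  ultimately show ?thesis by (simp add: vc_shift_def vc_complexes_def)
qed

lemma vc_shift_simps:
  "fst (vc_shift 1 X) = (\<lambda>i. fst X (i + 1))" "snd (vc_shift 1 X) = (\<lambda>i. (- 1) \<cdot>\<^sub>m snd X (i + 1))"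
  by (simp_all add: vc_shift_def)

text \<open>The differentials of source and target both change sign, and the signs cancel.\<close>

lemma vc_shift_maps:
  assumes X: "X \<in> vc_complexes" and Y: "Y \<in> vc_complexes"
  shows "(\<lambda>i. f (i + 1)) \<in> vc_maps (vc_shift 1 X) (vc_shift 1 Y) \<longleftrightarrow> f \<in> vc_maps X Y"
proof -
  have sh: "(\<forall>i. P (i + 1)) \<longleftrightarrow> (\<forall>i :: int. P i)" for P by (metis diff_add_cancel)
  have minus: "A = B" if "(- 1) \<cdot>\<^sub>m A = (- 1) \<cdot>\<^sub>m (B :: complex mat)" for A B
  proof (rule eq_matI)
    have d: "dim_row A = dim_row B" "dim_col A = dim_col B"
      using arg_cong[OF that, of dim_row] arg_cong[OF that, of dim_col] by auto
    fix i j assume "i < dim_row B" "j < dim_col B"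
    then show "A $$ (i, j) = B $$ (i, j)" using arg_cong[OF that, of "\<lambda>M. M $$ (i, j)"] d by simp
  qed (use arg_cong[OF that, of dim_row] arg_cong[OF that, of dim_col] in auto)
  have eq: "((- 1) \<cdot>\<^sub>m snd Y i) * f i = f (i + 1) * ((- 1) \<cdot>\<^sub>m snd X i) \<longleftrightarrow> snd Y i * f i = f (i + 1) * snd X i"
    if "\<And>i. f i \<in> carrier_mat (fst Y i) (fst X i)" for i
    using minus mult_smult_assoc_mat[OF vc_complexesD(3)[OF Y] that[of i]]
      mult_smult_distrib[OF that[of "i + 1"] vc_complexesD(3)[OF X]] by metis
  show ?thesis
    unfolding vc_maps_def vc_shift_simps mem_Collect_eq
      sh[of "\<lambda>i. f i \<in> carrier_mat (fst Y i) (fst X i)"]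
      sh[of "\<lambda>i. (- 1) \<cdot>\<^sub>m snd Y i * f i = f (i + 1) * ((- 1) \<cdot>\<^sub>m snd X i)"]
    using eq by blast
qed

text \<open>Inclusion of the indices of \<open>X[1]\<close> into those of the cone of \<open>X \<rightarrow> Y\<close>, for the indices of \<open>X\<close>.\<close>

definition cup :: "cplx \<Rightarrow> int \<times> nat \<Rightarrow> int \<times> nat" where
  "cup Y x = (fst x - 1, fst Y (fst x - 1) + snd x)"

lemma cone_Ix: "Ix (fst (vc_cone X Y f)) = Ix (fst Y) \<union> cup Y ` Ix (fst X)"
proof (intro equalityI subsetI)
  fix x assume x: "x \<in> Ix (fst (vc_cone X Y f))"
  obtain i a where ia: "x = (i, a)" by (cases x)
  have "x = cup Y (i + 1, a - fst Y i)" if "\<not> a < fst Y i" using that by (simp add: cup_def ia)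
  then show "x \<in> Ix (fst Y) \<union> cup Y ` Ix (fst X)" using x by (force simp: ia vc_cone_def)
qed (auto simp: cup_def vc_cone_def Ix_def)

lemma cup_notin: "cup Y x \<notin> Ix (fst Y)"
  by (simp add: cup_def)

lemma cup_inj: "inj (cup Y)"
  by (auto simp: cup_def inj_def)

lemma sum_cone:
  assumes "finite (Ix (fst X))" "finite (Ix (fst Y))"
  shows "(\<Sum>c\<in>Ix (fst (vc_cone X Y f)). g c) = (\<Sum>y\<in>Ix (fst Y). g y) + (\<Sum>x\<in>Ix (fst X). g (cup Y x))"
proof -
  have "Ix (fst Y) \<inter> cup Y ` Ix (fst X) = {}" using cup_notin by blast
  then show ?thesis unfolding cone_Ix
    using assms by (simp add: sum.union_disjoint sum.reindex inj_on_subset[OF cup_inj])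
qed

lemma cone_entries:
  assumes X: "X \<in> vc_complexes" and Y: "Y \<in> vc_complexes" and f: "f \<in> FM 0 X Y"
  shows "\<And>y y'. y \<in> Ix (fst Y) \<Longrightarrow> y' \<in> Ix (fst Y) \<Longrightarrow>
      fam 1 (snd (vc_cone X Y f)) y' y = fam 1 (snd Y) y' y"
    and "\<And>x y. x \<in> Ix (fst X) \<Longrightarrow> y \<in> Ix (fst Y) \<Longrightarrow> fam 1 (snd (vc_cone X Y f)) (cup Y x) y = 0"
    and "\<And>x y. x \<in> Ix (fst X) \<Longrightarrow> y \<in> Ix (fst Y) \<Longrightarrow> fam 1 (snd (vc_cone X Y f)) y (cup Y x) = fam 0 f y x"
    and "\<And>x x'. x \<in> Ix (fst X) \<Longrightarrow> x' \<in> Ix (fst X) \<Longrightarrow>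
      fam 1 (snd (vc_cone X Y f)) (cup Y x') (cup Y x) = - fam 1 (snd X) x' x"
proof -
  have dX: "dim_row (snd X i) = fst X (i + 1)" "dim_col (snd X i) = fst X i" for i
    using vc_complexesD(3)[OF X, of i] by auto
  have dY: "dim_row (snd Y i) = fst Y (i + 1)" "dim_col (snd Y i) = fst Y i" for i
    using vc_complexesD(3)[OF Y, of i] by auto
  have fc: "f i \<in> carrier_mat (fst Y i) (fst X i)" for i using f by (simp add: FM_def)
  note df = fc[THEN carrier_matD(1)] fc[THEN carrier_matD(2)]
  note d = fam_def vc_cone_def cup_def dX dY df ac_simps
  show "fam 1 (snd (vc_cone X Y f)) y' y = fam 1 (snd Y) y' y"
    if "y \<in> Ix (fst Y)" "y' \<in> Ix (fst Y)" for y y'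
    using that by (cases y; cases y') (auto simp: d)
  show "fam 1 (snd (vc_cone X Y f)) (cup Y x) y = 0" if "x \<in> Ix (fst X)" "y \<in> Ix (fst Y)" for x y
    using that by (cases x; cases y) (auto simp: d)
  show "fam 1 (snd (vc_cone X Y f)) y (cup Y x) = fam 0 f y x"
    if "x \<in> Ix (fst X)" "y \<in> Ix (fst Y)" for x y
    using that by (cases x; cases y) (auto simp: d)
  show "fam 1 (snd (vc_cone X Y f)) (cup Y x') (cup Y x) = - fam 1 (snd X) x' x"
    if "x \<in> Ix (fst X)" "x' \<in> Ix (fst X)" for x x'
    using that by (cases x; cases x') (auto simp: d)
qed

lemma vc_cone_complexes:
  assumes X: "X \<in> vc_complexes" and Y: "Y \<in> vc_complexes" and f: "f \<in> vc_maps X Y"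
  shows "vc_cone X Y f \<in> vc_complexes"
proof -
  have c: "snd X i \<in> carrier_mat (fst X (i + 1)) (fst X i)" "snd Y i \<in> carrier_mat (fst Y (i + 1)) (fst Y i)"
    "f i \<in> carrier_mat (fst Y i) (fst X i)" for i
    using vc_complexesD(3) X Y f by (auto simp: vc_maps_def)
  have "{i. fst X (i + 1) \<noteq> 0} \<subseteq> (\<lambda>i. i - 1) ` {i. fst X i \<noteq> 0}"
  proof
    fix i assume "i \<in> {i. fst X (i + 1) \<noteq> 0}"
    then show "i \<in> (\<lambda>i. i - 1) ` {i. fst X i \<noteq> 0}" by (intro image_eqI[of _ _ "i + 1"]) auto
  qed
  moreover have "finite {i. fst X i \<noteq> 0}" "finite {i. fst Y i \<noteq> 0}"
    using X Y by (auto simp: vc_complexes_def)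
  ultimately have "finite ({i. fst Y i \<noteq> 0} \<union> {i. fst X (i + 1) \<noteq> 0})" using finite_surj by blast
  then have fin: "finite {i. fst Y i + fst X (i + 1) \<noteq> 0}" by (rule finite_subset[rotated]) auto
  \<comment> \<open>The off-diagonal block of the square is \<open>d f - f d\<close>, which vanishes
    because \<open>f\<close> is a chain map.\<close>
  have sq: "four_block_mat (snd Y (i + 1)) (f (i + 1 + 1)) (0\<^sub>m (fst X (i + 1 + 2)) (fst Y (i + 1))) (- snd X (i + 1 + 1))
     * four_block_mat (snd Y i) (f (i + 1)) (0\<^sub>m (fst X (i + 2)) (fst Y i)) (- snd X (i + 1))
     = 0\<^sub>m (fst Y (i + 2) + fst X (i + 3)) (fst Y i + fst X (i + 1))" (is "?L = _") for i
  proof -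
    have s: "i + 1 + 1 = i + 2" "i + 2 + 1 = i + 3" "i + 1 + 2 = i + 3" by auto
    note c' = c(1)[of "i + 1", unfolded s] c(1)[of "i + 2", unfolded s] c(2)[of i] c(2)[of "i + 1", unfolded s]
      c(3)[of "i + 1"] c(3)[of "i + 2"]
    have m: "- snd X (i + 1) \<in> carrier_mat (fst X (i + 2)) (fst X (i + 1))"
      "- snd X (i + 2) \<in> carrier_mat (fst X (i + 3)) (fst X (i + 2))" using c' by auto
    have "?L = four_block_mat
       (snd Y (i + 1) * snd Y i + f (i + 2) * 0\<^sub>m (fst X (i + 2)) (fst Y i))
       (snd Y (i + 1) * f (i + 1) + f (i + 2) * (- snd X (i + 1)))
       (0\<^sub>m (fst X (i + 3)) (fst Y (i + 1)) * snd Y i + (- snd X (i + 2)) * 0\<^sub>m (fst X (i + 2)) (fst Y i))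
       (0\<^sub>m (fst X (i + 3)) (fst Y (i + 1)) * f (i + 1) + (- snd X (i + 2)) * (- snd X (i + 1)))"
      unfolding s by (rule mult_four_block_mat) (use c' m in auto)
    moreover have "snd Y (i + 1) * snd Y i = 0\<^sub>m (fst Y (i + 2)) (fst Y i)"
      "snd X (i + 2) * snd X (i + 1) = 0\<^sub>m (fst X (i + 3)) (fst X (i + 1))"
      using vc_complexesD(4)[OF Y, of i] vc_complexesD(4)[OF X, of "i + 1"] by (simp_all add: algebra_simps)
    moreover have "snd Y (i + 1) * f (i + 1) = f (i + 2) * snd X (i + 1)"
      using f unfolding vc_maps_def by (simp add: algebra_simps)
    moreover have "f (i + 2) * snd X (i + 1) + - (f (i + 2) * snd X (i + 1)) = 0\<^sub>m (fst Y (i + 2)) (fst X (i + 1))"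
      by (rule eq_matI) (use c' in auto)
    ultimately show ?thesis using c' m by (simp add: uminus_mult_left_mat uminus_mult_right_mat four_block_zero_mat)
  qed
  have "four_block_mat (snd Y i) (f (i + 1)) (0\<^sub>m (fst X (i + 2)) (fst Y i)) (- snd X (i + 1))
     \<in> carrier_mat (fst Y (i + 1) + fst X (i + 1 + 1)) (fst Y i + fst X (i + 1))" for i
    using c(1)[of "i + 1"] c(2)[of i] by (intro four_block_carrier_mat) auto
  then show ?thesis
    using fin sq unfolding vc_complexes_def vc_cone_def by (simp add: algebra_simps)
qed

context dg_ops
begin

text \<open>The same inclusions and projections serve, re-indexed by \<open>up\<close>: the shift
  moves their degrees by one and changes the sign of \<open>D\<close>, just as
  \<open>vc_shift\<close> changes the sign of the differential.\<close>

lemma R_shift: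
  assumes X: "R Z \<iota> \<pi> X"
  shows "R (sh 1 Z) (\<lambda>a. \<iota> (up a)) (\<lambda>a. \<pi> (up a)) (vc_shift 1 X)"
proof -
  note Z = RD(2)[OF X] and Zo = RD(3)[OF X] and Xc = RD(1)[OF X]
  let ?A = "Ix (\<lambda>i. fst X (i + 1))"
  have q: "fam 1 (snd (vc_shift 1 X)) a b = - fam 1 (snd X) (up a) (up b)" if "a \<in> ?A" "b \<in> ?A" for a b
  proof -
    obtain i r j s where ab: "a = (i, r)" "b = (j, s)" by (cases a, cases b)
    have "snd X (j + 1) \<in> carrier_mat (fst X (j + 1 + 1)) (fst X (j + 1))" using vc_complexesD(3)[OF Xc] .
    then show ?thesis using that by (auto simp: fam_def up_def ab vc_shift_simps)
  qed
  have fin: "finite ?A"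
    using vc_complexesD(1)[OF vc_shift_complexes[OF Xc, of 1]] by (simp add: vc_shift_simps)
  have u: "up a \<in> Ix (fst X)" if "a \<in> ?A" for a using that up_Ix by blast
  have upinj: "up a = up b \<longleftrightarrow> a = b" for a b by (auto simp: up_def prod_eq_iff)
  have "rz (sh 1 Z) (\<lambda>a. \<iota> (up a)) (\<lambda>a. \<pi> (up a)) ?A (fam 1 (snd (vc_shift 1 X)))"
    unfolding rz_def
  proof (intro conjI ballI)
    fix a assume a: "a \<in> ?A"
    show "\<iota> (up a) \<in> hom E (sh 1 Z) (fst a)"
      using rzD(3)[OF Z u[OF a]] hom_sh_right[OF E_ob Zo] by (simp add: up_def)
    show "\<pi> (up a) \<in> hom (sh 1 Z) E (- fst a)"
      using rzD(4)[OF Z u[OF a]] hom_sh_left[OF Zo E_ob] by (simp add: up_def)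
    fix b assume b: "b \<in> ?A"
    show "\<pi> (up a) * \<iota> (up b) = (if a = b then one E else 0)"
      using rzD(5)[OF Z u[OF a] u[OF b]] by (simp add: upinj)
  next
    show "(\<Sum>a\<in>?A. \<iota> (up a) * \<pi> (up a)) = one (sh 1 Z)"
      using sum_up[of "\<lambda>a. \<iota> a * \<pi> a" "fst X"] rzD(6)[OF Z] one_sh[OF Zo] by simp
  next
    fix b assume b: "b \<in> ?A"
    have "D (sh 1 Z) * \<iota> (up b) = - (\<Sum>a\<in>Ix (fst X). sc (fam 1 (snd X) a (up b)) * \<iota> a)"
      using rzD(7)[OF Z u[OF b]] D_sh[OF Zo] by (simp add: sn_simps)
    also have "\<dots> = (\<Sum>a\<in>?A. sc (fam 1 (snd (vc_shift 1 X)) a b) * \<iota> (up a))"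
      using q[OF _ b] sum_up[of "\<lambda>a. sc (fam 1 (snd X) a (up b)) * \<iota> a" "fst X"]
      by (simp add: sc_minus sum_negf)
    finally show "D (sh 1 Z) * \<iota> (up b) = (\<Sum>a\<in>?A. sc (fam 1 (snd (vc_shift 1 X)) a b) * \<iota> (up a))" .
  qed (use fin sh_ob Zo in auto)
  then show ?thesis using vc_shift_complexes[OF Xc] by (simp add: R_def vc_shift_simps)
qed

lemma mf_shift:
  "mf 0 (\<lambda>a. \<iota>' (up a)) (vc_shift 1 Y) (\<lambda>a. \<pi> (up a)) (vc_shift 1 X) (\<lambda>i. f (i + 1)) = mf 0 \<iota>' Y \<pi> X f"
proof -
  have "fam 0 (\<lambda>i. f (i + 1)) a b = fam 0 f (up a) (up b)" for a b
    by (cases a; cases b) (simp add: fam_def up_def)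
  then show ?thesis
    unfolding mf_def mo_def vc_shift_simps
    using sum_up[of "\<lambda>a. \<Sum>b\<in>Ix (fst X). sc (fam 0 f a b) * (\<iota>' a * \<pi> b)" "fst Y"]
      sum_up[of "\<lambda>b. sc (fam 0 f _ b) * (\<iota>' _ * \<pi> b)" "fst X"] by simp
qed

text \<open>An index outside \<open>Ix (fst Y)\<close> belongs to \<open>X[1]\<close> and is decoded
  by the inverse of \<open>cup\<close>.\<close>

definition \<iota>C :: "'o \<Rightarrow> 'o \<Rightarrow> cplx \<Rightarrow> (int \<times> nat \<Rightarrow> 'r) \<Rightarrow> (int \<times> nat \<Rightarrow> 'r) \<Rightarrow> int \<times> nat \<Rightarrow> 'r" where
  "\<iota>C Z Z' Y \<iota> \<iota>' a = (if a \<in> Ix (fst Y) then cj Z Z' * \<iota>' a else ct Z Z' * \<iota> (inv_into UNIV (cup Y) a))"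

definition \<pi>C :: "'o \<Rightarrow> 'o \<Rightarrow> cplx \<Rightarrow> (int \<times> nat \<Rightarrow> 'r) \<Rightarrow> (int \<times> nat \<Rightarrow> 'r) \<Rightarrow> int \<times> nat \<Rightarrow> 'r" where
  "\<pi>C Z Z' Y \<pi> \<pi>' a = (if a \<in> Ix (fst Y) then \<pi>' a * cs Z Z' else \<pi> (inv_into UNIV (cup Y) a) * cp Z Z')"

lemma C_simps:
  "y \<in> Ix (fst Y) \<Longrightarrow> \<iota>C Z Z' Y \<iota> \<iota>' y = cj Z Z' * \<iota>' y" "\<iota>C Z Z' Y \<iota> \<iota>' (cup Y x) = ct Z Z' * \<iota> x"
  "y \<in> Ix (fst Y) \<Longrightarrow> \<pi>C Z Z' Y \<pi> \<pi>' y = \<pi>' y * cs Z Z'" "\<pi>C Z Z' Y \<pi> \<pi>' (cup Y x) = \<pi> x * cp Z Z'"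
  using cup_notin by (simp_all add: \<iota>C_def \<pi>C_def inv_f_f[OF cup_inj])

text \<open>The coordinates of both ends, carried into the cone by \<open>cj\<close>,
  \<open>ct\<close>, \<open>cs\<close> and \<open>cp\<close>, have the block matrix of
  \<open>vc_cone\<close> as twisting matrix: by \<open>cone_D\<close>, the differential on the image
  of \<open>ct\<close> produces \<open>f\<close> into \<open>Y\<close> and minus the differential of
  \<open>X\<close>. So realisation is compatible with cones.\<close>

lemma R_cone:
  assumes X: "R Z \<iota> \<pi> X" and Y: "R Z' \<iota>' \<pi>' Y" and f: "f \<in> vc_maps X Y"
  shows "R (cn Z Z' (mf 0 \<iota>' Y \<pi> X f)) (\<iota>C Z Z' Y \<iota> \<iota>') (\<pi>C Z Z' Y \<pi> \<pi>') (vc_cone X Y f)"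
proof -
  note rX = RD(2)[OF X] and rY = RD(2)[OF Y] and ob = RD(3)[OF X] RD(3)[OF Y]
    and Xc = RD(1)[OF X] and Yc = RD(1)[OF Y] and fFM = vc_maps_FM[OF f]
  let ?F = "mf 0 \<iota>' Y \<pi> X f" and ?A = "Ix (fst X)" and ?B = "Ix (fst Y)" and ?K = "Ix (fst (vc_cone X Y f))"
  let ?I = "\<iota>C Z Z' Y \<iota> \<iota>'" and ?P = "\<pi>C Z Z' Y \<pi> \<pi>'"
  have F: "?F \<in> cyc Z Z' 0" using mf_cyc_iff[OF X Y fFM] f by simp
  let ?C = "cn Z Z' ?F" and ?j = "cj Z Z'" and ?s = "cs Z Z'" and ?t = "ct Z Z'" and ?p = "cp Z Z'"
  have C: "?C \<in> ob" using cn_ob[OF ob F] .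
  have h: "?j \<in> hom Z' ?C 0" "?s \<in> hom ?C Z' 0" "?t \<in> hom Z ?C (- 1)" "?p \<in> hom ?C Z 1"
    using cone_hom[OF ob F] by auto
  have e: "?p * ?t = one Z" "?s * ?j = one Z'" "?s * ?t = 0" "?p * ?j = 0"
    and id: "?j * ?s + ?t * ?p = one ?C" using cone_eqs[OF ob F] by auto
  note cD = cone_D[OF ob F]
  note fin = rzD(2)[OF rX] rzD(2)[OF rY]
  note ent = cone_entries[OF Xc Yc fFM]
  have l: "?p * (?t * \<iota> x) = \<iota> x" "?s * (?t * z) = 0" if "x \<in> ?A" for x z
    using one_left[OF E_ob ob(1) rzD(3)[OF rX that]] e by (metis mult.assoc, metis mult.assoc mult_zero_left)
  have l': "?s * (?j * \<iota>' y) = \<iota>' y" "?p * (?j * z) = 0" if "y \<in> ?B" for y z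
    using one_left[OF E_ob ob(2) rzD(3)[OF rY that]] e by (metis mult.assoc, metis mult.assoc mult_zero_left)
  have Fx: "?F * \<iota> x = (\<Sum>y\<in>?B. sc (fam 0 f y x) * \<iota>' y)" if x: "x \<in> ?A" for x
  proof -
    have "?F * \<iota> x = (\<Sum>y\<in>?B. \<Sum>b\<in>?A. if b = x then sc (fam 0 f y x) * \<iota>' y else 0)"
      unfolding mf_def mo_def sum_distrib_right
    proof (intro sum.cong refl)
      fix y b assume y: "y \<in> ?B" and b: "b \<in> ?A"
      show "sc (fam 0 f y b) * (\<iota>' y * \<pi> b) * \<iota> x = (if b = x then sc (fam 0 f y x) * \<iota>' y else 0)"
        using rzD(5)[OF rX b x] one_right[OF E_ob ob(2) rzD(3)[OF rY y]] by (auto simp: mult.assoc)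
    qed
    then show ?thesis using fin x by simp
  qed
  have K: "c \<in> ?K \<Longrightarrow> (\<And>y. y \<in> ?B \<Longrightarrow> c = y \<Longrightarrow> Q) \<Longrightarrow> (\<And>x. x \<in> ?A \<Longrightarrow> c = cup Y x \<Longrightarrow> Q) \<Longrightarrow> Q" for c Q
    unfolding cone_Ix by blast
  have deg: "fst (cup Y x) = fst x - 1" for x by (simp add: cup_def)
  have "rz ?C ?I ?P ?K (fam 1 (snd (vc_cone X Y f)))"
    unfolding rz_def
  proof (intro conjI ballI)
    show "?C \<in> ob" by (rule C)
    show "finite ?K" unfolding cone_Ix using fin by simp
    fix c assume c: "c \<in> ?K"
    show "?I c \<in> hom E ?C (fst c)"
    proof (rule K[OF c])
      fix y assume "y \<in> ?B" "c = y"
      then show ?thesis using hom_comp[OF E_ob ob(2) C rzD(3)[OF rY] h(1)] by (simp add: C_simps)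
    next
      fix x assume "x \<in> ?A" "c = cup Y x"
      then show ?thesis using hom_comp[OF E_ob ob(1) C rzD(3)[OF rX] h(3)] by (simp add: C_simps deg)
    qed
    show "?P c \<in> hom ?C E (- fst c)"
    proof (rule K[OF c])
      fix y assume "y \<in> ?B" "c = y"
      then show ?thesis using hom_comp[OF C ob(2) E_ob h(2) rzD(4)[OF rY]] by (simp add: C_simps)
    next
      fix x assume "x \<in> ?A" "c = cup Y x"
      then show ?thesis using hom_comp[OF C ob(1) E_ob h(4) rzD(4)[OF rX]] by (simp add: C_simps deg)
    qed
    fix c' assume c': "c' \<in> ?K"
    show "?P c * ?I c' = (if c = c' then one E else 0)"
    proof (rule K[OF c]; rule K[OF c'])
      fix y y' assume "y \<in> ?B" "c = y" "y' \<in> ?B" "c' = y'"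
      then show ?thesis using rzD(5)[OF rY, of y y'] l' by (simp add: C_simps mult.assoc)
    next
      fix x y assume "y \<in> ?B" "c = y" "x \<in> ?A" "c' = cup Y x"
      then show ?thesis using l cup_notin[of Y x] by (auto simp: C_simps mult.assoc)
    next
      fix x y assume "x \<in> ?A" "c = cup Y x" "y \<in> ?B" "c' = y"
      then show ?thesis using l' cup_notin[of Y x] by (auto simp: C_simps mult.assoc)
    next
      fix x x' assume "x \<in> ?A" "c = cup Y x" "x' \<in> ?A" "c' = cup Y x'"
      then show ?thesis using rzD(5)[OF rX, of x x'] l by (simp add: C_simps mult.assoc inj_eq[OF cup_inj])
    qed
  next
    have "(\<Sum>y\<in>?B. ?I y * ?P y) = ?j * (\<Sum>y\<in>?B. \<iota>' y * \<pi>' y) * ?s"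
      by (simp add: C_simps sum_distrib_left sum_distrib_right mult.assoc)
    moreover have "(\<Sum>x\<in>?A. ?I (cup Y x) * ?P (cup Y x)) = ?t * (\<Sum>x\<in>?A. \<iota> x * \<pi> x) * ?p"
      by (simp add: C_simps sum_distrib_left sum_distrib_right mult.assoc)
    ultimately show "(\<Sum>c\<in>?K. ?I c * ?P c) = one ?C"
      unfolding sum_cone[OF fin] rzD(6)[OF rX] rzD(6)[OF rY]
      using one_right[OF ob(2) C h(1)] one_right[OF ob(1) C h(3)] id by simp
  next
    fix c assume c: "c \<in> ?K"
    show "D ?C * ?I c = (\<Sum>a\<in>?K. sc (fam 1 (snd (vc_cone X Y f)) a c) * ?I a)"
      unfolding sum_cone[OF fin]
    proof (rule K[OF c])
      fix y assume y: "y \<in> ?B" "c = y"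
      have "D ?C * ?I c = ?j * (D Z' * \<iota>' y)"
        using y mult_eq_assoc[OF cD(1)] by (simp add: C_simps mult.assoc)
      then show "D ?C * ?I c = (\<Sum>a\<in>?B. sc (fam 1 (snd (vc_cone X Y f)) a c) * ?I a)
          + (\<Sum>x\<in>?A. sc (fam 1 (snd (vc_cone X Y f)) (cup Y x) c) * ?I (cup Y x))"
        using y ent(1,2) rzD(7)[OF rY y(1)] by (simp add: C_simps sum_distrib_left sc_left_comm[of ?j] sc_0)
    next
      fix x assume x: "x \<in> ?A" "c = cup Y x"
      have "D ?C * ?I c = ?j * (?F * \<iota> x) - ?t * (D Z * \<iota> x)"
        using x mult_eq_assoc[OF cD(2), of "\<iota> x"] by (simp add: C_simps left_diff_distrib mult.assoc)
      then show "D ?C * ?I c = (\<Sum>a\<in>?B. sc (fam 1 (snd (vc_cone X Y f)) a c) * ?I a)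
          + (\<Sum>x\<in>?A. sc (fam 1 (snd (vc_cone X Y f)) (cup Y x) c) * ?I (cup Y x))"
        using x ent(3,4) rzD(7)[OF rX x(1)] Fx[OF x(1)]
        by (simp add: C_simps sum_distrib_left sc_left_comm[of ?j] sc_left_comm[of ?t] sc_minus sum_negf)
    qed
  qed
  then show ?thesis using vc_cone_complexes[OF Xc Yc f] by (simp add: R_def)
qed

text \<open>Comparison of entries in the coordinates of \<open>R_cone\<close>; those at indices of
  \<open>X[1]\<close> vanish by \<open>cp * cj = 0\<close>.\<close>

lemma cone_in_eq:
  assumes X: "R Z \<iota> \<pi> X" and Y: "R Z' \<iota>' \<pi>' Y" and f: "f \<in> vc_maps X Y"
  shows "cj Z Z' = mf 0 (\<iota>C Z Z' Y \<iota> \<iota>') (vc_cone X Y f) \<pi>' Y (vc_cone_in X Y)"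
proof -
  note rX = RD(2)[OF X] and rY = RD(2)[OF Y] and ob = RD(3)[OF X] RD(3)[OF Y]
  have F: "mf 0 \<iota>' Y \<pi> X f \<in> cyc Z Z' 0" using mf_cyc_iff[OF X Y vc_maps_FM[OF f]] f by simp
  note e = cone_eqs[OF ob F]
  show ?thesis
  proof (rule mf_eqI[OF Y R_cone[OF X Y f]])
    show "cj Z Z' \<in> hom Z' (cn Z Z' (mf 0 \<iota>' Y \<pi> X f)) 0" using cone_hom[OF ob F] by simp
    fix c y assume c: "c \<in> Ix (fst (vc_cone X Y f))" and y: "y \<in> Ix (fst Y)"
    have o: "one Z' * \<iota>' y = \<iota>' y" using one_left[OF E_ob ob(2) rzD(3)[OF rY y]] .
    consider (1) "c \<in> Ix (fst Y)" | (2) x where "x \<in> Ix (fst X)" "c = cup Y x" using c unfolding cone_Ix by blast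
    then show "\<pi>C Z Z' Y \<pi> \<pi>' c * cj Z Z' * \<iota>' y = sc (fam 0 (vc_cone_in X Y) c y) * one E"
    proof cases
      case 1
      have "\<pi>C Z Z' Y \<pi> \<pi>' c * cj Z Z' * \<iota>' y = \<pi>' c * ((cs Z Z' * cj Z Z') * \<iota>' y)"
        using 1 by (simp add: C_simps mult.assoc)
      then have "\<pi>C Z Z' Y \<pi> \<pi>' c * cj Z Z' * \<iota>' y = \<pi>' c * \<iota>' y" using e o by simp
      then show ?thesis using rzD(5)[OF rY 1 y] 1 y
        by (cases c; cases y) (auto simp: fam_def vc_cone_in_def sc_0 sc_1)
    next
      case 2
      have "\<pi>C Z Z' Y \<pi> \<pi>' c * cj Z Z' * \<iota>' y = \<pi> x * ((cp Z Z' * cj Z Z') * \<iota>' y)"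
        using 2 by (simp add: C_simps mult.assoc)
      then show ?thesis using e 2 y
        by (cases x; cases y) (auto simp: fam_def vc_cone_in_def cup_def sc_0)
    qed
  qed
qed

text \<open>Again a comparison of entries, with the target in the coordinates of
  \<open>R_shift\<close>; now the entries at indices of \<open>Y\<close> vanish by
  \<open>cp * cj = 0\<close>.\<close>

lemma cone_out_eq:
  assumes X: "R Z \<iota> \<pi> X" and Y: "R Z' \<iota>' \<pi>' Y" and f: "f \<in> vc_maps X Y"
  shows "cp Z Z' = mf 0 (\<lambda>a. \<iota> (up a)) (vc_shift 1 X) (\<pi>C Z Z' Y \<pi> \<pi>') (vc_cone X Y f) (vc_cone_out X Y)"
proof -
  note rX = RD(2)[OF X] and rY = RD(2)[OF Y] and ob = RD(3)[OF X] RD(3)[OF Y]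
  have F: "mf 0 \<iota>' Y \<pi> X f \<in> cyc Z Z' 0" using mf_cyc_iff[OF X Y vc_maps_FM[OF f]] f by simp
  note e = cone_eqs[OF ob F]
  show ?thesis
  proof (rule mf_eqI[OF R_cone[OF X Y f] R_shift[OF X]])
    show "cp Z Z' \<in> hom (cn Z Z' (mf 0 \<iota>' Y \<pi> X f)) (sh 1 Z) 0"
      using cone_hom[OF ob F] hom_sh_right[OF cn_ob[OF ob F] ob(1)] by simp
    fix a c assume a: "a \<in> Ix (fst (vc_shift 1 X))" and c: "c \<in> Ix (fst (vc_cone X Y f))"
    have ua: "up a \<in> Ix (fst X)" using a by (simp add: up_Ix vc_shift_simps)
    consider (1) "c \<in> Ix (fst Y)" | (2) x where "x \<in> Ix (fst X)" "c = cup Y x" using c unfolding cone_Ix by blast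
    then show "\<pi> (up a) * cp Z Z' * \<iota>C Z Z' Y \<iota> \<iota>' c = sc (fam 0 (vc_cone_out X Y) a c) * one E"
    proof cases
      case 1
      have "\<pi> (up a) * cp Z Z' * \<iota>C Z Z' Y \<iota> \<iota>' c = \<pi> (up a) * ((cp Z Z' * cj Z Z') * \<iota>' c)"
        using 1 by (simp add: C_simps mult.assoc)
      then show ?thesis using e 1 ua
        by (cases a; cases c) (auto simp: fam_def vc_cone_out_def up_def sc_0)
    next
      case 2
      have o: "one Z * \<iota> x = \<iota> x" using one_left[OF E_ob ob(1) rzD(3)[OF rX 2(1)]] .
      have "\<pi> (up a) * cp Z Z' * \<iota>C Z Z' Y \<iota> \<iota>' c = \<pi> (up a) * ((cp Z Z' * ct Z Z') * \<iota> x)"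
        using 2 by (simp add: C_simps mult.assoc)
      then have "\<pi> (up a) * cp Z Z' * \<iota>C Z Z' Y \<iota> \<iota>' c = \<pi> (up a) * \<iota> x" using e o by simp
      then show ?thesis using rzD(5)[OF rX ua 2(1)] ua 2
        by (cases a; cases x) (auto simp: fam_def vc_cone_out_def up_def cup_def sc_0 sc_1)
    qed
  qed
qed

end

section \<open>Quasi-isomorphisms of complexes\<close>

lemma d_prev:
  assumes "X \<in> vc_complexes" shows "snd X (i - 1) \<in> carrier_mat (fst X i) (fst X (i - 1))"
  using vc_complexesD(3)[OF assms, of "i - 1"] by simp

lemma vc_cls_self:
  assumes X: "X \<in> vc_complexes" and v: "v \<in> carrier_vec (fst X i)" shows "v \<in> vc_cls X i v"
proof -
  have "snd X (i - 1) *\<^sub>v 0\<^sub>v (fst X (i - 1)) = 0\<^sub>v (fst X i)" using d_prev[OF X, of i] by auto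
  then show ?thesis unfolding vc_cls_def using v
    by (intro CollectI exI[of _ "0\<^sub>v (fst X (i - 1))"]) simp
qed

lemma vc_cls_eq:
  assumes X: "X \<in> vc_complexes" and v: "v \<in> carrier_vec (fst X i)" and v': "v' \<in> vc_cls X i v"
  shows "vc_cls X i v' = vc_cls X i v"
proof -
  note d = d_prev[OF X, of i]
  obtain u where u: "u \<in> carrier_vec (fst X (i - 1))" "v' = v + snd X (i - 1) *\<^sub>v u"
    using v' unfolding vc_cls_def by blast
  have "v' + snd X (i - 1) *\<^sub>v w = v + snd X (i - 1) *\<^sub>v (u + w)" if "w \<in> carrier_vec (fst X (i - 1))" for w
    unfolding u(2) mult_add_distrib_mat_vec[OF d u(1) that]
    using v u that d by (intro assoc_add_vec[of _ "fst X i"]) auto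
  moreover have "v + snd X (i - 1) *\<^sub>v w = v' + snd X (i - 1) *\<^sub>v (w - u)"
    if w: "w \<in> carrier_vec (fst X (i - 1))" for w
    unfolding u(2) mult_minus_distrib_mat_vec[OF d w u(1)]
    using v u w d by (intro eq_vecI) auto
  moreover have "u + w \<in> carrier_vec (fst X (i - 1))" "w - u \<in> carrier_vec (fst X (i - 1))"
    if "w \<in> carrier_vec (fst X (i - 1))" for w
    using that u(1) by auto
  ultimately have "vc_cls X i v' \<subseteq> vc_cls X i v" "vc_cls X i v \<subseteq> vc_cls X i v'"
    unfolding vc_cls_def by blast+
  then show ?thesis by (rule equalityI)
qed

lemma vc_kernel:
  assumes "X \<in> vc_complexes"
  shows "mat_kernel (snd X i) = {v \<in> carrier_vec (fst X i). snd X i *\<^sub>v v = 0\<^sub>v (fst X (i + 1))}"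
  using vc_complexesD(3)[OF assms, of i] by (auto simp: mat_kernel_def)

text \<open>\<open>f\<close> maps coboundaries to coboundaries, so the union in
  \<open>vc_qis\<close> runs over equal sets and is the class of a single vector.\<close>

lemma vc_cls_push:
  assumes X: "X \<in> vc_complexes" and Y: "Y \<in> vc_complexes" and f: "f \<in> vc_maps X Y"
    and v: "v \<in> carrier_vec (fst X i)"
  shows "(\<Union>w \<in> vc_cls X i v. vc_cls Y i (f i *\<^sub>v w)) = vc_cls Y i (f i *\<^sub>v v)"
proof -
  have fc: "f j \<in> carrier_mat (fst Y j) (fst X j)" for j using f by (simp add: vc_maps_def)
  have fv: "f i *\<^sub>v v \<in> carrier_vec (fst Y i)" using fc[of i] v by simp
  have "vc_cls Y i (f i *\<^sub>v w) = vc_cls Y i (f i *\<^sub>v v)" if "w \<in> vc_cls X i v" for w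
  proof -
    obtain u where u: "u \<in> carrier_vec (fst X (i - 1))" "w = v + snd X (i - 1) *\<^sub>v u"
      using \<open>w \<in> vc_cls X i v\<close> unfolding vc_cls_def by blast
    have comm: "f i * snd X (i - 1) = snd Y (i - 1) * f (i - 1)"
      using f unfolding vc_maps_def by (metis (mono_tags, lifting) diff_add_cancel mem_Collect_eq)
    have "f i *\<^sub>v w = f i *\<^sub>v v + f i *\<^sub>v (snd X (i - 1) *\<^sub>v u)"
      unfolding u(2) using mult_add_distrib_mat_vec[OF fc v] u(1) d_prev[OF X, of i] by simp
    also have "f i *\<^sub>v (snd X (i - 1) *\<^sub>v u) = snd Y (i - 1) *\<^sub>v (f (i - 1) *\<^sub>v u)"
      using assoc_mult_mat_vec[OF fc[of i] d_prev[OF X, of i] u(1)]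
        assoc_mult_mat_vec[OF d_prev[OF Y, of i] fc[of "i - 1"] u(1)]
        comm by simp
    finally have "f i *\<^sub>v w \<in> vc_cls Y i (f i *\<^sub>v v)"
      unfolding vc_cls_def using u(1) fc[of "i - 1"] by auto
    then show ?thesis using vc_cls_eq[OF Y fv] by blast
  qed
  then show ?thesis using vc_cls_self[OF X v] by blast
qed

text \<open>The classes of \<open>v\<close> and of 0 have the same image, so injectivity on
  cohomology makes \<open>v\<close> a coboundary.\<close>

lemma vc_qis_inj:
  assumes X: "X \<in> vc_complexes" and Y: "Y \<in> vc_complexes" and f: "f \<in> vc_maps X Y" and q: "vc_qis X Y f"
    and v: "v \<in> mat_kernel (snd X i)" and w: "w \<in> carrier_vec (fst Y (i - 1))" "f i *\<^sub>v v = snd Y (i - 1) *\<^sub>v w"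
  shows "\<exists>u \<in> carrier_vec (fst X (i - 1)). v = snd X (i - 1) *\<^sub>v u"
proof -
  have fc: "f i \<in> carrier_mat (fst Y i) (fst X i)" using f by (simp add: vc_maps_def)
  have vc: "v \<in> carrier_vec (fst X i)" using v vc_kernel[OF X] by simp
  let ?z = "0\<^sub>v (fst X i) :: complex vec"
  have z: "?z \<in> mat_kernel (snd X i)" using vc_kernel[OF X] vc_complexesD(3)[OF X, of i] by auto
  have "snd Y (i - 1) *\<^sub>v w = 0\<^sub>v (fst Y i) + snd Y (i - 1) *\<^sub>v w"
    using w(1) d_prev[OF Y, of i] by simp
  moreover have "f i *\<^sub>v ?z = 0\<^sub>v (fst Y i)" using fc by auto
  ultimately have "f i *\<^sub>v v \<in> vc_cls Y i (f i *\<^sub>v ?z)"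
    unfolding vc_cls_def w(2) using w(1) by auto
  then have "vc_cls Y i (f i *\<^sub>v v) = vc_cls Y i (f i *\<^sub>v ?z)" using vc_cls_eq[OF Y, of "f i *\<^sub>v ?z"] fc by auto
  then have eq: "(\<Union>w \<in> vc_cls X i v. vc_cls Y i (f i *\<^sub>v w)) = (\<Union>w \<in> vc_cls X i ?z. vc_cls Y i (f i *\<^sub>v w))"
    using vc_cls_push[OF X Y f] vc by simp
  have inj: "inj_on (\<lambda>c. \<Union>v \<in> c. vc_cls Y i (f i *\<^sub>v v)) (vc_coh X i)"
    using q by (simp add: vc_qis_def bij_betw_def)
  have "vc_cls X i v \<in> vc_coh X i" "vc_cls X i ?z \<in> vc_coh X i"
    unfolding vc_coh_def by (rule imageI[OF v], rule imageI[OF z])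
  then have "vc_cls X i v = vc_cls X i ?z" by (rule inj_onD[OF inj eq])
  then have "v \<in> vc_cls X i ?z" using vc_cls_self[OF X vc] by simp
  then obtain u where "u \<in> carrier_vec (fst X (i - 1))" "v = ?z + snd X (i - 1) *\<^sub>v u"
    unfolding vc_cls_def by blast
  then show ?thesis using d_prev[OF X, of i] by auto
qed

lemma vc_qis_surj:
  assumes X: "X \<in> vc_complexes" and Y: "Y \<in> vc_complexes" and f: "f \<in> vc_maps X Y" and q: "vc_qis X Y f"
    and w: "w \<in> mat_kernel (snd Y i)"
  shows "\<exists>v \<in> mat_kernel (snd X i). \<exists>u \<in> carrier_vec (fst Y (i - 1)). w = f i *\<^sub>v v + snd Y (i - 1) *\<^sub>v u"
proof -
  have "(\<lambda>c. \<Union>v \<in> c. vc_cls Y i (f i *\<^sub>v v)) ` vc_coh X i = vc_coh Y i"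
    using q by (simp add: vc_qis_def bij_betw_def)
  moreover have "vc_cls Y i w \<in> vc_coh Y i" using w by (simp add: vc_coh_def)
  ultimately have "vc_cls Y i w \<in> (\<lambda>c. \<Union>v \<in> c. vc_cls Y i (f i *\<^sub>v v)) ` vc_coh X i" by simp
  then obtain c where c: "c \<in> vc_coh X i" "vc_cls Y i w = (\<Union>v \<in> c. vc_cls Y i (f i *\<^sub>v v))"
    by (rule imageE)
  obtain v where "v \<in> mat_kernel (snd X i)" "c = vc_cls X i v"
    using c(1) unfolding vc_coh_def by (rule imageE)
  note v = this(1) c(2)[unfolded this(2)]
  have "vc_cls Y i w = vc_cls Y i (f i *\<^sub>v v)" using v vc_cls_push[OF X Y f] vc_kernel[OF X] by simp
  then have "w \<in> vc_cls Y i (f i *\<^sub>v v)" using vc_cls_self[OF Y, of w i] w vc_kernel[OF Y] by simp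
  then show ?thesis using v(1) unfolding vc_cls_def by blast
qed

text \<open>Puts the identities into the localising class, so that roofs with an identity as leg
  exist.\<close>

lemma vc_qis_id:
  assumes X: "X \<in> vc_complexes" shows "vc_qis X X (\<lambda>i. 1\<^sub>m (fst X i))"
  unfolding vc_qis_def
proof
  fix i
  have "(\<Union>w \<in> c. vc_cls X i (1\<^sub>m (fst X i) *\<^sub>v w)) = c" if "c \<in> vc_coh X i" for c
  proof -
    obtain v where v: "v \<in> carrier_vec (fst X i)" "c = vc_cls X i v"
      using \<open>c \<in> vc_coh X i\<close> vc_kernel[OF X] unfolding vc_coh_def by blast
    have "(\<lambda>i. 1\<^sub>m (fst X i)) \<in> vc_maps X X"
      using vc_complexesD(3)[OF X] unfolding vc_maps_def
      by (auto simp: left_mult_one_mat[OF vc_complexesD(3)[OF X]] right_mult_one_mat[OF vc_complexesD(3)[OF X]])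
    from vc_cls_push[OF X X this v(1)] show ?thesis using v by simp
  qed
  then show "bij_betw (\<lambda>c. \<Union>v \<in> c. vc_cls X i (1\<^sub>m (fst X i) *\<^sub>v v)) (vc_coh X i) (vc_coh X i)"
    by (simp add: bij_betw_def inj_on_def)
qed

context dg_ops
begin

text \<open>A vector of \<open>X\<close> in degree \<open>k\<close> as a morphism of degree
  \<open>k\<close> from \<open>E\<close>, written as a matrix with one column so that the rules for
  \<open>mo\<close> apply.\<close>

definition el :: "(int \<times> nat \<Rightarrow> 'r) \<Rightarrow> cplx \<Rightarrow> int \<Rightarrow> complex vec \<Rightarrow> 'r" where
  "el \<iota> X k v = mo \<iota> (Ix (fst X)) (\<lambda>_. one E) {(0, 0)} (\<lambda>x _. if fst x = k then v $ snd x else 0)"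

lemma el_eq:
  assumes "R Z \<iota> \<pi> X" shows "el \<iota> X k v = (\<Sum>a<fst X k. sc (v $ a) * \<iota> (k, a))"
proof -
  note Z = RD(2)[OF assms]
  have "el \<iota> X k v = (\<Sum>x\<in>Ix (fst X). sc (if fst x = k then v $ snd x else 0) * \<iota> x)"
    unfolding el_def mo_def using one_right[OF E_ob rzD(1)[OF Z] rzD(3)[OF Z]] by (intro sum.cong refl) simp
  also have "\<dots> = (\<Sum>a<fst X k. sc (v $ a) * \<iota> (k, a))"
    using rzD(2)[OF Z] by (subst sum_Ix[where k = k]) (auto simp: sc_0)
  finally show ?thesis .
qed

lemma el_hom: "R Z \<iota> \<pi> X \<Longrightarrow> el \<iota> X k v \<in> hom E Z k"
  unfolding el_def by (intro mo_hom[OF rz_E RD(2)]) (auto simp: graded_def)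

lemma el_surj:
  assumes X: "R Z \<iota> \<pi> X" and u: "u \<in> hom E Z k"
  shows "\<exists>v \<in> carrier_vec (fst X k). u = el \<iota> X k v"
proof -
  obtain c where "u = (\<Sum>a<fst X k. sc (c a) * \<iota> (k, a))" using hom_E_rz[OF RD(2)[OF X] u] by blast
  then show ?thesis unfolding el_eq[OF X] by (intro bexI[of _ "vec (fst X k) c"]) simp_all
qed

lemma el_inj:
  assumes X: "R Z \<iota> \<pi> X" and v: "v \<in> carrier_vec (fst X k)" "w \<in> carrier_vec (fst X k)"
    and eq: "el \<iota> X k v = el \<iota> X k w"
  shows "v = w"
proof (rule eq_vecI)
  fix a assume "a < dim_vec w"
  then show "v $ a = w $ a"
    using mo_inj[OF rz_E RD(2)[OF X] eq[unfolded el_def], of "(k, a)" "(0, 0)"] v by auto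
qed (use v in auto)

lemma el_add:
  assumes "R Z \<iota> \<pi> X" "v \<in> carrier_vec (fst X k)" "w \<in> carrier_vec (fst X k)"
  shows "el \<iota> X k (v + w) = el \<iota> X k v + el \<iota> X k w"
  unfolding el_eq[OF assms(1)] sum.distrib[symmetric]
  using assms(2,3) by (intro sum.cong refl) (simp add: sc_add distrib_right)

lemma mf_el:
  assumes X: "R Z \<iota> \<pi> X" and Y: "R Z' \<iota>' \<pi>' Y" and f: "f \<in> FM l X Y" and v: "v \<in> carrier_vec (fst X k)"
  shows "mf l \<iota>' Y \<pi> X f * el \<iota> X k v = el \<iota>' Y (k + l) (f k *\<^sub>v v)"
  unfolding mf_def el_def mo_comp[OF RD(2)[OF X] RD(2)[OF Y]]
proof (rule mo_cong)
  fix a b :: "int \<times> nat" assume a: "a \<in> Ix (fst Y)"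
  have fk: "f k \<in> carrier_mat (fst Y (k + l)) (fst X k)" using f by (simp add: FM_def)
  have "(\<Sum>b\<in>Ix (fst X). fam l f a b * (if fst b = k then v $ snd b else 0))
      = (\<Sum>b<fst X k. fam l f a (k, b) * v $ b)"
    using vc_complexesD(1)[OF RD(1)[OF X]] by (subst sum_Ix[where k = k]) auto
  also have "\<dots> = (if fst a = k + l then (f k *\<^sub>v v) $ snd a else 0)"
    using a fk v by (cases a) (auto simp: fam_def scalar_prod_def lessThan_atLeast0 intro!: sum.cong)
  finally show "(\<Sum>b\<in>Ix (fst X). fam l f a b * (if fst b = k then v $ snd b else 0))
      = (if fst a = k + l then (f k *\<^sub>v v) $ snd a else 0)" .
qed

lemma D_el:
  assumes X: "R Z \<iota> \<pi> X" and v: "v \<in> carrier_vec (fst X k)"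
  shows "D Z * el \<iota> X k v = el \<iota> X (k + 1) (snd X k *\<^sub>v v)"
  using mf_el[OF X X vc_complexesD(2)[OF RD(1)[OF X]] v] mf_D[OF X] by simp

lemma el_0: "R Z \<iota> \<pi> X \<Longrightarrow> el \<iota> X k (0\<^sub>v (fst X k)) = 0"
  by (simp add: el_eq sc_0)

lemma cyc_el:
  assumes X: "R Z \<iota> \<pi> X" and u: "u \<in> cyc E Z k"
  shows "\<exists>v \<in> mat_kernel (snd X k). u = el \<iota> X k v"
proof -
  have uh: "u \<in> hom E Z k" and Du: "D Z * u = 0" using u by (auto simp: cyc_E)
  obtain v where v: "v \<in> carrier_vec (fst X k)" "u = el \<iota> X k v" using el_surj[OF X uh] by blast
  have "el \<iota> X (k + 1) (snd X k *\<^sub>v v) = el \<iota> X (k + 1) (0\<^sub>v (fst X (k + 1)))"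
    using D_el[OF X v(1)] Du v(2) el_0[OF X] by simp
  then have "snd X k *\<^sub>v v = 0\<^sub>v (fst X (k + 1))"
    by (rule el_inj[OF X, rotated 2]) (use v(1) vc_complexesD(3)[OF RD(1)[OF X], of k] in auto)
  then show ?thesis using v vc_kernel[OF RD(1)[OF X]] by auto
qed

lemma el_cyc: "R Z \<iota> \<pi> X \<Longrightarrow> v \<in> mat_kernel (snd X k) \<Longrightarrow> el \<iota> X k v \<in> cyc E Z k"
  using D_el[of Z \<iota> \<pi> X v k] el_hom[of Z \<iota> \<pi> X k v] el_0[of Z \<iota> \<pi> X "k + 1"] vc_kernel[OF RD(1)] by (simp add: cyc_E)

lemma bnd_el_iff:
  assumes X: "R Z \<iota> \<pi> X" and v: "v \<in> carrier_vec (fst X k)"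
  shows "el \<iota> X k v \<in> bnd E Z k \<longleftrightarrow> (\<exists>w \<in> carrier_vec (fst X (k - 1)). v = snd X (k - 1) *\<^sub>v w)"
proof
  assume "el \<iota> X k v \<in> bnd E Z k"
  then obtain h where h: "h \<in> hom E Z (k - 1)" "el \<iota> X k v = D Z * h" by (auto simp: bnd_E)
  obtain w where w: "w \<in> carrier_vec (fst X (k - 1))" "h = el \<iota> X (k - 1) w" using el_surj[OF X h(1)] by blast
  have "el \<iota> X k v = el \<iota> X k (snd X (k - 1) *\<^sub>v w)" using h(2) w(2) D_el[OF X w(1)] by simp
  then have "v = snd X (k - 1) *\<^sub>v w" using el_inj[OF X v] w(1) d_prev[OF RD(1)[OF X], of k] by simp
  then show "\<exists>w \<in> carrier_vec (fst X (k - 1)). v = snd X (k - 1) *\<^sub>v w" using w(1) by blast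
next
  assume "\<exists>w \<in> carrier_vec (fst X (k - 1)). v = snd X (k - 1) *\<^sub>v w"
  then obtain w where "w \<in> carrier_vec (fst X (k - 1))" "v = snd X (k - 1) *\<^sub>v w" by blast
  then have "el \<iota> X k v = D Z * el \<iota> X (k - 1) w" using D_el[OF X, of w "k - 1"] by simp
  then show "el \<iota> X k v \<in> bnd E Z k" unfolding bnd_E using el_hom[OF X] by blast
qed

text \<open>Through \<open>el\<close> the Hom-complex from \<open>E\<close> to the realisation of
  \<open>X\<close> is \<open>X\<close> itself, so a bijection on the cohomology of complexes is one
  on the cohomology of these Hom-complexes.\<close>

lemma qis_qi:
  assumes X: "R Z \<iota> \<pi> X" and Y: "R Z' \<iota>' \<pi>' Y" and f: "f \<in> vc_maps X Y" and q: "vc_qis X Y f"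
  shows "qi Z Z' (mf 0 \<iota>' Y \<pi> X f)"
proof -
  note Xc = RD(1)[OF X] and Yc = RD(1)[OF Y] and fFM = vc_maps_FM[OF f]
  have fc: "f k \<in> carrier_mat (fst Y k) (fst X k)" for k using f by (simp add: vc_maps_def)
  have ker: "v \<in> carrier_vec (fst X k)" if "v \<in> mat_kernel (snd X k)" for v k
    using that vc_kernel[OF Xc] by simp
  show ?thesis
    unfolding qi_def
  proof (intro conjI allI ballI impI)
    show "mf 0 \<iota>' Y \<pi> X f \<in> cyc Z Z' 0" using mf_cyc_iff[OF X Y fFM] f by simp
    fix k u assume u: "u \<in> cyc E Z k" and fu: "mf 0 \<iota>' Y \<pi> X f * u \<in> bnd E Z' k"
    obtain v where v: "v \<in> mat_kernel (snd X k)" "u = el \<iota> X k v" using cyc_el[OF X u] by blast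
    have "el \<iota>' Y k (f k *\<^sub>v v) \<in> bnd E Z' k" using fu v mf_el[OF X Y fFM ker[OF v(1)]] by simp
    then obtain w where "w \<in> carrier_vec (fst Y (k - 1))" "f k *\<^sub>v v = snd Y (k - 1) *\<^sub>v w"
      using bnd_el_iff[OF Y, of "f k *\<^sub>v v" k] fc[of k] ker[OF v(1)] by auto
    then show "u \<in> bnd E Z k"
      using vc_qis_inj[OF Xc Yc f q v(1)] bnd_el_iff[OF X ker[OF v(1)]] v(2) by simp
  next
    fix k u assume u: "u \<in> cyc E Z' k"
    obtain w where w: "w \<in> mat_kernel (snd Y k)" "u = el \<iota>' Y k w" using cyc_el[OF Y u] by blast
    obtain v y where v: "v \<in> mat_kernel (snd X k)" and y: "y \<in> carrier_vec (fst Y (k - 1))"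
      and eq: "w = f k *\<^sub>v v + snd Y (k - 1) *\<^sub>v y" using vc_qis_surj[OF Xc Yc f q w(1)] by blast
    have c: "f k *\<^sub>v v \<in> carrier_vec (fst Y k)" "snd Y (k - 1) *\<^sub>v y \<in> carrier_vec (fst Y k)"
      using fc[of k] ker[OF v] y d_prev[OF Yc, of k] by auto
    have "u - mf 0 \<iota>' Y \<pi> X f * el \<iota> X k v = el \<iota>' Y k (snd Y (k - 1) *\<^sub>v y)"
      using mf_el[OF X Y fFM ker[OF v]] w(2) el_add[OF Y c] eq by simp
    also have "\<dots> \<in> bnd E Z' k" using bnd_el_iff[OF Y c(2)] y by blast
    finally show "\<exists>v \<in> cyc E Z k. u - mf 0 \<iota>' Y \<pi> X f * v \<in> bnd E Z' k"
      using el_cyc[OF X v] by blast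
  qed (use RD(3) X Y in blast)+
qed

end

section \<open>Embedding the bounded derived category\<close>

text \<open>\<open>T\<close> is tied to the operators by the class map \<open>cl\<close>, under
  which it is the category H^0 with the cones as standard triangles. Since shifts do not alter
  operators, they are the identity on morphisms of \<open>T\<close>.\<close>

locale dg_tricat = dg_ops sc ob one D hom E sh cn cj cs ct cp
  for sc :: "complex \<Rightarrow> 'r::ring_1" and ob :: "'o set" and one D :: "'o \<Rightarrow> 'r"
    and hom :: "'o \<Rightarrow> 'o \<Rightarrow> int \<Rightarrow> 'r set" and E :: 'o and sh :: "int \<Rightarrow> 'o \<Rightarrow> 'o"
    and cn :: "'o \<Rightarrow> 'o \<Rightarrow> 'r \<Rightarrow> 'o" and cj cs ct cp :: "'o \<Rightarrow> 'o \<Rightarrow> 'r" +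
  fixes T :: "('o, 'm) tricat" and cl :: "'o \<Rightarrow> 'o \<Rightarrow> 'r \<Rightarrow> 'm"
  assumes T_ob: "lc_ob T = ob"
    and T_hom: "\<lbrakk>X \<in> ob; Y \<in> ob\<rbrakk> \<Longrightarrow> lc_hom T X Y = cl X Y ` cyc X Y 0"
    and cl_eq: "\<lbrakk>X \<in> ob; Y \<in> ob; f \<in> cyc X Y 0; g \<in> cyc X Y 0\<rbrakk>
      \<Longrightarrow> cl X Y f = cl X Y g \<longleftrightarrow> f - g \<in> bnd X Y 0"
    and T_id: "X \<in> ob \<Longrightarrow> lc_id T X = cl X X (one X)"
    and T_comp: "\<lbrakk>X \<in> ob; Y \<in> ob; Z \<in> ob; f \<in> cyc X Y 0; g \<in> cyc Y Z 0\<rbrakk>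
      \<Longrightarrow> lc_comp T X Y Z (cl Y Z g) (cl X Y f) = cl X Z (g * f)"
    and T_zero: "\<lbrakk>X \<in> ob; Y \<in> ob\<rbrakk> \<Longrightarrow> lc_zero T X Y = cl X Y 0"
    and T_add: "\<lbrakk>X \<in> ob; Y \<in> ob; f \<in> cyc X Y 0; g \<in> cyc X Y 0\<rbrakk>
      \<Longrightarrow> lc_add T X Y (cl X Y f) (cl X Y g) = cl X Y (f + g)"
    and T_scale: "\<lbrakk>X \<in> ob; Y \<in> ob; f \<in> cyc X Y 0\<rbrakk>
      \<Longrightarrow> lc_scale T X Y c (cl X Y f) = cl X Y (sc c * f)"
    and T_sh: "tc_sh T = sh" and T_shm: "tc_shm T = (\<lambda>k F. F)"
    and cl_sh: "\<lbrakk>X \<in> ob; Y \<in> ob; f \<in> cyc X Y 0\<rbrakk> \<Longrightarrow> cl (sh k X) (sh k Y) f = cl X Y f"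
    and T_dist: "tc_dist T = {t. \<exists>X \<in> ob. \<exists>Y \<in> ob. \<exists>f \<in> cyc X Y 0.
       tri_iso T (sh 1) (\<lambda>F. F)
         (X, Y, cn X Y f, cl X Y f, cl Y (cn X Y f) (cj X Y), cl (cn X Y f) (sh 1 X) (cp X Y)) t}"
begin

lemma T_cl_in: "\<lbrakk>X \<in> ob; Y \<in> ob; f \<in> cyc X Y 0\<rbrakk> \<Longrightarrow> cl X Y f \<in> lc_hom T X Y"
  by (simp add: T_hom)

lemma T_homE:
  assumes "F \<in> lc_hom T X Y" "X \<in> ob" "Y \<in> ob" obtains f where "f \<in> cyc X Y 0" "F = cl X Y f"
  using assms T_hom by blast

lemma cyc_comp0: "\<lbrakk>X \<in> ob; Y \<in> ob; Z \<in> ob; f \<in> cyc X Y 0; g \<in> cyc Y Z 0\<rbrakk> \<Longrightarrow> g * f \<in> cyc X Z 0"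
  using cyc_comp[of X Y Z f 0 g 0 0] by simp

lemma lin_category_T: "lin_category T"
proof
  show "lc_id T X \<in> lc_hom T X X" if "X \<in> lc_ob T" for X
    using that by (simp add: T_ob T_id T_hom cyc_one)
  show "lc_comp T X Y Z g f \<in> lc_hom T X Z"
    if "X \<in> lc_ob T" "Y \<in> lc_ob T" "Z \<in> lc_ob T" "f \<in> lc_hom T X Y" "g \<in> lc_hom T Y Z" for X Y Z f g
    using that by (auto simp: T_ob T_hom T_comp cyc_comp0)
  show "lc_comp T X Y Y (lc_id T Y) f = f" if "X \<in> lc_ob T" "Y \<in> lc_ob T" "f \<in> lc_hom T X Y" for X Y f
    using that by (auto simp: T_ob T_hom T_id T_comp cyc_one one_left[OF _ _ cyc_hom])
  show "lc_comp T X X Y f (lc_id T X) = f" if "X \<in> lc_ob T" "Y \<in> lc_ob T" "f \<in> lc_hom T X Y" for X Y f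
    using that by (auto simp: T_ob T_hom T_id T_comp cyc_one one_right[OF _ _ cyc_hom])
  show "lc_comp T X Y W (lc_comp T Y Z W h g) f = lc_comp T X Z W h (lc_comp T X Y Z g f)"
    if "X \<in> lc_ob T" "Y \<in> lc_ob T" "Z \<in> lc_ob T" "W \<in> lc_ob T"
      "f \<in> lc_hom T X Y" "g \<in> lc_hom T Y Z" "h \<in> lc_hom T Z W" for X Y Z W f g h
    using that by (auto simp: T_ob T_hom T_comp cyc_comp0 mult.assoc)
  show "lc_add T X Y f g \<in> lc_hom T X Y"
    if "X \<in> lc_ob T" "Y \<in> lc_ob T" "f \<in> lc_hom T X Y" "g \<in> lc_hom T X Y" for X Y f g
    using that by (auto simp: T_ob T_hom T_add cyc_add)
  show "lc_scale T X Y c f \<in> lc_hom T X Y"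
    if "X \<in> lc_ob T" "Y \<in> lc_ob T" "f \<in> lc_hom T X Y" for X Y f c
    using that by (auto simp: T_ob T_hom T_scale cyc_sc)
  show "lc_comp T X Y Z (lc_add T Y Z f g) u = lc_add T X Z (lc_comp T X Y Z f u) (lc_comp T X Y Z g u)"
    if "X \<in> lc_ob T" "Y \<in> lc_ob T" "Z \<in> lc_ob T" "u \<in> lc_hom T X Y" "f \<in> lc_hom T Y Z" "g \<in> lc_hom T Y Z"
    for X Y Z u f g
    using that by (auto simp: T_ob T_hom T_comp T_add cyc_add cyc_comp0 distrib_right)
  show "lc_comp T X Y Z (lc_scale T Y Z c f) u = lc_scale T X Z c (lc_comp T X Y Z f u)"
    if "X \<in> lc_ob T" "Y \<in> lc_ob T" "Z \<in> lc_ob T" "u \<in> lc_hom T X Y" "f \<in> lc_hom T Y Z" for X Y Z u f c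
    using that by (auto simp: T_ob T_hom T_comp T_scale cyc_sc cyc_comp0 mult.assoc)
qed

definition standard_T :: "('o, 'm) triangle set" where
  "standard_T = {(X, Y, cn X Y f, cl X Y f, cl Y (cn X Y f) (cj X Y), cl (cn X Y f) (sh 1 X) (cp X Y)) | X Y f.
     X \<in> ob \<and> Y \<in> ob \<and> f \<in> cyc X Y 0}"

lemma T_shift_hom:
  assumes "X \<in> ob" "Y \<in> ob" shows "lc_hom T (sh k X) (sh k Y) = lc_hom T X Y"
proof -
  have "cyc (sh k X) (sh k Y) 0 = cyc X Y 0"
    using assms by (simp add: cyc_sh sh_ob cyc_sh_right)
  then show ?thesis using assms by (simp add: T_hom sh_ob cl_sh)
qed

lemma cl_sh_comp:
  "\<lbrakk>X \<in> ob; Y \<in> ob; Z \<in> ob; f \<in> lc_hom T X Y; g \<in> lc_hom T Y Z\<rbrakk>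
    \<Longrightarrow> lc_comp T (sh k X) (sh k Y) (sh k Z) g f = lc_comp T X Y Z g f"
proof -
  assume ob: "X \<in> ob" "Y \<in> ob" "Z \<in> ob" and f: "f \<in> lc_hom T X Y" and g: "g \<in> lc_hom T Y Z"
  obtain f0 g0 where 0: "f0 \<in> cyc X Y 0" "f = cl X Y f0" "g0 \<in> cyc Y Z 0" "g = cl Y Z g0"
    using f g ob T_homE by metis
  have "f0 \<in> cyc (sh k X) (sh k Y) 0" "g0 \<in> cyc (sh k Y) (sh k Z) 0"
    using 0 ob by (simp_all add: cyc_sh sh_ob cyc_sh_right)
  then have "lc_comp T (sh k X) (sh k Y) (sh k Z) (cl (sh k Y) (sh k Z) g0) (cl (sh k X) (sh k Y) f0)
      = cl (sh k X) (sh k Z) (g0 * f0)" using ob sh_ob T_comp by simp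
  then show ?thesis using 0 ob cl_sh cyc_comp0 T_comp by simp
qed

lemma tri_category_T: "tri_category T standard_T"
proof (rule tri_category.intro[OF lin_category_T], unfold_locales, unfold T_ob T_sh T_shm)
  show "sh k X \<in> ob" if "X \<in> ob" for X k using sh_ob[OF that] .
  show "f \<in> lc_hom T (sh 1 X) (sh 1 Y)" if "X \<in> ob" "Y \<in> ob" "f \<in> lc_hom T X Y" for X Y f
    using that T_shift_hom by simp
  show "lc_id T X = lc_id T (sh 1 X)" if "X \<in> ob" for X
    using that by (simp add: T_id sh_ob one_sh cl_sh cyc_one)
  show "lc_comp T X Y Z g f = lc_comp T (sh 1 X) (sh 1 Y) (sh 1 Z) g f"
    if "X \<in> ob" "Y \<in> ob" "Z \<in> ob" "f \<in> lc_hom T X Y" "g \<in> lc_hom T Y Z" for X Y Z f g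
    using that cl_sh_comp by simp
  show "tc_dist T = {t. \<exists>t0\<in>standard_T. tri_iso T (sh 1) (\<lambda>F. F) t0 t}"
    unfolding T_dist standard_T_def by blast
qed

lemma T_iso_iff:
  assumes ob: "X \<in> ob" "Y \<in> ob" and f: "f \<in> cyc X Y 0"
  shows "lc_iso T X Y (cl X Y f) \<longleftrightarrow>
    (\<exists>g \<in> cyc Y X 0. one X - g * f \<in> bnd X X 0 \<and> one Y - f * g \<in> bnd Y Y 0)"
proof -
  have "cl X X (g * f) = lc_id T X \<longleftrightarrow> one X - g * f \<in> bnd X X 0"
    "cl Y Y (f * g) = lc_id T Y \<longleftrightarrow> one Y - f * g \<in> bnd Y Y 0" if g: "g \<in> cyc Y X 0" for g
    using cl_eq[OF ob(1,1) cyc_one[OF ob(1)] cyc_comp0[OF ob ob(1) f g]]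
      cl_eq[OF ob(2,2) cyc_one[OF ob(2)] cyc_comp0[OF ob(2,1,2) g f]] T_id ob by auto
  then show ?thesis unfolding lc_iso_def using T_comp ob f by (auto simp: T_hom)
qed

lemma heq_iff: "X \<in> ob \<Longrightarrow> Y \<in> ob \<Longrightarrow> heq X Y \<longleftrightarrow> (\<exists>F. lc_iso T X Y F)"
  using T_iso_iff[of X Y] T_hom[of X Y] unfolding heq_def by (auto simp: lc_iso_def)

text \<open>The Hom-complex of \<open>E\<close> is concentrated in degree 0 and has no non-zero
  boundaries, so classes are the same as cocycles and different scalars stay different.\<close>

theorem exceptional_E: "exceptional T E"
  unfolding exceptional_def
proof (intro conjI allI impI)
  show "E \<in> lc_ob T" using E_ob T_ob by simp
  have c0: "cyc E E 0 = range (\<lambda>c. sc c * one E)" using hom_EE0 by (auto simp: cyc_E D_E)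
  have b0: "bnd E E 0 = {0}" using hom_EE[of "-1"] by (auto simp: bnd_E D_E)
  have s: "lc_scale T E E c (lc_id T E) = cl E E (sc c * one E)" for c
    using T_scale[OF E_ob E_ob cyc_one[OF E_ob]] T_id[OF E_ob] by simp
  show "bij_betw (\<lambda>c. lc_scale T E E c (lc_id T E)) UNIV (lc_hom T E E)"
    unfolding s bij_betw_def
  proof
    show "inj (\<lambda>c. cl E E (sc c * one E))"
    proof (rule injI)
      fix c c' assume "cl E E (sc c * one E) = cl E E (sc c' * one E)"
      then have "sc c * one E - sc c' * one E = 0" using cl_eq[OF E_ob E_ob] c0 b0 by blast
      then have "sc (c - c') * one E = 0" by (simp add: sc_diff left_diff_distrib)
      then show "c = c'" using sc_one_E by fastforce
    qed
    show "range (\<lambda>c. cl E E (sc c * one E)) = lc_hom T E E"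
      unfolding T_hom[OF E_ob E_ob] c0 by auto
  qed
next
  fix k :: int assume "k \<noteq> 0"
  then have "hom E E k = {0}" by (rule hom_EE)
  then have "cyc E E k = {0}" by (simp add: cyc_E D_E)
  then have "cyc E (sh k E) 0 = {0}" using cyc_sh_right[OF E_ob E_ob, of k 0] by simp
  then show "lc_hom T E (tc_sh T k E) = {lc_zero T E (tc_sh T k E)}"
    using T_hom[OF E_ob sh_ob[OF E_ob]] T_zero[OF E_ob sh_ob[OF E_ob]] by (simp add: T_sh)
qed

text \<open>A distinguished triangle is isomorphic to a cone, and the left orthogonal is closed
  under cones and homotopy equivalence. The morphisms of \<open>right_universal\<close> and
  \<open>left_universal\<close>, universal up to boundaries, become strictly universal for classes
  and give the two adjoints.\<close>

theorem admissible_lorth: "admissible T (Collect lorth)"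
  unfolding admissible_def
proof (intro conjI)
  interpret TC: tri_category T standard_T by (rule tri_category_T)
  have sub: "Collect lorth \<subseteq> lc_ob T" using lorth_ob T_ob by auto
  show "triangulated_subcategory T (Collect lorth)"
    unfolding triangulated_subcategory_def
  proof (intro conjI ballI allI impI)
    show "Collect lorth \<subseteq> lc_ob T" by (rule sub)
    show "Collect lorth \<noteq> {}" using lorth_E by blast
    show "Y \<in> Collect lorth" if X: "X \<in> Collect lorth" and Y: "Y \<in> lc_ob T" and f: "lc_iso T X Y f" for X Y f
    proof -
      have "heq X Y" using heq_iff[of X Y] lorth_ob[of X] X Y f T_ob by auto
      then show ?thesis using lorth_heq X by simp
    qed
    show "tc_sh T k X \<in> Collect lorth" if "X \<in> Collect lorth" for X k
      using that lorth_sh by (simp add: T_sh)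
    fix X Y Z u v w
    assume d: "(X, Y, Z, u, v, w) \<in> tc_dist T" and X: "X \<in> Collect lorth" and Y: "Y \<in> Collect lorth"
    obtain X0 Y0 f where ob0: "X0 \<in> ob" "Y0 \<in> ob" and f: "f \<in> cyc X0 Y0 0"
      and t: "tri_iso T (sh 1) (\<lambda>F. F) (X0, Y0, cn X0 Y0 f, cl X0 Y0 f, cl Y0 (cn X0 Y0 f) (cj X0 Y0),
         cl (cn X0 Y0 f) (sh 1 X0) (cp X0 Y0)) (X, Y, Z, u, v, w)"
      using d unfolding T_dist by blast
    have C: "cn X0 Y0 f \<in> ob" using cn_ob[OF ob0 f] .
    obtain a b c where abc: "lc_iso T X0 X a" "lc_iso T Y0 Y b" "lc_iso T (cn X0 Y0 f) Z c" and Z: "Z \<in> ob"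
      using t unfolding tri_iso_def T_ob by auto
    have ob: "X \<in> ob" "Y \<in> ob" using X Y lorth_ob by auto
    have "heq X0 X" "heq Y0 Y"
      using heq_iff[OF ob0(1) ob(1)] heq_iff[OF ob0(2) ob(2)] abc(1,2) by blast+
    then have "lorth X0" "lorth Y0" using lorth_heq[OF heq_sym] X Y by auto
    then have "lorth (cn X0 Y0 f)" using lorth_cone f by blast
    moreover have "heq (cn X0 Y0 f) Z" using heq_iff[OF C Z] abc(3) by blast
    ultimately show "Z \<in> Collect lorth" using lorth_heq by simp
  qed
  show "\<exists>R. adjoint (full_sub T (Collect lorth)) T incl R"
  proof (rule right_adjoint_of_incl[OF lin_category_T sub])
    fix Y assume "Y \<in> lc_ob T"
    then have Y: "Y \<in> ob" by (simp add: T_ob)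
    obtain V \<epsilon> where V: "lorth V" and \<epsilon>: "\<epsilon> \<in> cyc V Y 0"
      and surj: "\<And>X u. lorth X \<Longrightarrow> u \<in> cyc X Y 0 \<Longrightarrow> \<exists>v \<in> cyc X V 0. u - \<epsilon> * v \<in> bnd X Y 0"
      and inj: "\<And>X v. lorth X \<Longrightarrow> v \<in> cyc X V 0 \<Longrightarrow> \<epsilon> * v \<in> bnd X Y 0 \<Longrightarrow> v \<in> bnd X V 0"
      using right_universal[OF Y] by blast
    note Vo = lorth_ob[OF V]
    have "bij_betw (lc_comp T X V Y (cl V Y \<epsilon>)) (lc_hom T X V) (lc_hom T X Y)" if X: "lorth X" for X
    proof -
      note Xo = lorth_ob[OF X]
      have comp: "lc_comp T X V Y (cl V Y \<epsilon>) (cl X V v) = cl X Y (\<epsilon> * v)" if "v \<in> cyc X V 0" for v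
        using T_comp[OF Xo Vo Y that \<epsilon>] .
      have ev: "\<epsilon> * v \<in> cyc X Y 0" if "v \<in> cyc X V 0" for v using cyc_comp0[OF Xo Vo Y that \<epsilon>] .
      show ?thesis
        unfolding bij_betw_def T_hom[OF Xo Vo] T_hom[OF Xo Y]
      proof (intro conjI inj_onI equalityI subsetI)
        fix F G assume "F \<in> cl X V ` cyc X V 0" "G \<in> cl X V ` cyc X V 0"
          and eq: "lc_comp T X V Y (cl V Y \<epsilon>) F = lc_comp T X V Y (cl V Y \<epsilon>) G"
        then obtain v w where v: "v \<in> cyc X V 0" "F = cl X V v" and w: "w \<in> cyc X V 0" "G = cl X V w" by blast
        have "\<epsilon> * (v - w) \<in> bnd X Y 0"
          using eq v w comp cl_eq[OF Xo Y ev[OF v(1)] ev[OF w(1)]] by (simp add: right_diff_distrib)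
        then have "v - w \<in> bnd X V 0" by (rule inj[OF X cyc_diff[OF Xo Vo v(1) w(1)]])
        then show "F = G" using cl_eq[OF Xo Vo v(1) w(1)] v w by simp
      next
        fix G assume "G \<in> lc_comp T X V Y (cl V Y \<epsilon>) ` cl X V ` cyc X V 0"
        then show "G \<in> cl X Y ` cyc X Y 0" using comp ev by auto
      next
        fix G assume "G \<in> cl X Y ` cyc X Y 0"
        then obtain u where u: "u \<in> cyc X Y 0" "G = cl X Y u" by blast
        obtain v where v: "v \<in> cyc X V 0" "u - \<epsilon> * v \<in> bnd X Y 0" using surj[OF X u(1)] by blast
        then have "G = lc_comp T X V Y (cl V Y \<epsilon>) (cl X V v)"
          using u comp cl_eq[OF Xo Y u(1) ev[OF v(1)]] by simp
        then show "G \<in> lc_comp T X V Y (cl V Y \<epsilon>) ` cl X V ` cyc X V 0" using v(1) by blast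
      qed
    qed
    then show "\<exists>V\<in>Collect lorth. \<exists>\<epsilon>\<in>lc_hom T V Y. \<forall>X\<in>Collect lorth.
        bij_betw (lc_comp T X V Y \<epsilon>) (lc_hom T X V) (lc_hom T X Y)"
      using V T_cl_in[OF Vo Y \<epsilon>] by blast
  qed
  show "\<exists>L. adjoint T (full_sub T (Collect lorth)) L incl"
  proof (rule left_adjoint_of_incl[OF lin_category_T sub])
    fix Y assume "Y \<in> lc_ob T"
    then have Y: "Y \<in> ob" by (simp add: T_ob)
    obtain V \<eta> where V: "lorth V" and \<eta>: "\<eta> \<in> cyc Y V 0"
      and surj: "\<And>X u. lorth X \<Longrightarrow> u \<in> cyc Y X 0 \<Longrightarrow> \<exists>w \<in> cyc V X 0. u - w * \<eta> \<in> bnd Y X 0"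
      and inj: "\<And>X w. lorth X \<Longrightarrow> w \<in> cyc V X 0 \<Longrightarrow> w * \<eta> \<in> bnd Y X 0 \<Longrightarrow> w \<in> bnd V X 0"
      using left_universal[OF Y] by blast
    note Vo = lorth_ob[OF V]
    have "bij_betw (\<lambda>f. lc_comp T Y V X f (cl Y V \<eta>)) (lc_hom T V X) (lc_hom T Y X)" if X: "lorth X" for X
    proof -
      note Xo = lorth_ob[OF X]
      have comp: "lc_comp T Y V X (cl V X w) (cl Y V \<eta>) = cl Y X (w * \<eta>)" if "w \<in> cyc V X 0" for w
        using T_comp[OF Y Vo Xo \<eta> that] .
      have ev: "w * \<eta> \<in> cyc Y X 0" if "w \<in> cyc V X 0" for w using cyc_comp0[OF Y Vo Xo \<eta> that] .
      show ?thesis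
        unfolding bij_betw_def T_hom[OF Vo Xo] T_hom[OF Y Xo]
      proof (intro conjI inj_onI equalityI subsetI)
        fix F G assume "F \<in> cl V X ` cyc V X 0" "G \<in> cl V X ` cyc V X 0"
          and eq: "lc_comp T Y V X F (cl Y V \<eta>) = lc_comp T Y V X G (cl Y V \<eta>)"
        then obtain v w where v: "v \<in> cyc V X 0" "F = cl V X v" and w: "w \<in> cyc V X 0" "G = cl V X w" by blast
        have "(v - w) * \<eta> \<in> bnd Y X 0"
          using eq v w comp cl_eq[OF Y Xo ev[OF v(1)] ev[OF w(1)]] by (simp add: left_diff_distrib)
        then have "v - w \<in> bnd V X 0" by (rule inj[OF X cyc_diff[OF Vo Xo v(1) w(1)]])
        then show "F = G" using cl_eq[OF Vo Xo v(1) w(1)] v w by simp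
      next
        fix G assume "G \<in> (\<lambda>f. lc_comp T Y V X f (cl Y V \<eta>)) ` cl V X ` cyc V X 0"
        then show "G \<in> cl Y X ` cyc Y X 0" using comp ev by auto
      next
        fix G assume "G \<in> cl Y X ` cyc Y X 0"
        then obtain u where u: "u \<in> cyc Y X 0" "G = cl Y X u" by blast
        obtain w where w: "w \<in> cyc V X 0" "u - w * \<eta> \<in> bnd Y X 0" using surj[OF X u(1)] by blast
        then have "G = lc_comp T Y V X (cl V X w) (cl Y V \<eta>)"
          using u comp cl_eq[OF Y Xo u(1) ev[OF w(1)]] by simp
        then show "G \<in> (\<lambda>f. lc_comp T Y V X f (cl Y V \<eta>)) ` cl V X ` cyc V X 0" using w(1) by blast
      qed
    qed
    then show "\<exists>V\<in>Collect lorth. \<exists>\<eta>\<in>lc_hom T Y V. \<forall>X\<in>Collect lorth.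
        bij_betw (\<lambda>f. lc_comp T Y V X f \<eta>) (lc_hom T V X) (lc_hom T Y X)"
      using V T_cl_in[OF Y Vo \<eta>] by blast
  qed
qed

end

section \<open>The homotopy category of complexes of vector spaces\<close>

lemma Kb_simps [simp]:
  "lc_ob Kb_vect = vc_complexes" "lc_hom Kb_vect = lc_hom vc_lin" "lc_id Kb_vect = lc_id vc_lin"
  "lc_comp Kb_vect = lc_comp vc_lin" "lc_add Kb_vect = lc_add vc_lin" "lc_scale Kb_vect = lc_scale vc_lin"
  "tc_sh Kb_vect = vc_shift" "tc_shm Kb_vect = vc_shm"
  by (simp_all add: Kb_vect_def vc_lin_def lincat.defs)

lemma vc_lin_simps [simp]:
  "lc_ob vc_lin = vc_complexes" "lc_hom vc_lin X Y = vc_class X Y ` vc_maps X Y"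
  "lc_id vc_lin X = vc_class X X (\<lambda>i. 1\<^sub>m (fst X i))"
  by (simp_all add: vc_lin_def)

definition standard_K :: "(cplx, cmap set) triangle set" where
  "standard_K = {(X, Y, vc_cone X Y f, vc_class X Y f, vc_class Y (vc_cone X Y f) (vc_cone_in X Y),
     vc_class (vc_cone X Y f) (vc_shift 1 X) (vc_cone_out X Y)) | X Y f.
     X \<in> vc_complexes \<and> Y \<in> vc_complexes \<and> f \<in> vc_maps X Y}"

lemma Kb_dist: "tc_dist Kb_vect = {t. \<exists>t0 \<in> standard_K. tri_iso Kb_vect (vc_shift 1) (vc_shm 1) t0 t}"
proof -
  have tri: "tri_iso Kb_vect (vc_shift 1) (vc_shm 1) = tri_iso vc_lin (vc_shift 1) (vc_shm 1)"
    by (simp add: tri_iso_def lc_iso_def)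
  have dist: "tc_dist Kb_vect = {t. \<exists>X \<in> vc_complexes. \<exists>Y \<in> vc_complexes. \<exists>f \<in> vc_maps X Y.
       tri_iso vc_lin (vc_shift 1) (vc_shm 1)
         (X, Y, vc_cone X Y f, vc_class X Y f, vc_class Y (vc_cone X Y f) (vc_cone_in X Y),
          vc_class (vc_cone X Y f) (vc_shift 1 X) (vc_cone_out X Y)) t}"
    by (simp add: Kb_vect_def lincat.defs)
  show ?thesis unfolding dist tri standard_K_def by blast
qed

context dg_tricat
begin

text \<open>A realisation is chosen for each complex independently of all others, so shifts and
  cones are preserved only up to a change of coordinates.\<close>

definition rep :: "cplx \<Rightarrow> 'o \<times> (int \<times> nat \<Rightarrow> 'r) \<times> (int \<times> nat \<Rightarrow> 'r)" where
  "rep X = (SOME (Z, \<iota>, \<pi>). R Z \<iota> \<pi> X)"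

definition Fo :: "cplx \<Rightarrow> 'o" where "Fo X = fst (rep X)"
definition Fi :: "cplx \<Rightarrow> int \<times> nat \<Rightarrow> 'r" where "Fi X = fst (snd (rep X))"
definition Fp :: "cplx \<Rightarrow> int \<times> nat \<Rightarrow> 'r" where "Fp X = snd (snd (rep X))"

lemma R_rep:
  assumes "X \<in> vc_complexes" shows "R (Fo X) (Fi X) (Fp X) X"
proof -
  obtain Z \<iota> \<pi> where "R Z \<iota> \<pi> X" using R_exists[OF assms] by blast
  then have "case (Z, \<iota>, \<pi>) of (Z, \<iota>, \<pi>) \<Rightarrow> R Z \<iota> \<pi> X" by simp
  then have "case rep X of (Z, \<iota>, \<pi>) \<Rightarrow> R Z \<iota> \<pi> X" unfolding rep_def by (rule someI)
  then show ?thesis by (simp add: Fo_def Fi_def Fp_def case_prod_unfold)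
qed

lemma Fo_ob: "X \<in> vc_complexes \<Longrightarrow> Fo X \<in> ob" using R_rep RD(3) by blast

definition rmor :: "cplx \<Rightarrow> cplx \<Rightarrow> cmap \<Rightarrow> 'r" where
  "rmor X Y f = mf 0 (Fi Y) Y (Fp X) X f"

definition cmor :: "cplx \<Rightarrow> cplx \<Rightarrow> cmap \<Rightarrow> 'm" where
  "cmor X Y f = cl (Fo X) (Fo Y) (rmor X Y f)"

lemma rmor_cyc: "X \<in> vc_complexes \<Longrightarrow> Y \<in> vc_complexes \<Longrightarrow> f \<in> vc_maps X Y \<Longrightarrow> rmor X Y f \<in> cyc (Fo X) (Fo Y) 0"
  unfolding rmor_def using mf_cyc_iff[OF R_rep R_rep vc_maps_FM] by blast

lemma cmor_eq:
  assumes X: "X \<in> vc_complexes" and Y: "Y \<in> vc_complexes" and f: "f \<in> vc_maps X Y" and g: "g \<in> vc_maps X Y"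
  shows "cmor X Y f = cmor X Y g \<longleftrightarrow> vc_homotopic X Y f g"
  unfolding cmor_def cl_eq[OF Fo_ob[OF X] Fo_ob[OF Y] rmor_cyc[OF X Y f] rmor_cyc[OF X Y g]]
  unfolding rmor_def by (rule mf_bnd_iff[OF R_rep[OF X] R_rep[OF Y] vc_maps_FM[OF f] vc_maps_FM[OF g]])

text \<open>Homotopy is expressed as equality of images in \<open>T\<close>. In this form it is
  evidently an equivalence relation, and compatible with composition, sums and scalars because these
  operations are well defined in \<open>T\<close>.\<close>

lemma vc_class_alt:
  assumes "X \<in> vc_complexes" "Y \<in> vc_complexes" "f \<in> vc_maps X Y"
  shows "vc_class X Y f = {g \<in> vc_maps X Y. cmor X Y g = cmor X Y f}"
  unfolding vc_class_def by (rule Collect_cong) (use cmor_eq[OF assms] in metis)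

lemma vc_class_eq:
  assumes "X \<in> vc_complexes" "Y \<in> vc_complexes" "f \<in> vc_maps X Y" "g \<in> vc_maps X Y"
  shows "vc_class X Y f = vc_class X Y g \<longleftrightarrow> cmor X Y f = cmor X Y g"
  using assms by (auto simp: vc_class_alt)

lemma vc_class_self:
  assumes "X \<in> vc_complexes" "Y \<in> vc_complexes" "f \<in> vc_maps X Y" shows "f \<in> vc_class X Y f"
  using assms by (simp add: vc_class_alt)

lemma maps_carrier: "f \<in> vc_maps X Y \<Longrightarrow> f i \<in> carrier_mat (fst Y i) (fst X i)"
  by (simp add: vc_maps_def)

lemma FM0I: "(\<And>i. f i \<in> carrier_mat (fst Y i) (fst X i)) \<Longrightarrow> f \<in> FM 0 X Y"
  by (simp add: FM_def)

text \<open>That a composite of chain maps is a chain map is read off from the composite of the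
  corresponding cocycles; identities, sums and multiples are treated alike.\<close>

lemma maps_comp:
  assumes X: "X \<in> vc_complexes" and Y: "Y \<in> vc_complexes" and Z: "Z \<in> vc_complexes"
    and f: "f \<in> vc_maps X Y" and g: "g \<in> vc_maps Y Z"
  shows "(\<lambda>i. g i * f i) \<in> vc_maps X Z" and "rmor X Z (\<lambda>i. g i * f i) = rmor Y Z g * rmor X Y f"
proof -
  show eq: "rmor X Z (\<lambda>i. g i * f i) = rmor Y Z g * rmor X Y f"
    unfolding rmor_def
    using mf_comp[OF R_rep[OF X] R_rep[OF Y] vc_maps_FM[OF f] vc_maps_FM[OF g] R_rep[OF Z]] by simp
  have "(\<lambda>i. g i * f i) \<in> FM 0 X Z"
    by (rule FM0I) (rule mult_carrier_mat[OF maps_carrier[OF g] maps_carrier[OF f]])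
  moreover have "rmor X Z (\<lambda>i. g i * f i) \<in> cyc (Fo X) (Fo Z) 0"
    unfolding eq by (rule cyc_comp0[OF Fo_ob[OF X] Fo_ob[OF Y] Fo_ob[OF Z] rmor_cyc[OF X Y f] rmor_cyc[OF Y Z g]])
  ultimately show "(\<lambda>i. g i * f i) \<in> vc_maps X Z"
    unfolding rmor_def using mf_cyc_iff[OF R_rep[OF X] R_rep[OF Z]] by blast
qed

lemma maps_id:
  assumes X: "X \<in> vc_complexes"
  shows "(\<lambda>i. 1\<^sub>m (fst X i)) \<in> vc_maps X X" and "rmor X X (\<lambda>i. 1\<^sub>m (fst X i)) = one (Fo X)"
proof -
  show eq: "rmor X X (\<lambda>i. 1\<^sub>m (fst X i)) = one (Fo X)" unfolding rmor_def by (rule mf_one[OF R_rep[OF X]])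
  have F: "(\<lambda>i. 1\<^sub>m (fst X i)) \<in> FM 0 X X" by (rule FM0I) simp
  show "(\<lambda>i. 1\<^sub>m (fst X i)) \<in> vc_maps X X"
    using mf_cyc_iff[OF R_rep[OF X] R_rep[OF X] F] cyc_one[OF Fo_ob[OF X]] eq unfolding rmor_def by simp
qed

lemma maps_add:
  assumes X: "X \<in> vc_complexes" and Y: "Y \<in> vc_complexes" and f: "f \<in> vc_maps X Y" and g: "g \<in> vc_maps X Y"
  shows "(\<lambda>i. f i + g i) \<in> vc_maps X Y" and "rmor X Y (\<lambda>i. f i + g i) = rmor X Y f + rmor X Y g"
proof -
  show eq: "rmor X Y (\<lambda>i. f i + g i) = rmor X Y f + rmor X Y g"
    unfolding rmor_def by (rule mf_add[OF vc_maps_FM[OF f] vc_maps_FM[OF g]])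
  have F: "(\<lambda>i. f i + g i) \<in> FM 0 X Y" by (rule FM0I) (use maps_carrier[OF f] maps_carrier[OF g] in auto)
  show "(\<lambda>i. f i + g i) \<in> vc_maps X Y"
    using mf_cyc_iff[OF R_rep[OF X] R_rep[OF Y] F] cyc_add[OF Fo_ob[OF X] Fo_ob[OF Y] rmor_cyc[OF X Y f] rmor_cyc[OF X Y g]] eq
    unfolding rmor_def by simp
qed

lemma maps_scale:
  assumes X: "X \<in> vc_complexes" and Y: "Y \<in> vc_complexes" and f: "f \<in> vc_maps X Y"
  shows "(\<lambda>i. c \<cdot>\<^sub>m f i) \<in> vc_maps X Y" and "rmor X Y (\<lambda>i. c \<cdot>\<^sub>m f i) = sc c * rmor X Y f"
proof -
  show eq: "rmor X Y (\<lambda>i. c \<cdot>\<^sub>m f i) = sc c * rmor X Y f"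
    unfolding rmor_def by (rule mf_scale[OF vc_maps_FM[OF f]])
  have F: "(\<lambda>i. c \<cdot>\<^sub>m f i) \<in> FM 0 X Y" by (rule FM0I) (use maps_carrier[OF f] in auto)
  show "(\<lambda>i. c \<cdot>\<^sub>m f i) \<in> vc_maps X Y"
    using mf_cyc_iff[OF R_rep[OF X] R_rep[OF Y] F] cyc_sc[OF Fo_ob[OF X] Fo_ob[OF Y] rmor_cyc[OF X Y f]] eq
    unfolding rmor_def by simp
qed

lemma cmor_comp:
  assumes "X \<in> vc_complexes" "Y \<in> vc_complexes" "Z \<in> vc_complexes" "f \<in> vc_maps X Y" "g \<in> vc_maps Y Z"
  shows "cmor X Z (\<lambda>i. g i * f i) = lc_comp T (Fo X) (Fo Y) (Fo Z) (cmor Y Z g) (cmor X Y f)"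
  unfolding cmor_def using T_comp[OF Fo_ob Fo_ob Fo_ob rmor_cyc rmor_cyc] maps_comp(2) assms by simp

lemma cmor_add:
  assumes "X \<in> vc_complexes" "Y \<in> vc_complexes" "f \<in> vc_maps X Y" "g \<in> vc_maps X Y"
  shows "cmor X Y (\<lambda>i. f i + g i) = lc_add T (Fo X) (Fo Y) (cmor X Y f) (cmor X Y g)"
  unfolding cmor_def using T_add[OF Fo_ob Fo_ob rmor_cyc rmor_cyc] maps_add(2) assms by simp

lemma cmor_scale:
  assumes "X \<in> vc_complexes" "Y \<in> vc_complexes" "f \<in> vc_maps X Y"
  shows "cmor X Y (\<lambda>i. c \<cdot>\<^sub>m f i) = lc_scale T (Fo X) (Fo Y) c (cmor X Y f)"
  unfolding cmor_def using T_scale[OF Fo_ob Fo_ob rmor_cyc] maps_scale(2) assms by simp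

lemma K_comp:
  assumes ob: "X \<in> vc_complexes" "Y \<in> vc_complexes" "Z \<in> vc_complexes"
    and f: "f \<in> vc_maps X Y" and g: "g \<in> vc_maps Y Z"
  shows "lc_comp vc_lin X Y Z (vc_class Y Z g) (vc_class X Y f) = vc_class X Z (\<lambda>i. g i * f i)"
proof -
  have "vc_class X Z (\<lambda>i. g' i * f' i) = vc_class X Z (\<lambda>i. g i * f i)"
    if "g' \<in> vc_class Y Z g" "f' \<in> vc_class X Y f" for g' f'
    using that assms by (auto simp: vc_class_alt maps_comp(1) cmor_comp)
  then have "(\<Union>g'\<in>vc_class Y Z g. \<Union>f'\<in>vc_class X Y f. vc_class X Z (\<lambda>i. g' i * f' i)) = vc_class X Z (\<lambda>i. g i * f i)"
    using vc_class_self[OF ob(1,2) f] vc_class_self[OF ob(2,3) g] by blast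
  then show ?thesis by (simp add: vc_lin_def)
qed

lemma K_add:
  assumes ob: "X \<in> vc_complexes" "Y \<in> vc_complexes" and f: "f \<in> vc_maps X Y" and g: "g \<in> vc_maps X Y"
  shows "lc_add vc_lin X Y (vc_class X Y f) (vc_class X Y g) = vc_class X Y (\<lambda>i. f i + g i)"
proof -
  have "vc_class X Y (\<lambda>i. f' i + g' i) = vc_class X Y (\<lambda>i. f i + g i)"
    if "f' \<in> vc_class X Y f" "g' \<in> vc_class X Y g" for f' g'
    using that assms by (auto simp: vc_class_alt maps_add(1) cmor_add)
  then have "(\<Union>f'\<in>vc_class X Y f. \<Union>g'\<in>vc_class X Y g. vc_class X Y (\<lambda>i. f' i + g' i)) = vc_class X Y (\<lambda>i. f i + g i)"
    using vc_class_self[OF ob f] vc_class_self[OF ob g] by blast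
  then show ?thesis by (simp add: vc_lin_def)
qed

lemma K_scale:
  assumes ob: "X \<in> vc_complexes" "Y \<in> vc_complexes" and f: "f \<in> vc_maps X Y"
  shows "lc_scale vc_lin X Y c (vc_class X Y f) = vc_class X Y (\<lambda>i. c \<cdot>\<^sub>m f i)"
proof -
  have "vc_class X Y (\<lambda>i. c \<cdot>\<^sub>m f' i) = vc_class X Y (\<lambda>i. c \<cdot>\<^sub>m f i)" if "f' \<in> vc_class X Y f" for f'
    using that assms by (auto simp: vc_class_alt maps_scale(1) cmor_scale)
  then have "(\<Union>f'\<in>vc_class X Y f. vc_class X Y (\<lambda>i. c \<cdot>\<^sub>m f' i)) = vc_class X Y (\<lambda>i. c \<cdot>\<^sub>m f i)"
    using vc_class_self[OF ob f] by blast
  then show ?thesis by (simp add: vc_lin_def)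
qed

lemma lin_category_Kb: "lin_category Kb_vect"
proof (unfold_locales; (unfold Kb_simps)?)
  show "lc_id vc_lin X \<in> lc_hom vc_lin X X" if "X \<in> vc_complexes" for X
    using that maps_id(1) by simp
  show "lc_comp vc_lin X Y Z g f \<in> lc_hom vc_lin X Z"
    if "X \<in> vc_complexes" "Y \<in> vc_complexes" "Z \<in> vc_complexes" "f \<in> lc_hom vc_lin X Y" "g \<in> lc_hom vc_lin Y Z"
    for X Y Z f g
    using that by (auto simp: K_comp maps_comp(1))
  show "lc_comp vc_lin X Y Y (lc_id vc_lin Y) f = f"
    if "X \<in> vc_complexes" "Y \<in> vc_complexes" "f \<in> lc_hom vc_lin X Y" for X Y f
    using that by (auto simp: K_comp maps_id(1) left_mult_one_mat[OF maps_carrier])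
  show "lc_comp vc_lin X X Y f (lc_id vc_lin X) = f"
    if "X \<in> vc_complexes" "Y \<in> vc_complexes" "f \<in> lc_hom vc_lin X Y" for X Y f
    using that by (auto simp: K_comp maps_id(1) right_mult_one_mat[OF maps_carrier])
  show "lc_comp vc_lin X Y W (lc_comp vc_lin Y Z W h g) f = lc_comp vc_lin X Z W h (lc_comp vc_lin X Y Z g f)"
    if "X \<in> vc_complexes" "Y \<in> vc_complexes" "Z \<in> vc_complexes" "W \<in> vc_complexes"
      "f \<in> lc_hom vc_lin X Y" "g \<in> lc_hom vc_lin Y Z" "h \<in> lc_hom vc_lin Z W" for X Y Z W f g h
    using that by (auto simp: K_comp maps_comp(1) assoc_mult_mat[OF maps_carrier maps_carrier maps_carrier])
  show "lc_add vc_lin X Y f g \<in> lc_hom vc_lin X Y"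
    if "X \<in> vc_complexes" "Y \<in> vc_complexes" "f \<in> lc_hom vc_lin X Y" "g \<in> lc_hom vc_lin X Y" for X Y f g
    using that by (auto simp: K_add maps_add(1))
  show "lc_scale vc_lin X Y c f \<in> lc_hom vc_lin X Y"
    if "X \<in> vc_complexes" "Y \<in> vc_complexes" "f \<in> lc_hom vc_lin X Y" for X Y f c
    using that by (auto simp: K_scale maps_scale(1))
  show "lc_comp vc_lin X Y Z (lc_add vc_lin Y Z f g) u
      = lc_add vc_lin X Z (lc_comp vc_lin X Y Z f u) (lc_comp vc_lin X Y Z g u)"
    if "X \<in> vc_complexes" "Y \<in> vc_complexes" "Z \<in> vc_complexes" "u \<in> lc_hom vc_lin X Y"
      "f \<in> lc_hom vc_lin Y Z" "g \<in> lc_hom vc_lin Y Z" for X Y Z u f g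
    using that by (auto simp: K_comp K_add maps_add(1) maps_comp(1)
        add_mult_distrib_mat[OF maps_carrier maps_carrier maps_carrier])
  show "lc_comp vc_lin X Y Z (lc_scale vc_lin Y Z c f) u = lc_scale vc_lin X Z c (lc_comp vc_lin X Y Z f u)"
    if "X \<in> vc_complexes" "Y \<in> vc_complexes" "Z \<in> vc_complexes" "u \<in> lc_hom vc_lin X Y" "f \<in> lc_hom vc_lin Y Z"
    for X Y Z u f c
    using that by (auto simp: K_comp K_scale maps_scale(1) maps_comp(1)
        mult_smult_assoc_mat[OF maps_carrier maps_carrier])
qed

text \<open>Instead of changing signs of homotopies, the shifted maps are realised by
  \<open>R_shift\<close>: both sides then ask whether one and the same operator is a
  boundary.\<close>

lemma homotopic_shift:
  assumes X: "X \<in> vc_complexes" and Y: "Y \<in> vc_complexes" and f: "f \<in> vc_maps X Y" and g: "g \<in> vc_maps X Y"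
  shows "vc_homotopic (vc_shift 1 X) (vc_shift 1 Y) (\<lambda>i. f (i + 1)) (\<lambda>i. g (i + 1)) \<longleftrightarrow> vc_homotopic X Y f g"
proof -
  note RX = R_rep[OF X] and RY = R_rep[OF Y]
  have m: "(\<lambda>i. h (i + 1)) \<in> FM 0 (vc_shift 1 X) (vc_shift 1 Y)" if "h \<in> vc_maps X Y" for h
    using vc_maps_FM vc_shift_maps[OF X Y] that by blast
  have "bnd (sh 1 (Fo X)) (sh 1 (Fo Y)) 0 = bnd (Fo X) (Fo Y) 0"
    using Fo_ob[OF X] Fo_ob[OF Y] by (simp add: bnd_sh sh_ob bnd_sh_right)
  then show ?thesis
    using mf_bnd_iff[OF R_shift[OF RX] R_shift[OF RY] m[OF f] m[OF g]]
      mf_bnd_iff[OF RX RY vc_maps_FM[OF f] vc_maps_FM[OF g]] by (simp add: mf_shift)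
qed

lemma vc_shm_class:
  assumes X: "X \<in> vc_complexes" and Y: "Y \<in> vc_complexes" and f: "f \<in> vc_maps X Y"
  shows "vc_shm 1 (vc_class X Y f) = vc_class (vc_shift 1 X) (vc_shift 1 Y) (\<lambda>i. f (i + 1))"
proof (intro equalityI subsetI)
  fix h assume "h \<in> vc_shm 1 (vc_class X Y f)"
  then obtain g where g: "g \<in> vc_maps X Y" "vc_homotopic X Y f g" "h = (\<lambda>i. g (i + 1))"
    unfolding vc_shm_def vc_class_def by blast
  then show "h \<in> vc_class (vc_shift 1 X) (vc_shift 1 Y) (\<lambda>i. f (i + 1))"
    unfolding vc_class_def using vc_shift_maps[OF X Y] homotopic_shift[OF X Y f g(1)] by simp
next
  fix h assume "h \<in> vc_class (vc_shift 1 X) (vc_shift 1 Y) (\<lambda>i. f (i + 1))"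
  then have h: "h \<in> vc_maps (vc_shift 1 X) (vc_shift 1 Y)"
    "vc_homotopic (vc_shift 1 X) (vc_shift 1 Y) (\<lambda>i. f (i + 1)) h" by (auto simp: vc_class_def)
  \<comment> \<open>Shifting back shows that the image of a class is an entire class, not just
    contained in one.\<close>
  define g where "g i = h (i - 1)" for i
  have hg: "h = (\<lambda>i. g (i + 1))" by (simp add: g_def)
  have g: "g \<in> vc_maps X Y" using h(1) vc_shift_maps[OF X Y, of g] hg by simp
  then have "g \<in> vc_class X Y f" using h(2) homotopic_shift[OF X Y f g] hg by (simp add: vc_class_def)
  then show "h \<in> vc_shm 1 (vc_class X Y f)" unfolding vc_shm_def hg by (rule imageI)
qed

lemma tri_category_Kb: "tri_category Kb_vect standard_K"
proof (rule tri_category.intro[OF lin_category_Kb], unfold_locales, unfold Kb_simps)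
  show "vc_shift k X \<in> vc_complexes" if "X \<in> vc_complexes" for X k
    using vc_shift_complexes[OF that] .
  show "vc_shm 1 f \<in> lc_hom vc_lin (vc_shift 1 X) (vc_shift 1 Y)"
    if ob: "X \<in> vc_complexes" "Y \<in> vc_complexes" and f: "f \<in> lc_hom vc_lin X Y" for X Y f
    using f vc_shm_class[OF ob] vc_shift_maps[OF ob] by auto
  show "vc_shm 1 (lc_id vc_lin X) = lc_id vc_lin (vc_shift 1 X)" if "X \<in> vc_complexes" for X
    using vc_shm_class[OF that that maps_id(1)[OF that]] by (simp add: vc_shift_simps)
  show "vc_shm 1 (lc_comp vc_lin X Y Z g f)
      = lc_comp vc_lin (vc_shift 1 X) (vc_shift 1 Y) (vc_shift 1 Z) (vc_shm 1 g) (vc_shm 1 f)"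
    if "X \<in> vc_complexes" "Y \<in> vc_complexes" "Z \<in> vc_complexes" "f \<in> lc_hom vc_lin X Y" "g \<in> lc_hom vc_lin Y Z"
    for X Y Z f g
    using that by (auto simp: K_comp vc_shm_class maps_comp(1) vc_shift_maps vc_shift_complexes)
  show "tc_dist Kb_vect = {t. \<exists>t0\<in>standard_K. tri_iso Kb_vect (vc_shift 1) (vc_shm 1) t0 t}"
    by (rule Kb_dist)
qed

abbreviation qis_class :: "cplx \<Rightarrow> cplx \<Rightarrow> cmap set set" where
  "qis_class \<equiv> \<lambda>X Y. {F. \<exists>f \<in> F. vc_qis X Y f}"

text \<open>The realisations lie in the left orthogonal, so \<open>qi_heq\<close> provides an
  inverse up to homotopy, and fullness turns it into a chain map.\<close>

lemma qis_iso:
  assumes X: "X \<in> vc_complexes" and Y: "Y \<in> vc_complexes" and S: "S \<in> qis_class X Y"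
    and Sh: "S \<in> lc_hom Kb_vect X Y"
  shows "lc_iso Kb_vect X Y S"
proof -
  obtain f where f: "f \<in> S" "vc_qis X Y f" using S by blast
  obtain f0 where f0: "f0 \<in> vc_maps X Y" "S = vc_class X Y f0" using Sh by auto
  have fm: "f \<in> vc_maps X Y" and Sf: "S = vc_class X Y f"
    using f(1) vc_class_alt[OF X Y] f0 by auto
  note RX = R_rep[OF X] and RY = R_rep[OF Y]
  obtain g where g: "g \<in> cyc (Fo Y) (Fo X) 0" "one (Fo X) - g * rmor X Y f \<in> bnd (Fo X) (Fo X) 0"
    "one (Fo Y) - rmor X Y f * g \<in> bnd (Fo Y) (Fo Y) 0"
    using qi_heq[OF qis_qi[OF RX RY fm f(2)] R_lorth[OF RX] R_lorth[OF RY]] unfolding rmor_def by blast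
  obtain h where h: "h \<in> vc_maps Y X" "g = rmor Y X h" using mf_cyc_surj[OF RY RX g(1)] unfolding rmor_def by blast
  have "lc_comp vc_lin X Y X (vc_class Y X h) S = lc_id vc_lin X"
    unfolding Sf using K_comp[OF X Y X fm h(1)] maps_comp[OF X Y X fm h(1)] maps_id[OF X]
      vc_class_eq[OF X X] cl_eq[OF Fo_ob[OF X] Fo_ob[OF X] cyc_one[OF Fo_ob[OF X]]
        cyc_comp0[OF Fo_ob[OF X] Fo_ob[OF Y] Fo_ob[OF X] rmor_cyc[OF X Y fm] rmor_cyc[OF Y X h(1)]]] g(2) h(2)
    by (simp add: cmor_def)
  moreover have "lc_comp vc_lin Y X Y S (vc_class Y X h) = lc_id vc_lin Y"
    unfolding Sf using K_comp[OF Y X Y h(1) fm] maps_comp[OF Y X Y h(1) fm] maps_id[OF Y]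
      vc_class_eq[OF Y Y] cl_eq[OF Fo_ob[OF Y] Fo_ob[OF Y] cyc_one[OF Fo_ob[OF Y]]
        cyc_comp0[OF Fo_ob[OF Y] Fo_ob[OF X] Fo_ob[OF Y] rmor_cyc[OF Y X h(1)] rmor_cyc[OF X Y fm]]] g(3) h(2)
    by (simp add: cmor_def)
  ultimately show ?thesis unfolding lc_iso_def using Sh h(1) by auto
qed

lemma loc_Kb: "loc_at_isos Kb_vect standard_K qis_class"
proof (rule loc_at_isos.intro[OF tri_category_Kb], unfold_locales)
  show "lc_iso Kb_vect W X s"
    if "W \<in> lc_ob Kb_vect" "X \<in> lc_ob Kb_vect" "s \<in> qis_class W X" "s \<in> lc_hom Kb_vect W X" for W X s
    using that(1,2) qis_iso[OF _ _ that(3,4)] by simp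
  show "lc_id Kb_vect X \<in> qis_class X X" if "X \<in> lc_ob Kb_vect" for X
    using that vc_qis_id[of X] vc_class_self[of X X "\<lambda>i. 1\<^sub>m (fst X i)"] maps_id(1)[of X] by auto
qed

section \<open>The fully faithful functor from the homotopy category\<close>

definition fmor :: "cplx \<Rightarrow> cplx \<Rightarrow> cmap set \<Rightarrow> 'm" where
  "fmor X Y F = cmor X Y (SOME f. f \<in> F)"

lemma fmor_class:
  assumes "X \<in> vc_complexes" "Y \<in> vc_complexes" "f \<in> vc_maps X Y"
  shows "fmor X Y (vc_class X Y f) = cmor X Y f"
proof -
  have "(SOME g. g \<in> vc_class X Y f) \<in> vc_class X Y f" 
    using someI[of "\<lambda>g. g \<in> vc_class X Y f", OF vc_class_self[OF assms]] .
  then show ?thesis using vc_class_alt[OF assms] by (auto simp: fmor_def)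
qed

definition embed :: "(cplx, cmap set, 'o, 'm) funct" where
  "embed = \<lparr>fo = Fo, fm = fmor\<rparr>"

lemma embed_simps [simp]: "fo embed = Fo" "fm embed = fmor"
  by (simp_all add: embed_def)

lemma embed_functor: "is_functor Kb_vect T embed"
  unfolding is_functor_def
proof (intro conjI ballI; unfold embed_simps Kb_simps)
  show "Fo X \<in> lc_ob T" if "X \<in> vc_complexes" for X using Fo_ob[OF that] T_ob by simp
  show "fmor X Y f \<in> lc_hom T (Fo X) (Fo Y)"
    if ob: "X \<in> vc_complexes" "Y \<in> vc_complexes" and f: "f \<in> lc_hom vc_lin X Y" for X Y f
  proof -
    obtain f0 where "f0 \<in> vc_maps X Y" "f = vc_class X Y f0" using f by auto
    then show ?thesis
      using fmor_class[OF ob] T_cl_in[OF Fo_ob[OF ob(1)] Fo_ob[OF ob(2)] rmor_cyc[OF ob]]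
      by (simp add: cmor_def)
  qed
  show "fmor X X (lc_id vc_lin X) = lc_id T (Fo X)" if "X \<in> vc_complexes" for X
    using that fmor_class[OF that that maps_id(1)[OF that]] by (simp add: cmor_def maps_id(2) T_id Fo_ob)
  show "fmor X Z (lc_comp vc_lin X Y Z g f) = lc_comp T (Fo X) (Fo Y) (Fo Z) (fmor Y Z g) (fmor X Y f)"
    if "X \<in> vc_complexes" "Y \<in> vc_complexes" "Z \<in> vc_complexes" "f \<in> lc_hom vc_lin X Y" "g \<in> lc_hom vc_lin Y Z"
    for X Y Z f g
    using that by (auto simp: K_comp fmor_class maps_comp(1) cmor_comp)
qed

lemma embed_linear: "is_linear_functor Kb_vect T embed"
  unfolding is_linear_functor_def
proof (intro conjI ballI allI embed_functor; unfold embed_simps Kb_simps)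
  show "fmor X Y (lc_add vc_lin X Y f g) = lc_add T (Fo X) (Fo Y) (fmor X Y f) (fmor X Y g)"
    if "X \<in> vc_complexes" "Y \<in> vc_complexes" "f \<in> lc_hom vc_lin X Y" "g \<in> lc_hom vc_lin X Y" for X Y f g
    using that by (auto simp: K_add fmor_class maps_add(1) cmor_add)
  show "fmor X Y (lc_scale vc_lin X Y c f) = lc_scale T (Fo X) (Fo Y) c (fmor X Y f)"
    if "X \<in> vc_complexes" "Y \<in> vc_complexes" "f \<in> lc_hom vc_lin X Y" for X Y f c
    using that by (auto simp: K_scale fmor_class maps_scale(1) cmor_scale)
qed

lemma embed_ff: "fully_faithful Kb_vect T embed"
  unfolding fully_faithful_def embed_simps Kb_simps
proof (intro ballI)
  fix X Y assume X: "X \<in> vc_complexes" and Y: "Y \<in> vc_complexes"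
  show "bij_betw (fmor X Y) (lc_hom vc_lin X Y) (lc_hom T (Fo X) (Fo Y))"
  proof (rule bij_betw_imageI, rule inj_onI, goal_cases inj image)
    case (inj F G)
    then have "F \<in> lc_hom vc_lin X Y" "G \<in> lc_hom vc_lin X Y" and eq: "fmor X Y F = fmor X Y G" by auto
    then obtain f g where f: "f \<in> vc_maps X Y" "F = vc_class X Y f" and g: "g \<in> vc_maps X Y" "G = vc_class X Y g"
      by auto
    then show ?case using fmor_class[OF X Y] vc_class_eq[OF X Y f(1) g(1)] eq by simp
  next
    case image
    show ?case
    proof (intro equalityI subsetI)
    fix G assume "G \<in> fmor X Y ` lc_hom vc_lin X Y"
    then show "G \<in> lc_hom T (Fo X) (Fo Y)" using functorD(2)[OF embed_functor, of X Y] X Y by auto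
  next
    fix G assume "G \<in> lc_hom T (Fo X) (Fo Y)"
    then obtain g where g: "g \<in> cyc (Fo X) (Fo Y) 0" "G = cl (Fo X) (Fo Y) g"
      using T_homE Fo_ob X Y by blast
    obtain f where f: "f \<in> vc_maps X Y" "g = rmor X Y f"
      using mf_cyc_surj[OF R_rep[OF X] R_rep[OF Y] g(1)] unfolding rmor_def by blast
    have "G = fmor X Y (vc_class X Y f)" using fmor_class[OF X Y f(1)] g f by (simp add: cmor_def)
    then show "G \<in> fmor X Y ` lc_hom vc_lin X Y" using f(1) by simp
    qed
  qed
qed

section \<open>Comparison of realisations; shifts and cones under the functor\<close>

abbreviation idm :: "cplx \<Rightarrow> cmap" where
  "idm X \<equiv> \<lambda>i. 1\<^sub>m (fst X i)"

lemma idm_FM: "idm X \<in> FM 0 X X" by (rule FM0I) simp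

lemma mf_id_left:
  assumes X: "R Z \<iota> \<pi> X" and Y: "R Za \<iota>1 \<pi>1 Y" and Y': "R Zb \<iota>2 \<pi>2 Y" and f: "f \<in> FM 0 X Y"
  shows "mf 0 \<iota>2 Y \<pi>1 Y (idm Y) * mf 0 \<iota>1 Y \<pi> X f = mf 0 \<iota>2 Y \<pi> X f"
proof -
  have "f i \<in> carrier_mat (fst Y i) (fst X i)" for i using f by (simp add: FM_def)
  then have "(\<lambda>i. 1\<^sub>m (fst Y i) * f i) = f" by (intro ext left_mult_one_mat)
  then show ?thesis using mf_comp[OF X Y f idm_FM Y'] by simp
qed

lemma mf_id_right:
  assumes X: "R Z \<iota> \<pi> X" and X': "R Za \<iota>1 \<pi>1 X" and Y: "R Zb \<iota>2 \<pi>2 Y" and f: "f \<in> FM 0 X Y"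
  shows "mf 0 \<iota>2 Y \<pi>1 X f * mf 0 \<iota>1 X \<pi> X (idm X) = mf 0 \<iota>2 Y \<pi> X f"
proof -
  have "f i \<in> carrier_mat (fst Y i) (fst X i)" for i using f by (simp add: FM_def)
  then have "(\<lambda>i. f i * 1\<^sub>m (fst X i)) = f" by (intro ext right_mult_one_mat)
  then show ?thesis using mf_comp[OF X X' idm_FM f Y] by simp
qed

lemma mf_id_cyc:
  assumes "R Z \<iota> \<pi> X" "R Z' \<iota>' \<pi>' X" shows "mf 0 \<iota>' X \<pi> X (idm X) \<in> cyc Z Z' 0"
  using mf_cyc_iff[OF assms idm_FM] maps_id(1)[OF RD(1)[OF assms(1)]] by simp

text \<open>Two realisations of one complex differ by the identity matrix. The comparison
  isomorphisms for shifts and cones are both of this form.\<close>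

lemma mf_id_iso:
  assumes X: "R Z \<iota> \<pi> X" and X': "R Z' \<iota>' \<pi>' X"
  shows "lc_iso T Z Z' (cl Z Z' (mf 0 \<iota>' X \<pi> X (idm X)))"
proof -
  have "mf 0 \<iota> X \<pi>' X (idm X) * mf 0 \<iota>' X \<pi> X (idm X) = one Z"
    "mf 0 \<iota>' X \<pi> X (idm X) * mf 0 \<iota> X \<pi>' X (idm X) = one Z'"
    using mf_id_left[OF X X' X idm_FM] mf_id_left[OF X' X X' idm_FM] mf_one[OF X] mf_one[OF X'] by simp_all
  then show ?thesis
    using T_iso_iff[OF RD(3)[OF X] RD(3)[OF X'] mf_id_cyc[OF X X']] mf_id_cyc[OF X' X] bnd_0 RD(3)[OF X] RD(3)[OF X']
    by (metis cancel_comm_monoid_add_class.diff_cancel)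
qed

text \<open>By \<open>R_shift\<close>, the shift of the realisation of \<open>X\<close> is a second
  realisation of \<open>vc_shift 1 X\<close>, besides the chosen one.\<close>

definition \<theta>r :: "cplx \<Rightarrow> 'r" where
  "\<theta>r X = mf 0 (\<lambda>a. Fi X (up a)) (vc_shift 1 X) (Fp (vc_shift 1 X)) (vc_shift 1 X) (idm (vc_shift 1 X))"

definition \<theta> :: "cplx \<Rightarrow> 'm" where
  "\<theta> X = cl (Fo (vc_shift 1 X)) (sh 1 (Fo X)) (\<theta>r X)"

lemma \<theta>_iso: "X \<in> vc_complexes \<Longrightarrow> lc_iso T (Fo (vc_shift 1 X)) (sh 1 (Fo X)) (\<theta> X)"
  unfolding \<theta>_def \<theta>r_def using mf_id_iso[OF R_rep[OF vc_shift_complexes] R_shift[OF R_rep]] .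

lemma \<theta>r_cyc: "X \<in> vc_complexes \<Longrightarrow> \<theta>r X \<in> cyc (Fo (vc_shift 1 X)) (sh 1 (Fo X)) 0"
  unfolding \<theta>r_def using mf_id_cyc[OF R_rep[OF vc_shift_complexes] R_shift[OF R_rep]] .

text \<open>Both composites are the matrix family \<open>f (i + 1)\<close>, taken from the chosen
  coordinates of \<open>X[1]\<close> to the shifted coordinates of \<open>Y\<close>.\<close>

lemma \<theta>_nat:
  assumes X: "X \<in> vc_complexes" and Y: "Y \<in> vc_complexes" and F: "F \<in> lc_hom vc_lin X Y"
  shows "lc_comp T (Fo (vc_shift 1 X)) (sh 1 (Fo X)) (sh 1 (Fo Y)) (fmor X Y F) (\<theta> X)
    = lc_comp T (Fo (vc_shift 1 X)) (Fo (vc_shift 1 Y)) (sh 1 (Fo Y)) (\<theta> Y)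
        (fmor (vc_shift 1 X) (vc_shift 1 Y) (vc_shm 1 F))"
proof -
  obtain f where f: "f \<in> vc_maps X Y" "F = vc_class X Y f" using F by auto
  let ?X = "vc_shift 1 X" and ?Y = "vc_shift 1 Y" and ?f = "\<lambda>i. f (i + 1)"
  note X' = vc_shift_complexes[OF X, of 1] and Y' = vc_shift_complexes[OF Y, of 1]
  note RX = R_rep[OF X] and RY = R_rep[OF Y] and RX' = R_rep[OF X'] and RY' = R_rep[OF Y']
  have f': "?f \<in> vc_maps ?X ?Y" using vc_shift_maps[OF X Y] f(1) by simp
  have sob: "sh 1 (Fo X) \<in> ob" "sh 1 (Fo Y) \<in> ob" using sh_ob Fo_ob X Y by auto
  have r: "rmor X Y f = mf 0 (\<lambda>a. Fi Y (up a)) ?Y (\<lambda>a. Fp X (up a)) ?X ?f"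
    unfolding rmor_def by (rule mf_shift[symmetric])
  have rs: "rmor X Y f \<in> cyc (sh 1 (Fo X)) (sh 1 (Fo Y)) 0"
    unfolding r using mf_cyc_iff[OF R_shift[OF RX] R_shift[OF RY] vc_maps_FM[OF f']] f' by blast
  have eq: "rmor X Y f * \<theta>r X = \<theta>r Y * rmor ?X ?Y ?f"
    unfolding r unfolding \<theta>r_def rmor_def
      mf_id_right[OF RX' R_shift[OF RX] R_shift[OF RY] vc_maps_FM[OF f']]
      mf_id_left[OF RX' RY' R_shift[OF RY] vc_maps_FM[OF f']] ..
  have "fmor X Y F = cl (sh 1 (Fo X)) (sh 1 (Fo Y)) (rmor X Y f)"
    using fmor_class[OF X Y f(1)] f(2) cl_sh[OF Fo_ob[OF X] Fo_ob[OF Y] rmor_cyc[OF X Y f(1)]] by (simp add: cmor_def)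
  moreover have "fmor ?X ?Y (vc_shm 1 F) = cl (Fo ?X) (Fo ?Y) (rmor ?X ?Y ?f)"
    using vc_shm_class[OF X Y f(1)] fmor_class[OF X' Y' f'] f(2) by (simp add: cmor_def)
  ultimately show ?thesis
    unfolding \<theta>_def
    using T_comp[OF Fo_ob[OF X'] sob \<theta>r_cyc[OF X] rs]
      T_comp[OF Fo_ob[OF X'] Fo_ob[OF Y'] sob(2) rmor_cyc[OF X' Y' f'] \<theta>r_cyc[OF Y]] eq by simp
qed

text \<open>The image triangle is isomorphic to the cone triangle of \<open>rmor X Y f\<close>: by
  identities on the first two terms and, on the third, by the change of coordinates \<open>W\<close>
  from the cone to the chosen realisation of \<open>vc_cone X Y f\<close>.\<close>

lemma embed_standard:
  assumes X: "X \<in> vc_complexes" and Y: "Y \<in> vc_complexes" and f: "f \<in> vc_maps X Y"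
  shows "(Fo X, Fo Y, Fo (vc_cone X Y f), fmor X Y (vc_class X Y f),
      fmor Y (vc_cone X Y f) (vc_class Y (vc_cone X Y f) (vc_cone_in X Y)),
      lc_comp T (Fo (vc_cone X Y f)) (Fo (vc_shift 1 X)) (sh 1 (Fo X)) (\<theta> X)
        (fmor (vc_cone X Y f) (vc_shift 1 X) (vc_class (vc_cone X Y f) (vc_shift 1 X) (vc_cone_out X Y))))
    \<in> tc_dist T"
proof -
  let ?C = "vc_cone X Y f" and ?X = "vc_shift 1 X" and ?r = "rmor X Y f"
  let ?c = "cn (Fo X) (Fo Y) ?r"
  note X' = vc_shift_complexes[OF X, of 1] and C = vc_cone_complexes[OF X Y f]
  note RX = R_rep[OF X] and RY = R_rep[OF Y] and RX' = R_rep[OF X'] and RC = R_rep[OF C]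
  note Rc = R_cone[OF RX RY f, folded rmor_def]
  note oX = Fo_ob[OF X] and oY = Fo_ob[OF Y] and oC = Fo_ob[OF C] and oX' = Fo_ob[OF X'] and oc = RD(3)[OF Rc]
  note r = rmor_cyc[OF X Y f]
  have soX: "sh 1 (Fo X) \<in> ob" using sh_ob[OF oX] .
  define W where "W = mf 0 (Fi ?C) ?C (\<pi>C (Fo X) (Fo Y) Y (Fp X) (Fp Y)) ?C (idm ?C)"
  have W: "W \<in> cyc ?c (Fo ?C) 0" and Wiso: "lc_iso T ?c (Fo ?C) (cl ?c (Fo ?C) W)"
    unfolding W_def using mf_id_cyc[OF Rc RC] mf_id_iso[OF Rc RC] by auto
  have inFM: "vc_cone_in X Y \<in> FM 0 Y ?C" by (rule FM0I) (simp add: vc_cone_in_def vc_cone_def)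
  have outFM: "vc_cone_out X Y \<in> FM 0 ?C ?X"
    by (rule FM0I) (simp add: vc_cone_out_def vc_cone_def vc_shift_simps)
  have j: "cj (Fo X) (Fo Y) \<in> cyc (Fo Y) ?c 0"
    using cone_hom[OF oX oY r] cone_D(1)[OF oX oY r] by (simp add: cyc_def sn_simps)
  have p: "cp (Fo X) (Fo Y) \<in> cyc ?c (sh 1 (Fo X)) 0"
    using cone_hom[OF oX oY r] cone_D(4)[OF oX oY r]
    by (simp add: cyc_sh_right[OF oc oX]) (simp add: cyc_def sn_simps)
  note jeq = cone_in_eq[OF RX RY f] and peq = cone_out_eq[OF RX RY f]
  have inm: "vc_cone_in X Y \<in> vc_maps Y ?C"
    using mf_cyc_iff[OF RY Rc inFM] j unfolding jeq by simp
  have outm: "vc_cone_out X Y \<in> vc_maps ?C ?X"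
    using mf_cyc_iff[OF Rc R_shift[OF RX] outFM] p unfolding peq by simp
  have 2: "W * cj (Fo X) (Fo Y) = rmor Y ?C (vc_cone_in X Y)"
    unfolding jeq W_def rmor_def by (rule mf_id_left[OF RY Rc RC inFM])
  \<comment> \<open>Both sides are the family \<open>vc_cone_out\<close>, from the coordinates of
    the cone to the shifted coordinates of \<open>X\<close>.\<close>
  have 3: "cp (Fo X) (Fo Y) = \<theta>r X * rmor ?C ?X (vc_cone_out X Y) * W"
    unfolding peq W_def \<theta>r_def rmor_def
    unfolding mf_id_left[OF RC RX' R_shift[OF RX] outFM] mf_id_right[OF Rc RC R_shift[OF RX] outFM] ..
  interpret TC: tri_category T standard_T by (rule tri_category_T)
  let ?w = "lc_comp T (Fo ?C) (Fo ?X) (sh 1 (Fo X)) (\<theta> X) (fmor ?C ?X (vc_class ?C ?X (vc_cone_out X Y)))"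
  have out: "rmor ?C ?X (vc_cone_out X Y) \<in> cyc (Fo ?C) (Fo ?X) 0" using rmor_cyc[OF C X' outm] .
  have w: "?w = cl (Fo ?C) (sh 1 (Fo X)) (\<theta>r X * rmor ?C ?X (vc_cone_out X Y))"
    unfolding fmor_class[OF C X' outm] cmor_def \<theta>_def by (rule T_comp[OF oC oX' soX out \<theta>r_cyc[OF X]])
  have wc: "\<theta>r X * rmor ?C ?X (vc_cone_out X Y) \<in> cyc (Fo ?C) (sh 1 (Fo X)) 0"
    using cyc_comp0[OF oC oX' soX out \<theta>r_cyc[OF X]] .
  have inr: "rmor Y ?C (vc_cone_in X Y) \<in> cyc (Fo Y) (Fo ?C) 0" using rmor_cyc[OF Y C inm] .
  have id: "lc_iso T Z Z (cl Z Z (one Z))" if "Z \<in> ob" for Z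
    using TC.iso_id[of Z] T_id[OF that] that T_ob by simp
  have "tri_iso T (sh 1) (\<lambda>F. F)
      (Fo X, Fo Y, ?c, cl (Fo X) (Fo Y) ?r, cl (Fo Y) ?c (cj (Fo X) (Fo Y)), cl ?c (sh 1 (Fo X)) (cp (Fo X) (Fo Y)))
      (Fo X, Fo Y, Fo ?C, cl (Fo X) (Fo Y) ?r, cl (Fo Y) (Fo ?C) (rmor Y ?C (vc_cone_in X Y)),
        cl (Fo ?C) (sh 1 (Fo X)) (\<theta>r X * rmor ?C ?X (vc_cone_out X Y)))"
    unfolding tri_iso_def case_prod_unfold fst_conv snd_conv T_ob
  proof (intro conjI)
    show "\<exists>a b c. lc_iso T (Fo X) (Fo X) a \<and> lc_iso T (Fo Y) (Fo Y) b \<and> lc_iso T ?c (Fo ?C) c \<and>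
       lc_comp T (Fo X) (Fo Y) (Fo Y) b (cl (Fo X) (Fo Y) ?r) = lc_comp T (Fo X) (Fo X) (Fo Y) (cl (Fo X) (Fo Y) ?r) a \<and>
       lc_comp T (Fo Y) ?c (Fo ?C) c (cl (Fo Y) ?c (cj (Fo X) (Fo Y)))
         = lc_comp T (Fo Y) (Fo Y) (Fo ?C) (cl (Fo Y) (Fo ?C) (rmor Y ?C (vc_cone_in X Y))) b \<and>
       lc_comp T ?c (sh 1 (Fo X)) (sh 1 (Fo X)) a (cl ?c (sh 1 (Fo X)) (cp (Fo X) (Fo Y)))
         = lc_comp T ?c (Fo ?C) (sh 1 (Fo X)) (cl (Fo ?C) (sh 1 (Fo X)) (\<theta>r X * rmor ?C ?X (vc_cone_out X Y))) c"
    proof (intro exI conjI)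
      show "lc_iso T (Fo X) (Fo X) (cl (Fo X) (Fo X) (one (Fo X)))" using id[OF oX] .
      show "lc_iso T (Fo Y) (Fo Y) (cl (Fo Y) (Fo Y) (one (Fo Y)))" using id[OF oY] .
      show "lc_iso T ?c (Fo ?C) (cl ?c (Fo ?C) W)" by (rule Wiso)
      show "lc_comp T (Fo X) (Fo Y) (Fo Y) (cl (Fo Y) (Fo Y) (one (Fo Y))) (cl (Fo X) (Fo Y) ?r)
          = lc_comp T (Fo X) (Fo X) (Fo Y) (cl (Fo X) (Fo Y) ?r) (cl (Fo X) (Fo X) (one (Fo X)))"
        using T_comp[OF oX oY oY r cyc_one[OF oY]] T_comp[OF oX oX oY cyc_one[OF oX] r]
          one_left[OF oX oY cyc_hom[OF r]] one_right[OF oX oY cyc_hom[OF r]] by simp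
      show "lc_comp T (Fo Y) ?c (Fo ?C) (cl ?c (Fo ?C) W) (cl (Fo Y) ?c (cj (Fo X) (Fo Y)))
         = lc_comp T (Fo Y) (Fo Y) (Fo ?C) (cl (Fo Y) (Fo ?C) (rmor Y ?C (vc_cone_in X Y))) (cl (Fo Y) (Fo Y) (one (Fo Y)))"
        using T_comp[OF oY oc oC j W] T_comp[OF oY oY oC cyc_one[OF oY] inr]
          one_right[OF oY oC cyc_hom[OF inr]] 2 by simp
      \<comment> \<open>The third square contains the shift of the identity of \<open>X\<close>,
        which is the same class; it has to be recognised as the identity of the shifted
        object.\<close>
      have i: "cl (Fo X) (Fo X) (one (Fo X)) = cl (sh 1 (Fo X)) (sh 1 (Fo X)) (one (sh 1 (Fo X)))"
        using cl_sh[OF oX oX cyc_one[OF oX]] one_sh[OF oX] by simp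
      show "lc_comp T ?c (sh 1 (Fo X)) (sh 1 (Fo X)) (cl (Fo X) (Fo X) (one (Fo X))) (cl ?c (sh 1 (Fo X)) (cp (Fo X) (Fo Y)))
         = lc_comp T ?c (Fo ?C) (sh 1 (Fo X)) (cl (Fo ?C) (sh 1 (Fo X)) (\<theta>r X * rmor ?C ?X (vc_cone_out X Y)))
             (cl ?c (Fo ?C) W)"
        unfolding i T_comp[OF oc soX soX p cyc_one[OF soX]] T_comp[OF oc oC soX W wc]
        using one_left[OF oc soX cyc_hom[OF p]] 3 by simp
    qed
  qed (use oX oY oc oC r j p inr wc soX in \<open>auto intro: T_cl_in\<close>)
  then show ?thesis
    unfolding T_dist w fmor_class[OF X Y f] fmor_class[OF Y C inm] cmor_def using oX oY r by blast
qed

lemma embed_exact: "exact_functor Kb_vect T embed"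
  unfolding exact_functor_def
proof (intro conjI exI[of _ \<theta>] embed_linear ballI allI impI; unfold embed_simps Kb_simps T_sh T_shm)
  show "lc_iso T (Fo (vc_shift 1 X)) (sh 1 (Fo X)) (\<theta> X)" if "X \<in> vc_complexes" for X
    using \<theta>_iso[OF that] .
  show "lc_comp T (Fo (vc_shift 1 X)) (sh 1 (Fo X)) (sh 1 (Fo Y)) (fmor X Y f) (\<theta> X)
    = lc_comp T (Fo (vc_shift 1 X)) (Fo (vc_shift 1 Y)) (sh 1 (Fo Y)) (\<theta> Y)
        (fmor (vc_shift 1 X) (vc_shift 1 Y) (vc_shm 1 f))"
    if "X \<in> vc_complexes" "Y \<in> vc_complexes" "f \<in> lc_hom vc_lin X Y" for X Y f
    using \<theta>_nat[OF that] .
  fix X Y Z u v w assume "(X, Y, Z, u, v, w) \<in> tc_dist Kb_vect"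
  then obtain X0 Y0 f where X0: "X0 \<in> vc_complexes" and Y0: "Y0 \<in> vc_complexes" and f: "f \<in> vc_maps X0 Y0"
    and t: "tri_iso Kb_vect (vc_shift 1) (vc_shm 1) (X0, Y0, vc_cone X0 Y0 f, vc_class X0 Y0 f,
      vc_class Y0 (vc_cone X0 Y0 f) (vc_cone_in X0 Y0),
      vc_class (vc_cone X0 Y0 f) (vc_shift 1 X0) (vc_cone_out X0 Y0)) (X, Y, Z, u, v, w)"
    unfolding Kb_dist standard_K_def by blast
  have i: "tri_iso T (tc_sh T 1) (tc_shm T 1)
    (fo embed X0, fo embed Y0, fo embed (vc_cone X0 Y0 f), fm embed X0 Y0 (vc_class X0 Y0 f),
      fm embed Y0 (vc_cone X0 Y0 f) (vc_class Y0 (vc_cone X0 Y0 f) (vc_cone_in X0 Y0)),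
      lc_comp T (fo embed (vc_cone X0 Y0 f)) (fo embed (tc_sh Kb_vect 1 X0)) (tc_sh T 1 (fo embed X0)) (\<theta> X0)
        (fm embed (vc_cone X0 Y0 f) (tc_sh Kb_vect 1 X0)
          (vc_class (vc_cone X0 Y0 f) (vc_shift 1 X0) (vc_cone_out X0 Y0))))
    (fo embed X, fo embed Y, fo embed Z, fm embed X Y u, fm embed Y Z v,
      lc_comp T (fo embed Z) (fo embed (tc_sh Kb_vect 1 X)) (tc_sh T 1 (fo embed X)) (\<theta> X)
        (fm embed Z (tc_sh Kb_vect 1 X) w))"
    by (rule exact_functor_tri_iso[where \<theta> = \<theta>, OF tri_category_Kb tri_category_T embed_functor])
      (use \<theta>_iso \<theta>_nat t in \<open>auto simp: T_sh T_shm\<close>)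
  interpret TC: tri_category T standard_T by (rule tri_category_T)
  show "(Fo X, Fo Y, Fo Z, fmor X Y u, fmor Y Z v,
      lc_comp T (Fo Z) (Fo (vc_shift 1 X)) (sh 1 (Fo X)) (\<theta> X) (fmor Z (vc_shift 1 X) w)) \<in> tc_dist T"
    using TC.dist_iso[OF _ i] embed_standard[OF X0 Y0 f] unfolding embed_simps Kb_simps T_sh by blast
qed

lemma embed_ess_image: "{Y \<in> lc_ob T. \<exists>X \<in> vc_complexes. \<exists>f. lc_iso T (Fo X) Y f} = Collect lorth"
proof (intro equalityI subsetI)
  fix Y assume "Y \<in> {Y \<in> lc_ob T. \<exists>X \<in> vc_complexes. \<exists>f. lc_iso T (Fo X) Y f}"
  then obtain X f where Y: "Y \<in> ob" and X: "X \<in> vc_complexes" and f: "lc_iso T (Fo X) Y f" by (auto simp: T_ob)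
  have "heq (Fo X) Y" using heq_iff[OF Fo_ob[OF X] Y] f by blast
  then show "Y \<in> Collect lorth" using lorth_heq[OF _ R_lorth[OF R_rep[OF X]]] by simp
next
  fix Y assume "Y \<in> Collect lorth"
  then have Y: "lorth Y" by simp
  obtain V \<iota> \<pi> n where sp: "formal V \<iota> \<pi> n" and eq: "heq V Y" using lorth_heq_formal[OF Y] by blast
  \<comment> \<open>A formal object is a realisation of the complex with the same dimensions and
    zero differentials.\<close>
  define X :: cplx where "X = (n, \<lambda>i. 0\<^sub>m (n (i + 1)) (n i))"
  have X: "X \<in> vc_complexes" using sp by (auto simp: X_def vc_complexes_def formal_def ac_simps)
  have "fam 1 (snd X) a b = 0" if "a \<in> Ix n" "b \<in> Ix n" for a b
    using that by (cases a; cases b) (auto simp: fam_def X_def)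
  then have "rz V \<iota> \<pi> (Ix n) (fam 1 (snd X))"
    using sp unfolding formal_def rz_def by (auto simp: sc_0)
  then have "heq (Fo X) V" using rz_heq[OF RD(2)[OF R_rep[OF X]]] by (simp add: X_def)
  then obtain a where a: "lc_iso T (Fo X) V a" using heq_iff heq_def by blast
  obtain b where b: "lc_iso T V Y b" using eq heq_iff heq_def by blast
  interpret TC: tri_category T standard_T by (rule tri_category_T)
  have "lc_iso T (Fo X) Y (lc_comp T (Fo X) V Y b a)"
    using TC.iso_comp[OF _ _ _ a b] Fo_ob[OF X] eq T_ob unfolding heq_def by simp
  then show "Y \<in> {Y \<in> lc_ob T. \<exists>X \<in> vc_complexes. \<exists>f. lc_iso T (Fo X) Y f}"
    using X lorth_ob[OF Y] T_ob by auto
qed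

text \<open>The functor induced on the localisation agrees with the one on the homotopy category on
  objects, so its essential image is the left orthogonal.\<close>

theorem Db_vect_embeds:
  "\<exists>\<Phi>. exact_functor Db_vect T \<Phi> \<and> fully_faithful Db_vect T \<Phi> \<and> admissible T (ess_image Db_vect T \<Phi>)"
proof -
  interpret L: loc_at_isos Kb_vect standard_K qis_class by (rule loc_Kb)
  obtain \<Phi> where \<Phi>: "exact_functor Db_vect T \<Phi>" "fully_faithful Db_vect T \<Phi>" "fo \<Phi> = Fo"
    using L.exact_functor_on_localisation[OF tri_category_T embed_exact embed_ff] by (auto simp: Db_vect_def)
  have "lc_ob Db_vect = vc_complexes" by (simp add: Db_vect_def)
  then have "ess_image Db_vect T \<Phi> = Collect lorth"
    using embed_ess_image \<Phi>(3) by (simp add: ess_image_def)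
  then show ?thesis using \<Phi> admissible_lorth by (intro exI[of _ \<Phi>]) simp
qed

end

section \<open>Linearised semi-free modules\<close>

interpretation pv: vector_space "Polynomial.smult :: complex \<Rightarrow> complex poly \<Rightarrow> complex poly"
  by unfold_locales (simp_all add: smult_add_right smult_add_left)

abbreviation Lc :: "int \<Rightarrow> (dgmod \<times> (int \<Rightarrow> complex poly \<Rightarrow> complex poly), complex poly \<Rightarrow> complex poly) dgcat" where
  "Lc d \<equiv> linearised Z2 (semifree_cat d) twist_ob twist_mor"

lemma tot_0: "0 \<in> tot M" and tot_add: "x \<in> tot M \<Longrightarrow> y \<in> tot M \<Longrightarrow> x + y \<in> tot M"
  and tot_smult: "x \<in> tot M \<Longrightarrow> Polynomial.smult c x \<in> tot M"
  and gr_tot: "x \<in> dm_gr M p \<Longrightarrow> x \<in> tot M"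
  unfolding tot_def by (auto intro: pv.span_zero pv.span_add pv.span_scale pv.span_base)

lemma tot_sum: "(\<And>a. a \<in> A \<Longrightarrow> f a \<in> tot M) \<Longrightarrow> (\<Sum>a\<in>A. f a) \<in> tot M"
  by (induction A rule: infinite_finite_induct) (auto simp: tot_0 tot_add)

lemma tot_induct [consumes 1, case_names gr zero add smult]:
  assumes "x \<in> tot M" "\<And>p x. x \<in> dm_gr M p \<Longrightarrow> P x" "P 0"
    "\<And>x y. x \<in> tot M \<Longrightarrow> y \<in> tot M \<Longrightarrow> P x \<Longrightarrow> P y \<Longrightarrow> P (x + y)"
    "\<And>c x. x \<in> tot M \<Longrightarrow> P x \<Longrightarrow> P (Polynomial.smult c x)"
  shows "P x"
proof -
  have "x \<in> tot M \<and> P x"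
    using assms(1)[unfolded tot_def]
  proof (induction rule: pv.span_induct_alt)
    case base
    then show ?case using assms(3) tot_0 by blast
  next
    case (step c y z)
    then obtain p where y: "y \<in> dm_gr M p" by blast
    have "Polynomial.smult c y \<in> tot M" using gr_tot[OF y] by (rule tot_smult)
    moreover have "P (Polynomial.smult c y)" by (rule assms(5)[OF gr_tot[OF y] assms(2)[OF y]])
    ultimately show ?case using step(2) assms(4) tot_add by simp
  qed
  then show ?thesis by blast
qed

lemma linear_on_0: "linear_on V f \<Longrightarrow> 0 \<in> V \<Longrightarrow> f 0 = 0"
  unfolding linear_on_def by (metis add_cancel_right_right)

lemma linear_on_sum:
  assumes "linear_on (tot M) f" "\<And>a. a \<in> A \<Longrightarrow> g a \<in> tot M"
  shows "f (\<Sum>a\<in>A. g a) = (\<Sum>a\<in>A. f (g a))"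
  using assms(2)
proof (induction A rule: infinite_finite_induct)
  case (insert a A)
  then show ?case using assms(1) tot_sum[of A g M] by (simp add: linear_on_def)
qed (use linear_on_0[OF assms(1) tot_0] in auto)

lemma dm_homD:
  assumes "f \<in> dm_hom M N k"
  shows "linear_on (tot M) f" "\<And>p x. x \<in> dm_gr M p \<Longrightarrow> f x \<in> dm_gr N (p + k)"
    "\<And>x b. x \<in> tot M \<Longrightarrow> b \<in> Balg \<Longrightarrow> f (dm_act M x b) = dm_act N (f x) b" "\<And>x. x \<notin> tot M \<Longrightarrow> f x = 0"
  using assms by (auto simp: dm_hom_def)

lemma dm_hom_tot:
  assumes f: "f \<in> dm_hom M N k" shows "f x \<in> tot N"
proof (cases "x \<in> tot M")
  case True
  then show ?thesis
  proof (induction rule: tot_induct)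
    case (gr p x)
    then show ?case using dm_homD(2)[OF f] gr_tot by blast
  next
    case zero
    then show ?case using linear_on_0[OF dm_homD(1)[OF f] tot_0] tot_0 by simp
  qed (use dm_homD(1)[OF f] in \<open>auto simp: linear_on_def tot_add tot_smult\<close>)
next
  case False
  then show ?thesis using dm_homD(4)[OF f] tot_0 by simp
qed

lemma dg_moduleD:
  assumes "dg_module d M"
  shows "\<And>p. pv.subspace (dm_gr M p)"
    "\<And>x. \<lbrakk>\<And>p. x p \<in> dm_gr M p; finite {p. x p \<noteq> 0}; (\<Sum>p | x p \<noteq> 0. x p) = 0\<rbrakk> \<Longrightarrow> \<forall>p. x p = 0"
    "\<And>b. b \<in> Balg \<Longrightarrow> linear_on (tot M) (\<lambda>x. dm_act M x b)"
    "\<And>x. x \<in> tot M \<Longrightarrow> linear_on Balg (dm_act M x)"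
    "\<And>x. x \<in> tot M \<Longrightarrow> dm_act M x 1 = x"
    "linear_on (tot M) (dm_diff M)" "\<And>p x. x \<in> dm_gr M p \<Longrightarrow> dm_diff M x \<in> dm_gr M (p + 1)"
    "\<And>x. x \<in> tot M \<Longrightarrow> dm_diff M (dm_diff M x) = 0"
    "\<And>x b. x \<in> tot M \<Longrightarrow> b \<in> Balg \<Longrightarrow> dm_diff M (dm_act M x b) = dm_act M (dm_diff M x) b"
proof -
  note * = assms[unfolded dg_module_def]
  have 1: "\<forall>p. pv.subspace (dm_gr M p)"
    and 2: "\<forall>x. (\<forall>p. x p \<in> dm_gr M p) \<and> finite {p. x p \<noteq> 0} \<and> (\<Sum>p | x p \<noteq> 0. x p) = 0 \<longrightarrow> (\<forall>p. x p = 0)"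
    and 3: "\<forall>b \<in> Balg. linear_on (tot M) (\<lambda>x. dm_act M x b)"
    and 4: "\<forall>x \<in> tot M. linear_on Balg (dm_act M x)"
    and 5: "\<forall>x \<in> tot M. dm_act M x 1 = x"
    and 6: "linear_on (tot M) (dm_diff M)"
    and 7: "\<forall>p. \<forall>x \<in> dm_gr M p. dm_diff M x \<in> dm_gr M (p + 1)"
    and 8: "\<forall>x \<in> tot M. dm_diff M (dm_diff M x) = 0"
    and 9: "\<forall>x \<in> tot M. \<forall>b \<in> Balg. dm_diff M (dm_act M x b) = dm_act M (dm_diff M x) b"
    using * by - (elim conjE, assumption)+
  show "pv.subspace (dm_gr M p)" for p using 1 by simp
  show "\<forall>p. x p = 0" if "\<And>p. x p \<in> dm_gr M p" "finite {p. x p \<noteq> 0}" "(\<Sum>p | x p \<noteq> 0. x p) = 0" for x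
    using 2[rule_format, of x] that by simp
  show "linear_on (tot M) (\<lambda>x. dm_act M x b)" if "b \<in> Balg" for b using 3 that by simp
  show "linear_on Balg (dm_act M x)" if "x \<in> tot M" for x using 4 that by simp
  show "dm_act M x 1 = x" if "x \<in> tot M" for x using 5 that by simp
  show "linear_on (tot M) (dm_diff M)" by (rule 6)
  show "dm_diff M x \<in> dm_gr M (p + 1)" if "x \<in> dm_gr M p" for p x using 7 that by simp
  show "dm_diff M (dm_diff M x) = 0" if "x \<in> tot M" for x using 8 that by simp
  show "dm_diff M (dm_act M x b) = dm_act M (dm_diff M x) b" if "x \<in> tot M" "b \<in> Balg" for x b using 9 that by simp
qed

lemma dm_act_tot:
  assumes M: "dg_module d M" and x: "x \<in> tot M" and b: "b \<in> Balg"
  shows "dm_act M x b \<in> tot M"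
proof -
  have "\<forall>p k. \<forall>x \<in> dm_gr M p. \<forall>b \<in> Bgr d k. dm_act M x b \<in> dm_gr M (p + k)"
    using M[unfolded dg_module_def] by (elim conjE)
  then have gr_act: "\<And>p k x b. x \<in> dm_gr M p \<Longrightarrow> b \<in> Bgr d k \<Longrightarrow> dm_act M x b \<in> dm_gr M (p + k)" by blast
  have 1: "dm_act M x c \<in> tot M" if c: "c \<in> Bgr d k" for c k
  proof -
    have lin: "linear_on (tot M) (\<lambda>x. dm_act M x c)" using dg_moduleD(3)[OF M] c by (simp add: Bgr_def)
    show ?thesis using x
    proof (induction rule: tot_induct)
      case (gr p x)
      then show ?case using gr_act[OF _ c] gr_tot by blast
    next
      case zero
      then show ?case using linear_on_0[OF lin tot_0] tot_0 by simp
    qed (use lin in \<open>auto simp: linear_on_def tot_add tot_smult\<close>)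
  qed
  let ?b0 = "[:coeff b 0:]" and ?b1 = "[:0, coeff b 1:]"
  have e: "b = ?b0 + ?b1" using b by (auto simp: Balg_def poly_eq_iff coeff_pCons coeff_eq_0 split: nat.split)
  have g: "?b0 \<in> Bgr d 0" "?b1 \<in> Bgr d d" by (auto simp: Bgr_def Balg_def)
  then have "dm_act M x (?b0 + ?b1) = dm_act M x ?b0 + dm_act M x ?b1"
    using dg_moduleD(4)[OF M x] unfolding linear_on_def Bgr_def by blast
  then show ?thesis using 1[OF g(1)] 1[OF g(2)] e tot_add by metis
qed

lemma dm_hom_0:
  assumes M: "dg_module d N" shows "(\<lambda>x. 0) \<in> dm_hom M N k"
proof -
  have "dm_act N 0 b = 0" if "b \<in> Balg" for b using linear_on_0[OF dg_moduleD(3)[OF M that] tot_0] .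
  then show ?thesis using pv.subspace_0[OF dg_moduleD(1)[OF M]] by (simp add: dm_hom_def linear_on_def)
qed

lemma dm_hom_add:
  assumes N: "dg_module d N" and f: "f \<in> dm_hom M N k" and g: "g \<in> dm_hom M N k"
  shows "(\<lambda>x. f x + g x) \<in> dm_hom M N k"
proof -
  have "dm_act N (f x + g x) b = dm_act N (f x) b + dm_act N (g x) b" if "b \<in> Balg" for x b
    using dg_moduleD(3)[OF N that] dm_hom_tot[OF f, of x] dm_hom_tot[OF g, of x] by (simp add: linear_on_def)
  then show ?thesis
    using dm_homD[OF f] dm_homD[OF g] pv.subspace_add[OF dg_moduleD(1)[OF N]]
    by (auto simp: dm_hom_def linear_on_def smult_add_right)
qed

lemma dm_hom_smult:
  assumes N: "dg_module d N" and f: "f \<in> dm_hom M N k"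
  shows "(\<lambda>x. Polynomial.smult c (f x)) \<in> dm_hom M N k"
proof -
  have "dm_act N (Polynomial.smult c (f x)) b = Polynomial.smult c (dm_act N (f x) b)" if "b \<in> Balg" for x b
    using dg_moduleD(3)[OF N that] dm_hom_tot[OF f, of x] by (simp add: linear_on_def)
  then show ?thesis
    using dm_homD[OF f] pv.subspace_scale[OF dg_moduleD(1)[OF N]]
    by (auto simp: dm_hom_def linear_on_def smult_add_right mult.commute)
qed

lemma dm_hom_comp:
  assumes f: "f \<in> dm_hom M N k" and g: "g \<in> dm_hom N P l"
  shows "(\<lambda>x. if x \<in> tot M then g (f x) else 0) \<in> dm_hom M P (k + l)"
proof -
  have g0: "g 0 = 0" using linear_on_0[OF dm_homD(1)[OF g] tot_0] .
  have h: "(\<lambda>x. if x \<in> tot M then g (f x) else 0) = (\<lambda>x. g (f x))"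
    using dm_homD(4)[OF f] g0 by auto
  have "linear_on (tot M) (\<lambda>x. g (f x))"
    using dm_homD(1)[OF f] dm_homD(1)[OF g] dm_hom_tot[OF f] unfolding linear_on_def by auto
  moreover have "g (f x) \<in> dm_gr P (p + (k + l))" if "x \<in> dm_gr M p" for p x
    using dm_homD(2)[OF g dm_homD(2)[OF f that]] by (simp add: add.assoc)
  ultimately show ?thesis unfolding h
    using dm_homD(3,4)[OF f] dm_homD(3)[OF g] dm_hom_tot[OF f] g0 by (simp add: dm_hom_def)
qed

lemma dm_hom_id: "dg_module d M \<Longrightarrow> (\<lambda>x. if x \<in> tot M then x else 0) \<in> dm_hom M M 0"
  using dm_act_tot[of d M] gr_tot by (auto simp: dm_hom_def linear_on_def tot_add tot_smult)

text \<open>Cut off outside the total space, so that the differential is itself in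
  \<open>dm_hom M M 1\<close> and the differential of the Hom-complexes becomes a graded
  commutator.\<close>

definition dmd :: "dgmod \<Rightarrow> complex poly \<Rightarrow> complex poly" where
  "dmd M = (\<lambda>x. if x \<in> tot M then dm_diff M x else 0)"

lemma dm_hom_dmd:
  assumes M: "dg_module d M" shows "dmd M \<in> dm_hom M M 1"
  using dg_moduleD(6,7,9)[OF M] dm_act_tot[OF M] gr_tot
  by (auto simp: dm_hom_def dmd_def linear_on_def tot_add tot_smult)

lemma dmd_square: "dg_module d M \<Longrightarrow> dmd M (dmd M x) = 0"
  using dg_moduleD(8)[of d M x] linear_on_0[OF dg_moduleD(6)[of d M] tot_0] by (simp add: dmd_def)

text \<open>On a homogeneous element the values \<open>u k x\<close> lie in different degrees of
  \<open>N\<close>, whose grading is direct. The offset \<open>s\<close> accounts for the shifts of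
  the summands of twisted complexes.\<close>

lemma dm_direct:
  assumes N: "dg_module d N" and fin: "finite K" and u: "\<And>k. k \<in> K \<Longrightarrow> u k \<in> dm_hom M N (k + s)"
    and sum: "\<And>x. (\<Sum>k\<in>K. u k x) = 0" and k: "k \<in> K"
  shows "u k x = 0"
proof (cases "x \<in> tot M")
  case True
  then show ?thesis
  proof (induction rule: tot_induct)
    case (gr p x)
    \<comment> \<open>The values \<open>u k x\<close>, indexed by the degree in which they
      lie.\<close>
    define y where "y q = (if q - p - s \<in> K then u (q - p - s) x else 0)" for q
    have im: "{q. y q \<noteq> 0} \<subseteq> (\<lambda>k. p + (k + s)) ` K"
    proof
      fix q assume "q \<in> {q. y q \<noteq> 0}"
      then show "q \<in> (\<lambda>k. p + (k + s)) ` K"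
        by (intro image_eqI[of _ _ "q - p - s"]) (auto simp: y_def split: if_splits)
    qed
    have "\<forall>q. y q = 0"
    proof (rule dg_moduleD(2)[OF N])
      show "y q \<in> dm_gr N q" for q
        using dm_homD(2)[OF u gr, of "q - p - s"] pv.subspace_0[OF dg_moduleD(1)[OF N]] by (simp add: y_def)
      show "finite {q. y q \<noteq> 0}" using im fin finite_surj by blast
      have "(\<Sum>q | y q \<noteq> 0. y q) = (\<Sum>q\<in>(\<lambda>k. p + (k + s)) ` K. y q)"
        using im fin by (intro sum.mono_neutral_left) auto
      also have "\<dots> = (\<Sum>k\<in>K. u k x)" by (subst sum.reindex) (auto simp: inj_on_def y_def)
      finally show "(\<Sum>q | y q \<noteq> 0. y q) = 0" using sum by simp
    qed
    then have "y (p + (k + s)) = 0" by blast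
    then show ?case using k by (simp add: y_def)
  next
    case zero
    then show ?case using linear_on_0[OF dm_homD(1)[OF u[OF k]] tot_0] .
  qed (use dm_homD(1)[OF u[OF k]] in \<open>auto simp: linear_on_def\<close>)
qed (use dm_homD(4)[OF u[OF k]] in blast)

text \<open>Each generator \<open>e i\<close> of the \<open>B\<close>-basis contributes two vectors,
  itself and its product with \<open>s\<close>.\<close>

lemma semifree_finite:
  assumes "semifree d M" shows "\<exists>F. finite F \<and> tot M \<subseteq> pv.span F"
proof -
  have M: "dg_module d M" using assms by (simp add: semifree_def)
  obtain n :: nat and e r where e: "\<forall>i<n. e i \<in> dm_gr M (r i)"
    and sp: "\<forall>x \<in> tot M. \<exists>!b. b \<in> {..<n} \<rightarrow>\<^sub>E Balg \<and> x = (\<Sum>i<n. dm_act M (e i) (b i))"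
    using assms unfolding semifree_def by blast
  let ?F = "e ` {..<n} \<union> (\<lambda>i. dm_act M (e i) [:0, 1:]) ` {..<n}"
  have "x \<in> pv.span ?F" if x: "x \<in> tot M" for x
  proof -
    obtain b where b: "b \<in> {..<n} \<rightarrow>\<^sub>E Balg" "x = (\<Sum>i<n. dm_act M (e i) (b i))"
      using sp x by blast
    have "dm_act M (e i) (b i) \<in> pv.span ?F" if i: "i < n" for i
    proof -
      have ei: "e i \<in> tot M" using e i gr_tot by blast
      have "b i \<in> Balg" using b(1) i by auto
      then have "b i = Polynomial.smult (coeff (b i) 0) 1 + Polynomial.smult (coeff (b i) 1) [:0, 1:]"
        by (auto simp: Balg_def poly_eq_iff coeff_pCons coeff_eq_0 split: nat.split)
      then obtain \<alpha> \<beta> where eq: "b i = Polynomial.smult \<alpha> 1 + Polynomial.smult \<beta> [:0, 1:]" by blast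
      have B: "1 \<in> Balg" "[:0, 1:] \<in> Balg" "Polynomial.smult c 1 \<in> Balg"
        "Polynomial.smult c [:0, 1:] \<in> Balg" for c
        by (auto simp: Balg_def)
      have lin: "dm_act M (e i) (p + q) = dm_act M (e i) p + dm_act M (e i) q"
        and lin': "dm_act M (e i) (Polynomial.smult c p) = Polynomial.smult c (dm_act M (e i) p)"
        if "p \<in> Balg" "q \<in> Balg" for p q c
        using dg_moduleD(4)[OF M ei] that unfolding linear_on_def by blast+
      have "dm_act M (e i) (b i) = Polynomial.smult \<alpha> (e i)
          + Polynomial.smult \<beta> (dm_act M (e i) [:0, 1:])"
        by (simp only: eq lin[OF B(3,4)] lin'[OF B(1,1)] lin'[OF B(2,2)] dg_moduleD(5)[OF M ei])
      moreover have "e i \<in> pv.span ?F" "dm_act M (e i) [:0, 1:] \<in> pv.span ?F"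
        using i by (auto intro: pv.span_base)
      ultimately show ?thesis by (simp add: pv.span_add pv.span_scale)
    qed
    then show ?thesis unfolding b(2) by (intro pv.span_sum) auto
  qed
  then show ?thesis by (intro exI[of _ ?F]) auto
qed

subsection \<open>The linearised DG-category\<close>

lemma LcD:
  "dg_ob (Lc d) = {(X, l). semifree d X \<and> linearisation Z2 (semifree_cat d) twist_ob twist_mor X l}"
  "dg_id (Lc d) X = (\<lambda>x. if x \<in> tot (fst X) then x else 0)"
  "dg_comp (Lc d) X Y Z g f = (\<lambda>x. if x \<in> tot (fst X) then g (f x) else 0)"
  "dg_scale (Lc d) c f = (\<lambda>x. Polynomial.smult c (f x))"
  "dg_diff (Lc d) X Y k f = (\<lambda>x. if x \<in> tot (fst X)
     then dm_diff (fst Y) (f x) - Polynomial.smult (sg k) (f (dm_diff (fst X) x)) else 0)"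
  by (simp_all add: linearised_def semifree_cat_def case_prod_unfold)

text \<open>The group acts trivially on maps, so compatibility with the linearisations is a
  pointwise commutation on the total space.\<close>

lemma Lc_hom:
  "f \<in> dg_hom (Lc d) X Y k \<longleftrightarrow> f \<in> dm_hom (fst X) (fst Y) k \<and>
    (\<forall>g \<in> carrier Z2. \<forall>x \<in> tot (fst X). snd Y g (f x) = f (snd X g x))"
proof -
  have "f \<in> dg_hom (Lc d) X Y k \<longleftrightarrow> f \<in> dm_hom (fst X) (fst Y) k \<and> (\<forall>g \<in> carrier Z2.
      (\<lambda>x. if x \<in> tot (fst X) then snd Y g (f x) else 0) = (\<lambda>x. if x \<in> tot (fst X) then f (snd X g x) else 0))"
    by (simp add: linearised_def semifree_cat_def twist_mor_def case_prod_unfold)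
  moreover have "(\<lambda>x. if x \<in> A then p x else 0) = (\<lambda>x. if x \<in> A then q x else 0) \<longleftrightarrow> (\<forall>x \<in> A. p x = q x)"
    for A and p q :: "complex poly \<Rightarrow> complex poly" by (auto simp: fun_eq_iff)
  ultimately show ?thesis by simp
qed

text \<open>The last claim restates closedness of the linearisation; it will make the differential a
  morphism of the linearised category.\<close>

lemma Lc_ob:
  assumes X: "X \<in> dg_ob (Lc d)"
  shows "semifree d (fst X)" "dg_module d (fst X)"
    and "\<And>g. g \<in> carrier Z2 \<Longrightarrow> linear_on (tot (fst X)) (snd X g)"
    and "\<And>g x. g \<in> carrier Z2 \<Longrightarrow> snd X g x \<in> tot (fst X)"
    and "\<And>g x. g \<in> carrier Z2 \<Longrightarrow> x \<in> tot (fst X) \<Longrightarrow> dm_diff (fst X) (snd X g x) = snd X g (dm_diff (fst X) x)"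
proof -
  obtain M l where Ml: "X = (M, l)" by (cases X)
  have sf: "semifree d M" and lin: "linearisation Z2 (semifree_cat d) twist_ob twist_mor M l"
    using X by (auto simp: LcD Ml)
  have tw: "tot (twist_ob g M) = tot M" "dm_diff (twist_ob g M) = dm_diff M" for g
    by (auto simp: twist_ob_def tot_def)
  have cc: "l g \<in> dg_cocycles (semifree_cat d) M (twist_ob g M)" if "g \<in> carrier Z2" for g
    using lin that unfolding linearisation_def by blast
  then have h: "l g \<in> dm_hom M (twist_ob g M) 0" if "g \<in> carrier Z2" for g
    using that by (auto simp: dg_cocycles_def semifree_cat_def)
  show "semifree d (fst X)" "dg_module d (fst X)" using sf by (auto simp: Ml semifree_def)
  show "linear_on (tot (fst X)) (snd X g)" if "g \<in> carrier Z2" for g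
    using dm_homD(1)[OF h[OF that]] by (simp add: Ml)
  show "snd X g x \<in> tot (fst X)" if "g \<in> carrier Z2" for g x
    using dm_hom_tot[OF h[OF that]] tw by (simp add: Ml)
  show "dm_diff (fst X) (snd X g x) = snd X g (dm_diff (fst X) x)" if "g \<in> carrier Z2" "x \<in> tot (fst X)" for g x
  proof -
    have "dg_diff (semifree_cat d) M (twist_ob g M) 0 (l g) x = 0"
      using cc[OF that(1)] by (simp add: dg_cocycles_def)
    then show ?thesis using that(2) tw by (simp add: semifree_cat_def Ml)
  qed
qed

lemma Lc_hom_dm: "f \<in> dg_hom (Lc d) X Y k \<Longrightarrow> f \<in> dm_hom (fst X) (fst Y) k"
  by (simp add: Lc_hom)

lemma Lc_0: "X \<in> dg_ob (Lc d) \<Longrightarrow> Y \<in> dg_ob (Lc d) \<Longrightarrow> 0 \<in> dg_hom (Lc d) X Y k"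
  using dm_hom_0[OF Lc_ob(2)] linear_on_0[OF Lc_ob(3) tot_0] by (simp add: Lc_hom zero_fun_def)

lemma Lc_add:
  assumes "X \<in> dg_ob (Lc d)" "Y \<in> dg_ob (Lc d)" "f \<in> dg_hom (Lc d) X Y k" "g \<in> dg_hom (Lc d) X Y k"
  shows "f + g \<in> dg_hom (Lc d) X Y k"
  using dm_hom_add[OF Lc_ob(2)[OF assms(2)] Lc_hom_dm[OF assms(3)] Lc_hom_dm[OF assms(4)]]
    Lc_ob(3)[OF assms(2)] dm_hom_tot[OF Lc_hom_dm[OF assms(3)]] dm_hom_tot[OF Lc_hom_dm[OF assms(4)]] assms(3,4)
  by (simp add: Lc_hom plus_fun_def linear_on_def)

lemma Lc_scale:
  assumes "X \<in> dg_ob (Lc d)" "Y \<in> dg_ob (Lc d)" "f \<in> dg_hom (Lc d) X Y k"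
  shows "dg_scale (Lc d) c f \<in> dg_hom (Lc d) X Y k"
  using dm_hom_smult[OF Lc_ob(2)[OF assms(2)] Lc_hom_dm[OF assms(3)]]
    Lc_ob(3)[OF assms(2)] dm_hom_tot[OF Lc_hom_dm[OF assms(3)]] assms(3)
  by (simp add: Lc_hom LcD linear_on_def)

lemma Lc_sum:
  assumes "X \<in> dg_ob (Lc d)" "Y \<in> dg_ob (Lc d)" "\<And>a. a \<in> A \<Longrightarrow> f a \<in> dg_hom (Lc d) X Y k"
  shows "(\<Sum>a\<in>A. f a) \<in> dg_hom (Lc d) X Y k"
  using assms(3) by (induction A rule: infinite_finite_induct) (auto intro: Lc_0 Lc_add assms(1,2))

lemma Lc_comp_app:
  assumes "f \<in> dg_hom (Lc d) X Y k" "g \<in> dg_hom (Lc d) Y Z l"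
  shows "dg_comp (Lc d) X Y Z g f x = g (f x)"
  using dm_homD(4)[OF Lc_hom_dm[OF assms(1)]] linear_on_0[OF dm_homD(1)[OF Lc_hom_dm[OF assms(2)]] tot_0]
  by (simp add: LcD)

lemma Lc_comp:
  assumes X: "X \<in> dg_ob (Lc d)" and f: "f \<in> dg_hom (Lc d) X Y k" and g: "g \<in> dg_hom (Lc d) Y Z l"
  shows "dg_comp (Lc d) X Y Z g f \<in> dg_hom (Lc d) X Z (k + l)"
proof -
  have "snd Z h (g (f x)) = g (f (snd X h x))" if "h \<in> carrier Z2" "x \<in> tot (fst X)" for h x
    using f g that dm_hom_tot[OF Lc_hom_dm[OF f]] by (simp add: Lc_hom)
  then show ?thesis using dm_hom_comp[OF Lc_hom_dm[OF f] Lc_hom_dm[OF g]] Lc_ob(4)[OF X]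
    by (simp add: Lc_hom LcD)
qed

lemma Lc_id: "X \<in> dg_ob (Lc d) \<Longrightarrow> dg_id (Lc d) X \<in> dg_hom (Lc d) X X 0"
  using dm_hom_id[OF Lc_ob(2)] Lc_ob(4)[of X d] by (simp add: Lc_hom LcD)

lemma Lc_dmd: "X \<in> dg_ob (Lc d) \<Longrightarrow> dmd (fst X) \<in> dg_hom (Lc d) X X 1"
  using dm_hom_dmd[OF Lc_ob(2)] Lc_ob(4,5)[of X d] by (simp add: Lc_hom dmd_def)

section \<open>Twisted complexes as operators\<close>

text \<open>All morphisms between twisted complexes become elements of one ring: a matrix acts on
  sequences of polynomials, after projecting the \<open>j\<close>-th entry onto the total space of the \<open>j\<close>-th
  summand.\<close>

typedef seq_op = "{F :: (nat \<Rightarrow> complex poly) \<Rightarrow> nat \<Rightarrow> complex poly.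
    (\<forall>v w. F (\<lambda>i. v i + w i) = (\<lambda>i. F v i + F w i)) \<and>
    (\<forall>c v. F (\<lambda>i. Polynomial.smult c (v i)) = (\<lambda>i. Polynomial.smult c (F v i)))}"
  morphisms ap Seq_op by (rule exI[of _ "\<lambda>v. v"]) simp

setup_lifting type_definition_seq_op

lemma ap_add: "ap F (\<lambda>i. v i + w i) i = ap F v i + ap F w i"
  and ap_smult: "ap F (\<lambda>i. Polynomial.smult c (v i)) i = Polynomial.smult c (ap F v i)"
  using ap[of F] by (simp_all add: fun_eq_iff)

lemma ap_0: "ap F (\<lambda>i. 0) i = 0"
  using ap_smult[of F 0 "\<lambda>i. 0" i] by simp

lemma ap_sum: "ap F (\<lambda>i. \<Sum>a\<in>A. v a i) i = (\<Sum>a\<in>A. ap F (v a) i)"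
  by (induction A rule: infinite_finite_induct) (simp_all add: ap_0 ap_add)

lemma seq_op_eqI: "(\<And>v i. ap F v i = ap G v i) \<Longrightarrow> F = G"
  by (metis ap_inject ext)

instantiation seq_op :: ring_1
begin

lift_definition zero_seq_op :: seq_op is "\<lambda>v i. 0" by simp
lift_definition one_seq_op :: seq_op is "\<lambda>v. v" by simp
lift_definition plus_seq_op :: "seq_op \<Rightarrow> seq_op \<Rightarrow> seq_op" is "\<lambda>F G v i. F v i + G v i"
  by (simp add: smult_add_right add_ac)
lift_definition uminus_seq_op :: "seq_op \<Rightarrow> seq_op" is "\<lambda>F v i. - F v i" by simp
lift_definition minus_seq_op :: "seq_op \<Rightarrow> seq_op \<Rightarrow> seq_op" is "\<lambda>F G v i. F v i - G v i"
  by (simp add: smult_diff_right) (simp add: fun_eq_iff)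
lift_definition times_seq_op :: "seq_op \<Rightarrow> seq_op \<Rightarrow> seq_op" is "\<lambda>F G v. F (G v)" by simp

instance
proof
  have "(0::seq_op) \<noteq> 1"
  proof
    assume "(0::seq_op) = 1"
    then have "ap 0 (\<lambda>i. 1) 0 = ap 1 (\<lambda>i. 1) 0" by simp
    then show False by (simp add: zero_seq_op.rep_eq one_seq_op.rep_eq)
  qed
  then show "(0::seq_op) \<noteq> 1" .
qed (transfer; simp add: fun_eq_iff add_ac)+

end

lift_definition lsc :: "complex \<Rightarrow> seq_op" is "\<lambda>c v i. Polynomial.smult c (v i)"
  by (simp add: smult_add_right mult.commute)
text \<open>In a cone the summands of \<open>X\<close> come after those of \<open>Y\<close>; these
  operators move a sequence behind the first \<open>n\<close> positions and back.\<close>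

lift_definition sh_up :: "nat \<Rightarrow> seq_op" is "\<lambda>n v i. if n \<le> i then v (i - n) else 0" by (auto simp: fun_eq_iff)
lift_definition sh_dn :: "nat \<Rightarrow> seq_op" is "\<lambda>n v i. v (i + n)" by simp

lemmas ap_simps = zero_seq_op.rep_eq one_seq_op.rep_eq plus_seq_op.rep_eq uminus_seq_op.rep_eq minus_seq_op.rep_eq
  times_seq_op.rep_eq lsc.rep_eq sh_up.rep_eq sh_dn.rep_eq

lemma lsc_add: "lsc (a + b) = lsc a + lsc b" and lsc_mult: "lsc (a * b) = lsc a * lsc b"
  and lsc_1: "lsc 1 = 1" and lsc_comm: "F * lsc a = lsc a * F"
  by (rule seq_op_eqI; simp add: ap_simps smult_add_left ap_smult)+

lemma sg_eq: "sg k = (if even k then 1 else - 1)"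
  by (simp add: power_int_minus_left)

lemma sg_add: "sg (k + l) = sg k * sg l" and sg_diff: "sg (k - l) = sg k * sg l"
  by (simp_all add: sg_eq)

lemma sn_lsc: "sn k = lsc (sg k)"
  by (rule seq_op_eqI) (simp add: sn_def sg_eq ap_simps)

lemma sh_dn_up: "sh_dn n * sh_up n = 1"
  by (rule seq_op_eqI) (simp add: ap_simps)

lemma sum_ap: "ap (\<Sum>a\<in>A. F a) v i = (\<Sum>a\<in>A. ap (F a) v i)"
  by (induction A rule: infinite_finite_induct) (simp_all add: ap_simps)

text \<open>Maps of modules carry information on total spaces only; a linear projection, which
  exists because subspaces have complements, extends them to linear operators on all
  polynomials.\<close>

definition tot_prj :: "dgmod \<Rightarrow> complex poly \<Rightarrow> complex poly" where
  "tot_prj M = (SOME p. (\<forall>x y. p (x + y) = p x + p y) \<and> (\<forall>c x. p (Polynomial.smult c x) = Polynomial.smult c (p x)) \<and>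
     (\<forall>x. p x \<in> tot M) \<and> (\<forall>x \<in> tot M. p x = x))"

lemma tot_prj: "tot_prj M (x + y) = tot_prj M x + tot_prj M y" "tot_prj M (Polynomial.smult c x) = Polynomial.smult c (tot_prj M x)"
  "tot_prj M x \<in> tot M" "x \<in> tot M \<Longrightarrow> tot_prj M x = x"
proof -
  interpret pp: vector_space_pair "Polynomial.smult :: complex \<Rightarrow> complex poly \<Rightarrow> complex poly"
    "Polynomial.smult :: complex \<Rightarrow> complex poly \<Rightarrow> complex poly" ..
  have V: "pv.subspace (tot M)" unfolding tot_def by simp
  obtain g where g: "g ` UNIV \<subseteq> tot M" "Vector_Spaces.linear Polynomial.smult Polynomial.smult g"
      "\<forall>v\<in>tot M. g v = v"
    using pp.linear_exists_left_inverse_on[OF pv.linear_id V inj_on_id] by auto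
  interpret g: Vector_Spaces.linear Polynomial.smult Polynomial.smult g by (rule g(2))
  have "\<exists>p. (\<forall>x y. p (x + y) = p x + p y) \<and> (\<forall>c x. p (Polynomial.smult c x) = Polynomial.smult c (p x)) \<and>
     (\<forall>x. p x \<in> tot M) \<and> (\<forall>x \<in> tot M. p x = x)"
    using g(1,3) g.add g.scale by (intro exI[of _ g]) auto
  from someI_ex[OF this] show "tot_prj M (x + y) = tot_prj M x + tot_prj M y"
    "tot_prj M (Polynomial.smult c x) = Polynomial.smult c (tot_prj M x)"
    "tot_prj M x \<in> tot M" "x \<in> tot M \<Longrightarrow> tot_prj M x = x"
    unfolding tot_prj_def[symmetric] by auto
qed

lemma tot_prj_0: "tot_prj M 0 = 0" using tot_prj(4)[OF tot_0] .

type_synonym lob = "dgmod \<times> (int \<Rightarrow> complex poly \<Rightarrow> complex poly)"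
type_synonym lmap = "complex poly \<Rightarrow> complex poly"
type_synonym tw = "(lob, lmap) twisted"

abbreviation tm :: "tw \<Rightarrow> nat \<Rightarrow> dgmod" where "tm X i \<equiv> fst (tob X i)"

definition mop :: "tw \<Rightarrow> (nat \<Rightarrow> nat \<Rightarrow> lmap) \<Rightarrow> seq_op" where
  "mop X f = Seq_op (\<lambda>v i. \<Sum>j<sz X. f i j (tot_prj (tm X j) (v j)))"

definition lin_mat :: "tw \<Rightarrow> (nat \<Rightarrow> nat \<Rightarrow> lmap) \<Rightarrow> bool" where
  "lin_mat X f \<longleftrightarrow> (\<forall>i. \<forall>j<sz X. linear_on (tot (tm X j)) (f i j))"

text \<open>Linearity of the entries on the total spaces makes the defining formula a member of the
  type, so that \<open>Seq_op\<close> can be inverted.\<close>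

lemma ap_mop:
  assumes "lin_mat X f" shows "ap (mop X f) v i = (\<Sum>j<sz X. f i j (tot_prj (tm X j) (v j)))"
proof -
  let ?F = "\<lambda>v i. \<Sum>j<sz X. f i j (tot_prj (tm X j) (v j))"
  have l: "f i j (tot_prj (tm X j) x + tot_prj (tm X j) y) = f i j (tot_prj (tm X j) x) + f i j (tot_prj (tm X j) y)"
     "f i j (Polynomial.smult c (tot_prj (tm X j) x)) = Polynomial.smult c (f i j (tot_prj (tm X j) x))"
     if "j < sz X" for i j x y c
    using assms that tot_prj(3) unfolding lin_mat_def linear_on_def by auto
  have "(\<Sum>j<sz X. f i j (tot_prj (tm X j) (v j + w j))) = ?F v i + ?F w i" for v w i
    unfolding sum.distrib[symmetric] by (rule sum.cong) (simp_all add: l tot_prj)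
  moreover have "(\<Sum>j<sz X. f i j (tot_prj (tm X j) (Polynomial.smult c (v j)))) = Polynomial.smult c (?F v i)" for c v i
    unfolding pv.scale_sum_right by (rule sum.cong) (simp_all add: l tot_prj)
  ultimately have "?F \<in> {F. (\<forall>v w. F (\<lambda>i. v i + w i) = (\<lambda>i. F v i + F w i)) \<and>
    (\<forall>c v. F (\<lambda>i. Polynomial.smult c (v i)) = (\<lambda>i. Polynomial.smult c (F v i)))}" by simp
  from Seq_op_inverse[OF this] show ?thesis unfolding mop_def by simp
qed

lemma mop_cong: "sz X = sz Y \<Longrightarrow> (\<And>j. j < sz X \<Longrightarrow> tob X j = tob Y j) \<Longrightarrow> mop X f = mop Y f"
  unfolding mop_def by (intro arg_cong[of _ _ Seq_op] ext sum.cong) auto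

lemma mop_add: "lin_mat X f \<Longrightarrow> lin_mat X g \<Longrightarrow> mop X (f + g) = mop X f + mop X g \<and> lin_mat X (f + g)"
proof -
  assume a: "lin_mat X f" "lin_mat X g"
  then have "lin_mat X (f + g)" by (simp add: lin_mat_def linear_on_def plus_fun_def add_ac smult_add_right)
  then show ?thesis using a
    by (intro conjI seq_op_eqI) (simp_all add: ap_mop ap_simps plus_fun_def sum.distrib)
qed

lemma mop_diff: "lin_mat X f \<Longrightarrow> lin_mat X g \<Longrightarrow> mop X (f - g) = mop X f - mop X g \<and> lin_mat X (f - g)"
proof -
  assume a: "lin_mat X f" "lin_mat X g"
  then have "lin_mat X (f - g)" by (simp add: lin_mat_def linear_on_def fun_diff_def smult_diff_right)
  then show ?thesis using a
    by (intro conjI seq_op_eqI) (simp_all add: ap_mop ap_simps fun_diff_def sum_subtractf)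
qed

lemma mop_0: "mop X 0 = 0"
proof -
  have "lin_mat X 0" by (simp add: lin_mat_def linear_on_def zero_fun_def)
  then show ?thesis by (intro seq_op_eqI) (simp add: ap_mop ap_simps zero_fun_def)
qed

lemma mop_scale: "lin_mat X f \<Longrightarrow> mop X (pt_scale (Lc d) c f) = lsc c * mop X f \<and> lin_mat X (pt_scale (Lc d) c f)"
proof -
  assume a: "lin_mat X f"
  then have "lin_mat X (pt_scale (Lc d) c f)"
    by (simp add: lin_mat_def linear_on_def pt_scale_def LcD smult_add_right mult.commute)
  then show ?thesis using a
    by (intro conjI seq_op_eqI) (simp_all add: ap_mop ap_simps pt_scale_def LcD pv.scale_sum_right)
qed

lemma pt_homD:
  assumes "f \<in> pt_hom (Lc d) X Y l"
  shows "\<And>i j. i < sz Y \<Longrightarrow> j < sz X \<Longrightarrow> f i j \<in> dg_hom (Lc d) (tob X j) (tob Y i) (l + tsh Y i - tsh X j)"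
    "\<And>i j. \<not> (i < sz Y \<and> j < sz X) \<Longrightarrow> f i j = 0"
proof -
  have *: "if i < sz Y \<and> j < sz X then f i j \<in> dg_hom (Lc d) (tob X j) (tob Y i) (l + tsh Y i - tsh X j)
      else f i j = 0" for i j
    using assms unfolding pt_hom_def mem_Collect_eq by (elim allE)
  show "f i j \<in> dg_hom (Lc d) (tob X j) (tob Y i) (l + tsh Y i - tsh X j)" if "i < sz Y" "j < sz X" for i j
    using *[of i j] that by (simp only: simp_thms if_True)
  show "f i j = 0" if "\<not> (i < sz Y \<and> j < sz X)" for i j
    using *[of i j] that by (simp only: simp_thms if_False)
qed

lemma pt_hom_lin: "f \<in> pt_hom (Lc d) X Y l \<Longrightarrow> lin_mat X f"
  unfolding lin_mat_def
proof (intro allI impI)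
  fix i j assume f: "f \<in> pt_hom (Lc d) X Y l" and j: "j < sz X"
  show "linear_on (tot (tm X j)) (f i j)"
    using dm_homD(1)[OF Lc_hom_dm[OF pt_homD(1)[OF f _ j]], of i] pt_homD(2)[OF f, of i j] j
    by (cases "i < sz Y") (auto simp: linear_on_def)
qed

lemma pt_hom_out:
  assumes f: "f \<in> pt_hom (Lc d) X Y l" and "x \<notin> tot (tm X j)" shows "f i j x = 0"
  using dm_homD(4)[OF Lc_hom_dm[OF pt_homD(1)[OF f]], of i j x] pt_homD(2)[OF f, of i j] assms(2)
  by (cases "i < sz Y \<and> j < sz X") auto

lemma pt_hom_in:
  assumes f: "f \<in> pt_hom (Lc d) X Y l" shows "f i j x \<in> tot (tm Y i)"
  using dm_hom_tot[OF Lc_hom_dm[OF pt_homD(1)[OF f]], of i j x] pt_homD(2)[OF f, of i j] tot_0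
  by (cases "i < sz Y \<and> j < sz X") auto

lemma mop_single:
  assumes f: "lin_mat X f" and j: "j < sz X" and x: "x \<in> tot (tm X j)"
  shows "ap (mop X f) (\<lambda>k. if k = j then x else 0) i = f i j x"
proof -
  have "f i k (tot_prj (tm X k) (if k = j then x else 0)) = (if k = j then f i j x else 0)" if "k < sz X" for k
    using f that x linear_on_0[OF _ tot_0] by (auto simp: tot_prj tot_prj_0 lin_mat_def)
  then show ?thesis using j by (simp add: ap_mop[OF f] sum.delta)
qed

text \<open>Entries are recovered by applying the operator to sequences supported in one position;
  outside the total spaces they vanish by convention.\<close>

lemma mop_inj:
  assumes f: "f \<in> pt_hom (Lc d) X Y l" and g: "g \<in> pt_hom (Lc d) X Y l'" and eq: "mop X f = mop X g"
  shows "f = g"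
proof (intro ext)
  fix i j x
  show "f i j x = g i j x"
  proof (cases "j < sz X \<and> x \<in> tot (tm X j)")
    case True
    then show ?thesis using mop_single[OF pt_hom_lin[OF f], of j x i] mop_single[OF pt_hom_lin[OF g], of j x i] eq
      by simp
  next
    case False
    then show ?thesis using pt_hom_out[OF f] pt_hom_out[OF g] pt_homD(2)[OF f, of i j] pt_homD(2)[OF g, of i j]
      by (cases "j < sz X") auto
  qed
qed

definition pob :: "int \<Rightarrow> tw \<Rightarrow> bool" where
  "pob d X \<longleftrightarrow> (\<forall>i<sz X. tob X i \<in> dg_ob (Lc d))"

lemma pobD: "pob d X \<Longrightarrow> i < sz X \<Longrightarrow> tob X i \<in> dg_ob (Lc d)" by (simp add: pob_def)

lemma pt_hom_0: "pob d X \<Longrightarrow> pob d Y \<Longrightarrow> 0 \<in> pt_hom (Lc d) X Y l"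
  by (simp add: pt_hom_def Lc_0 pobD)

lemma pt_hom_add:
  "\<lbrakk>pob d X; pob d Y; f \<in> pt_hom (Lc d) X Y l; g \<in> pt_hom (Lc d) X Y l\<rbrakk> \<Longrightarrow> f + g \<in> pt_hom (Lc d) X Y l"
  unfolding pt_hom_def by (auto simp: Lc_add pobD)

lemma pt_hom_scale:
  "\<lbrakk>pob d X; pob d Y; f \<in> pt_hom (Lc d) X Y l\<rbrakk> \<Longrightarrow> pt_scale (Lc d) c f \<in> pt_hom (Lc d) X Y l"
  unfolding pt_hom_def pt_scale_def by (auto simp: Lc_scale pobD) (auto simp: LcD)

lemma pt_hom_diff:
  assumes "pob d X" "pob d Y" "f \<in> pt_hom (Lc d) X Y l" "g \<in> pt_hom (Lc d) X Y l"
  shows "f - g \<in> pt_hom (Lc d) X Y l"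
proof -
  have *: "f - g = f + pt_scale (Lc d) (- 1) g" by (auto simp: fun_eq_iff pt_scale_def LcD)
  show ?thesis unfolding * by (rule pt_hom_add[OF assms(1-3) pt_hom_scale[OF assms(1,2,4)]])
qed

lemma pt_hom_comp:
  assumes "pob d X" "pob d Z" and Y: "pob d Y" and f: "f \<in> pt_hom (Lc d) X Y k" and g: "g \<in> pt_hom (Lc d) Y Z l"
  shows "pt_comp (Lc d) X Y Z g f \<in> pt_hom (Lc d) X Z (k + l)"
  unfolding pt_hom_def mem_Collect_eq
proof (intro allI)
  fix i j
  have "dg_comp (Lc d) (tob X j) (tob Y m) (tob Z i) (g i m) (f m j)
      \<in> dg_hom (Lc d) (tob X j) (tob Z i) (k + l + tsh Z i - tsh X j)" if "i < sz Z" "j < sz X" "m < sz Y" for m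
    using Lc_comp[OF pobD[OF assms(1) that(2)] pt_homD(1)[OF f that(3,2)] pt_homD(1)[OF g that(1,3)]]
    by (simp add: algebra_simps)
  then have "i < sz Z \<Longrightarrow> j < sz X \<Longrightarrow> (\<Sum>m<sz Y. dg_comp (Lc d) (tob X j) (tob Y m) (tob Z i) (g i m) (f m j))
      \<in> dg_hom (Lc d) (tob X j) (tob Z i) (k + l + tsh Z i - tsh X j)"
    by (intro Lc_sum[OF pobD[OF assms(1)] pobD[OF assms(2)]]) auto
  then show "if i < sz Z \<and> j < sz X then pt_comp (Lc d) X Y Z g f i j
       \<in> dg_hom (Lc d) (tob X j) (tob Z i) (k + l + tsh Z i - tsh X j) else pt_comp (Lc d) X Y Z g f i j = 0"
    unfolding pt_comp_def by (cases "i < sz Z \<and> j < sz X") (simp_all only: simp_thms if_True if_False)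
qed

lemma sum_fun_app: "(\<Sum>a\<in>A. f a) x = (\<Sum>a\<in>A. f a x)"
  for f :: "'a \<Rightarrow> 'b \<Rightarrow> 'c::comm_monoid_add"
  by (induction A rule: infinite_finite_induct) auto

text \<open>The projection between the two factors does nothing, since the entries of
  \<open>f\<close> take values in the total spaces of the middle summands.\<close>

lemma mop_comp:
  assumes "pob d X" "pob d Z" and Y: "pob d Y" and f: "f \<in> pt_hom (Lc d) X Y k" and g: "g \<in> pt_hom (Lc d) Y Z l"
  shows "mop X (pt_comp (Lc d) X Y Z g f) = mop Y g * mop X f"
proof (rule seq_op_eqI)
  fix v i
  let ?p = "\<lambda>j. tot_prj (tm X j) (v j)"
  have "ap (mop Y g * mop X f) v i = (\<Sum>m<sz Y. g i m (tot_prj (tm Y m) (\<Sum>j<sz X. f m j (?p j))))"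
    by (simp add: ap_simps ap_mop pt_hom_lin[OF f] pt_hom_lin[OF g])
  also have "\<dots> = (\<Sum>m<sz Y. \<Sum>j<sz X. g i m (f m j (?p j)))"
  proof (rule sum.cong[OF refl])
    fix m assume "m \<in> {..<sz Y}"
    then have l: "linear_on (tot (tm Y m)) (g i m)" using pt_hom_lin[OF g] by (simp add: lin_mat_def)
    show "g i m (tot_prj (tm Y m) (\<Sum>j<sz X. f m j (?p j))) = (\<Sum>j<sz X. g i m (f m j (?p j)))"
      unfolding tot_prj(4)[OF tot_sum[OF pt_hom_in[OF f]]] by (rule linear_on_sum[OF l pt_hom_in[OF f]])
  qed
  also have "\<dots> = (\<Sum>j<sz X. \<Sum>m<sz Y. g i m (f m j (?p j)))" by (rule sum.swap)
  also have "\<dots> = (\<Sum>j<sz X. pt_comp (Lc d) X Y Z g f i j (?p j))"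
  proof (rule sum.cong[OF refl])
    fix j assume j: "j \<in> {..<sz X}"
    show "(\<Sum>m<sz Y. g i m (f m j (?p j))) = pt_comp (Lc d) X Y Z g f i j (?p j)"
    proof (cases "i < sz Z")
      case True
      then show ?thesis using j Lc_comp_app[OF pt_homD(1)[OF f] pt_homD(1)[OF g]]
        by (simp add: pt_comp_def sum_fun_app)
    next
      case False
      then have "g i m = 0" for m using pt_homD(2)[OF g] by simp
      then show ?thesis using False by (simp add: pt_comp_def)
    qed
  qed
  also have "\<dots> = ap (mop X (pt_comp (Lc d) X Y Z g f)) v i"
    by (simp add: ap_mop[OF pt_hom_lin[OF pt_hom_comp[OF assms]]])
  finally show "ap (mop X (pt_comp (Lc d) X Y Z g f)) v i = ap (mop Y g * mop X f) v i" by simp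
qed

section \<open>Hom-sets, identities and total differentials as operators\<close>

definition op_hom :: "int \<Rightarrow> tw \<Rightarrow> tw \<Rightarrow> int \<Rightarrow> seq_op set" where
  "op_hom d X Y k = mop X ` pt_hom (Lc d) X Y k"

definition id_mat :: "int \<Rightarrow> tw \<Rightarrow> nat \<Rightarrow> nat \<Rightarrow> lmap" where
  "id_mat d X = dg_id (pretr (Lc d)) X"

text \<open>The internal differentials of the summands as a diagonal matrix, with the sign of the
  differential of \<open>C[r]\<close>. With the twist added, as in \<open>op_diff\<close>, it is the
  total differential of the twisted complex.\<close>

definition diff_mat :: "tw \<Rightarrow> nat \<Rightarrow> nat \<Rightarrow> lmap" where
  "diff_mat X = (\<lambda>i j. if i = j \<and> i < sz X then (\<lambda>x. Polynomial.smult (sg (tsh X i)) (dmd (tm X i) x)) else 0)"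

definition op_id :: "int \<Rightarrow> tw \<Rightarrow> seq_op" where "op_id d X = mop X (id_mat d X)"
definition op_diff :: "tw \<Rightarrow> seq_op" where "op_diff X = mop X (diff_mat X) + mop X (tq X)"

lemma id_mat_hom: "pob d X \<Longrightarrow> id_mat d X \<in> pt_hom (Lc d) X X 0"
  using Lc_id[OF pobD] by (auto simp: id_mat_def pretr_def pt_hom_def Lc_0 pobD)

lemma diff_mat_hom: "pob d X \<Longrightarrow> diff_mat X \<in> pt_hom (Lc d) X X 1"
  using Lc_scale[OF pobD pobD Lc_dmd[OF pobD], of d X] by (auto simp: diff_mat_def pt_hom_def Lc_0 pobD LcD(4))

lemma ap_op_id: assumes "pob d X" shows "ap (op_id d X) v i = (if i < sz X then tot_prj (tm X i) (v i) else 0)"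
proof -
  have "id_mat d X i j (tot_prj (tm X j) x) = (if j = i then if i < sz X then tot_prj (tm X i) x else 0 else 0)" for j x
    using tot_prj(3) by (auto simp: id_mat_def pretr_def LcD)
  then show ?thesis unfolding op_id_def ap_mop[OF pt_hom_lin[OF id_mat_hom[OF assms]]] by (simp add: sum.delta)
qed

lemma op_hom_0: "pob d X \<Longrightarrow> pob d Y \<Longrightarrow> 0 \<in> op_hom d X Y k"
  unfolding op_hom_def using mop_0[of X] pt_hom_0[of d X Y k] by (intro image_eqI[of _ _ 0]) simp_all

lemma op_hom_add:
  assumes X: "pob d X" and Y: "pob d Y" and "F \<in> op_hom d X Y k" "G \<in> op_hom d X Y k"
  shows "F + G \<in> op_hom d X Y k"
proof -
  obtain f g where f: "f \<in> pt_hom (Lc d) X Y k" "F = mop X f" and g: "g \<in> pt_hom (Lc d) X Y k" "G = mop X g"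
    using assms(3,4) unfolding op_hom_def by (elim imageE) simp
  show ?thesis unfolding op_hom_def
    using mop_add[OF pt_hom_lin[OF f(1)] pt_hom_lin[OF g(1)]] f(2) g(2)
    by (intro image_eqI[OF _ pt_hom_add[OF X Y f(1) g(1)]]) simp
qed

lemma op_hom_scale:
  assumes X: "pob d X" and Y: "pob d Y" and "F \<in> op_hom d X Y k"
  shows "lsc c * F \<in> op_hom d X Y k"
proof -
  obtain f where f: "f \<in> pt_hom (Lc d) X Y k" "F = mop X f"
    using assms(3) unfolding op_hom_def by (elim imageE) simp
  show ?thesis unfolding op_hom_def
    using mop_scale[OF pt_hom_lin[OF f(1)]] f(2)
    by (intro image_eqI[OF _ pt_hom_scale[OF X Y f(1)]]) simp
qed

lemma op_hom_mult:
  assumes X: "pob d X" and Y: "pob d Y" and Z: "pob d Z" and "F \<in> op_hom d X Y k" "G \<in> op_hom d Y Z l"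
  shows "G * F \<in> op_hom d X Z (k + l)"
proof -
  obtain f g where f: "f \<in> pt_hom (Lc d) X Y k" "F = mop X f" and g: "g \<in> pt_hom (Lc d) Y Z l" "G = mop Y g"
    using assms(4,5) unfolding op_hom_def by (elim imageE) simp
  show ?thesis unfolding op_hom_def
    using mop_comp[OF X Z Y f(1) g(1)] f(2) g(2)
    by (intro image_eqI[OF _ pt_hom_comp[OF X Z Y f(1) g(1)]]) simp
qed

lemma op_hom_one: "pob d X \<Longrightarrow> op_id d X \<in> op_hom d X X 0"
  unfolding op_hom_def op_id_def by (rule imageI) (rule id_mat_hom)

lemma op_hom_mop: "f \<in> pt_hom (Lc d) X Y k \<Longrightarrow> mop X f \<in> op_hom d X Y k"
  unfolding op_hom_def by (rule imageI)

lemma op_id_left: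
  assumes X: "pob d X" and Y: "pob d Y" and "F \<in> op_hom d X Y k" shows "op_id d Y * F = F"
proof -
  obtain f where f: "f \<in> pt_hom (Lc d) X Y k" "F = mop X f"
    using assms(3) unfolding op_hom_def by (elim imageE) simp
  have F: "ap F v i = (\<Sum>j<sz X. f i j (tot_prj (tm X j) (v j)))" for v i by (simp add: ap_mop[OF pt_hom_lin[OF f(1)]] f(2))
  have "ap (op_id d Y * F) v i = ap F v i" for v i
  proof (cases "i < sz Y")
    case True
    have "ap F v i \<in> tot (tm Y i)" unfolding F by (intro tot_sum pt_hom_in[OF f(1)])
    then show ?thesis using True by (simp add: ap_simps ap_op_id[OF Y] tot_prj)
  next
    case False
    then have "f i j = 0" for j using pt_homD(2)[OF f(1)] by blast
    then show ?thesis using False by (simp add: ap_simps ap_op_id[OF Y] F)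
  qed
  then show ?thesis by (rule seq_op_eqI)
qed

lemma op_id_right:
  assumes X: "pob d X" and "F \<in> op_hom d X Y k" shows "F * op_id d X = F"
proof -
  obtain f where f: "f \<in> pt_hom (Lc d) X Y k" "F = mop X f"
    using assms(2) unfolding op_hom_def by (elim imageE) simp
  have F: "ap F v i = (\<Sum>j<sz X. f i j (tot_prj (tm X j) (v j)))" for v i by (simp add: ap_mop[OF pt_hom_lin[OF f(1)]] f(2))
  show ?thesis by (rule seq_op_eqI) (simp add: ap_simps F ap_op_id[OF X] tot_prj)
qed

lemma pt_ob_D:
  assumes "X \<in> pt_ob (Lc d)"
  shows "pob d X" "tq X \<in> pt_hom (Lc d) X X 1" "\<And>i j. i \<ge> j \<Longrightarrow> tq X i j = 0"
    "pt_naive_diff (Lc d) X X 1 (tq X) + pt_comp (Lc d) X X X (tq X) (tq X) = 0"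
  using assms by (auto simp: pt_ob_def pob_def)

lemma Lc_diff_eq:
  assumes Y: "Y \<in> dg_ob (Lc d)" and f: "f \<in> dg_hom (Lc d) X Y k"
  shows "dg_diff (Lc d) X Y k f x = dmd (fst Y) (f x) - Polynomial.smult (sg k) (f (dmd (fst X) x))"
  using dm_homD(4)[OF Lc_hom_dm[OF f]] dm_hom_tot[OF Lc_hom_dm[OF f], of x]
    linear_on_0[OF dm_homD(1)[OF Lc_hom_dm[OF f]] tot_0]
    linear_on_0[OF dg_moduleD(6)[OF Lc_ob(2)[OF Y]] tot_0]
  by (auto simp: LcD dmd_def)

lemma Lc_diff_hom:
  assumes X: "X \<in> dg_ob (Lc d)" and Y: "Y \<in> dg_ob (Lc d)" and f: "f \<in> dg_hom (Lc d) X Y k"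
  shows "dg_diff (Lc d) X Y k f \<in> dg_hom (Lc d) X Y (k + 1)"
proof -
  have a: "dg_comp (Lc d) X Y Y (dmd (fst Y)) f \<in> dg_hom (Lc d) X Y (k + 1)"
    by (rule Lc_comp[OF X f Lc_dmd[OF Y]])
  have b: "dg_scale (Lc d) (- sg k) (dg_comp (Lc d) X X Y f (dmd (fst X))) \<in> dg_hom (Lc d) X Y (k + 1)"
    using Lc_scale[OF X Y Lc_comp[OF X Lc_dmd[OF X] f]] by (simp add: add.commute)
  have "dg_diff (Lc d) X Y k f = dg_comp (Lc d) X Y Y (dmd (fst Y)) f +
      dg_scale (Lc d) (- sg k) (dg_comp (Lc d) X X Y f (dmd (fst X)))"
    by (rule ext) (simp add: Lc_diff_eq[OF Y f] Lc_comp_app[OF f Lc_dmd[OF Y]] Lc_comp_app[OF Lc_dmd[OF X] f] LcD(4))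
  then show ?thesis using Lc_add[OF X Y a b] by simp
qed

lemma naive_hom:
  assumes X: "pob d X" and Y: "pob d Y" and f: "f \<in> pt_hom (Lc d) X Y l"
  shows "pt_naive_diff (Lc d) X Y l f \<in> pt_hom (Lc d) X Y (l + 1)"
  unfolding pt_hom_def mem_Collect_eq
proof (intro allI)
  fix i j
  have "pt_naive_diff (Lc d) X Y l f i j \<in> dg_hom (Lc d) (tob X j) (tob Y i) (l + 1 + tsh Y i - tsh X j)"
    if ij: "i < sz Y" "j < sz X"
    using Lc_scale[OF pobD[OF X ij(2)] pobD[OF Y ij(1)]
        Lc_diff_hom[OF pobD[OF X ij(2)] pobD[OF Y ij(1)] pt_homD(1)[OF f ij]], of "sg (tsh Y i)"] ij
    by (simp add: pt_naive_diff_def algebra_simps)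
  then show "if i < sz Y \<and> j < sz X then pt_naive_diff (Lc d) X Y l f i j
       \<in> dg_hom (Lc d) (tob X j) (tob Y i) (l + 1 + tsh Y i - tsh X j) else pt_naive_diff (Lc d) X Y l f i j = 0"
    by (simp add: pt_naive_diff_def)
qed

text \<open>The sign conventions for shifted summands turn the entrywise differential into a graded
  commutator with the diagonal matrix \<open>diff_mat\<close>.\<close>

lemma naive_eq:
  assumes X: "pob d X" and Y: "pob d Y" and f: "f \<in> pt_hom (Lc d) X Y l"
  shows "pt_naive_diff (Lc d) X Y l f =
    pt_comp (Lc d) X Y Y (diff_mat Y) f - pt_scale (Lc d) (sg l) (pt_comp (Lc d) X X Y f (diff_mat X))"
proof (intro ext)
  fix i j x
  show "pt_naive_diff (Lc d) X Y l f i j x =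
    (pt_comp (Lc d) X Y Y (diff_mat Y) f - pt_scale (Lc d) (sg l) (pt_comp (Lc d) X X Y f (diff_mat X))) i j x"
  proof (cases "i < sz Y \<and> j < sz X")
    case True
    note fij = pt_homD(1)[OF f conjunct1[OF True] conjunct2[OF True]]
    have fl: "f i j (Polynomial.smult c y) = Polynomial.smult c (f i j y)" if "y \<in> tot (tm X j)" for c y
      using dm_homD(1)[OF Lc_hom_dm[OF fij]] that by (simp add: linear_on_def)
    have f0: "f i j 0 = 0" using linear_on_0[OF dm_homD(1)[OF Lc_hom_dm[OF fij]] tot_0] .
    have dt: "dmd (tm X j) y \<in> tot (tm X j)" for y
      using dm_hom_tot[OF Lc_hom_dm[OF Lc_dmd[OF pobD[OF X conjunct2[OF True]]]]] by simp
    have d0: "x \<notin> tot (tm X j) \<Longrightarrow> dmd (tm Y i) (f i j x) = 0 \<and> dmd (tm X j) x = 0"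
      using dm_homD(4)[OF Lc_hom_dm[OF fij]] linear_on_0[OF dm_homD(1)[OF dm_hom_dmd[OF Lc_ob(2)[OF pobD[OF Y conjunct1[OF True]]]]] tot_0]
      by (simp add: dmd_def)
    \<comment> \<open>The sign of the target summand enters twice and cancels, leaving the degree of
      \<open>f\<close> and the sign of the source summand.\<close>
    have ss: "sg (tsh Y i) * sg (l + tsh Y i - tsh X j) = sg l * sg (tsh X j)"
      by (simp add: sg_add sg_diff sg_eq)
    have A: "pt_comp (Lc d) X Y Y (diff_mat Y) f i j x = Polynomial.smult (sg (tsh Y i)) (dmd (tm Y i) (f i j x))"
    proof -
      have "pt_comp (Lc d) X Y Y (diff_mat Y) f i j x = (\<Sum>k<sz Y. diff_mat Y i k (f k j x))"
        using True Lc_comp_app[OF pt_homD(1)[OF f] pt_homD(1)[OF diff_mat_hom[OF Y]]]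
        by (simp add: pt_comp_def sum_fun_app)
      also have "\<dots> = (\<Sum>k<sz Y. if k = i then Polynomial.smult (sg (tsh Y i)) (dmd (tm Y i) (f i j x)) else 0)"
        using True by (intro sum.cong refl) (simp add: diff_mat_def)
      finally show ?thesis using True by (simp add: sum.delta)
    qed
    have B: "pt_comp (Lc d) X X Y f (diff_mat X) i j x = Polynomial.smult (sg (tsh X j)) (f i j (dmd (tm X j) x))"
    proof -
      have "pt_comp (Lc d) X X Y f (diff_mat X) i j x = (\<Sum>k<sz X. f i k (diff_mat X k j x))"
        using True Lc_comp_app[OF pt_homD(1)[OF diff_mat_hom[OF X]] pt_homD(1)[OF f]]
        by (simp add: pt_comp_def sum_fun_app)
      also have "\<dots> = (\<Sum>k<sz X. if k = j then Polynomial.smult (sg (tsh X j)) (f i j (dmd (tm X j) x)) else 0)"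
      proof (intro sum.cong refl)
        fix k assume k: "k \<in> {..<sz X}"
        have "f i k 0 = 0" using linear_on_0[OF dm_homD(1)[OF Lc_hom_dm[OF pt_homD(1)[OF f]]] tot_0] True k by auto
        then show "f i k (diff_mat X k j x) = (if k = j then Polynomial.smult (sg (tsh X j)) (f i j (dmd (tm X j) x)) else 0)"
          using True fl[OF dt] by (simp add: diff_mat_def)
      qed
      finally show ?thesis using True by (simp add: sum.delta)
    qed
    have "pt_naive_diff (Lc d) X Y l f i j x = Polynomial.smult (sg (tsh Y i))
       (dmd (tm Y i) (f i j x) - Polynomial.smult (sg (l + tsh Y i - tsh X j)) (f i j (dmd (tm X j) x)))"
      using True Lc_diff_eq[OF pobD[OF Y] fij] by (simp add: pt_naive_diff_def LcD(4))
    then show ?thesis by (simp add: A B pt_scale_def LcD(4) smult_diff_right ss)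
  next
    case False
    have e: "pt_naive_diff (Lc d) X Y l f i j = 0" "pt_comp (Lc d) X Y Y (diff_mat Y) f i j = 0"
      "pt_comp (Lc d) X X Y f (diff_mat X) i j = 0"
      by (simp_all only: pt_naive_diff_def pt_comp_def if_not_P[OF False])
    show ?thesis by (simp add: e pt_scale_def LcD(4))
  qed
qed

lemma mop_naive:
  assumes X: "pob d X" and Y: "pob d Y" and f: "f \<in> pt_hom (Lc d) X Y l"
  shows "mop X (pt_naive_diff (Lc d) X Y l f) = mop Y (diff_mat Y) * mop X f - sn l * mop X f * mop X (diff_mat X)"
proof -
  note c1 = pt_hom_comp[OF X Y Y f diff_mat_hom[OF Y]] and c2 = pt_hom_comp[OF X Y X diff_mat_hom[OF X] f]
  show ?thesis unfolding naive_eq[OF assms]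
    using mop_diff[OF pt_hom_lin[OF c1] conjunct2[OF mop_scale[OF pt_hom_lin[OF c2]]]]
      mop_scale[OF pt_hom_lin[OF c2]] mop_comp[OF X Y Y f diff_mat_hom[OF Y]] mop_comp[OF X Y X diff_mat_hom[OF X] f]
    by (simp add: sn_lsc mult.assoc)
qed

lemma ap_diff_mat:
  assumes X: "pob d X"
  shows "ap (mop X (diff_mat X)) v i = (if i < sz X then Polynomial.smult (sg (tsh X i)) (dmd (tm X i) (tot_prj (tm X i) (v i))) else 0)"
proof -
  have "diff_mat X i j (tot_prj (tm X j) (v j)) = (if j = i then
     if i < sz X then Polynomial.smult (sg (tsh X i)) (dmd (tm X i) (tot_prj (tm X i) (v i))) else 0 else 0)" for j
    by (auto simp: diff_mat_def)
  then show ?thesis unfolding ap_mop[OF pt_hom_lin[OF diff_mat_hom[OF X]]] by (simp add: sum.delta)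
qed

lemma diff_mat_square: assumes X: "pob d X" shows "mop X (diff_mat X) * mop X (diff_mat X) = 0"
proof -
  note a = ap_diff_mat[OF X]
  have "ap (mop X (diff_mat X) * mop X (diff_mat X)) v i = 0" for v i
  proof (cases "i < sz X")
    case True
    note M = Lc_ob(2)[OF pobD[OF X True]]
    have t: "dmd (tm X i) y \<in> tot (tm X i)" for y using dm_hom_tot[OF dm_hom_dmd[OF M]] .
    have "dmd (tm X i) (Polynomial.smult c (dmd (tm X i) y)) = 0" for c y
      using dm_homD(1)[OF dm_hom_dmd[OF M]] t[of y] dmd_square[OF M, of y] by (simp add: linear_on_def)
    then show ?thesis using t tot_smult by (simp add: ap_simps a tot_prj)
  qed (simp add: ap_simps a)
  then show ?thesis by (intro seq_op_eqI) (simp add: ap_simps)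
qed

text \<open>The diagonal part has square zero and \<open>tq X\<close> has degree 1, so the square of
  the total differential is exactly \<open>dq + q^2\<close>.\<close>

lemma MC_iff:
  assumes X: "pob d X" and q: "tq X \<in> pt_hom (Lc d) X X 1"
  shows "pt_naive_diff (Lc d) X X 1 (tq X) + pt_comp (Lc d) X X X (tq X) (tq X) = 0 \<longleftrightarrow> op_diff X * op_diff X = 0"
proof -
  let ?m = "pt_naive_diff (Lc d) X X 1 (tq X)" and ?c = "pt_comp (Lc d) X X X (tq X) (tq X)"
  have 1: "?m \<in> pt_hom (Lc d) X X 2" "?c \<in> pt_hom (Lc d) X X 2"
    using naive_hom[OF X X q] pt_hom_comp[OF X X X q q] by simp_all
  have "mop X (?m + ?c) = op_diff X * op_diff X"
    using mop_add[OF pt_hom_lin[OF 1(1)] pt_hom_lin[OF 1(2)]] mop_naive[OF X X q] mop_comp[OF X X X q q]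
      diff_mat_square[OF X] by (simp add: op_diff_def sn_simps distrib_left distrib_right)
  then show ?thesis using mop_inj[OF pt_hom_add[OF X X 1] pt_hom_0[OF X X]] mop_0 by metis
qed

lemma pt_obI:
  assumes "pob d X" "tq X \<in> pt_hom (Lc d) X X 1" "\<And>i j. i \<ge> j \<Longrightarrow> tq X i j = 0" "op_diff X * op_diff X = 0"
  shows "X \<in> pt_ob (Lc d)"
  using assms MC_iff[OF assms(1,2)] by (simp add: pt_ob_def pob_def)

lemma op_diff_square: "X \<in> pt_ob (Lc d) \<Longrightarrow> op_diff X * op_diff X = 0"
  using MC_iff[OF pt_ob_D(1,2)] pt_ob_D(4) by blast

lemma op_diff_hom: "X \<in> pt_ob (Lc d) \<Longrightarrow> op_diff X \<in> op_hom d X X 1"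
  unfolding op_diff_def by (intro op_hom_add op_hom_mop diff_mat_hom pt_ob_D(1,2))

text \<open>Internal differentials and twists combine into a single graded commutator, which is the
  form of differential used in \<open>op_cat\<close>.\<close>

lemma pretr_diff:
  assumes X: "X \<in> pt_ob (Lc d)" and Y: "Y \<in> pt_ob (Lc d)" and f: "f \<in> pt_hom (Lc d) X Y l"
  shows "dg_diff (pretr (Lc d)) X Y l f \<in> pt_hom (Lc d) X Y (l + 1)"
    "mop X (dg_diff (pretr (Lc d)) X Y l f) = op_diff Y * mop X f - sn l * mop X f * op_diff X"
proof -
  note X' = pt_ob_D(1,2)[OF X] and Y' = pt_ob_D(1,2)[OF Y]
  note a = naive_hom[OF X'(1) Y'(1) f] and b = pt_hom_comp[OF X'(1) Y'(1) Y'(1) f Y'(2)]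
  have c: "pt_comp (Lc d) X X Y f (tq X) \<in> pt_hom (Lc d) X Y (l + 1)"
    using pt_hom_comp[OF X'(1) Y'(1) X'(1) X'(2) f] by (simp add: add.commute)
  note s = pt_hom_scale[OF X'(1) Y'(1) c, of "sg l"]
  note ab = pt_hom_add[OF X'(1) Y'(1) a b]
  have e: "dg_diff (pretr (Lc d)) X Y l f = pt_naive_diff (Lc d) X Y l f + pt_comp (Lc d) X Y Y (tq Y) f
                  - pt_scale (Lc d) (sg l) (pt_comp (Lc d) X X Y f (tq X))" by (simp add: pretr_def)
  show "dg_diff (pretr (Lc d)) X Y l f \<in> pt_hom (Lc d) X Y (l + 1)"
    unfolding e by (rule pt_hom_diff[OF X'(1) Y'(1) ab s])
  have "mop X (dg_diff (pretr (Lc d)) X Y l f) = mop Y (diff_mat Y) * mop X f - sn l * mop X f * mop X (diff_mat X)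
      + mop Y (tq Y) * mop X f - sn l * (mop X f * mop X (tq X))"
    unfolding e using mop_diff[OF pt_hom_lin[OF ab] pt_hom_lin[OF s]] mop_add[OF pt_hom_lin[OF a] pt_hom_lin[OF b]]
      mop_scale[OF pt_hom_lin[OF c]] mop_naive[OF X'(1) Y'(1) f] mop_comp[OF X'(1) Y'(1) Y'(1) f Y'(2)]
      mop_comp[OF X'(1) Y'(1) X'(1) X'(2) f] by (simp add: sn_lsc)
  then show "mop X (dg_diff (pretr (Lc d)) X Y l f) = op_diff Y * mop X f - sn l * mop X f * op_diff X"
    by (simp add: op_diff_def distrib_left distrib_right mult.assoc)
qed

subsection \<open>Shifts and cones\<close>

lemma shift_simps:
  "sz (pt_shift A k X) = sz X" "tq (pt_shift A k X) = pt_scale A (sg k) (tq X)"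
  "i < sz X \<Longrightarrow> tob (pt_shift A k X) i = tob X i" "i < sz X \<Longrightarrow> tsh (pt_shift A k X) i = tsh X i + k"
  by (simp_all add: pt_shift_def sz_def tob_def tsh_def tq_def case_prod_unfold)

lemma pob_shift: "pob d X \<Longrightarrow> pob d (pt_shift (Lc d) k X)"
  by (simp add: pob_def shift_simps)

lemma pt_hom_shift_left: "pt_hom (Lc d) (pt_shift (Lc d) m X) Y l = pt_hom (Lc d) X Y (l - m)"
proof -
  have e: "l + a - (b + m) = l - m + a - b" for a b by simp
  show ?thesis by (simp add: e pt_hom_def shift_simps cong: if_cong)
qed

lemma pt_hom_shift_right: "pt_hom (Lc d) X (pt_shift (Lc d) m Y) l = pt_hom (Lc d) X Y (l + m)"
proof -
  have e: "l + (a + m) - b = l + m + a - b" for a b by simp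
  show ?thesis by (simp add: e pt_hom_def shift_simps cong: if_cong)
qed

lemma mop_shift: "mop (pt_shift (Lc d) m X) f = mop X f"
  by (rule mop_cong) (simp_all add: shift_simps)

lemma op_hom_shift: "op_hom d (pt_shift (Lc d) m X) Y k = op_hom d X Y (k - m)" "op_hom d X (pt_shift (Lc d) m Y) k = op_hom d X Y (k + m)"
  by (simp_all add: op_hom_def pt_hom_shift_left pt_hom_shift_right mop_shift cong: image_cong)

lemma op_id_shift: "op_id d (pt_shift (Lc d) k X) = op_id d X"
proof -
  have "id_mat d (pt_shift (Lc d) k X) = id_mat d X" by (intro ext) (simp add: id_mat_def pretr_def shift_simps)
  then show ?thesis by (simp add: op_id_def mop_shift)
qed

lemma op_diff_shift: assumes X: "X \<in> pt_ob (Lc d)" shows "op_diff (pt_shift (Lc d) k X) = sn k * op_diff X"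
proof -
  note X' = pt_ob_D[OF X]
  have "diff_mat (pt_shift (Lc d) k X) = pt_scale (Lc d) (sg k) (diff_mat X)"
    by (intro ext) (simp add: diff_mat_def pt_scale_def LcD(4) shift_simps sg_add mult.commute)
  then show ?thesis
    using mop_scale[OF pt_hom_lin[OF diff_mat_hom[OF X'(1)]]] mop_scale[OF pt_hom_lin[OF X'(2)]]
    by (simp add: op_diff_def mop_shift shift_simps sn_lsc distrib_left)
qed

lemma shift_ob: assumes X: "X \<in> pt_ob (Lc d)" shows "pt_shift (Lc d) k X \<in> pt_ob (Lc d)"
proof (rule pt_obI)
  note X' = pt_ob_D[OF X]
  show "pob d (pt_shift (Lc d) k X)" by (rule pob_shift[OF X'(1)])
  show "tq (pt_shift (Lc d) k X) \<in> pt_hom (Lc d) (pt_shift (Lc d) k X) (pt_shift (Lc d) k X) 1"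
    by (simp add: pt_hom_shift_left pt_hom_shift_right shift_simps(2) pt_hom_scale X'(1,2))
  show "tq (pt_shift (Lc d) k X) i j = 0" if "i \<ge> j" for i j
    using X'(3)[OF that] by (simp add: shift_simps(2) pt_scale_def LcD(4) fun_eq_iff)
  show "op_diff (pt_shift (Lc d) k X) * op_diff (pt_shift (Lc d) k X) = 0"
    by (simp add: op_diff_shift[OF X] sn_def op_diff_square[OF X])
qed

lemma sum_split: "(\<Sum>j<n+m. h j) = (\<Sum>j<n. h j) + (\<Sum>j<m. h (n + j))" for h :: "nat \<Rightarrow> 'a::comm_monoid_add"
  by (induction m) (simp_all add: add.assoc)

lemma cone_simps:
  "sz (pt_cone A X Y f) = sz Y + sz X"
  "i < sz Y \<Longrightarrow> tob (pt_cone A X Y f) i = tob Y i" "i < sz Y \<Longrightarrow> tsh (pt_cone A X Y f) i = tsh Y i"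
  "i < sz X \<Longrightarrow> tob (pt_cone A X Y f) (sz Y + i) = tob X i"
  "i < sz X \<Longrightarrow> tsh (pt_cone A X Y f) (sz Y + i) = tsh X i + 1"
  by (simp_all add: pt_cone_def pt_shift_def sz_def tob_def tsh_def case_prod_unfold nth_append)

lemma cone_tq:
  "j < sz Y \<Longrightarrow> tq (pt_cone (Lc d) X Y f) i j = (if i < sz Y then tq Y i j else 0)"
  "i < sz Y \<Longrightarrow> tq (pt_cone (Lc d) X Y f) i (sz Y + j) = f i j"
  "tq (pt_cone (Lc d) X Y f) (sz Y + i) (sz Y + j) = dg_scale (Lc d) (- 1) (tq X i j)"
  by (simp_all add: pt_cone_def tq_def pt_shift_def pt_scale_def)

lemma pob_cone: assumes "pob d X" "pob d Y" shows "pob d (pt_cone (Lc d) X Y f)"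
  unfolding pob_def
proof (intro allI impI)
  fix i assume i: "i < sz (pt_cone (Lc d) X Y f)"
  show "tob (pt_cone (Lc d) X Y f) i \<in> dg_ob (Lc d)"
  proof (cases "i < sz Y")
    case True then show ?thesis using pobD[OF assms(2)] by (simp add: cone_simps)
  next
    case False
    then obtain i' where "i = sz Y + i'" using le_Suc_ex linorder_not_less by blast
    then show ?thesis using i pobD[OF assms(1)] by (simp add: cone_simps)
  qed
qed

text \<open>\<open>Y\<close> occupies the first \<open>sz Y\<close> positions, and conjugation by
  \<open>sh_up\<close> and \<open>sh_dn\<close> puts \<open>X\<close> behind it. The differentials
  have the same block form.\<close>

lemma op_id_cone: assumes X: "pob d X" and Y: "pob d Y"
  shows "op_id d (pt_cone (Lc d) X Y f) = op_id d Y + sh_up (sz Y) * op_id d X * sh_dn (sz Y)"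
proof (rule seq_op_eqI)
  fix v i
  show "ap (op_id d (pt_cone (Lc d) X Y f)) v i = ap (op_id d Y + sh_up (sz Y) * op_id d X * sh_dn (sz Y)) v i"
  proof (cases "i < sz Y")
    case True then show ?thesis by (simp add: ap_simps ap_op_id[OF X] ap_op_id[OF Y] ap_op_id[OF pob_cone[OF X Y]] cone_simps)
  next
    case False
    then obtain i' where "i = sz Y + i'" using le_Suc_ex linorder_not_less by blast
    then show ?thesis
      by (simp add: ap_simps ap_op_id[OF X] ap_op_id[OF Y] ap_op_id[OF pob_cone[OF X Y]] cone_simps add.commute[of _ "sz Y"])
  qed
qed

text \<open>In the cone the shifts of the summands of \<open>X\<close> are raised by one, hence the
  minus sign.\<close>

lemma diff_mat_cone: assumes X: "pob d X" and Y: "pob d Y"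
  shows "mop (pt_cone (Lc d) X Y f) (diff_mat (pt_cone (Lc d) X Y f))
    = mop Y (diff_mat Y) - sh_up (sz Y) * mop X (diff_mat X) * sh_dn (sz Y)"
proof (rule seq_op_eqI)
  fix v i
  show "ap (mop (pt_cone (Lc d) X Y f) (diff_mat (pt_cone (Lc d) X Y f))) v i
    = ap (mop Y (diff_mat Y) - sh_up (sz Y) * mop X (diff_mat X) * sh_dn (sz Y)) v i"
  proof (cases "i < sz Y")
    case True then show ?thesis by (simp add: ap_simps ap_diff_mat[OF X] ap_diff_mat[OF Y] ap_diff_mat[OF pob_cone[OF X Y]] cone_simps)
  next
    case False
    then obtain i' where "i = sz Y + i'" using le_Suc_ex linorder_not_less by blast
    then show ?thesis
      by (simp add: ap_simps ap_diff_mat[OF X] ap_diff_mat[OF Y] ap_diff_mat[OF pob_cone[OF X Y]] cone_simps sg_add add.commute[of _ "sz Y"])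
  qed
qed

lemma cone_tq_hom:
  assumes X: "X \<in> pt_ob (Lc d)" and Y: "Y \<in> pt_ob (Lc d)" and f: "f \<in> pt_hom (Lc d) X Y 0"
  shows "tq (pt_cone (Lc d) X Y f) \<in> pt_hom (Lc d) (pt_cone (Lc d) X Y f) (pt_cone (Lc d) X Y f) 1"
  unfolding pt_hom_def mem_Collect_eq
proof (intro allI)
  let ?C = "pt_cone (Lc d) X Y f"
  note X' = pt_ob_D[OF X] and Y' = pt_ob_D[OF Y]
  note qX = pt_homD[OF X'(2)] and qY = pt_homD[OF Y'(2)] and ff = pt_homD[OF f]
  fix i j
  consider "i < sz Y" "j < sz Y" | i' where "i = sz Y + i'" "j < sz Y" | j' where "i < sz Y" "j = sz Y + j'"
    | i' j' where "i = sz Y + i'" "j = sz Y + j'"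
    using le_Suc_ex linorder_not_less by metis
  then show "if i < sz ?C \<and> j < sz ?C then tq ?C i j \<in> dg_hom (Lc d) (tob ?C j) (tob ?C i) (1 + tsh ?C i - tsh ?C j)
    else tq ?C i j = 0"
  proof cases
    case 1
    then show ?thesis using qY(1)[of i j] by (simp add: cone_simps cone_tq)
  next
    case 2
    then show ?thesis using Lc_0[OF pobD[OF Y'(1)] pobD[OF X'(1)]] by (simp add: cone_simps cone_tq)
  next
    case 3
    then show ?thesis using ff(1)[of i j'] ff(2)[of i j'] by (simp add: cone_simps cone_tq zero_fun_def)
  next
    case 4
    show ?thesis
    proof (cases "i' < sz X \<and> j' < sz X")
      case True
      then show ?thesis using 4 Lc_scale[OF pobD[OF X'(1)] pobD[OF X'(1)] qX(1)[of i' j'], where c = "- 1"]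
        by (simp add: cone_simps cone_tq add_diff_eq)
    next
      case False
      then have "tq X i' j' = 0" using qX(2) by blast
      then show ?thesis using 4 False by (auto simp: cone_simps cone_tq LcD(4) zero_fun_def)
    qed
  qed
qed

lemma tq_cone:
  assumes X: "X \<in> pt_ob (Lc d)" and Y: "Y \<in> pt_ob (Lc d)" and f: "f \<in> pt_hom (Lc d) X Y 0"
  shows "mop (pt_cone (Lc d) X Y f) (tq (pt_cone (Lc d) X Y f))
    = mop Y (tq Y) + mop X f * sh_dn (sz Y) - sh_up (sz Y) * mop X (tq X) * sh_dn (sz Y)"
proof (rule seq_op_eqI)
  fix v i
  note X' = pt_ob_D[OF X] and Y' = pt_ob_D[OF Y]
  let ?C = "pt_cone (Lc d) X Y f"
  have "ap (mop ?C (tq ?C)) v i = (\<Sum>j<sz Y. tq ?C i j (tot_prj (tm Y j) (v j))) +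
      (\<Sum>j<sz X. tq ?C i (sz Y + j) (tot_prj (tm X j) (v (sz Y + j))))"
    unfolding ap_mop[OF pt_hom_lin[OF cone_tq_hom[OF assms]]] cone_simps(1) sum_split
    by (simp add: cone_simps)
  also have "\<dots> = ap (mop Y (tq Y) + mop X f * sh_dn (sz Y) - sh_up (sz Y) * mop X (tq X) * sh_dn (sz Y)) v i"
  proof (cases "i < sz Y")
    case True
    then show ?thesis
      by (simp add: ap_simps ap_mop[OF pt_hom_lin[OF X'(2)]] ap_mop[OF pt_hom_lin[OF Y'(2)]]
          ap_mop[OF pt_hom_lin[OF f]] cone_tq add.commute[of _ "sz Y"])
  next
    case False
    then obtain i' where i: "i = sz Y + i'" using le_Suc_ex linorder_not_less by blast
    have "tq Y i j = 0" "f i j = 0" for j using pt_homD(2)[OF Y'(2), of i] pt_homD(2)[OF f, of i] False by auto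
    then show ?thesis using i
      by (simp add: ap_simps ap_mop[OF pt_hom_lin[OF X'(2)]] ap_mop[OF pt_hom_lin[OF Y'(2)]]
          ap_mop[OF pt_hom_lin[OF f]] cone_tq LcD(4) sum_negf add.commute[of _ "sz Y"])
  qed
  finally show "ap (mop ?C (tq ?C)) v i =
      ap (mop Y (tq Y) + mop X f * sh_dn (sz Y) - sh_up (sz Y) * mop X (tq X) * sh_dn (sz Y)) v i" .
qed

lemma op_diff_cone:
  assumes X: "X \<in> pt_ob (Lc d)" and Y: "Y \<in> pt_ob (Lc d)" and f: "f \<in> pt_hom (Lc d) X Y 0"
  shows "op_diff (pt_cone (Lc d) X Y f) = op_diff Y + mop X f * sh_dn (sz Y) - sh_up (sz Y) * op_diff X * sh_dn (sz Y)"
  unfolding op_diff_def diff_mat_cone[OF pt_ob_D(1)[OF X] pt_ob_D(1)[OF Y]] tq_cone[OF assms]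
  by (simp add: algebra_simps)

text \<open>Operators of \<open>Y\<close> neither read nor write the positions from
  \<open>sz Y\<close> on; this kills the mixed terms in products of block operators.\<close>

lemma op_id_up: "pob d Y \<Longrightarrow> op_id d Y * sh_up (sz Y) = 0" and dn_op_id: "pob d Y \<Longrightarrow> sh_dn (sz Y) * op_id d Y = 0"
  by (rule seq_op_eqI; simp add: ap_simps ap_op_id tot_prj_0)+

lemma op_diff_up: "Y \<in> pt_ob (Lc d) \<Longrightarrow> op_diff Y * sh_up (sz Y) = 0"
  and dn_op_hom: "pob d X \<Longrightarrow> pob d Y \<Longrightarrow> F \<in> op_hom d X Y k \<Longrightarrow> sh_dn (sz Y) * F = 0"
proof -
  show "op_diff Y * sh_up (sz Y) = 0" if Y: "Y \<in> pt_ob (Lc d)"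
  proof -
    have "op_diff Y * sh_up (sz Y) = op_diff Y * op_id d Y * sh_up (sz Y)"
      using op_id_right[OF pt_ob_D(1)[OF Y] op_diff_hom[OF Y]] by simp
    then show ?thesis by (simp add: mult.assoc op_id_up[OF pt_ob_D(1)[OF Y]])
  qed
  show "sh_dn (sz Y) * F = 0" if "pob d X" "pob d Y" "F \<in> op_hom d X Y k"
  proof -
    have "sh_dn (sz Y) * F = sh_dn (sz Y) * op_id d Y * F" using op_id_left[OF that] by (simp add: mult.assoc)
    then show ?thesis by (simp add: dn_op_id[OF that(2)])
  qed
qed

text \<open>In the square of the block differential the diagonal terms vanish because
  \<open>X\<close> and \<open>Y\<close> are objects. What remains is the commutator of
  \<open>f\<close> with the two differentials, which is zero for closed \<open>f\<close>.\<close>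

lemma cone_ob:
  assumes X: "X \<in> pt_ob (Lc d)" and Y: "Y \<in> pt_ob (Lc d)" and f: "f \<in> pt_hom (Lc d) X Y 0"
    and cyc: "op_diff Y * mop X f = mop X f * op_diff X"
  shows "pt_cone (Lc d) X Y f \<in> pt_ob (Lc d)"
proof (rule pt_obI)
  note X' = pt_ob_D[OF X] and Y' = pt_ob_D[OF Y]
  let ?C = "pt_cone (Lc d) X Y f"
  show "pob d ?C" by (rule pob_cone[OF X'(1) Y'(1)])
  show "tq ?C \<in> pt_hom (Lc d) ?C ?C 1" by (rule cone_tq_hom[OF X Y f])
  show "tq ?C i j = 0" if ij: "i \<ge> j" for i j
  proof -
    \<comment> \<open>The block that contains \<open>f\<close> lies above the diagonal and does not
      meet \<open>i \<ge> j\<close>.\<close>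
    consider "i < sz Y" "j < sz Y" | i' where "i = sz Y + i'" "j < sz Y" | i' j' where "i = sz Y + i'" "j = sz Y + j'"
      using le_Suc_ex linorder_not_less ij by (metis order_le_less_trans)
    then show ?thesis
    proof cases
      case 3
      then have "tq X i' j' = 0" using ij X'(3) by simp
      then show ?thesis using 3 by (simp add: cone_tq LcD(4) zero_fun_def)
    qed (use ij Y'(3) in \<open>simp_all add: cone_tq\<close>)
  qed
  let ?n = "sh_dn (sz Y)" and ?u = "sh_up (sz Y)"
  have e: "op_diff Y * op_diff Y = 0" "op_diff X * op_diff X = 0" "op_diff Y * ?u = 0" "?n * op_diff Y = 0" "?n * mop X f = 0" "?n * ?u = 1"
    using op_diff_square[OF Y] op_diff_square[OF X] op_diff_up[OF Y] dn_op_hom[OF Y'(1) Y'(1) op_diff_hom[OF Y]]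
      dn_op_hom[OF X'(1) Y'(1) op_hom_mop[OF f]] sh_dn_up by auto
  show "op_diff ?C * op_diff ?C = 0"
    unfolding op_diff_cone[OF X Y f]
    by (simp add: distrib_left distrib_right left_diff_distrib right_diff_distrib mult.assoc
        e e[THEN mult_eq_assoc] cyc cyc[THEN mult_eq_assoc])
qed

text \<open>The matrix behind \<open>ct\<close>; \<open>pt_cone_out\<close> is behind
  \<open>cp\<close>, and \<open>id_mat d Y\<close> behind both \<open>cj\<close> and
  \<open>cs\<close>.\<close>

definition cs_mat :: "int \<Rightarrow> tw \<Rightarrow> tw \<Rightarrow> nat \<Rightarrow> nat \<Rightarrow> lmap" where
  "cs_mat d X Y = (\<lambda>i j. if i = sz Y + j \<and> j < sz X then dg_id (Lc d) (tob X j) else 0)"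

lemma cone_maps:
  assumes X: "pob d X" and Y: "pob d Y"
  shows "id_mat d Y \<in> pt_hom (Lc d) Y (pt_cone (Lc d) X Y f) 0" "id_mat d Y \<in> pt_hom (Lc d) (pt_cone (Lc d) X Y f) Y 0"
    "cs_mat d X Y \<in> pt_hom (Lc d) X (pt_cone (Lc d) X Y f) (- 1)"
    "pt_cone_out (Lc d) X Y \<in> pt_hom (Lc d) (pt_cone (Lc d) X Y f) X 1"
proof -
  let ?C = "pt_cone (Lc d) X Y f"
  have zC: "0 \<in> dg_hom (Lc d) (tob Y j) (tob ?C i) k" "0 \<in> dg_hom (Lc d) (tob ?C i) (tob Y j) k" if "i < sz ?C" "j < sz Y" for i j k
    using pobD[OF pob_cone[OF X Y] that(1)] pobD[OF Y that(2)] by (blast intro: Lc_0)+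
  have zX: "0 \<in> dg_hom (Lc d) (tob X j) (tob ?C i) k" "0 \<in> dg_hom (Lc d) (tob ?C i) (tob X j) k" if "i < sz ?C" "j < sz X" for i j k
    using pobD[OF pob_cone[OF X Y] that(1)] pobD[OF X that(2)] by (blast intro: Lc_0)+
  have iY: "dg_id (Lc d) (tob Y j) \<in> dg_hom (Lc d) (tob Y j) (tob Y j) 0" if "j < sz Y" for j
    using Lc_id[OF pobD[OF Y that]] .
  have iX: "dg_id (Lc d) (tob X j) \<in> dg_hom (Lc d) (tob X j) (tob X j) 0" if "j < sz X" for j
    using Lc_id[OF pobD[OF X that]] .
  show "id_mat d Y \<in> pt_hom (Lc d) Y ?C 0" "id_mat d Y \<in> pt_hom (Lc d) ?C Y 0"
    unfolding pt_hom_def id_mat_def pretr_def using zC iY by (auto simp: cone_simps)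
  show "cs_mat d X Y \<in> pt_hom (Lc d) X ?C (- 1)" "pt_cone_out (Lc d) X Y \<in> pt_hom (Lc d) ?C X 1"
    unfolding pt_hom_def cs_mat_def pt_cone_out_def using zX iX by (auto simp: cone_simps)
qed

lemma mop_cone_maps:
  assumes X: "pob d X" and Y: "pob d Y"
  shows "mop (pt_cone (Lc d) X Y f) (id_mat d Y) = op_id d Y"
    "mop X (cs_mat d X Y) = sh_up (sz Y) * op_id d X"
    "mop (pt_cone (Lc d) X Y f) (pt_cone_out (Lc d) X Y) = op_id d X * sh_dn (sz Y)"
proof -
  let ?C = "pt_cone (Lc d) X Y f"
  note l = cone_maps[OF X Y, of f, THEN pt_hom_lin]
  show "mop ?C (id_mat d Y) = op_id d Y"
  proof (rule seq_op_eqI)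
    fix v i
    have z: "id_mat d Y i (sz Y + j) = 0" for j by (auto simp: id_mat_def pretr_def)
    show "ap (mop ?C (id_mat d Y)) v i = ap (op_id d Y) v i"
      unfolding ap_mop[OF l(2)] cone_simps(1) sum_split op_id_def ap_mop[OF pt_hom_lin[OF id_mat_hom[OF Y]]]
      by (simp add: z cone_simps)
  qed
  show "mop X (cs_mat d X Y) = sh_up (sz Y) * op_id d X"
  proof (rule seq_op_eqI)
    fix v i
    have "(\<Sum>j<sz X. cs_mat d X Y i j (tot_prj (tm X j) (v j)))
        = (\<Sum>j<sz X. if j = i - sz Y then if sz Y \<le> i then tot_prj (tm X j) (v j) else 0 else 0)"
      using tot_prj(3) by (intro sum.cong refl) (auto simp: cs_mat_def LcD)
    then show "ap (mop X (cs_mat d X Y)) v i = ap (sh_up (sz Y) * op_id d X) v i"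
      unfolding ap_mop[OF l(3)] by (simp add: sum.delta ap_simps ap_op_id[OF X])
  qed
  show "mop ?C (pt_cone_out (Lc d) X Y) = op_id d X * sh_dn (sz Y)"
  proof (rule seq_op_eqI)
    fix v i
    have 1: "(\<Sum>j<sz Y. pt_cone_out (Lc d) X Y i j (tot_prj (tm ?C j) (v j))) = 0"
      by (intro sum.neutral ballI) (auto simp: pt_cone_out_def)
    have 2: "(\<Sum>j<sz X. pt_cone_out (Lc d) X Y i (sz Y + j) (tot_prj (tm ?C (sz Y + j)) (v (sz Y + j))))
        = (\<Sum>j<sz X. if j = i then tot_prj (tm X i) (v (sz Y + i)) else 0)"
      using tot_prj(3) by (intro sum.cong refl) (auto simp: pt_cone_out_def LcD cone_simps)
    show "ap (mop ?C (pt_cone_out (Lc d) X Y)) v i = ap (op_id d X * sh_dn (sz Y)) v i"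
      unfolding ap_mop[OF l(4)] cone_simps(1) sum_split 1 2
      by (simp add: sum.delta ap_simps ap_op_id[OF X] add.commute[of _ "sz Y"])
  qed
qed

section \<open>Finite-dimensionality and grading of the Hom-complexes\<close>

interpretation fv: vector_space "\<lambda>c (v :: nat \<Rightarrow> complex poly) i. Polynomial.smult c (v i)"
  by unfold_locales (simp_all add: fun_eq_iff smult_add_right smult_add_left)

interpretation lv: vector_space "\<lambda>c F. lsc c * F"
  by unfold_locales (simp_all add: distrib_left distrib_right lsc_add lsc_mult lsc_1 mult.assoc)

text \<open>The values of \<open>op_id d X\<close> are sequences supported in finitely many
  positions, with entries in finite-dimensional total spaces. Independence of \<open>B\<close>
  provides the coordinate functions used next.\<close>

lemma op_id_finite:
  assumes X: "pob d X"
  shows "\<exists>B. finite B \<and> fv.independent B \<and> (\<forall>v. ap (op_id d X) v \<in> fv.span B)"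
proof -
  define s where "s j x = (\<lambda>i. if i = j then x else 0)" for j :: nat and x :: "complex poly"
  have "\<forall>j\<in>{..<sz X}. \<exists>F. finite F \<and> tot (tm X j) \<subseteq> pv.span F"
    using semifree_finite[OF Lc_ob(1)[OF pobD[OF X]]] by blast
  from bchoice[OF this] obtain F where F: "\<And>j. j < sz X \<Longrightarrow> finite (F j)" "\<And>j. j < sz X \<Longrightarrow> tot (tm X j) \<subseteq> pv.span (F j)"
    by auto
  let ?S = "\<Union>j<sz X. s j ` F j"
  have sp: "s j x \<in> fv.span ?S" if j: "j < sz X" and x: "x \<in> pv.span (F j)" for j x
    using x
  proof (induction rule: pv.span_induct_alt)
    case base
    have "s j 0 = 0" by (simp add: s_def fun_eq_iff)
    then show ?case by (simp only: fv.span_zero)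
  next
    case (step c y z)
    have y: "s j y \<in> fv.span ?S" using step(1) j by (intro fv.span_base) blast
    have e: "s j (Polynomial.smult c y + z) = (\<lambda>i. Polynomial.smult c (s j y i)) + s j z" by (simp add: s_def fun_eq_iff)
    show ?case unfolding e by (rule fv.span_add[OF fv.span_scale[OF y] step(2)])
  qed
  have "finite ?S" using F(1) by auto
  obtain B where B: "B \<subseteq> ?S" "fv.independent B" "?S \<subseteq> fv.span B"
    using fv.maximal_independent_subset[of ?S] by blast
  have "fv.span ?S \<subseteq> fv.span B" by (rule fv.span_minimal[OF B(3) fv.subspace_span])
  moreover have "ap (op_id d X) v \<in> fv.span ?S" for v
  proof -
    have e: "ap (op_id d X) v = (\<Sum>j<sz X. s j (tot_prj (tm X j) (v j)))"
      by (rule ext) (simp add: ap_op_id[OF X] sum_fun_app s_def sum.delta')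
    show ?thesis unfolding e using sp F(2) tot_prj(3) by (intro fv.span_sum) blast
  qed
  ultimately show ?thesis using B(2) finite_subset[OF B(1) \<open>finite ?S\<close>] by blast
qed

text \<open>An operator absorbs \<open>op_id d X\<close> on the right and \<open>op_id d Y\<close>
  on the left, so it is determined by its values on \<open>B\<close>, expanded in \<open>C\<close>.
  The matrix units \<open>e b c\<close> therefore span the Hom-spaces of all degrees
  together.\<close>

lemma op_hom_finite:
  assumes X: "pob d X" and Y: "pob d Y"
  shows "\<exists>F. finite F \<and> (\<forall>k. op_hom d X Y k \<subseteq> range (\<lambda>c. \<Sum>f\<in>F. lsc (c f) * f))"
proof -
  obtain B where B: "finite B" "fv.independent B" "\<And>v. ap (op_id d X) v \<in> fv.span B" using op_id_finite[OF X] by blast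
  obtain C where C: "finite C" "fv.independent C" "\<And>v. ap (op_id d Y) v \<in> fv.span C" using op_id_finite[OF Y] by blast
  \<comment> \<open>The coordinate at \<open>b\<close> of the projection of \<open>v\<close> to
    \<open>X\<close>; the unit \<open>e b c\<close> sends \<open>v\<close> to this multiple of
    \<open>c\<close>.\<close>
  define r where "r b v = fv.representation B (ap (op_id d X) v) b" for b v
  define e where "e b c = Seq_op (\<lambda>v i. Polynomial.smult (r b v) (c i))" for b and c :: "nat \<Rightarrow> complex poly"
  have r: "r b (\<lambda>i. v i + w i) = r b v + r b w" "r b (\<lambda>i. Polynomial.smult a (v i)) = a * r b v" for b v w a
  proof -
    have 1: "ap (op_id d X) (\<lambda>i. v i + w i) = ap (op_id d X) v + ap (op_id d X) w"
      and 2: "ap (op_id d X) (\<lambda>i. Polynomial.smult a (v i)) = (\<lambda>i. Polynomial.smult a (ap (op_id d X) v i))"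
      by (rule ext; simp add: ap_add ap_smult)+
    show "r b (\<lambda>i. v i + w i) = r b v + r b w" "r b (\<lambda>i. Polynomial.smult a (v i)) = a * r b v"
      unfolding r_def 1 2 using fv.representation_add[OF B(2,3,3)] fv.representation_scale[OF B(2,3)] by simp_all
  qed
  have e: "ap (e b c) v i = Polynomial.smult (r b v) (c i)" for b c v i
  proof -
    have "(\<lambda>v i. Polynomial.smult (r b v) (c i)) \<in> {F. (\<forall>v w. F (\<lambda>i. v i + w i) = (\<lambda>i. F v i + F w i)) \<and>
        (\<forall>a v. F (\<lambda>i. Polynomial.smult a (v i)) = (\<lambda>i. Polynomial.smult a (F v i)))}"
      by (simp add: r smult_add_left)
    from Seq_op_inverse[OF this] show ?thesis by (simp add: e_def)
  qed
  let ?F = "(\<lambda>(b, c). e b c) ` (B \<times> C)"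
  have fin: "finite ?F" using B(1) C(1) by simp
  have "G \<in> lv.span ?F" if G: "G \<in> op_hom d X Y k" for G k
  proof -
    have "G = (\<Sum>b\<in>B. \<Sum>c\<in>C. lsc (fv.representation C (ap G b) c) * e b c)"
    proof (rule seq_op_eqI)
      fix v i
      have 1: "ap G v = ap G (ap (op_id d X) v)" for v
        using op_id_right[OF X G] by (metis times_seq_op.rep_eq)
      have 2: "ap G b = ap (op_id d Y) (ap G b)" for b
        using op_id_left[OF X Y G] by (metis times_seq_op.rep_eq)
      have "ap (op_id d X) v = (\<lambda>i. \<Sum>b\<in>B. Polynomial.smult (r b v) (b i))"
        using fv.sum_representation_eq[OF B(2) B(3)[of v] B(1) order_refl] unfolding r_def
        by (metis (no_types, lifting) ext sum.cong sum_fun_app)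
      then have "ap G v i = (\<Sum>b\<in>B. Polynomial.smult (r b v) (ap G b i))"
        using 1[of v] by (simp add: ap_sum ap_smult)
      also have "\<dots> = (\<Sum>b\<in>B. Polynomial.smult (r b v) (\<Sum>c\<in>C. Polynomial.smult (fv.representation C (ap G b) c) (c i)))"
      proof -
        have "ap G b i = (\<Sum>c\<in>C. Polynomial.smult (fv.representation C (ap G b) c) (c i))" for b
        proof -
          have "ap G b \<in> fv.span C" using C(3)[of "ap G b"] 2[of b] by simp
          from fv.sum_representation_eq[OF C(2) this C(1) order_refl]
          have "(\<Sum>c\<in>C. (\<lambda>i. Polynomial.smult (fv.representation C (ap G b) c) (c i))) i = ap G b i" by simp
          then show ?thesis by (simp only: sum_fun_app)
        qed
        then show ?thesis by (intro sum.cong arg_cong2[of _ _ _ _ Polynomial.smult] refl)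
      qed
      also have "\<dots> = ap (\<Sum>b\<in>B. \<Sum>c\<in>C. lsc (fv.representation C (ap G b) c) * e b c) v i"
        by (simp add: sum_ap ap_simps e pv.scale_sum_right mult.commute)
      finally show "ap G v i = ap (\<Sum>b\<in>B. \<Sum>c\<in>C. lsc (fv.representation C (ap G b) c) * e b c) v i" .
    qed
    also have "\<dots> \<in> lv.span ?F" by (intro lv.span_sum lv.span_scale lv.span_base) auto
    finally show ?thesis .
  qed
  then have "\<forall>k. op_hom d X Y k \<subseteq> range (\<lambda>c. \<Sum>f\<in>?F. lsc (c f) * f)"
    unfolding lv.span_finite[OF fin, symmetric] by blast
  then show ?thesis using fin by (intro exI[of _ ?F]) simp
qed

text \<open>Checked entry by entry: the degree of an entry differs from that of the morphism by the
  shifts of the two summands, which is the offset in \<open>dm_direct\<close>.\<close>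

lemma op_hom_direct:
  assumes X: "pob d X" and Y: "pob d Y" and K: "finite K" and u: "\<forall>k\<in>K. u k \<in> op_hom d X Y k" and s: "(\<Sum>k\<in>K. u k) = 0"
  shows "\<forall>k\<in>K. u k = 0"
proof
  fix k assume k: "k \<in> K"
  have "\<forall>k\<in>K. \<exists>f. f \<in> pt_hom (Lc d) X Y k \<and> u k = mop X f"
    using u unfolding op_hom_def by (simp add: image_iff Bex_def)
  from bchoice[OF this] obtain f where f: "\<And>k. k \<in> K \<Longrightarrow> f k \<in> pt_hom (Lc d) X Y k" "\<And>k. k \<in> K \<Longrightarrow> u k = mop X (f k)"
    by auto
  have "f k i j x = 0" for i j x
  proof (cases "i < sz Y \<and> j < sz X")
    case True
    show ?thesis
    proof (rule dm_direct[where u = "\<lambda>k. f k i j" and s = "tsh Y i - tsh X j", OF Lc_ob(2)[OF pobD[OF Y conjunct1[OF True]]] K _ _ k])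
      show "f k i j \<in> dm_hom (tm X j) (tm Y i) (k + (tsh Y i - tsh X j))" if "k \<in> K" for k
        using Lc_hom_dm[OF pt_homD(1)[OF f(1)[OF that] conjunct1[OF True] conjunct2[OF True]]]
        by (simp add: add_diff_eq)
      show "(\<Sum>k\<in>K. f k i j x) = 0" for x
      proof (cases "x \<in> tot (tm X j)")
        case t: True
        have "(\<Sum>k\<in>K. f k i j x) = (\<Sum>k\<in>K. ap (u k) (\<lambda>m. if m = j then x else 0) i)"
          using mop_single[OF pt_hom_lin[OF f(1)] conjunct2[OF True] t] f(2) by (intro sum.cong refl) simp
        also have "\<dots> = 0" by (simp only: sum_ap[symmetric] s ap_simps)
        finally show ?thesis .
      next
        case False
        then show ?thesis using pt_hom_out[OF f(1)] by (intro sum.neutral) auto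
      qed
    qed
  next
    case False
    then show ?thesis using pt_homD(2)[OF f(1)[OF k]] by (simp add: zero_fun_def)
  qed
  then have "f k = 0" by (simp add: fun_eq_iff)
  then show "u k = 0" using f(2)[OF k] mop_0 by simp
qed

subsection \<open>The spherical object\<close>

lemma BalgE: assumes "b \<in> Balg" obtains a c where "b = [:a, c:]"
proof -
  have "b = [:coeff b 0, coeff b 1:]"
    using assms by (auto simp: Balg_def poly_eq_iff coeff_pCons coeff_eq_0 split: nat.split)
  then show ?thesis by (rule that)
qed

lemma Balg_pCons: "[:a, c:] \<in> Balg" by (simp add: Balg_def)

lemma Bgr_pCons: "[:a, c:] \<in> Bgr d k \<longleftrightarrow> (a \<noteq> 0 \<longrightarrow> k = 0) \<and> (c \<noteq> 0 \<longrightarrow> k = d)"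
  by (simp add: Bgr_def Balg_pCons)

lemma Bmult_pCons: "Bmult [:a, c:] [:p, q:] = [:a * p, a * q + c * p:]"
proof -
  \<comment> \<open>Division by the square of \<open>s\<close>: the quotient is the top coefficient,
    the rest is the remainder.\<close>
  have "[:a, c:] * [:p, q:] = [:a * p, a * q + c * p:] + [:c * q:] * [:0, 0, 1:]" by simp
  then have "Bmult [:a, c:] [:p, q:] = [:a * p, a * q + c * p:] mod [:0, 0, 1:]"
    by (simp only: Bmult_def mod_mult_self1)
  then show ?thesis by (simp add: mod_poly_less)
qed

lemma phi_neg_pCons: "phi_neg [:a, c:] = [:a, - c:]"
  by (simp add: phi_neg_def pcompose_pCons)

lemma one_pCons': "(1 :: complex poly) = [:1, 0:]" by simp

lemma tot_Bmod: "tot (Bmod d) = Balg"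
proof
  have "pv.subspace Balg"
    by (rule pv.subspaceI) (auto simp: Balg_def intro: degree_add_le order_trans[OF degree_smult_le])
  then show "tot (Bmod d) \<subseteq> Balg"
    unfolding tot_def by (intro pv.span_minimal) (auto simp: Bmod_def Bgr_def)
  show "Balg \<subseteq> tot (Bmod d)"
  proof
    fix b assume "b \<in> Balg"
    then obtain a c where b: "b = [:a, 0:] + [:0, c:]" by (elim BalgE) simp
    have "[:a, 0:] \<in> dm_gr (Bmod d) 0" "[:0, c:] \<in> dm_gr (Bmod d) d" by (simp_all only: Bmod_def dgmod.simps Bgr_pCons) simp_all
    then show "b \<in> tot (Bmod d)" unfolding b by (intro tot_add gr_tot)
  qed
qed

lemma dg_module_Bmod: "dg_module d (Bmod d)"
  unfolding dg_module_def tot_Bmod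
proof (intro conjI allI ballI impI)
  show "pv.subspace (dm_gr (Bmod d) p)" for p
    by (rule pv.subspaceI)
      (auto simp: Bmod_def Bgr_def Balg_def intro: degree_add_le order_trans[OF degree_smult_le])
  fix p x assume x: "(\<forall>p. x p \<in> dm_gr (Bmod d) p) \<and> finite {p. x p \<noteq> 0} \<and> (\<Sum>p | x p \<noteq> 0. x p) = 0"
  have g: "x p \<in> Bgr d p" for p using x by (simp add: Bmod_def)
  \<comment> \<open>The coefficients are treated separately: each can be non-zero in a single degree
    only, and for \<open>d = 0\<close> these degrees coincide.\<close>
  have z: "(\<Sum>p | x p \<noteq> 0. coeff (x p) n) = 0" for n
    using x by (simp add: coeff_sum[symmetric])
  have "coeff (x 0) 0 = (\<Sum>p | x p \<noteq> 0. if p = 0 then coeff (x 0) 0 else 0)" using x by (simp add: sum.delta)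
  also have "\<dots> = (\<Sum>p | x p \<noteq> 0. coeff (x p) 0)" using g by (intro sum.cong) (auto simp: Bgr_def)
  finally have 0: "coeff (x 0) 0 = 0" using z by simp
  have "coeff (x d) 1 = (\<Sum>p | x p \<noteq> 0. if p = d then coeff (x d) 1 else 0)" using x by (simp add: sum.delta)
  also have "\<dots> = (\<Sum>p | x p \<noteq> 0. coeff (x p) 1)" using g by (intro sum.cong) (auto simp: Bgr_def)
  finally have 1: "coeff (x d) 1 = 0" using z by simp
  have "x p \<in> Balg" using g[of p] by (simp add: Bgr_def)
  then obtain a c where ac: "x p = [:a, c:]" by (rule BalgE)
  have "a \<noteq> 0 \<longrightarrow> p = 0" "c \<noteq> 0 \<longrightarrow> p = d" using g[of p] unfolding ac Bgr_pCons by blast+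
  then have "a = 0" "c = 0" using 0 1 ac by (cases "a = 0"; cases "c = 0"; auto)+
  then show "x p = 0" using ac by simp
next
  show "dm_act (Bmod d) x b \<in> dm_gr (Bmod d) (p + k)" if "x \<in> dm_gr (Bmod d) p" "b \<in> Bgr d k" for p k x b
  proof -
    have "x \<in> Balg" "b \<in> Balg" using that by (simp_all add: Bmod_def Bgr_def)
    then obtain a c a' c' where x: "x = [:a, c:]" and b: "b = [:a', c':]" by (elim BalgE)
    show ?thesis using that unfolding x b
      by (simp only: Bmod_def dgmod.simps Bmult_pCons Bgr_pCons) auto
  qed
  show "linear_on Balg (\<lambda>x. dm_act (Bmod d) x b)" if "b \<in> Balg" for b
    using that unfolding linear_on_def by (auto elim!: BalgE simp: Bmod_def Bmult_pCons algebra_simps)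
  show "linear_on Balg (dm_act (Bmod d) x)" if "x \<in> Balg" for x
    using that unfolding linear_on_def by (auto elim!: BalgE simp: Bmod_def Bmult_pCons algebra_simps)
  show "dm_act (Bmod d) x 1 = x" if "x \<in> Balg" for x
    using that unfolding one_pCons' by (auto elim!: BalgE simp: Bmod_def Bmult_pCons simp del: pCons_0_0)
  show "dm_act (Bmod d) (dm_act (Bmod d) x b) c = dm_act (Bmod d) x (Bmult b c)"
    if "x \<in> Balg" "b \<in> Balg" "c \<in> Balg" for x b c
    using that by (auto elim!: BalgE simp: Bmod_def Bmult_pCons algebra_simps)
qed (auto simp: linear_on_def Bmod_def Bgr_def Balg_def Bmult_def)

lemma semifree_Bmod: "semifree d (Bmod d)"
  unfolding semifree_def tot_Bmod
proof (intro conjI exI[of _ "Suc 0"] exI[of _ "\<lambda>i :: nat. 1 :: complex poly"] exI[of _ "\<lambda>i :: nat. 0 :: int"] allI ballI impI)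
  have act: "dm_act (Bmod d) 1 b = b" if "b \<in> Balg" for b
    using that unfolding one_pCons' by (auto elim!: BalgE simp: Bmod_def Bmult_pCons simp del: pCons_0_0)
  show "dg_module d (Bmod d)" by (rule dg_module_Bmod)
  show "1 \<in> dm_gr (Bmod d) 0" by (simp add: Bmod_def Bgr_def Balg_def)
  show "\<exists>!b. b \<in> {..<Suc 0} \<rightarrow>\<^sub>E Balg \<and> x = (\<Sum>i<Suc 0. dm_act (Bmod d) 1 (b i))" if x: "x \<in> Balg" for x
  proof (rule ex1I[of _ "\<lambda>i\<in>{..<Suc 0}. x"])
    show "(\<lambda>i\<in>{..<Suc 0}. x) \<in> {..<Suc 0} \<rightarrow>\<^sub>E Balg \<and> x = (\<Sum>i<Suc 0. dm_act (Bmod d) 1 ((\<lambda>i\<in>{..<Suc 0}. x) i))"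
      using x by (simp add: act)
    fix b :: "nat \<Rightarrow> complex poly"
    assume b: "b \<in> {..<Suc 0} \<rightarrow>\<^sub>E Balg \<and> x = (\<Sum>i<Suc 0. dm_act (Bmod d) 1 (b i))"
    then have "b 0 \<in> Balg" by auto
    then have "b 0 = x" using b by (simp add: act)
    moreover have "b i = undefined" if "i \<noteq> 0" for i using b that by (auto simp: PiE_def extensional_def)
    ultimately show "b = (\<lambda>i\<in>{..<Suc 0}. x)" by (auto simp: fun_eq_iff)
  qed
  show "\<exists>b\<in>{..<j} \<rightarrow> Balg. dm_diff (Bmod d) 1 = (\<Sum>i<j. dm_act (Bmod d) 1 (b i))" if "j < Suc 0" for j :: nat
    using that by (intro bexI[of _ "\<lambda>i. 0"]) (simp_all add: Bmod_def)
qed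

lemma carrier_Z2: "carrier Z2 = {0, 1}"
  by (auto simp: carrier_integer_mod_group)

lemma lam_pCons:
  "lam d \<epsilon> 0 [:a, c:] = [:a, c:]" "lam d \<epsilon> 1 [:a, c:] = [:\<epsilon> * a, - (\<epsilon> * c):]"
  "g \<in> carrier Z2 \<Longrightarrow> x \<notin> Balg \<Longrightarrow> lam d \<epsilon> g x = 0"
proof -
  have "dm_act (Bmod d) [:\<epsilon>, 0:] (phi_neg [:a, c:]) = [:\<epsilon> * a, - (\<epsilon> * c):]"
    by (simp only: phi_neg_pCons) (simp only: Bmod_def dgmod.simps Bmult_pCons, simp)
  then show "lam d \<epsilon> 0 [:a, c:] = [:a, c:]" "lam d \<epsilon> 1 [:a, c:] = [:\<epsilon> * a, - (\<epsilon> * c):]"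
    by (simp_all add: lam_def carrier_Z2 tot_Bmod Balg_pCons twist_ob_def)
  show "g \<in> carrier Z2 \<Longrightarrow> x \<notin> Balg \<Longrightarrow> lam d \<epsilon> g x = 0" by (simp add: lam_def tot_Bmod)
qed

text \<open>As \<open>phi_neg\<close> is an involution, a map linear up to this change of sign is
  linear in both directions. For \<open>\<epsilon> * \<epsilon> = 1\<close> it is its own
  inverse.\<close>

lemma lam_hom:
  assumes g: "g \<in> carrier Z2"
  shows "lam d \<epsilon> g \<in> dm_hom (Bmod d) (twist_ob g (Bmod d)) 0"
    "lam d \<epsilon> g \<in> dm_hom (twist_ob g (Bmod d)) (Bmod d) 0"
proof -
  have t: "tot (twist_ob g (Bmod d)) = Balg" using tot_Bmod by (simp add: twist_ob_def tot_def)
  have gr: "dm_gr (twist_ob g (Bmod d)) = Bgr d" "dm_gr (Bmod d) = Bgr d" by (simp_all add: twist_ob_def Bmod_def)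
  have lin: "linear_on Balg (lam d \<epsilon> g)"
    using g unfolding linear_on_def carrier_Z2 by (auto elim!: BalgE simp: lam_pCons algebra_simps)
  have deg: "lam d \<epsilon> g x \<in> Bgr d p" if "x \<in> Bgr d p" for x p
  proof -
    have "x \<in> Balg" using that by (simp add: Bgr_def)
    then obtain a c where x: "x = [:a, c:]" by (rule BalgE)
    have "g = 0 \<or> g = 1" using g by (simp add: carrier_Z2)
    then show ?thesis using that unfolding x by (elim disjE) (auto simp add: lam_pCons Bgr_pCons)
  qed
  have act: "dm_act (twist_ob g (Bmod d)) x b = Bmult x (if g = 0 then b else phi_neg b)" "dm_act (Bmod d) x b = Bmult x b" for x b
    by (simp_all add: twist_ob_def Bmod_def)
  have "lam d \<epsilon> g (Bmult x b) = Bmult (lam d \<epsilon> g x) (if g = 0 then b else phi_neg b)"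
    "lam d \<epsilon> g (Bmult x (if g = 0 then b else phi_neg b)) = Bmult (lam d \<epsilon> g x) b" if "x \<in> Balg" "b \<in> Balg" for x b
    using g that unfolding carrier_Z2 by (auto elim!: BalgE simp: lam_pCons Bmult_pCons phi_neg_pCons algebra_simps)
  then show "lam d \<epsilon> g \<in> dm_hom (Bmod d) (twist_ob g (Bmod d)) 0" "lam d \<epsilon> g \<in> dm_hom (twist_ob g (Bmod d)) (Bmod d) 0"
    using lin deg lam_pCons(3)[OF g] by (simp_all add: dm_hom_def t tot_Bmod gr act)
qed

text \<open>With one non-trivial group element, the cocycle condition says that
  \<open>\<lambda>\<^sub>g\<close> composed with itself is the identity, and this is the condition
  on \<open>\<epsilon>\<close>.\<close>

lemma linearisation_lam:
  assumes \<epsilon>: "\<epsilon> * \<epsilon> = 1"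
  shows "linearisation Z2 (semifree_cat d) twist_ob twist_mor (Bmod d) (lam d \<epsilon>)"
proof -
  have t: "tot (twist_ob g (Bmod d)) = Balg" for g using tot_Bmod by (simp add: twist_ob_def tot_def)
  have z: "dm_diff (twist_ob g (Bmod d)) x = 0" "dm_diff (Bmod d) x = 0" for g x by (simp_all add: twist_ob_def Bmod_def)
  have l0: "lam d \<epsilon> g 0 = 0" if "g \<in> carrier Z2" for g
    using linear_on_0[OF dm_homD(1)[OF lam_hom(1)[OF that]] tot_0] .
  have cc: "lam d \<epsilon> g \<in> dg_cocycles (semifree_cat d) (Bmod d) (twist_ob g (Bmod d))"
    "lam d \<epsilon> g \<in> dg_cocycles (semifree_cat d) (twist_ob g (Bmod d)) (Bmod d)" if "g \<in> carrier Z2" for g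
    using lam_hom[OF that] l0[OF that] by (simp_all add: dg_cocycles_def semifree_cat_def z zero_fun_def cong: if_cong)
  have sq: "lam d \<epsilon> g (lam d \<epsilon> g x) = x" if "g \<in> carrier Z2" "x \<in> Balg" for g x
    using that \<epsilon> unfolding carrier_Z2 by (auto elim!: BalgE simp: lam_pCons mult.assoc[symmetric])
  have id: "lam d \<epsilon> 0 x = (if x \<in> Balg then x else 0)" for x
    by (simp add: lam_def tot_Bmod carrier_Z2)
  show ?thesis
    unfolding linearisation_def
  proof (intro conjI ballI)
    show "lam d \<epsilon> \<in> extensional (carrier Z2)" by (simp add: lam_def)
    show "lam d \<epsilon> \<one>\<^bsub>Z2\<^esub> = dg_id (semifree_cat d) (Bmod d)"
      by (rule ext) (simp add: semifree_cat_def tot_Bmod id)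
    fix g assume g: "g \<in> carrier Z2"
    show "lam d \<epsilon> g \<in> dg_cocycles (semifree_cat d) (Bmod d) (twist_ob g (Bmod d))" by (rule cc[OF g])
    show "\<exists>m\<in>dg_cocycles (semifree_cat d) (twist_ob g (Bmod d)) (Bmod d).
        dg_comp (semifree_cat d) (Bmod d) (twist_ob g (Bmod d)) (Bmod d) m (lam d \<epsilon> g) = dg_id (semifree_cat d) (Bmod d) \<and>
        dg_comp (semifree_cat d) (twist_ob g (Bmod d)) (Bmod d) (twist_ob g (Bmod d)) (lam d \<epsilon> g) m =
          dg_id (semifree_cat d) (twist_ob g (Bmod d))"
      using sq[OF g] by (intro bexI[OF _ cc(2)[OF g]]) (simp add: semifree_cat_def t tot_Bmod fun_eq_iff)
    fix h assume h: "h \<in> carrier Z2"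
    have inB: "lam d \<epsilon> h x \<in> Balg" for x using dm_hom_tot[OF lam_hom(2)[OF h]] by (simp add: tot_Bmod)
    have "lam d \<epsilon> (g \<otimes>\<^bsub>Z2\<^esub> h) x = (if x \<in> Balg then lam d \<epsilon> g (lam d \<epsilon> h x) else 0)" for x
    proof (cases "x \<in> Balg")
      case True
      show ?thesis
      proof (cases "g = 0")
        case g0: True
        then show ?thesis using True h inB by (auto simp: carrier_Z2 id)
      next
        case False
        then show ?thesis using True g h sq[OF g True] by (auto simp: carrier_Z2 id)
      qed
    next
      case False
      have "g \<otimes>\<^bsub>Z2\<^esub> h \<in> carrier Z2" using g h by (auto simp: carrier_Z2)
      then show ?thesis using False lam_pCons(3) by simp
    qed
    then show "lam d \<epsilon> (g \<otimes>\<^bsub>Z2\<^esub> h) = dg_comp (semifree_cat d) (Bmod d) (twist_ob h (Bmod d))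
        (twist_ob h (twist_ob g (Bmod d))) (twist_mor h (lam d \<epsilon> g)) (lam d \<epsilon> h)"
      by (simp add: semifree_cat_def twist_mor_def tot_Bmod fun_eq_iff)
  qed
qed

lemma lam_distinct: "lam d 1 \<noteq> lam d (- 1)"
proof
  assume "lam d 1 = lam d (- 1)"
  then have "lam d 1 1 [:1, 0:] = lam d (- 1) 1 [:1, 0:]" by (rule arg_cong)
  then show False by (simp only: lam_pCons) simp
qed

lemma lam_endo:
  assumes \<epsilon>: "\<epsilon> \<noteq> 0" and f: "f \<in> dg_hom (Lc d) (Bmod d, lam d \<epsilon>) (Bmod d, lam d \<epsilon>) k"
  obtains a where "a \<noteq> 0 \<Longrightarrow> k = 0" "f = dg_scale (Lc d) a (dg_id (Lc d) (Bmod d, lam d \<epsilon>))"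
proof -
  note h = dm_homD[OF Lc_hom_dm[OF f], simplified, unfolded tot_Bmod]
  have f1: "f [:1, 0:] \<in> Bgr d k" using h(2)[of "[:1, 0:]" 0] by (simp add: Bmod_def Bgr_def Balg_def)
  then have "f [:1, 0:] \<in> Balg" by (simp add: Bgr_def)
  then obtain a c where ac: "f [:1, 0:] = [:a, c:]" by (rule BalgE)
  with f1 have k: "a \<noteq> 0 \<Longrightarrow> k = 0" by (simp add: Bgr_pCons)
  \<comment> \<open>The two sides are \<open>\<epsilon> a - \<epsilon> c s\<close> and
    \<open>\<epsilon> a + \<epsilon> c s\<close>. This removes \<open>c\<close> in every degree,
    also for \<open>d = 0\<close>, where the grading does not separate \<open>s\<close> from
    1.\<close>
  have "lam d \<epsilon> 1 (f [:1, 0:]) = f (lam d \<epsilon> 1 [:1, 0:])"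
    using f Balg_pCons[of 1 0] by (simp add: Lc_hom carrier_Z2 tot_Bmod)
  also have "lam d \<epsilon> 1 [:1, 0:] = Polynomial.smult \<epsilon> [:1, 0:]" by (simp only: lam_pCons) simp
  also have "f \<dots> = Polynomial.smult \<epsilon> (f [:1, 0:])" using h(1) Balg_pCons[of 1 0] by (simp only: linear_on_def)
  finally have c: "c = 0" using \<epsilon> unfolding ac lam_pCons by simp
  have "f x = Polynomial.smult a x" if x: "x \<in> Balg" for x
  proof -
    have "f (Bmult [:1, 0:] x) = Bmult [:a, 0:] x"
      using h(3)[OF Balg_pCons[of 1 0] x] ac c by (simp only: Bmod_def dgmod.simps)
    moreover obtain p q where "x = [:p, q:]" using x by (elim BalgE)
    ultimately show ?thesis by (simp only: Bmult_pCons) simp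
  qed
  then have "f = dg_scale (Lc d) a (dg_id (Lc d) (Bmod d, lam d \<epsilon>))"
    using h(4) by (auto simp: fun_eq_iff LcD(2,4) tot_Bmod)
  then show ?thesis using k that by blast
qed

section \<open>The linearised category as an instance of the general setting\<close>

definition op_mat :: "int \<Rightarrow> tw \<Rightarrow> tw \<Rightarrow> seq_op \<Rightarrow> nat \<Rightarrow> nat \<Rightarrow> lmap" where
  "op_mat d X Y F = (SOME f. f \<in> pt_hom (Lc d) X Y 0 \<and> mop X f = F)"

lemma op_mat: assumes "F \<in> op_hom d X Y 0" shows "op_mat d X Y F \<in> pt_hom (Lc d) X Y 0" "mop X (op_mat d X Y F) = F"
proof -
  have "\<exists>f. f \<in> pt_hom (Lc d) X Y 0 \<and> mop X f = F" using assms unfolding op_hom_def by (simp add: image_iff Bex_def eq_commute)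
  from someI_ex[OF this] show "op_mat d X Y F \<in> pt_hom (Lc d) X Y 0" "mop X (op_mat d X Y F) = F"
    unfolding op_mat_def by auto
qed

text \<open>The operators determine their matrices, so forming cones from operators, as in
  \<open>dg_ops\<close>, and from matrices, as in \<open>pt_cone\<close>, amounts to the
  same.\<close>

lemma op_mat_mop: assumes f: "f \<in> pt_hom (Lc d) X Y 0" shows "op_mat d X Y (mop X f) = f"
  using mop_inj[OF op_mat(1)[OF op_hom_mop[OF f]] f] op_mat(2)[OF op_hom_mop[OF f]] by blast

lemma op_cat_Lc: "op_cat lsc (pt_ob (Lc d)) (op_id d) op_diff (op_hom d)"
  by unfold_locales (auto intro: lsc_add lsc_mult lsc_1 lsc_comm op_hom_0 op_hom_add op_hom_scale op_hom_mult op_hom_one op_id_left op_id_right op_diff_hom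
    op_diff_square dest: pt_ob_D(1))

text \<open>\<open>Y\<close> keeps its positions in the cone, so its inclusion and its projection
  are both \<open>op_id d Y\<close>, while \<open>X\<close> is moved by \<open>sh_up\<close> and
  \<open>sh_dn\<close>. The condition on \<open>\<epsilon>\<close> makes \<open>E\<close> an object
  of the linearised category.\<close>

lemma dg_ops_Lc:
  assumes \<epsilon>: "\<epsilon> * \<epsilon> = 1"
  shows "dg_ops lsc (pt_ob (Lc d)) (op_id d) op_diff (op_hom d) (pt_single (Bmod d, lam d \<epsilon>)) (pt_shift (Lc d))
    (\<lambda>X Y F. pt_cone (Lc d) X Y (op_mat d X Y F)) (\<lambda>X Y. op_id d Y) (\<lambda>X Y. op_id d Y)
    (\<lambda>X Y. sh_up (sz Y) * op_id d X) (\<lambda>X Y. op_id d X * sh_dn (sz Y))"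
proof -
  interpret O: op_cat lsc "pt_ob (Lc d)" "op_id d" op_diff "op_hom d" by (rule op_cat_Lc)
  let ?E = "pt_single (Bmod d, lam d \<epsilon>) :: tw"
  have E: "sz ?E = 1" "tob ?E 0 = (Bmod d, lam d \<epsilon>)" "tsh ?E 0 = 0" "tq ?E = (\<lambda>i j. 0)"
    by (simp_all add: pt_single_def sz_def tob_def tsh_def tq_def)
  have \<epsilon>0: "\<epsilon> \<noteq> 0" using \<epsilon> by auto
  have pE: "pob d ?E" using semifree_Bmod linearisation_lam[OF \<epsilon>] by (simp add: pob_def E LcD)
  have tE: "tq ?E = 0" by (simp add: E(4) zero_fun_def)
  have D0: "op_diff ?E = 0"
  proof -
    have "dmd (Bmod d) x = 0" for x by (simp add: dmd_def Bmod_def)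
    then have "diff_mat ?E = 0" by (auto simp: diff_mat_def E fun_eq_iff)
    then show ?thesis by (simp add: op_diff_def tE mop_0)
  qed
  have obE: "?E \<in> pt_ob (Lc d)"
    by (rule pt_obI[OF pE]) (simp_all add: tE D0 pt_hom_0[OF pE pE])
  have homE: "\<exists>a. (a \<noteq> 0 \<longrightarrow> k = 0) \<and> F = lsc a * op_id d ?E" if F: "F \<in> op_hom d ?E ?E k" for F k
  proof -
    obtain f where f: "f \<in> pt_hom (Lc d) ?E ?E k" "F = mop ?E f" using F unfolding op_hom_def by (elim imageE) simp
    have "f 0 0 \<in> dg_hom (Lc d) (Bmod d, lam d \<epsilon>) (Bmod d, lam d \<epsilon>) k"
      using pt_homD(1)[OF f(1), of 0 0] by (simp add: E)
    then obtain a where a: "a \<noteq> 0 \<Longrightarrow> k = 0" "f 0 0 = dg_scale (Lc d) a (dg_id (Lc d) (Bmod d, lam d \<epsilon>))"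
      using lam_endo[OF \<epsilon>0] by blast
    have "f = pt_scale (Lc d) a (id_mat d ?E)"
    proof (intro ext)
      fix i j x
      show "f i j x = pt_scale (Lc d) a (id_mat d ?E) i j x"
        using a(2) pt_homD(2)[OF f(1), of i j]
        by (cases "i = 0 \<and> j = 0") (auto simp: pt_scale_def id_mat_def pretr_def E LcD(4))
    qed
    then show ?thesis using f(2) a(1) mop_scale[OF pt_hom_lin[OF id_mat_hom[OF pE]]]
      by (intro exI[of _ a]) (auto simp: op_id_def)
  qed
  show ?thesis
  proof
    show "?E \<in> pt_ob (Lc d)" by (rule obE)
    show "op_hom d ?E ?E 0 = range (\<lambda>c. lsc c * op_id d ?E)"
      using homE[of _ 0] op_hom_scale[OF pE pE op_hom_one[OF pE]] by blast
    show "op_hom d ?E ?E k = {0}" if "k \<noteq> 0" for k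
    proof -
      have "F = 0" if F: "F \<in> op_hom d ?E ?E k" for F using homE[OF F] \<open>k \<noteq> 0\<close> O.sc_0 by auto
      then show ?thesis using op_hom_0[OF pE pE] by blast
    qed
    show "c = 0" if c: "lsc c * op_id d ?E = 0" for c
    proof -
      have "ap (lsc c * op_id d ?E) (\<lambda>i. 1) 0 = 0" by (simp only: c ap_simps)
      moreover have "tot_prj (Bmod d) 1 = 1" by (rule tot_prj(4)) (simp add: tot_Bmod Balg_def)
      ultimately show ?thesis by (simp add: ap_simps ap_op_id[OF pE] E)
    qed
    show "pt_shift (Lc d) k X \<in> pt_ob (Lc d)" if "X \<in> pt_ob (Lc d)" for X k by (rule shift_ob[OF that])
    show "op_diff (pt_shift (Lc d) k X) = sn k * op_diff X" if "X \<in> pt_ob (Lc d)" for X k by (rule op_diff_shift[OF that])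
    show "op_id d (pt_shift (Lc d) k X) = op_id d X" for X k by (rule op_id_shift)
    show "op_hom d (pt_shift (Lc d) m X) Y k = op_hom d X Y (k - m)" for X Y m k by (rule op_hom_shift)
    show "op_hom d X (pt_shift (Lc d) m Y) k = op_hom d X Y (k + m)" for X Y m k by (rule op_hom_shift)
    fix X Y assume X: "X \<in> pt_ob (Lc d)" and Y: "Y \<in> pt_ob (Lc d)"
    note pX = pt_ob_D(1)[OF X] and pY = pt_ob_D(1)[OF Y]
    show "\<exists>F. finite F \<and> (\<forall>k. op_hom d X Y k \<subseteq> range (\<lambda>c. \<Sum>f\<in>F. lsc (c f) * f))" by (rule op_hom_finite[OF pX pY])
    show "\<forall>k\<in>K. u k = 0" if "finite K" "\<forall>k\<in>K. u k \<in> op_hom d X Y k" "(\<Sum>k\<in>K. u k) = 0" for K u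
      by (rule op_hom_direct[OF pX pY that])
    fix F assume F: "F \<in> O.cyc X Y 0"
    have FH: "F \<in> op_hom d X Y 0" and Fc: "op_diff Y * F = F * op_diff X" using F by (simp_all add: O.cyc_def sn_simps)
    note f = op_mat[OF FH]
    let ?C = "pt_cone (Lc d) X Y (op_mat d X Y F)"
    show "?C \<in> pt_ob (Lc d)" using Fc by (intro cone_ob[OF X Y f(1)]) (simp add: f(2))
    note m = cone_maps[OF pX pY, of "op_mat d X Y F"] and mm = mop_cone_maps[OF pX pY]
    show "op_id d Y \<in> op_hom d Y ?C 0 \<and> op_id d Y \<in> op_hom d ?C Y 0 \<and> sh_up (sz Y) * op_id d X \<in> op_hom d X ?C (- 1) \<and>
        op_id d X * sh_dn (sz Y) \<in> op_hom d ?C X 1"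
      using op_hom_mop[OF m(1)] op_hom_mop[OF m(2)] op_hom_mop[OF m(3)] op_hom_mop[OF m(4)] mm by (simp add: op_id_def)
    have II: "op_id d X * op_id d X = op_id d X" "op_id d Y * op_id d Y = op_id d Y"
      using op_id_left[OF pX pX op_hom_one[OF pX]] op_id_left[OF pY pY op_hom_one[OF pY]] by auto
    have DI: "op_diff X * op_id d X = op_diff X" "op_id d X * op_diff X = op_diff X" "op_diff Y * op_id d Y = op_diff Y" "op_id d Y * op_diff Y = op_diff Y"
        "F * op_id d X = F" "op_id d Y * F = F"
      using op_id_left[OF pX pX op_diff_hom[OF X]] op_id_right[OF pX op_diff_hom[OF X]] op_id_left[OF pY pY op_diff_hom[OF Y]]
        op_id_right[OF pY op_diff_hom[OF Y]] op_id_left[OF pX pY FH] op_id_right[OF pX FH] by auto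
    note z = II DI op_id_up[OF pY] dn_op_id[OF pY] sh_dn_up
    show "op_id d X * sh_dn (sz Y) * (sh_up (sz Y) * op_id d X) = op_id d X \<and> op_id d Y * op_id d Y = op_id d Y \<and>
      op_id d Y * (sh_up (sz Y) * op_id d X) = 0 \<and> op_id d X * sh_dn (sz Y) * op_id d Y = 0 \<and>
      op_id d Y * op_id d Y + sh_up (sz Y) * op_id d X * (op_id d X * sh_dn (sz Y)) = op_id d ?C \<and>
      op_diff ?C = op_id d Y * op_diff Y * op_id d Y + op_id d Y * F * (op_id d X * sh_dn (sz Y)) -
        sh_up (sz Y) * op_id d X * op_diff X * (op_id d X * sh_dn (sz Y))"
      by (simp add: op_id_cone[OF pX pY] op_diff_cone[OF X Y f(1)] f(2) mult.assoc z z[THEN mult_eq_assoc])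
  next
    show "\<exists>Z\<in>pt_ob (Lc d). op_id d Z = 0"
    proof -
      let ?Z = "([], \<lambda>i j. 0) :: tw"
      have s: "sz ?Z = 0" by (simp add: sz_def)
      have pZ: "pob d ?Z" by (simp add: pob_def s)
      have I: "op_id d ?Z = 0" by (rule seq_op_eqI) (simp add: ap_op_id[OF pZ] s ap_simps)
      have "op_diff ?Z = mop ?Z (diff_mat ?Z) + mop ?Z (tq ?Z)" by (simp add: op_diff_def)
      moreover have "diff_mat ?Z = 0" "tq ?Z = 0" by (intro ext; simp add: diff_mat_def tq_def s)+
      ultimately have "op_diff ?Z = 0" by (simp add: mop_0)
      then have "?Z \<in> pt_ob (Lc d)"
        by (intro pt_obI[OF pZ]) (simp_all add: \<open>tq ?Z = 0\<close> pt_hom_0[OF pZ pZ])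
      then show ?thesis using I by blast
    qed
  qed
qed

text \<open>A set of matrices and not of operators, so that it can equal the coset that is a
  morphism of \<open>H0\<close>.\<close>

definition op_class :: "int \<Rightarrow> tw \<Rightarrow> tw \<Rightarrow> seq_op \<Rightarrow> (nat \<Rightarrow> nat \<Rightarrow> lmap) set" where
  "op_class d X Y F = {f \<in> pt_hom (Lc d) X Y 0. mop X f - F \<in> op_cat.bnd op_diff (op_hom d) X Y 0}"

text \<open>Boundaries in the pretriangulated hull correspond under \<open>mop\<close> to boundaries
  of operators, and \<open>mop\<close> is injective.\<close>

lemma dg_class_cl:
  assumes X: "X \<in> pt_ob (Lc d)" and Y: "Y \<in> pt_ob (Lc d)" and f: "f \<in> pt_hom (Lc d) X Y 0"
  shows "dg_class (pretr (Lc d)) X Y f = op_class d X Y (mop X f)"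
proof -
  interpret O: op_cat lsc "pt_ob (Lc d)" "op_id d" op_diff "op_hom d" by (rule op_cat_Lc)
  note pX = pt_ob_D(1)[OF X] and pY = pt_ob_D(1)[OF Y]
  have dh: "dg_diff (pretr (Lc d)) X Y (- 1) h \<in> pt_hom (Lc d) X Y 0"
    "mop X (dg_diff (pretr (Lc d)) X Y (- 1) h) = op_diff Y * mop X h + mop X h * op_diff X"
    if "h \<in> pt_hom (Lc d) X Y (- 1)" for h
    using pretr_diff[OF X Y that] by (simp_all add: sn_simps)
  have hom: "dg_hom (pretr (Lc d)) = pt_hom (Lc d)" by (simp add: pretr_def)
  show ?thesis
  proof (intro subset_antisym subsetI)
    fix g assume "g \<in> dg_class (pretr (Lc d)) X Y f"
    then obtain h where h: "h \<in> pt_hom (Lc d) X Y (- 1)" and g: "g = f + dg_diff (pretr (Lc d)) X Y (- 1) h"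
      unfolding dg_class_def hom by (elim CollectE exE conjE)
    have "mop X g = mop X f + (op_diff Y * mop X h + mop X h * op_diff X)"
      unfolding g using mop_add[OF pt_hom_lin[OF f] pt_hom_lin[OF dh(1)[OF h]]] dh(2)[OF h] by simp
    then have "mop X g - mop X f \<in> O.bnd X Y 0"
      unfolding O.bnd_def using op_hom_mop[OF h] by (intro CollectI exI[of _ "mop X h"]) (simp add: sn_simps)
    then show "g \<in> op_class d X Y (mop X f)" using pt_hom_add[OF pX pY f dh(1)[OF h]] by (simp add: op_class_def g)
  next
    fix g assume g: "g \<in> op_class d X Y (mop X f)"
    then have "mop X g - mop X f \<in> O.bnd X Y 0" and gh: "g \<in> pt_hom (Lc d) X Y 0" by (simp_all add: op_class_def)
    then obtain H where H: "H \<in> op_hom d X Y (0 - 1)" "mop X g - mop X f = op_diff Y * H + sn 0 * H * op_diff X"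
      unfolding O.bnd_def by (elim CollectE exE conjE)
    then obtain h where h: "h \<in> pt_hom (Lc d) X Y (- 1)" "H = mop X h" unfolding op_hom_def by (elim imageE) simp
    have "mop X g = mop X (f + dg_diff (pretr (Lc d)) X Y (- 1) h)"
      using mop_add[OF pt_hom_lin[OF f] pt_hom_lin[OF dh(1)[OF h(1)]]] dh(2)[OF h(1)] H(2) h(2)
      by (simp add: sn_simps algebra_simps)
    then have "g = f + dg_diff (pretr (Lc d)) X Y (- 1) h"
      by (rule mop_inj[OF gh pt_hom_add[OF pX pY f dh(1)[OF h(1)]]])
    then show "g \<in> dg_class (pretr (Lc d)) X Y f" unfolding dg_class_def hom using h(1) by blast
  qed
qed

lemma cocycles_mop:
  assumes X: "X \<in> pt_ob (Lc d)" and Y: "Y \<in> pt_ob (Lc d)"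
  shows "f \<in> dg_cocycles (pretr (Lc d)) X Y \<longleftrightarrow>
    f \<in> pt_hom (Lc d) X Y 0 \<and> mop X f \<in> op_cat.cyc op_diff (op_hom d) X Y 0"
proof -
  interpret O: op_cat lsc "pt_ob (Lc d)" "op_id d" op_diff "op_hom d" by (rule op_cat_Lc)
  have "dg_diff (pretr (Lc d)) X Y 0 f = 0 \<longleftrightarrow> op_diff Y * mop X f = mop X f * op_diff X" if f: "f \<in> pt_hom (Lc d) X Y 0"
  proof -
    have "dg_diff (pretr (Lc d)) X Y 0 f = 0 \<longleftrightarrow> mop X (dg_diff (pretr (Lc d)) X Y 0 f) = 0"
      using mop_inj[OF pretr_diff(1)[OF X Y f] pt_hom_0[OF pt_ob_D(1)[OF X] pt_ob_D(1)[OF Y], of 0]] mop_0[of X] by metis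
    then show ?thesis using pretr_diff(2)[OF X Y f] by (simp add: sn_simps)
  qed
  then show ?thesis using op_hom_mop[of f d X Y 0] by (auto simp: dg_cocycles_def O.cyc_def sn_simps pretr_def)
qed

lemma Tdlin_simps:
  "lc_ob (Tdlin d) = pt_ob (Lc d)"
  "lc_hom (Tdlin d) = (\<lambda>X Y. dg_class (pretr (Lc d)) X Y ` dg_cocycles (pretr (Lc d)) X Y)"
  "lc_id (Tdlin d) = (\<lambda>X. dg_class (pretr (Lc d)) X X (id_mat d X))"
  "lc_comp (Tdlin d) = (\<lambda>X Y Z G F. \<Union>g\<in>G. \<Union>f\<in>F. dg_class (pretr (Lc d)) X Z (pt_comp (Lc d) X Y Z g f))"
  "lc_zero (Tdlin d) = (\<lambda>X Y. dg_class (pretr (Lc d)) X Y 0)"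
  "lc_add (Tdlin d) = (\<lambda>X Y F G. \<Union>f\<in>F. \<Union>g\<in>G. dg_class (pretr (Lc d)) X Y (f + g))"
  "lc_scale (Tdlin d) = (\<lambda>X Y c F. \<Union>f\<in>F. dg_class (pretr (Lc d)) X Y (pt_scale (Lc d) c f))"
  "tc_sh (Tdlin d) = pt_shift (Lc d)" "tc_shm (Tdlin d) = (\<lambda>k F. F)"
  by (simp_all add: Tdlin_def H0_pretr_def H0_def lincat.defs tricat.defs pretr_def id_mat_def)

lemma tri_iso_Tdlin: "tri_iso (H0 (pretr (Lc d))) = tri_iso (Tdlin d)"
  by (simp add: tri_iso_def lc_iso_def fun_eq_iff Tdlin_def H0_pretr_def lincat.defs)

lemma Tdlin_dist:
  "tc_dist (Tdlin d) = {t. \<exists>X \<in> pt_ob (Lc d). \<exists>Y \<in> pt_ob (Lc d). \<exists>f \<in> dg_cocycles (pretr (Lc d)) X Y.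
       tri_iso (Tdlin d) (pt_shift (Lc d) 1) (\<lambda>F. F)
         (X, Y, pt_cone (Lc d) X Y f,
          dg_class (pretr (Lc d)) X Y f,
          dg_class (pretr (Lc d)) Y (pt_cone (Lc d) X Y f) (id_mat d Y),
          dg_class (pretr (Lc d)) (pt_cone (Lc d) X Y f) (pt_shift (Lc d) 1 X) (pt_cone_out (Lc d) X Y)) t}"
proof -
  have "pt_cone_in (Lc d) Y = id_mat d Y" for Y by (intro ext) (simp add: pt_cone_in_def id_mat_def pretr_def)
  then show ?thesis unfolding tri_iso_Tdlin[symmetric] by (simp add: Tdlin_def H0_pretr_def lincat.defs)
qed

text \<open>The operations of \<open>H0\<close> are unions over all representatives of cosets. The
  members of each union are equal, because boundaries are stable under the operation, so the union
  is the class of the operator obtained from any representatives.\<close>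

lemma dg_tricat_Tdlin:
  assumes \<epsilon>: "\<epsilon> * \<epsilon> = 1"
  shows "dg_tricat lsc (pt_ob (Lc d)) (op_id d) op_diff (op_hom d) (pt_single (Bmod d, lam d \<epsilon>)) (pt_shift (Lc d))
    (\<lambda>X Y F. pt_cone (Lc d) X Y (op_mat d X Y F)) (\<lambda>X Y. op_id d Y) (\<lambda>X Y. op_id d Y)
    (\<lambda>X Y. sh_up (sz Y) * op_id d X) (\<lambda>X Y. op_id d X * sh_dn (sz Y)) (Tdlin d) (op_class d)"
proof -
  interpret O: dg_ops lsc "pt_ob (Lc d)" "op_id d" op_diff "op_hom d" "pt_single (Bmod d, lam d \<epsilon>)" "pt_shift (Lc d)"
    "\<lambda>X Y F. pt_cone (Lc d) X Y (op_mat d X Y F)" "\<lambda>X Y. op_id d Y" "\<lambda>X Y. op_id d Y"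
    "\<lambda>X Y. sh_up (sz Y) * op_id d X" "\<lambda>X Y. op_id d X * sh_dn (sz Y)" by (rule dg_ops_Lc[OF \<epsilon>])
  have rpcl: "op_mat d X Y F \<in> op_class d X Y F" if "X \<in> pt_ob (Lc d)" "Y \<in> pt_ob (Lc d)" "F \<in> O.cyc X Y 0" for X Y F
    using op_mat[OF O.cyc_hom[OF that(3)]] O.bnd_0[OF that(1,2)] by (simp add: op_class_def)
  have cl_cong: "op_class d X Y F = op_class d X Y G" if ob: "X \<in> pt_ob (Lc d)" "Y \<in> pt_ob (Lc d)" and b: "F - G \<in> O.bnd X Y 0" for X Y F G
  proof -
    have "H - F \<in> O.bnd X Y 0 \<longleftrightarrow> H - G \<in> O.bnd X Y 0" for H
      using O.bnd_add[OF ob _ b, of "H - F"] O.bnd_diff[OF ob _ b, of "H - G"] by auto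
    then show ?thesis by (simp add: op_class_def)
  qed
  have clD: "f \<in> pt_hom (Lc d) X Y 0" "mop X f - F \<in> O.bnd X Y 0" if "f \<in> op_class d X Y F" for f X Y F
    using that by (simp_all add: op_class_def)
  have clc: "mop X f \<in> O.cyc X Y 0" if "X \<in> pt_ob (Lc d)" "Y \<in> pt_ob (Lc d)" "F \<in> O.cyc X Y 0" "f \<in> op_class d X Y F" for f X Y F
    using O.cyc_add[OF that(1,2) O.bnd_cyc[OF that(1,2) clD(2)[OF that(4)]] that(3)] by simp
  have UN: "(\<Union>a\<in>A. f a) = c" if "b \<in> A" "\<And>a. a \<in> A \<Longrightarrow> f a = c" for A b f and c :: "(nat \<Rightarrow> nat \<Rightarrow> lmap) set"
    using that by blast
  show ?thesis
  proof
    show "lc_ob (Tdlin d) = pt_ob (Lc d)" "tc_sh (Tdlin d) = pt_shift (Lc d)" "tc_shm (Tdlin d) = (\<lambda>k F. F)"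
      by (simp_all add: Tdlin_simps)
    show "lc_id (Tdlin d) X = op_class d X X (op_id d X)" if "X \<in> pt_ob (Lc d)" for X
      using dg_class_cl[OF that that id_mat_hom[OF pt_ob_D(1)[OF that]]] by (simp add: Tdlin_simps op_id_def)
    fix X Y assume X: "X \<in> pt_ob (Lc d)" and Y: "Y \<in> pt_ob (Lc d)"
    note pX = pt_ob_D(1)[OF X] and pY = pt_ob_D(1)[OF Y]
    show "lc_hom (Tdlin d) X Y = op_class d X Y ` O.cyc X Y 0"
    proof (intro subset_antisym subsetI)
      fix G assume "G \<in> lc_hom (Tdlin d) X Y"
      then obtain f where f: "f \<in> dg_cocycles (pretr (Lc d)) X Y" "G = dg_class (pretr (Lc d)) X Y f"
        by (auto simp: Tdlin_simps)
      then show "G \<in> op_class d X Y ` O.cyc X Y 0"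
        using f(1)[unfolded cocycles_mop[OF X Y]] dg_class_cl[OF X Y] by auto
    next
      fix G assume "G \<in> op_class d X Y ` O.cyc X Y 0"
      then obtain F where F: "F \<in> O.cyc X Y 0" "G = op_class d X Y F" by (elim imageE)
      note r = op_mat[OF O.cyc_hom[OF F(1)]]
      have "op_mat d X Y F \<in> dg_cocycles (pretr (Lc d)) X Y" using r F(1) by (simp add: cocycles_mop[OF X Y])
      moreover have "G = dg_class (pretr (Lc d)) X Y (op_mat d X Y F)" using dg_class_cl[OF X Y r(1)] r(2) F(2) by simp
      ultimately show "G \<in> lc_hom (Tdlin d) X Y" by (simp add: Tdlin_simps)
    qed
    show "lc_zero (Tdlin d) X Y = op_class d X Y 0"
      using dg_class_cl[OF X Y pt_hom_0[OF pX pY]] by (simp add: Tdlin_simps mop_0)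
    fix F assume F: "F \<in> O.cyc X Y 0"
    show "lc_scale (Tdlin d) X Y c (op_class d X Y F) = op_class d X Y (lsc c * F)" for c
      unfolding Tdlin_simps
    proof (rule UN[OF rpcl[OF X Y F]])
      fix f assume f: "f \<in> op_class d X Y F"
      have "dg_class (pretr (Lc d)) X Y (pt_scale (Lc d) c f) = op_class d X Y (lsc c * mop X f)"
        using dg_class_cl[OF X Y pt_hom_scale[OF pX pY clD(1)[OF f]]] mop_scale[OF pt_hom_lin[OF clD(1)[OF f]]] by simp
      also have "\<dots> = op_class d X Y (lsc c * F)"
        using O.bnd_sc[OF X Y clD(2)[OF f]] by (intro cl_cong[OF X Y]) (simp add: right_diff_distrib)
      finally show "dg_class (pretr (Lc d)) X Y (pt_scale (Lc d) c f) = op_class d X Y (lsc c * F)" .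
    qed
    \<comment> \<open>Shifting both ends by \<open>k\<close> changes neither the matrices nor the
      set of boundaries.\<close>
    show "op_class d (pt_shift (Lc d) k X) (pt_shift (Lc d) k Y) F = op_class d X Y F" for k
    proof -
      have "O.bnd (pt_shift (Lc d) k X) (pt_shift (Lc d) k Y) 0 = O.bnd X Y 0"
        using O.bnd_sh[OF X shift_ob[OF Y], of k k 0] O.bnd_sh_right[OF X Y, of k "- k"] by simp
      then show ?thesis by (simp add: op_class_def pt_hom_shift_left pt_hom_shift_right mop_shift)
    qed
    fix G assume G: "G \<in> O.cyc X Y 0"
    show "op_class d X Y F = op_class d X Y G \<longleftrightarrow> F - G \<in> O.bnd X Y 0"
    proof
      assume "op_class d X Y F = op_class d X Y G"
      then have "op_mat d X Y F \<in> op_class d X Y G" using rpcl[OF X Y F] by simp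
      then show "F - G \<in> O.bnd X Y 0" using clD(2) op_mat(2)[OF O.cyc_hom[OF F]] by fastforce
    qed (rule cl_cong[OF X Y])
    show "lc_add (Tdlin d) X Y (op_class d X Y F) (op_class d X Y G) = op_class d X Y (F + G)"
      unfolding Tdlin_simps
    proof (rule UN[OF rpcl[OF X Y F]], rule UN[OF rpcl[OF X Y G]])
      fix f g assume f: "f \<in> op_class d X Y F" and g: "g \<in> op_class d X Y G"
      have "dg_class (pretr (Lc d)) X Y (f + g) = op_class d X Y (mop X f + mop X g)"
        using dg_class_cl[OF X Y pt_hom_add[OF pX pY clD(1)[OF f] clD(1)[OF g]]]
          mop_add[OF pt_hom_lin[OF clD(1)[OF f]] pt_hom_lin[OF clD(1)[OF g]]] by simp
      also have "\<dots> = op_class d X Y (F + G)"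
        using O.bnd_add[OF X Y clD(2)[OF f] clD(2)[OF g]] by (intro cl_cong[OF X Y]) (simp add: algebra_simps)
      finally show "dg_class (pretr (Lc d)) X Y (f + g) = op_class d X Y (F + G)" .
    qed
  next
    fix X Y Z F G assume X: "X \<in> pt_ob (Lc d)" and Y: "Y \<in> pt_ob (Lc d)" and Z: "Z \<in> pt_ob (Lc d)"
      and F: "F \<in> O.cyc X Y 0" and G: "G \<in> O.cyc Y Z 0"
    note pX = pt_ob_D(1)[OF X] and pY = pt_ob_D(1)[OF Y] and pZ = pt_ob_D(1)[OF Z]
    show "lc_comp (Tdlin d) X Y Z (op_class d Y Z G) (op_class d X Y F) = op_class d X Z (G * F)"
      unfolding Tdlin_simps
    proof (rule UN[OF rpcl[OF Y Z G]], rule UN[OF rpcl[OF X Y F]])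
      fix g f assume g: "g \<in> op_class d Y Z G" and f: "f \<in> op_class d X Y F"
      have h: "pt_comp (Lc d) X Y Z g f \<in> pt_hom (Lc d) X Z 0"
        using pt_hom_comp[OF pX pZ pY clD(1)[OF f] clD(1)[OF g]] by simp
      have "dg_class (pretr (Lc d)) X Z (pt_comp (Lc d) X Y Z g f) = op_class d X Z (mop Y g * mop X f)"
        using dg_class_cl[OF X Z h] mop_comp[OF pX pZ pY clD(1)[OF f] clD(1)[OF g]] by simp
      also have "\<dots> = op_class d X Z (G * F)"
      proof (rule cl_cong[OF X Z])
        \<comment> \<open>Changing one factor at a time: each summand is a boundary composed with a
          cocycle.\<close>
        have "mop Y g * mop X f - G * F = mop Y g * (mop X f - F) + (mop Y g - G) * F" by (simp add: algebra_simps)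
        moreover have "mop Y g * (mop X f - F) \<in> O.bnd X Z 0"
          by (rule O.bnd_comp_left[OF X Y Z clD(2)[OF f] clc[OF Y Z G g]]) simp
        moreover have "(mop Y g - G) * F \<in> O.bnd X Z 0"
          by (rule O.bnd_comp_right[OF X Y Z F clD(2)[OF g]]) simp
        ultimately show "mop Y g * mop X f - G * F \<in> O.bnd X Z 0" using O.bnd_add[OF X Z] by simp
      qed
      finally show "dg_class (pretr (Lc d)) X Z (pt_comp (Lc d) X Y Z g f) = op_class d X Z (G * F)" .
    qed
  next
    \<comment> \<open>The standard triangle of a matrix is that of its operator, since
      \<open>op_mat\<close> gives the matrix back.\<close>
    have e: "(X, Y, pt_cone (Lc d) X Y f, dg_class (pretr (Lc d)) X Y f,
          dg_class (pretr (Lc d)) Y (pt_cone (Lc d) X Y f) (id_mat d Y),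
          dg_class (pretr (Lc d)) (pt_cone (Lc d) X Y f) (pt_shift (Lc d) 1 X) (pt_cone_out (Lc d) X Y)) =
        (X, Y, pt_cone (Lc d) X Y (op_mat d X Y (mop X f)), op_class d X Y (mop X f),
          op_class d Y (pt_cone (Lc d) X Y (op_mat d X Y (mop X f))) (op_id d Y),
          op_class d (pt_cone (Lc d) X Y (op_mat d X Y (mop X f))) (pt_shift (Lc d) 1 X) (op_id d X * sh_dn (sz Y)))"
      if X: "X \<in> pt_ob (Lc d)" and Y: "Y \<in> pt_ob (Lc d)" and f: "f \<in> pt_hom (Lc d) X Y 0" "mop X f \<in> O.cyc X Y 0" for X Y f
    proof -
      note pX = pt_ob_D(1)[OF X] and pY = pt_ob_D(1)[OF Y]
      have C: "pt_cone (Lc d) X Y f \<in> pt_ob (Lc d)" using O.cn_ob[OF X Y f(2)] op_mat_mop[OF f(1)] by simp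
      have out: "pt_cone_out (Lc d) X Y \<in> pt_hom (Lc d) (pt_cone (Lc d) X Y f) (pt_shift (Lc d) 1 X) 0"
        using cone_maps(4)[OF pX pY] by (simp add: pt_hom_shift_right)
      show ?thesis
        unfolding op_mat_mop[OF f(1)] dg_class_cl[OF X Y f(1)] dg_class_cl[OF Y C cone_maps(1)[OF pX pY]]
          dg_class_cl[OF C shift_ob[OF X] out] mop_cone_maps(3)[OF pX pY] op_id_def ..
    qed
    show "tc_dist (Tdlin d) = {t. \<exists>X\<in>pt_ob (Lc d). \<exists>Y\<in>pt_ob (Lc d). \<exists>F\<in>O.cyc X Y 0.
       tri_iso (Tdlin d) (pt_shift (Lc d) 1) (\<lambda>F. F) (X, Y, pt_cone (Lc d) X Y (op_mat d X Y F), op_class d X Y F,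
          op_class d Y (pt_cone (Lc d) X Y (op_mat d X Y F)) (op_id d Y),
          op_class d (pt_cone (Lc d) X Y (op_mat d X Y F)) (pt_shift (Lc d) 1 X) (op_id d X * sh_dn (sz Y))) t}"
      unfolding Tdlin_dist
    proof (intro Collect_cong bex_cong refl iffI)
      fix t X Y assume X: "X \<in> pt_ob (Lc d)" and Y: "Y \<in> pt_ob (Lc d)"
      let ?P = "\<lambda>F. tri_iso (Tdlin d) (pt_shift (Lc d) 1) (\<lambda>F. F) (X, Y, pt_cone (Lc d) X Y (op_mat d X Y F), op_class d X Y F,
          op_class d Y (pt_cone (Lc d) X Y (op_mat d X Y F)) (op_id d Y),
          op_class d (pt_cone (Lc d) X Y (op_mat d X Y F)) (pt_shift (Lc d) 1 X) (op_id d X * sh_dn (sz Y))) t"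
      let ?Q = "\<lambda>f. tri_iso (Tdlin d) (pt_shift (Lc d) 1) (\<lambda>F. F) (X, Y, pt_cone (Lc d) X Y f, dg_class (pretr (Lc d)) X Y f,
          dg_class (pretr (Lc d)) Y (pt_cone (Lc d) X Y f) (id_mat d Y),
          dg_class (pretr (Lc d)) (pt_cone (Lc d) X Y f) (pt_shift (Lc d) 1 X) (pt_cone_out (Lc d) X Y)) t"
      {
        assume "\<exists>f\<in>dg_cocycles (pretr (Lc d)) X Y. ?Q f"
        then obtain f where f: "f \<in> dg_cocycles (pretr (Lc d)) X Y" "?Q f" by (elim bexE)
        note f' = f(1)[unfolded cocycles_mop[OF X Y]]
        show "\<exists>F\<in>O.cyc X Y 0. ?P F"
          using f' f(2)[unfolded e[OF X Y conjunct1[OF f'] conjunct2[OF f']]] by (intro bexI[of _ "mop X f"]) simp_all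
      next
        assume "\<exists>F\<in>O.cyc X Y 0. ?P F"
        then obtain F where F: "F \<in> O.cyc X Y 0" "?P F" by (elim bexE)
        note r = op_mat[OF O.cyc_hom[OF F(1)]]
        have rc: "mop X (op_mat d X Y F) \<in> O.cyc X Y 0" using r(2) F(1) by simp
        show "\<exists>f\<in>dg_cocycles (pretr (Lc d)) X Y. ?Q f"
        proof (rule bexI[of _ "op_mat d X Y F"])
          show "?Q (op_mat d X Y F)" unfolding e[OF X Y r(1) rc] using F(2) by (simp add: r(2))
          show "op_mat d X Y F \<in> dg_cocycles (pretr (Lc d)) X Y" using r rc by (simp add: cocycles_mop[OF X Y])
        qed
      }
    qed
  qed
qed

theorem proposition5p6:
  fixes d :: int
  shows "linearisation Z2 (semifree_cat d) twist_ob twist_mor (Bmod d) (lam d 1) \<and>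
    linearisation Z2 (semifree_cat d) twist_ob twist_mor (Bmod d) (lam d (- 1)) \<and>
    lam d 1 \<noteq> lam d (- 1) \<and>
    exceptional (Tdlin d) (pt_single (Bmod d, lam d 1)) \<and>
    exceptional (Tdlin d) (pt_single (Bmod d, lam d (- 1))) \<and>
    (\<exists>\<Phi>. exact_functor Db_vect (Tdlin d) \<Phi> \<and> fully_faithful Db_vect (Tdlin d) \<Phi> \<and>
         admissible (Tdlin d) (ess_image Db_vect (Tdlin d) \<Phi>))"
proof (intro conjI)
  show "linearisation Z2 (semifree_cat d) twist_ob twist_mor (Bmod d) (lam d 1)"
    "linearisation Z2 (semifree_cat d) twist_ob twist_mor (Bmod d) (lam d (- 1))"
    by (rule linearisation_lam, simp)+
  show "lam d 1 \<noteq> lam d (- 1)" by (rule lam_distinct)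
  show "exceptional (Tdlin d) (pt_single (Bmod d, lam d 1))" "exceptional (Tdlin d) (pt_single (Bmod d, lam d (- 1)))"
    by (rule dg_tricat.exceptional_E[OF dg_tricat_Tdlin], simp)+
  \<comment> \<open>The embedding is built on the linearisation with sign 1; the sign -1 yields one
    in the same way.\<close>
  show "\<exists>\<Phi>. exact_functor Db_vect (Tdlin d) \<Phi> \<and> fully_faithful Db_vect (Tdlin d) \<Phi> \<and>
         admissible (Tdlin d) (ess_image Db_vect (Tdlin d) \<Phi>)"
    by (rule dg_tricat.Db_vect_embeds[OF dg_tricat_Tdlin[of 1]]) simp
qed

end
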